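(* Let $\mathfrak{c}\subset\Delta$ be the Cartan subspace of the half-spin representation $\Delta$ of $\mathrm{Spin}_{16}$ described in the context, $W=W(E_8)$ its Weyl group, and let $\Theta_2\subset S_{\langle 2,2\rangle}\mathbb{C}^{16}$ be the linear span of the image of $\mathfrak{c}$ under $h\mapsto\Gamma_2(h^4)$. Then $\Theta_2$, as a representation of $W$, is an irreducible Macdonald representation of dimension $84$.
   Context: The base field is $\mathbb{C}$. Let $V=\mathbb{C}^{16}$ with a nondegenerate quadratic form, $V=E\oplus F$ a decomposition into maximal isotropic subspaces, and $\Delta=\wedge^{+}E$ (even exterior algebra) the corresponding half-spin representation of $\mathrm{Spin}_{16}$, of dimension $128$. There is a $\mathbb{Z}/2$-grading $\mathfrak{e}_8=\mathfrak{so}_{16}\oplus\Delta$. With $e_0,\dots,e_7$ a basis of $E$ and $e_{ijkl}=e_i\wedge e_j\wedge e_k\wedge e_l$, the Cartan subspace $\mathfrak{c}\subset\Delta$ (which is also a Cartan subalgebra of $\mathfrak{e}_8$) is spanned by $h_1=e_{0123}+e_{4567}$, $h_2=e_{0145}+e_{2367}$, $h_3=e_{0246}+e_{1357}$, $h_4=e_{0356}+e_{1247}$, $h_5=e_{0257}+e_{1346}$, $h_6=e_{0347}+e_{1256}$, $h_7=e_{0167}+e_{2345}$, $h_8=1+e_{01234567}$. The group $W=N_{\mathrm{Spin}_{16}}(\mathfrak{c})/Z_{\mathrm{Spin}_{16}}(\mathfrak{c})$ is the Weyl group of type $E_8$ acting on $\mathfrak{c}$ in the usual way. $S_{\langle2,2\rangle}V=H^0(OG(2,16),\mathcal{O}(2))$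 is the space of quadric sections of the orthogonal Grassmannian $OG(2,16)$ of isotropic planes in $V$; it is an irreducible $\mathrm{Spin}_{16}$-module. $\Gamma_2:S^4\Delta\to S_{\langle2,2\rangle}V$ is the nonzero $\mathrm{Spin}_{16}$-equivariant linear map, unique up to scalar; it is induced by the quartic invariant of the half-spin representation of $\mathrm{Spin}_{12}$, applied to the spinor bundle on $OG(2,16)$ whose space of global sections is $\Delta$. By equivariance $W$ acts on $\Theta_2$, and (through the coordinate functions of the map $h\mapsto\Gamma_2(h^4)$) $\Theta_2$ is identified with a $W$-stable space of quartic polynomials on $\mathfrak{c}$. A Macdonald representation of a complex reflection group $W$ acting on $\mathfrak{c}$ is an irreducible representation of the form $\langle w\cdot(\ell_1\ell_2\cdots\ell_k)\rangle_{w\in W}\subset\mathbb{C}[\mathfrak{c}]_k$, where $\ell_1,\dots,\ell_k\in\mathfrak{c}^\vee$ are linear forms defining reflection hyperplanes of $W$. *)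

theory Defs
  imports
    "HOL-Analysis.Analysis"
    "HOL-Library.Function_Algebras"
    "HOL-Library.Poly_Mapping"
    "HOL-Algebra.Coset"
begin

section \<open>Linear algebra over the complex numbers\<close>

text \<open>Complex-valued functions and the symmetric algebra below are treated as complex vector
  spaces via the following scalings; on \<^typ>\<open>complex ^ 'n\<close> the library's
  \<^term>\<open>vec.span\<close> for \<^term>\<open>(*s)\<close> is used.\<close>

definition fun_scale :: "complex \<Rightarrow> ('a \<Rightarrow> complex) \<Rightarrow> 'a \<Rightarrow> complex" where
  "fun_scale c f = (\<lambda>x. c * f x)"

interpretation fun_vs: vector_space fun_scale
  by standard (auto simp: fun_scale_def fun_eq_iff algebra_simps)

definition linear_on ::
  "(complex \<Rightarrow> 'a \<Rightarrow> 'a::ab_group_add) \<Rightarrow> (complex \<Rightarrow> 'b \<Rightarrow> 'b::ab_group_add) \<Rightarrow> 'a set \<Rightarrow> ('a \<Rightarrow> 'b) \<Rightarrow> bool"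
  where
  "linear_on s1 s2 S f \<longleftrightarrow>
     (\<forall>x\<in>S. \<forall>y\<in>S. f (x + y) = f x + f y) \<and> (\<forall>c. \<forall>x\<in>S. f (s1 c x) = s2 c (f x))"

section \<open>The quadratic space and the half-spin representation\<close>

text \<open>The index type \<open>8\<close> has the elements \<open>0, \<dots>, 7\<close>.
  The coordinate \<open>Inl i\<close> of a vector is its coefficient on the basis vector \<open>e\<^sub>i\<close> of \<open>E\<close>,
  and \<open>Inr i\<close> the one on the dual basis vector \<open>f\<^sub>i\<close> of \<open>F\<close>.\<close>

type_synonym V = "complex ^ (8 + 8)"

definition quad :: "V \<Rightarrow> complex" where
  "quad v = (\<Sum>i\<in>UNIV. v $ Inl i * v $ Inr i)"

text \<open>The full exterior algebra of \<open>E\<close>: the coordinate \<open>I\<close> of a spinor is its coefficient on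
  \<open>e\<^sub>I\<close>, the wedge product of the \<open>e\<^sub>i\<close> (\<open>i \<in> I\<close>) in increasing order.\<close>

type_synonym spinor = "complex ^ (8 set)"

definition e_basis :: "8 set \<Rightarrow> spinor" where
  "e_basis I = axis I 1"

definition half_spin :: "spinor set" where
  "half_spin = {x. \<forall>I. odd (card I) \<longrightarrow> x $ I = 0}"

definition wedge_sign :: "8 \<Rightarrow> 8 set \<Rightarrow> complex" where
  "wedge_sign i I = (-1) ^ card {j \<in> I. j < i}"

definition wedge_e :: "8 \<Rightarrow> spinor \<Rightarrow> spinor" where
  "wedge_e i x = (\<chi> I. if i \<in> I then wedge_sign i I * x $ (I - {i}) else 0)"

definition contract_f :: "8 \<Rightarrow> spinor \<Rightarrow> spinor" where
  "contract_f i x = (\<chi> I. if i \<notin> I then wedge_sign i I * x $ insert i I else 0)"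

text \<open>Clifford multiplication, normalised so that
  \<open>clifford v (clifford v x) = quad v *s x\<close>. It identifies the Clifford algebra of
  \<open>V\<close> with the endomorphism algebra of the full exterior algebra.\<close>

definition clifford :: "V \<Rightarrow> spinor \<Rightarrow> spinor" where
  "clifford v x = (\<Sum>i\<in>UNIV. v $ Inl i *s wedge_e i x + v $ Inr i *s contract_f i x)"

text \<open>The spin group inside the Clifford algebra: products of an even number of vectors
  on which the quadratic form takes the value 1.\<close>

definition Spin16 :: "(spinor \<Rightarrow> spinor) monoid" where
  "Spin16 = \<lparr>carrier = {foldr (\<lambda>v g. clifford v \<circ> g) vs id | vs. even (length vs) \<and> (\<forall>v\<in>set vs. quad v = 1)},
             mult = (\<circ>), one = id\<rparr>"

text \<open>The vector representation, by conjugation in the Clifford algebra.\<close>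

definition vec_act :: "(spinor \<Rightarrow> spinor) \<Rightarrow> V \<Rightarrow> V" where
  "vec_act g v = (THE u. clifford u = g \<circ> clifford v \<circ> inv\<^bsub>Spin16\<^esub> g)"

section \<open>Quadric sections of the orthogonal Grassmannian of isotropic planes\<close>

definition isotropic_frame :: "V \<times> V \<Rightarrow> bool" where
  "isotropic_frame = (\<lambda>(u, v). (\<forall>a b. a *s u + b *s v = 0 \<longrightarrow> a = 0 \<and> b = 0) \<and>
                              (\<forall>a b. quad (a *s u + b *s v) = 0))"

definition pluecker :: "8 + 8 \<Rightarrow> 8 + 8 \<Rightarrow> V \<times> V \<Rightarrow> complex" where
  "pluecker i j = (\<lambda>(u, v). u $ i * v $ j - u $ j * v $ i)"

text \<open>A section of \<open>\<O>(2)\<close> on \<open>OG(2,16)\<close> is represented by the corresponding function on bases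
  \<open>(u, v)\<close> of isotropic planes (extended by 0 to all pairs). The quadric sections are the
  restrictions of the quadratic polynomials in the Pluecker coordinates; two quadratic
  polynomials are identified iff they agree on \<open>OG(2,16)\<close>.\<close>

definition quadric_sections :: "(V \<times> V \<Rightarrow> complex) set" where
  "quadric_sections = fun_vs.span
     {(\<lambda>p. if isotropic_frame p then pluecker i j p * pluecker k l p else 0) | i j k l. True}"

definition section_act :: "(spinor \<Rightarrow> spinor) \<Rightarrow> (V \<times> V \<Rightarrow> complex) \<Rightarrow> V \<times> V \<Rightarrow> complex" where
  "section_act g s = (\<lambda>(u, v). s (vec_act (inv\<^bsub>Spin16\<^esub> g) u, vec_act (inv\<^bsub>Spin16\<^esub> g) v))"

section \<open>The fourth symmetric power and equivariant maps\<close>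

text \<open>Polynomials in the basis elements \<open>e\<^sub>I\<close>, i.e. the symmetric algebra of the exterior algebra
  (which contains that of \<^term>\<open>half_spin\<close>).\<close>

type_synonym sym_algebra = "(8 set \<Rightarrow>\<^sub>0 nat) \<Rightarrow>\<^sub>0 complex"

definition sym_scale :: "complex \<Rightarrow> sym_algebra \<Rightarrow> sym_algebra" where
  "sym_scale c p = Poly_Mapping.single 0 c * p"

interpretation sym_vs: vector_space sym_scale
  by standard
    (simp_all add: sym_scale_def algebra_simps single_add mult_single flip: mult.assoc)

definition sym_embed :: "spinor \<Rightarrow> sym_algebra" where
  "sym_embed x = (\<Sum>I\<in>UNIV. Poly_Mapping.single (Poly_Mapping.single I 1) (x $ I))"

definition S4_half_spin :: "sym_algebra set" where
  "S4_half_spin = sym_vs.span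
     {sym_embed x1 * sym_embed x2 * sym_embed x3 * sym_embed x4 | x1 x2 x3 x4.
        x1 \<in> half_spin \<and> x2 \<in> half_spin \<and> x3 \<in> half_spin \<and> x4 \<in> half_spin}"

text \<open>Equivariance is stated on the products that span the fourth symmetric power.\<close>

definition nonzero_equivariant_map :: "(sym_algebra \<Rightarrow> (V \<times> V \<Rightarrow> complex)) \<Rightarrow> bool" where
  "nonzero_equivariant_map \<Gamma> \<longleftrightarrow>
     linear_on sym_scale fun_scale S4_half_spin \<Gamma> \<and>
     \<Gamma> ` S4_half_spin \<subseteq> quadric_sections \<and>
     (\<exists>p\<in>S4_half_spin. \<Gamma> p \<noteq> 0) \<and>
     (\<forall>g\<in>carrier Spin16. \<forall>x1\<in>half_spin. \<forall>x2\<in>half_spin. \<forall>x3\<in>half_spin. \<forall>x4\<in>half_spin.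
        \<Gamma> (sym_embed (g x1) * sym_embed (g x2) * sym_embed (g x3) * sym_embed (g x4)) =
        section_act g (\<Gamma> (sym_embed x1 * sym_embed x2 * sym_embed x3 * sym_embed x4)))"

section \<open>The Cartan subspace and its Weyl group\<close>

definition cartan :: "spinor set" where
  "cartan = vec.span
    {e_basis {0,1,2,3} + e_basis {4,5,6,7},
     e_basis {0,1,4,5} + e_basis {2,3,6,7},
     e_basis {0,2,4,6} + e_basis {1,3,5,7},
     e_basis {0,3,5,6} + e_basis {1,2,4,7},
     e_basis {0,2,5,7} + e_basis {1,3,4,6},
     e_basis {0,3,4,7} + e_basis {1,2,5,6},
     e_basis {0,1,6,7} + e_basis {2,3,4,5},
     e_basis {} + e_basis {0,1,2,3,4,5,6,7}}"

definition normalizer_c :: "(spinor \<Rightarrow> spinor) set" where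
  "normalizer_c = {g \<in> carrier Spin16. g ` cartan = cartan}"

definition centralizer_c :: "(spinor \<Rightarrow> spinor) set" where
  "centralizer_c = {g \<in> carrier Spin16. \<forall>h\<in>cartan. g h = h}"

definition Weyl :: "(spinor \<Rightarrow> spinor) set monoid" where
  "Weyl = (Spin16\<lparr>carrier := normalizer_c\<rparr>) Mod centralizer_c"

text \<open>Elements of \<^term>\<open>Weyl\<close> are cosets; they act through any of their representatives.\<close>

definition coset_rep :: "(spinor \<Rightarrow> spinor) set \<Rightarrow> spinor \<Rightarrow> spinor" where
  "coset_rep w = (SOME n. n \<in> w)"

definition W_section_act :: "(spinor \<Rightarrow> spinor) set \<Rightarrow> (V \<times> V \<Rightarrow> complex) \<Rightarrow> V \<times> V \<Rightarrow> complex" where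
  "W_section_act w = section_act (coset_rep w)"

text \<open>Functions on the Cartan subspace are represented by functions vanishing outside it.\<close>

definition on_cartan :: "(spinor \<Rightarrow> complex) \<Rightarrow> spinor \<Rightarrow> complex" where
  "on_cartan f = (\<lambda>h. if h \<in> cartan then f h else 0)"

definition W_poly_act :: "(spinor \<Rightarrow> spinor) set \<Rightarrow> (spinor \<Rightarrow> complex) \<Rightarrow> spinor \<Rightarrow> complex" where
  "W_poly_act w f = on_cartan (\<lambda>h. f (coset_rep (inv\<^bsub>Weyl\<^esub> w) h))"

section \<open>Representations\<close>

definition representation ::
  "'g monoid \<Rightarrow> ('g \<Rightarrow> ('a \<Rightarrow> complex) \<Rightarrow> 'a \<Rightarrow> complex) \<Rightarrow> ('a \<Rightarrow> complex) set \<Rightarrow> bool" where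
  "representation G act M \<longleftrightarrow>
     fun_vs.subspace M \<and>
     (\<forall>g\<in>carrier G. linear_on fun_scale fun_scale M (act g) \<and> act g ` M \<subseteq> M) \<and>
     (\<forall>x\<in>M. act \<one>\<^bsub>G\<^esub> x = x) \<and>
     (\<forall>g\<in>carrier G. \<forall>h\<in>carrier G. \<forall>x\<in>M. act (g \<otimes>\<^bsub>G\<^esub> h) x = act g (act h x))"

definition irreducible_rep ::
  "'g monoid \<Rightarrow> ('g \<Rightarrow> ('a \<Rightarrow> complex) \<Rightarrow> 'a \<Rightarrow> complex) \<Rightarrow> ('a \<Rightarrow> complex) set \<Rightarrow> bool" where
  "irreducible_rep G act M \<longleftrightarrow>
     representation G act M \<and> M \<noteq> {0} \<and>
     (\<forall>U. fun_vs.subspace U \<and> U \<subseteq> M \<and> (\<forall>g\<in>carrier G. act g ` U \<subseteq> U) \<longrightarrow> U = {0} \<or> U = M)"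

definition isomorphic_reps ::
  "'g monoid \<Rightarrow> ('g \<Rightarrow> ('a \<Rightarrow> complex) \<Rightarrow> 'a \<Rightarrow> complex) \<Rightarrow> ('a \<Rightarrow> complex) set \<Rightarrow>
   ('g \<Rightarrow> ('b \<Rightarrow> complex) \<Rightarrow> 'b \<Rightarrow> complex) \<Rightarrow> ('b \<Rightarrow> complex) set \<Rightarrow> bool" where
  "isomorphic_reps G act1 M1 act2 M2 \<longleftrightarrow>
     (\<exists>\<phi>. linear_on fun_scale fun_scale M1 \<phi> \<and> bij_betw \<phi> M1 M2 \<and>
          (\<forall>g\<in>carrier G. \<forall>x\<in>M1. \<phi> (act1 g x) = act2 g (\<phi> x)))"

text \<open>A linear form defining the fixed hyperplane of a reflection in \<^term>\<open>Weyl\<close>; the second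
  condition says that the form is not zero, so that its kernel is a hyperplane.\<close>

definition reflection_form :: "(spinor \<Rightarrow> complex) \<Rightarrow> bool" where
  "reflection_form \<l> \<longleftrightarrow>
     linear_on (*s) (*) cartan \<l> \<and> (\<exists>h\<in>cartan. \<l> h \<noteq> 0) \<and>
     (\<exists>w\<in>carrier Weyl. {h\<in>cartan. coset_rep w h = h} = {h\<in>cartan. \<l> h = 0})"

definition Macdonald_rep :: "(spinor \<Rightarrow> complex) set \<Rightarrow> bool" where
  "Macdonald_rep M \<longleftrightarrow>
     irreducible_rep Weyl W_poly_act M \<and>
     (\<exists>ls. (\<forall>\<l>\<in>set ls. reflection_form \<l>) \<and>
           M = fun_vs.span {W_poly_act w (on_cartan (\<lambda>h. \<Prod>\<l>\<leftarrow>ls. \<l> h)) | w. w \<in> carrier Weyl})"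

section \<open>The span of the image of the Cartan subspace\<close>

definition Theta2 :: "(sym_algebra \<Rightarrow> (V \<times> V \<Rightarrow> complex)) \<Rightarrow> (V \<times> V \<Rightarrow> complex) set" where
  "Theta2 \<Gamma> = fun_vs.span {\<Gamma> (sym_embed h ^ 4) | h. h \<in> cartan}"

text \<open>The quartic polynomials on the Cartan subspace obtained by composing
  \<open>h \<mapsto> \<Gamma>(h\<^sup>4)\<close> with the linear forms on \<^term>\<open>Theta2 \<Gamma>\<close>.\<close>

definition coordinate_quartics :: "(sym_algebra \<Rightarrow> (V \<times> V \<Rightarrow> complex)) \<Rightarrow> (spinor \<Rightarrow> complex) set" where
  "coordinate_quartics \<Gamma> =
     {on_cartan (\<lambda>h. \<phi> (\<Gamma> (sym_embed h ^ 4))) | \<phi>. linear_on fun_scale (*) (Theta2 \<Gamma>) \<phi>}"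

end

theory Submission
  imports Defs
begin

text \<open>Index the basis vectors of the Cartan subspace by \<open>k \<in> \<F>\<^sub>2\<^sup>3\<close>, so that
  \<open>h\<^sub>k = e\<^sub>S + e\<^sub>T\<close> with \<open>S = {i. k \<cdot> i = 0}\<close> and \<open>T\<close> its complement; the roots are then
  the coordinates \<open>z\<^sub>k\<close> and the forms \<open>(1/2) (\<plusminus> z\<^sub>a \<plusminus> z\<^sub>b \<plusminus> z\<^sub>c \<plusminus> z\<^sub>d)\<close> attached to affine planes.

  Upper bound: sections in \<open>\<Theta>\<^sub>2\<close> are fixed by the finite group of spin elements that centralize the Cartan
  subspace. Averaging products of two Pluecker coordinates over it leaves sums indexed by pairs in
  \<open>\<F>\<^sub>2\<^sup>4\<close>, and the Pluecker and isotropy relations reduce these to 84.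

  Lower bound: the value of \<open>\<Gamma>\<^sub>2(h\<^sup>4)\<close> at the frame \<open>(e\<^sub>0, e\<^sub>1)\<close> changes sign under the coordinate
  reflections 0, 2, 4, 6, so it is a multiple of \<open>z\<^sub>0 z\<^sub>2 z\<^sub>4 z\<^sub>6\<close>. The multiple is not zero because
  otherwise invariance under the torus and the Lie algebra of the stabilizer of the frame would force
  \<open>\<Gamma>\<^sub>2\<close> to vanish there, hence everywhere by transitivity on isotropic frames. The orbit of this product
  spans a space that contains 84 explicit independent forms.

  Irreducibility: for the natural inner product of quartic forms the coefficient of
  \<open>z\<^sub>0 z\<^sub>2 z\<^sub>4 z\<^sub>6\<close> is the pairing with a cyclic vector, so by positivity some translate of any nonzero
  element has that coefficient nonzero, and antisymmetrizing the translate gives the cyclic vector.\<close>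

section \<open>The Clifford action on spinors\<close>

text \<open>Nothing is given about \<open>\<Gamma>\<close> beyond equivariance and being nonzero, so
  each of its values has to be forced by symmetry. The two bounds meet through counts in finite
  geometry. Above, 84 = 14 + 2 * 35: the 35 two-dimensional subspaces of F_2^4 keep two sums each
  after the three-term Pluecker relation, and the 15 nonzero vectors give 14 more after the isotropy
  relation. Below, 84 = 14 + 2 * 28 + 14: a squarefree monomial for each of the 14 affine planes of
  F_2^3, two forms for each of the 28 pairs of points, and another form for each plane. The quartics
  arise from linear forms on \<open>Theta2\<close>, hence carry the dual representation. Returning
  to \<open>Theta2\<close> itself takes a self-duality, and this is why the invariant bilinear form
  on spinors is developed: it makes the normalizer act by orthogonal matrices. Infinitesimal
  invariance is obtained without differentiation, from finitely many rational points of a circle of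
  group elements.\<close>

lemma UNIV_8: "(UNIV :: 8 set) = {0,1,2,3,4,5,6,7}"
proof -
  have "card {0,1,2,3,4,5,6,7::8} = CARD(8)" by simp
  thus ?thesis by (metis card_subset_eq finite subset_UNIV)
qed

lemma all_8: "(\<forall>i::8. P i) \<longleftrightarrow> P 0 \<and> P 1 \<and> P 2 \<and> P 3 \<and> P 4 \<and> P 5 \<and> P 6 \<and> P 7"
proof -
  have "(\<forall>i::8. P i) \<longleftrightarrow> (\<forall>i\<in>{0,1,2,3,4,5,6,7::8}. P i)" unfolding UNIV_8 [symmetric] by simp
  thus ?thesis by simp
qed

lemma less_8_numeral [simp]:
  "(numeral a :: 8) < numeral b \<longleftrightarrow> (numeral a mod 8 :: int) < numeral b mod 8"
  "(0 :: 8) < numeral b \<longleftrightarrow> (0::int) < numeral b mod 8"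
  "(1 :: 8) < numeral b \<longleftrightarrow> (1::int) < numeral b mod 8"
  "(numeral b :: 8) < 1 \<longleftrightarrow> numeral b mod 8 < (1::int)"
  "(numeral b :: 8) < 0 \<longleftrightarrow> numeral b mod 8 < (0::int)"
  "(0 :: 8) < 1" "\<not> (1 :: 8) < 0"
  by (simp_all add: less_bit0_def bit0.Rep_numeral bit0.Rep_0 bit0.Rep_1)

text \<open>The index read as an integer, by counting; its parity supplies the signs of
  \<open>spinor_form\<close>.\<close>

definition nat8 :: "8 \<Rightarrow> nat" where "nat8 i = card {j. j < i}"

lemma wedge_sign_sq [simp]: "wedge_sign i I * wedge_sign i I = 1"
  by (simp add: wedge_sign_def power_add [symmetric] flip: power_mult_distrib)

lemma wedge_sign_sq' [simp]: "wedge_sign i I * (wedge_sign i I * z) = z"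
  by (simp add: mult.assoc [symmetric])

lemma wedge_sign_self [simp]:
  "wedge_sign i (insert i I) = wedge_sign i I" "wedge_sign i (I - {i}) = wedge_sign i I"
  unfolding wedge_sign_def by (rule arg_cong [where f = "\<lambda>s. (-1) ^ card s"]; auto)+

text \<open>A new factor changes the sign exactly if it precedes \<open>j\<close>. All
  anticommutation relations below come down to this.\<close>

lemma wedge_sign_insert:
  "wedge_sign j (insert i I) = (if i \<notin> I \<and> i < j then - wedge_sign j I else wedge_sign j I)"
proof (cases "i \<notin> I \<and> i < j")
  case True
  hence "{k \<in> insert i I. k < j} = insert i {k \<in> I. k < j}" by auto
  thus ?thesis using True by (simp add: wedge_sign_def)
next
  case False
  hence "{k \<in> insert i I. k < j} = {k \<in> I. k < j}" by auto
  thus ?thesis using False by (simp add: wedge_sign_def)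
qed

lemma wedge_sign_remove:
  "wedge_sign j (I - {i}) = (if i \<in> I \<and> i < j then - wedge_sign j I else wedge_sign j I)"
proof (cases "i \<in> I")
  case True
  hence "wedge_sign j I = wedge_sign j (insert i (I - {i}))" by (simp add: insert_absorb)
  also note wedge_sign_insert
  finally show ?thesis using True by auto
qed simp

lemma wedge_e_linear: "wedge_e i (x + y) = wedge_e i x + wedge_e i y"
  "wedge_e i (c *s x) = c *s wedge_e i x"
  by (simp_all add: wedge_e_def vec_eq_iff algebra_simps)

lemma contract_f_linear: "contract_f i (x + y) = contract_f i x + contract_f i y"
  "contract_f i (c *s x) = c *s contract_f i x"
  by (simp_all add: contract_f_def vec_eq_iff algebra_simps)

lemma wedge_e_nth: "wedge_e i x $ I = (if i \<in> I then wedge_sign i I * x $ (I - {i}) else 0)"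
  by (simp add: wedge_e_def)

lemma contract_f_nth: "contract_f i x $ I = (if i \<notin> I then wedge_sign i I * x $ insert i I else 0)"
  by (simp add: contract_f_def)

text \<open>For distinct indices exactly one of the two orders moves one factor past the other,
  hence the opposite signs.\<close>

lemma wedge_e_anticomm: "wedge_e i (wedge_e j x) + wedge_e j (wedge_e i x) = 0"
proof (cases "i = j")
  case True thus ?thesis by (simp add: vec_eq_iff wedge_e_nth)
next
  case False
  have "(wedge_e i (wedge_e j x) + wedge_e j (wedge_e i x)) $ I = 0" for I
  proof (cases "i \<in> I \<and> j \<in> I")
    case True
    have "I - {i} - {j} = I - {j} - {i}" by auto
    with True False show ?thesis
      by (cases i j rule: linorder_cases) (simp_all add: wedge_e_nth wedge_sign_remove)
  qed (use False in \<open>auto simp: wedge_e_nth\<close>)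
  thus ?thesis by (simp add: vec_eq_iff)
qed

lemma contract_f_anticomm: "contract_f i (contract_f j x) + contract_f j (contract_f i x) = 0"
proof (cases "i = j")
  case True thus ?thesis by (simp add: vec_eq_iff contract_f_nth)
next
  case False
  have "(contract_f i (contract_f j x) + contract_f j (contract_f i x)) $ I = 0" for I
  proof (cases "i \<notin> I \<and> j \<notin> I")
    case True
    have "insert i (insert j I) = insert j (insert i I)" by auto
    with True False show ?thesis
      by (cases i j rule: linorder_cases) (simp_all add: contract_f_nth wedge_sign_insert)
  qed (use False in \<open>auto simp: contract_f_nth\<close>)
  thus ?thesis by (simp add: vec_eq_iff)
qed

text \<open>For equal indices exactly one of the two terms is nonzero at a given set, and its two
  signs cancel.\<close>

lemma wedge_contract: "wedge_e i (contract_f j x) + contract_f j (wedge_e i x) = (if i = j then x else 0)"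
proof (cases "i = j")
  case True thus ?thesis
    by (simp add: vec_eq_iff wedge_e_nth contract_f_nth insert_absorb)
next
  case False
  have "(wedge_e i (contract_f j x) + contract_f j (wedge_e i x)) $ I = 0" for I
  proof (cases "i \<in> I \<and> j \<notin> I")
    case True
    have "insert j (I - {i}) = insert j I - {i}" using False by auto
    with True False show ?thesis
      by (cases i j rule: linorder_cases)
         (simp_all add: wedge_e_nth contract_f_nth wedge_sign_remove wedge_sign_insert)
  qed (use False in \<open>auto simp: wedge_e_nth contract_f_nth\<close>)
  thus ?thesis using False by (simp add: vec_eq_iff)
qed

section \<open>Polar form and the Clifford relation\<close>

definition polar :: "V \<Rightarrow> V \<Rightarrow> complex" where
  "polar u v = (\<Sum>i\<in>UNIV. u $ Inl i * v $ Inr i + u $ Inr i * v $ Inl i)"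

lemma clifford_add: "clifford v (x + y) = clifford v x + clifford v y"
  by (simp add: clifford_def wedge_e_linear contract_f_linear vec.scale_right_distrib sum.distrib algebra_simps)

lemma clifford_scale: "clifford v (c *s x) = c *s clifford v x"
  by (simp add: clifford_def wedge_e_linear contract_f_linear vec.scale_sum_right vec.scale_right_distrib mult_ac)

lemma clifford_add_left: "clifford (u + v) x = clifford u x + clifford v x"
  by (simp add: clifford_def vec.scale_left_distrib sum.distrib algebra_simps)

lemma clifford_scale_left: "clifford (c *s v) x = c *s clifford v x"
  by (simp add: clifford_def vec.scale_sum_right vec.scale_right_distrib)

lemma clifford_0 [simp]: "clifford v 0 = 0" "clifford 0 x = 0"
  using clifford_scale [of v 0 0] clifford_scale_left [of 0 0 x] by simp_all

lemma clifford_uminus [simp]: "clifford v (- x) = - clifford v x" "clifford (- v) x = - clifford v x"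
  using clifford_scale [of v "-1" x] clifford_scale_left [of "-1" v x] by simp_all

lemma clifford_diff: "clifford v (x - y) = clifford v x - clifford v y"
  "clifford (u - v) x = clifford u x - clifford v x"
  using clifford_add [of v x "- y"] clifford_add_left [of u "- v" x] by simp_all

definition ebas :: "8 \<Rightarrow> V" where "ebas i = axis (Inl i) 1"
definition fbas :: "8 \<Rightarrow> V" where "fbas i = axis (Inr i) 1"

lemma bas_nth [simp]:
  "ebas i $ Inl j = (if i = j then 1 else 0)" "ebas i $ Inr j = 0"
  "fbas i $ Inr j = (if i = j then 1 else 0)" "fbas i $ Inl j = 0"
  by (auto simp: ebas_def fbas_def axis_def)

lemma clifford_bas [simp]: "clifford (ebas i) x = wedge_e i x" "clifford (fbas i) x = contract_f i x"
proof -
  have *: "(if i = j then 1 else 0) *s y = (if j = i then y else 0)" for j :: 8 and y :: spinor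
    by simp
  show "clifford (ebas i) x = wedge_e i x" "clifford (fbas i) x = contract_f i x"
    by (simp_all add: clifford_def *)
qed

lemma V_expand: "v = (\<Sum>i\<in>UNIV. v $ Inl i *s ebas i + v $ Inr i *s fbas i)"
proof -
  have "v $ k = (\<Sum>i\<in>UNIV. v $ Inl i *s ebas i + v $ Inr i *s fbas i) $ k" for k
  proof (cases k)
    case (Inl j)
    have "(\<Sum>i\<in>UNIV. v $ Inl i * (if i = j then 1 else 0)) = v $ Inl j"
      by (subst sum.remove [of _ j]) (auto intro!: sum.neutral)
    thus ?thesis using Inl by simp
  next
    case (Inr j)
    have "(\<Sum>i\<in>UNIV. v $ Inr i * (if i = j then 1 else 0)) = v $ Inr j"
      by (subst sum.remove [of _ j]) (auto intro!: sum.neutral)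
    thus ?thesis using Inr by simp
  qed
  thus ?thesis unfolding vec_eq_iff by blast
qed


lemma polar_linear:
  "polar (u + u') v = polar u v + polar u' v" "polar (c *s u) v = c * polar u v"
  "polar v (u + u') = polar v u + polar v u'" "polar v (c *s u) = c * polar v u"
  by (simp_all add: polar_def sum.distrib sum_distrib_left algebra_simps)

lemma polar_commute: "polar u v = polar v u"
  by (simp add: polar_def algebra_simps)

lemma polar_0 [simp]: "polar 0 v = 0" "polar v 0 = 0"
  by (simp_all add: polar_def)

lemma polar_uminus [simp]: "polar (- u) v = - polar u v" "polar v (- u) = - polar v u"
  using polar_linear(2) [of "-1" u v] polar_linear(4) [of v "-1" u] by simp_all

lemma polar_diff: "polar (u - u') v = polar u v - polar u' v" "polar v (u - u') = polar v u - polar v u'"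
  using polar_linear(1) [of u "- u'"] polar_linear(3) [of v u "- u'"] by simp_all

lemma quad_add: "quad (u + v) = quad u + quad v + polar u v"
  by (simp add: quad_def polar_def sum.distrib algebra_simps)

lemma quad_scale: "quad (c *s u) = c\<^sup>2 * quad u"
  by (simp add: quad_def sum_distrib_left power2_eq_square algebra_simps)

lemma polar_self: "polar u u = 2 * quad u"
  by (simp add: quad_def polar_def sum_distrib_left)

lemma polar_bas [simp]:
  "polar (ebas i) v = v $ Inr i" "polar (fbas i) v = v $ Inl i"
  "polar v (ebas i) = v $ Inr i" "polar v (fbas i) = v $ Inl i"
proof -
  have *: "(if i = j then 1 else 0) * z = (if j = i then z else 0)"
     "z * (if i = j then 1 else 0) = (if j = i then z else 0)" for j :: 8 and z :: complex
    by simp_all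
  show "polar (ebas i) v = v $ Inr i" "polar (fbas i) v = v $ Inl i"
    "polar v (ebas i) = v $ Inr i" "polar v (fbas i) = v $ Inl i"
    by (simp_all add: polar_def *)
qed

text \<open>Reduces a statement linear in a vector to the sixteen basis vectors; the zero vector is
  covered by scaling with 0.\<close>

lemma V_induct [case_names add scale e f]:
  assumes "\<And>u v. P u \<Longrightarrow> P v \<Longrightarrow> P (u + v)" "\<And>c u. P u \<Longrightarrow> P (c *s u)"
    "\<And>i. P (ebas i)" "\<And>i. P (fbas i)"
  shows "P v"
proof -
  have 0: "P 0" using assms(2) [of "ebas 0" 0] assms(3) by simp
  have "P (\<Sum>i\<in>A. v $ Inl i *s ebas i + v $ Inr i *s fbas i)" if "finite A" for A
    using that by (induction A rule: finite_induct) (auto intro: assms 0)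
  thus ?thesis by (subst V_expand) simp
qed

lemma clifford_anticomm: "clifford u (clifford v x) + clifford v (clifford u x) = polar u v *s x"
proof (induction u rule: V_induct)
  case (add u u')
  have "clifford (u + u') (clifford v x) + clifford v (clifford (u + u') x)
      = (clifford u (clifford v x) + clifford v (clifford u x)) + (clifford u' (clifford v x) + clifford v (clifford u' x))"
    by (simp add: clifford_add clifford_add_left)
  thus ?case using add by (simp add: polar_linear vec.scale_left_distrib)
next
  case (scale c u)
  have "clifford (c *s u) (clifford v x) + clifford v (clifford (c *s u) x)
      = c *s (clifford u (clifford v x) + clifford v (clifford u x))"
    by (simp add: clifford_scale clifford_scale_left vec.scale_right_distrib)
  thus ?case using scale by (simp add: polar_linear)
next
  case (e i)
  show ?case
  proof (induction v rule: V_induct)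
    case (add u v)
    thus ?case
      by (simp add: clifford_add clifford_add_left wedge_e_linear vec.scale_left_distrib add.assoc)
         (simp add: algebra_simps)
  next
    case (scale c u)
    thus ?case
      by (simp add: clifford_scale clifford_scale_left wedge_e_linear flip: vec.scale_right_distrib)
  next
    case (e j) thus ?case by (simp add: wedge_e_anticomm)
  next
    case (f j) thus ?case by (simp add: wedge_contract)
  qed
next
  case (f i)
  show ?case
  proof (induction v rule: V_induct)
    case (add u v)
    thus ?case
      by (simp add: clifford_add clifford_add_left contract_f_linear vec.scale_left_distrib add.assoc)
         (simp add: algebra_simps)
  next
    case (scale c u)
    thus ?case
      by (simp add: clifford_scale clifford_scale_left contract_f_linear flip: vec.scale_right_distrib)
  next
    case (e j) thus ?case using wedge_contract [of j i x] by (simp add: add.commute)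
  next
    case (f j) thus ?case by (simp add: contract_f_anticomm)
  qed
qed

lemma clifford_square: "clifford v (clifford v x) = quad v *s x"
proof -
  have "clifford v (clifford v x) = (1/2) *s (clifford v (clifford v x) + clifford v (clifford v x))"
    by (simp add: vec_eq_iff)
  also have "\<dots> = quad v *s x"
    by (subst clifford_anticomm) (simp add: polar_self vec_eq_iff)
  finally show ?thesis .
qed

section \<open>Basis spinors, faithfulness of the Clifford action and the invariant bilinear
  form\<close>

lemma wedge_e_basis: "wedge_e i (e_basis I) = (if i \<in> I then 0 else wedge_sign i I *s e_basis (insert i I))"
proof -
  have "wedge_e i (e_basis I) $ J = (if i \<in> I then 0 else wedge_sign i I *s e_basis (insert i I)) $ J" for J
    using insert_absorb [of i J] by (auto simp: wedge_e_nth e_basis_def axis_def)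
  thus ?thesis unfolding vec_eq_iff by blast
qed

lemma contract_f_basis: "contract_f i (e_basis I) = (if i \<in> I then wedge_sign i I *s e_basis (I - {i}) else 0)"
proof -
  have "contract_f i (e_basis I) $ J = (if i \<in> I then wedge_sign i I *s e_basis (I - {i}) else 0) $ J" for J
    by (auto simp: contract_f_nth e_basis_def axis_def insert_absorb)
  thus ?thesis unfolding vec_eq_iff by blast
qed

lemma spinor_expand: "x = (\<Sum>I\<in>UNIV. x $ I *s e_basis I)"
proof -
  have "x $ J = (\<Sum>I\<in>UNIV. x $ I *s e_basis I) $ J" for J
  proof -
    have "(\<Sum>I\<in>UNIV. x $ I * e_basis I $ J) = x $ J"
      by (subst sum.remove [of _ J]) (auto intro!: sum.neutral simp: e_basis_def axis_def)
    thus ?thesis by simp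
  qed
  thus ?thesis unfolding vec_eq_iff by blast
qed

text \<open>The anticommutator recovers the polar form from Clifford multiplication, and the polar
  form is nondegenerate: its values on the basis are the coordinates.\<close>

lemma clifford_inject:
  assumes "clifford u = clifford v" shows "u = v"
proof -
  have 0: "clifford (u - v) x = 0" for x using assms by (simp add: clifford_diff)
  have "polar (u - v) w *s e_basis {} = 0" for w
    using clifford_anticomm [of "u - v" w "e_basis {}"] by (simp add: 0)
  hence p: "polar (u - v) w = 0" for w
    using arg_cong [of _ 0 "\<lambda>x. x $ {}"] by (fastforce simp: e_basis_def)
  have "(u - v) $ k = 0" for k
    using p [of "ebas (case k of Inl i \<Rightarrow> i | Inr i \<Rightarrow> i)"] p [of "fbas (case k of Inl i \<Rightarrow> i | Inr i \<Rightarrow> i)"]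
    by (cases k) simp_all
  hence "u $ k = v $ k" for k by simp
  thus ?thesis unfolding vec_eq_iff by blast
qed

text \<open>The spin-invariant form pairs a basis spinor with the one of the complementary set. The
  sign is the one that makes every Clifford multiplication self-adjoint.\<close>

definition spinor_form :: "spinor \<Rightarrow> spinor \<Rightarrow> complex" where
  "spinor_form x y = (\<Sum>I\<in>UNIV. (\<Prod>i\<in>I. (-1) ^ nat8 i) * x $ I * y $ (- I))"

lemma spinor_form_linear:
  "spinor_form (x + x') y = spinor_form x y + spinor_form x' y" "spinor_form (c *s x) y = c * spinor_form x y"
  "spinor_form y (x + x') = spinor_form y x + spinor_form y x'" "spinor_form y (c *s x) = c * spinor_form y x"
  by (simp_all add: spinor_form_def sum.distrib sum_distrib_left algebra_simps)

text \<open>The indices below \<open>i\<close> are divided between \<open>I\<close> and its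
  complement, so the product of the two signs is the parity of their total number.\<close>

lemma wedge_sign_compl: "i \<notin> I \<Longrightarrow> wedge_sign i I * wedge_sign i (- insert i I) = (-1) ^ nat8 i"
proof -
  assume "i \<notin> I"
  have "{j. j < i} = {j \<in> I. j < i} \<union> {j \<in> - insert i I. j < i}" by auto
  hence "nat8 i = card {j \<in> I. j < i} + card {j \<in> - insert i I. j < i}"
    unfolding nat8_def by (simp only:) (rule card_Un_disjoint; auto)
  thus ?thesis by (simp add: wedge_sign_def power_add)
qed

text \<open>Inserting or removing \<open>i\<close> is a bijection between the index sets of the two
  sums. By \<open>wedge_sign_compl\<close> the sign of \<open>I\<close> becomes that of the
  complement, and the leftover parity is the change in the weight of
  \<open>spinor_form\<close>.\<close>

lemma spinor_form_adjoint:
  "spinor_form (wedge_e i x) y = spinor_form x (wedge_e i y)"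
  "spinor_form (contract_f i x) y = spinor_form x (contract_f i y)"
proof -
  let ?s = "\<lambda>I. \<Prod>i\<in>I. (-1) ^ nat8 i :: complex"
  have s: "?s (insert i I) = (-1) ^ nat8 i * ?s I" if "i \<notin> I" for I using that by simp
  have w: "wedge_sign i I = (-1) ^ nat8 i * wedge_sign i (- insert i I)" if "i \<notin> I" for I
    using wedge_sign_compl [OF that] by (metis (no_types, opaque_lifting) mult.commute mult.left_commute wedge_sign_sq')
  have sq: "(-1) ^ nat8 i * ((-1) ^ nat8 i * z) = (z::complex)" for z
    by (simp add: mult.assoc [symmetric] flip: power_mult_distrib)
  have bij: "bij_betw (insert i) {I. i \<notin> I} {I. i \<in> I}"
    by (rule bij_betw_byWitness [where f' = "\<lambda>I. I - {i}"]) auto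
  have "spinor_form (wedge_e i x) y = (\<Sum>I\<in>{I. i \<in> I}. ?s I * (wedge_sign i I * x $ (I - {i})) * y $ (- I))"
    unfolding spinor_form_def wedge_e_nth by (rule sum.mono_neutral_cong_right) auto
  also have "\<dots> = (\<Sum>I\<in>{I. i \<notin> I}. ?s (insert i I) * (wedge_sign i I * x $ I) * y $ (- insert i I))"
    by (subst sum.reindex_bij_betw [OF bij, symmetric]) (auto intro!: sum.cong)
  also have "\<dots> = (\<Sum>I\<in>{I. i \<notin> I}. ?s I * x $ I * (wedge_sign i (- I) * y $ (- I - {i})))"
  proof (rule sum.cong [OF refl])
    fix I assume "I \<in> {I. i \<notin> I}"
    hence i: "i \<notin> I" by simp
    have "- insert i I = - I - {i}" by auto
    thus "?s (insert i I) * (wedge_sign i I * x $ I) * y $ (- insert i I) = ?s I * x $ I * (wedge_sign i (- I) * y $ (- I - {i}))"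
      unfolding s [OF i] w [OF i] using sq by (simp add: mult_ac)
  qed
  also have "\<dots> = spinor_form x (wedge_e i y)"
    unfolding spinor_form_def wedge_e_nth by (rule sum.mono_neutral_cong_left) auto
  finally show "spinor_form (wedge_e i x) y = spinor_form x (wedge_e i y)" .
  have "spinor_form (contract_f i x) y = (\<Sum>I\<in>{I. i \<notin> I}. ?s I * (wedge_sign i I * x $ insert i I) * y $ (- I))"
    unfolding spinor_form_def contract_f_nth by (rule sum.mono_neutral_cong_right) auto
  also have "\<dots> = (\<Sum>I\<in>{I. i \<notin> I}. ?s (insert i I) * x $ insert i I * (wedge_sign i (- insert i I) * y $ insert i (- insert i I)))"
  proof (rule sum.cong [OF refl])
    fix I assume "I \<in> {I. i \<notin> I}"
    hence i: "i \<notin> I" by simp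
    have "insert i (- insert i I) = - I" using i by auto
    thus "?s I * (wedge_sign i I * x $ insert i I) * y $ (- I) = ?s (insert i I) * x $ insert i I * (wedge_sign i (- insert i I) * y $ insert i (- insert i I))"
      unfolding s [OF i] w [OF i] using sq by (simp add: mult_ac)
  qed
  also have "\<dots> = (\<Sum>I\<in>{I. i \<in> I}. ?s I * x $ I * (wedge_sign i (- I) * y $ insert i (- I)))"
    by (subst sum.reindex_bij_betw [OF bij, symmetric]) simp
  also have "\<dots> = spinor_form x (contract_f i y)"
    unfolding spinor_form_def contract_f_nth by (rule sum.mono_neutral_cong_left) auto
  finally show "spinor_form (contract_f i x) y = spinor_form x (contract_f i y)" .
qed

text \<open>Moving one factor across the form leaves the square of \<open>clifford v\<close>, a
  scalar.\<close>

lemma spinor_form_clifford: "spinor_form (clifford v x) (clifford v y) = quad v * spinor_form x y"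
proof -
  have "spinor_form (clifford v x) y = spinor_form x (clifford v y)" for x y
    by (induction v rule: V_induct)
       (simp_all add: clifford_add_left clifford_scale_left spinor_form_linear spinor_form_adjoint)
  thus ?thesis by (simp add: clifford_square spinor_form_linear)
qed

section \<open>The spin group\<close>

definition cliff_prod :: "V list \<Rightarrow> spinor \<Rightarrow> spinor" where
  "cliff_prod vs = foldr (\<lambda>v g. clifford v \<circ> g) vs id"

lemma cliff_prod_simps [simp]: "cliff_prod [] = id" "cliff_prod (v # vs) = clifford v \<circ> cliff_prod vs"
  by (simp_all add: cliff_prod_def)

lemma cliff_prod_append: "cliff_prod (vs @ ws) = cliff_prod vs \<circ> cliff_prod ws"
  by (induction vs) (simp_all add: o_assoc)

abbreviation Spin :: "(spinor \<Rightarrow> spinor) set" where "Spin \<equiv> carrier Spin16"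

lemma Spin_def': "Spin = {cliff_prod vs | vs. even (length vs) \<and> (\<forall>v\<in>set vs. quad v = 1)}"
  by (simp add: Spin16_def cliff_prod_def)

lemma Spin16_simps [simp]: "\<one>\<^bsub>Spin16\<^esub> = id" "g \<otimes>\<^bsub>Spin16\<^esub> h = g \<circ> h"
  by (simp_all add: Spin16_def)

lemma SpinI: "even (length vs) \<Longrightarrow> (\<And>v. v \<in> set vs \<Longrightarrow> quad v = 1) \<Longrightarrow> cliff_prod vs \<in> Spin"
  unfolding Spin_def' by blast

lemma SpinE:
  assumes "g \<in> Spin"
  obtains vs where "g = cliff_prod vs" "even (length vs)" "\<forall>v\<in>set vs. quad v = 1"
  using assms unfolding Spin_def' by blast

lemma Spin_pair: "quad u = 1 \<Longrightarrow> quad v = 1 \<Longrightarrow> clifford u \<circ> clifford v \<in> Spin"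
  using SpinI [of "[u, v]"] by auto

lemma Spin_id [simp]: "id \<in> Spin"
  using SpinI [of "[]"] by simp

lemma Spin_comp: "g \<in> Spin \<Longrightarrow> h \<in> Spin \<Longrightarrow> g \<circ> h \<in> Spin"
proof (elim SpinE)
  fix vs ws
  assume "g = cliff_prod vs" "even (length vs)" "\<forall>v\<in>set vs. quad v = 1"
    "h = cliff_prod ws" "even (length ws)" "\<forall>v\<in>set ws. quad v = 1"
  thus "g \<circ> h \<in> Spin" using SpinI [of "vs @ ws"] by (auto simp: cliff_prod_append)
qed

lemma cliff_prod_rev:
  "\<forall>v\<in>set vs. quad v = 1 \<Longrightarrow> cliff_prod (rev vs) \<circ> cliff_prod vs = id"
proof (induction vs)
  case (Cons v vs)
  have "cliff_prod (rev (v # vs)) (cliff_prod (v # vs) x) = cliff_prod (rev vs) (cliff_prod vs x)" for x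
    using Cons.prems by (simp add: cliff_prod_append clifford_square)
  thus ?case using Cons by (simp add: fun_eq_iff)
qed simp

lemma Spin_inverse:
  assumes "g \<in> Spin" obtains h where "h \<in> Spin" "h \<circ> g = id" "g \<circ> h = id"
proof -
  obtain vs where vs: "g = cliff_prod vs" "even (length vs)" "\<forall>v\<in>set vs. quad v = 1"
    using assms by (rule SpinE)
  show ?thesis
    using that [of "cliff_prod (rev vs)"] vs SpinI [of "rev vs"] cliff_prod_rev [of vs] cliff_prod_rev [of "rev vs"]
    by auto
qed

lemma group_Spin16: "group Spin16"
proof (rule groupI)
  fix g assume "g \<in> Spin"
  thus "\<exists>h\<in>Spin. h \<otimes>\<^bsub>Spin16\<^esub> g = \<one>\<^bsub>Spin16\<^esub>" by (auto elim: Spin_inverse)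
qed (auto simp: Spin_comp o_assoc)

interpretation Spin: group Spin16 by (rule group_Spin16)

abbreviation spin_inv :: "(spinor \<Rightarrow> spinor) \<Rightarrow> spinor \<Rightarrow> spinor" where "spin_inv g \<equiv> inv\<^bsub>Spin16\<^esub> g"

lemma spin_inv: assumes "g \<in> Spin" shows "spin_inv g \<in> Spin" "spin_inv g \<circ> g = id" "g \<circ> spin_inv g = id"
  using Spin.l_inv [OF assms] Spin.r_inv [OF assms] Spin.inv_closed [OF assms] by simp_all

lemma spin_inv_apply: assumes "g \<in> Spin" shows "spin_inv g (g x) = x" "g (spin_inv g x) = x"
  using spin_inv [OF assms] by (simp_all add: fun_eq_iff)

lemma spin_inv_comp: "g \<in> Spin \<Longrightarrow> h \<in> Spin \<Longrightarrow> spin_inv (g \<circ> h) = spin_inv h \<circ> spin_inv g"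
  using Spin.inv_mult_group [of g h] by simp

lemma cliff_prod_linear:
  "cliff_prod vs (x + y) = cliff_prod vs x + cliff_prod vs y" "cliff_prod vs (c *s x) = c *s cliff_prod vs x"
  by (induction vs) (simp_all add: clifford_add clifford_scale)

lemma Spin_linear:
  assumes "g \<in> Spin" shows "g (x + y) = g x + g y" "g (c *s x) = c *s g x"
  using assms by (auto elim!: SpinE simp: cliff_prod_linear)

lemma Spin_zero: "g \<in> Spin \<Longrightarrow> g 0 = 0"
  using Spin_linear(2) [of g 0 0] by simp

lemma Spin_sum: "g \<in> Spin \<Longrightarrow> g (\<Sum>i\<in>A. f i) = (\<Sum>i\<in>A. g (f i))"
  by (induction A rule: infinite_finite_induct) (simp_all add: Spin_linear Spin_zero)

lemma Spin_form: "g \<in> Spin \<Longrightarrow> spinor_form (g x) (g y) = spinor_form x y"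
proof (elim SpinE)
  fix vs assume g: "g = cliff_prod vs" and "\<forall>v\<in>set vs. quad v = 1"
  hence "spinor_form (cliff_prod vs x) (cliff_prod vs y) = spinor_form x y"
    by (induction vs arbitrary: g) (simp_all add: spinor_form_clifford)
  thus ?thesis by (simp add: g)
qed

section \<open>The half-spin spaces and the vector representation\<close>

definition half_spin_odd :: "spinor set" where
  "half_spin_odd = {x. \<forall>I. even (card I) \<longrightarrow> x $ I = 0}"

lemma half_spin_subspace:
  "x \<in> half_spin \<Longrightarrow> y \<in> half_spin \<Longrightarrow> x + y \<in> half_spin" "x \<in> half_spin \<Longrightarrow> c *s x \<in> half_spin"
  by (auto simp: half_spin_def)

lemma half_spin_odd_subspace:
  "x \<in> half_spin_odd \<Longrightarrow> y \<in> half_spin_odd \<Longrightarrow> x + y \<in> half_spin_odd" "x \<in> half_spin_odd \<Longrightarrow> c *s x \<in> half_spin_odd"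
  by (auto simp: half_spin_odd_def)

lemma clifford_parity:
  "(x \<in> half_spin \<longrightarrow> clifford v x \<in> half_spin_odd) \<and> (x \<in> half_spin_odd \<longrightarrow> clifford v x \<in> half_spin)"
proof (induction v rule: V_induct)
  case (e i)
  have *: "card I = Suc (card (I - {i}))" if "i \<in> I" for I
    using card.remove [OF _ that] by simp
  have "odd (card (I - {i}))" if "i \<in> I" "even (card I)" for I using * that by force
  moreover have "even (card (I - {i}))" if "i \<in> I" "odd (card I)" for I using * that by force
  ultimately show ?case unfolding half_spin_def half_spin_odd_def wedge_e_nth clifford_bas mem_Collect_eq by (metis mult_zero_right)
next
  case (f i)
  thus ?case by (auto simp: half_spin_def half_spin_odd_def contract_f_nth)
qed (auto simp: clifford_add_left clifford_scale_left half_spin_subspace half_spin_odd_subspace)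

lemma Spin_half_spin:
  assumes "g \<in> Spin" "x \<in> half_spin" shows "g x \<in> half_spin"
proof -
  obtain vs where vs: "g = cliff_prod vs" "even (length vs)" using assms(1) by (rule SpinE)
  have "cliff_prod vs x \<in> (if even (length vs) then half_spin else half_spin_odd)"
    using assms(2) clifford_parity by (induction vs) (auto split: if_splits)
  thus ?thesis using vs by simp
qed

text \<open>Relational form of "g takes u to v". It composes and is linear without any inverse or
  description operator, so it is used instead of \<open>vec_act\<close> wherever images are known
  explicitly.\<close>

definition intertwines :: "(spinor \<Rightarrow> spinor) \<Rightarrow> V \<Rightarrow> V \<Rightarrow> bool" where
  "intertwines g u v \<longleftrightarrow> g \<circ> clifford u = clifford v \<circ> g"

text \<open>Conjugation by a unit vector is the negative of the reflection in it; the sign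
  disappears in products of even length.\<close>

lemma intertwines_clifford: "quad w = 1 \<Longrightarrow> intertwines (clifford w) v (polar v w *s w - v)"
proof -
  assume w: "quad w = 1"
  have "clifford w (clifford v x) = clifford (polar v w *s w - v) (clifford w x)" for x
    using clifford_anticomm [of v w x] w
    by (simp add: clifford_diff clifford_scale_left clifford_square algebra_simps)
  thus ?thesis by (auto simp: intertwines_def)
qed

lemma intertwines_comp: "intertwines g v w \<Longrightarrow> intertwines h u v \<Longrightarrow> intertwines (g \<circ> h) u w"
  by (auto simp: intertwines_def fun_eq_iff)

lemma intertwines_linear:
  assumes "g \<in> Spin"
  shows "intertwines g u v \<Longrightarrow> intertwines g u' v' \<Longrightarrow> intertwines g (u + u') (v + v')"
    "intertwines g u v \<Longrightarrow> intertwines g (c *s u) (c *s v)"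
  using assms by (auto simp: intertwines_def fun_eq_iff clifford_add_left clifford_scale_left Spin_linear)

lemma intertwines_exists: assumes "g \<in> Spin" shows "\<exists>v. intertwines g u v"
proof -
  obtain vs where vs: "g = cliff_prod vs" "\<forall>v\<in>set vs. quad v = 1" using assms by (rule SpinE)
  have "\<exists>v. intertwines (cliff_prod vs) u v"
    using vs(2)
  proof (induction vs)
    case Nil
    have "intertwines id u u" by (simp add: intertwines_def)
    thus ?case unfolding cliff_prod_simps by blast
  next
    case (Cons w vs)
    then obtain v where "intertwines (cliff_prod vs) u v" by auto
    hence "intertwines (clifford w \<circ> cliff_prod vs) u (polar v w *s w - v)"
      using intertwines_comp [OF intertwines_clifford [of w v]] Cons.prems by simp
    thus ?case unfolding cliff_prod_simps by blast
  qed
  thus ?thesis by (simp add: vs)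
qed

lemma vec_act_eqI: assumes "g \<in> Spin" "intertwines g u v" shows "vec_act g u = v"
proof -
  have "clifford v = g \<circ> clifford u \<circ> spin_inv g"
    using assms by (auto simp: intertwines_def fun_eq_iff spin_inv_apply)
  thus ?thesis unfolding vec_act_def by (intro the_equality) (auto intro: clifford_inject)
qed

lemma vec_act_intertwines: "g \<in> Spin \<Longrightarrow> intertwines g u (vec_act g u)"
  using intertwines_exists vec_act_eqI by metis

lemma vec_act_id [simp]: "vec_act id u = u"
  by (rule vec_act_eqI) (auto simp: intertwines_def)

lemma vec_act_comp: "g \<in> Spin \<Longrightarrow> h \<in> Spin \<Longrightarrow> vec_act (g \<circ> h) u = vec_act g (vec_act h u)"
  by (rule vec_act_eqI [OF Spin_comp intertwines_comp [OF vec_act_intertwines vec_act_intertwines]])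

lemma vec_act_inv: assumes "g \<in> Spin"
  shows "vec_act (spin_inv g) (vec_act g u) = u" "vec_act g (vec_act (spin_inv g) u) = u"
  using vec_act_comp [of g "spin_inv g" u] vec_act_comp [of "spin_inv g" g u] spin_inv [OF assms] assms
  by simp_all

lemma vec_act_inv_eqI: "g \<in> Spin \<Longrightarrow> intertwines g u v \<Longrightarrow> vec_act (spin_inv g) v = u"
  using vec_act_eqI vec_act_inv by metis

lemma vec_act_linear: assumes "g \<in> Spin"
  shows "vec_act g (u + v) = vec_act g u + vec_act g v" "vec_act g (c *s u) = c *s vec_act g u"
  by (intro vec_act_eqI intertwines_linear vec_act_intertwines assms)+

text \<open>The quadratic form is read off from the square of Clifford multiplication on one nonzero
  spinor, here the image of \<open>e_basis {}\<close>.\<close>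

lemma vec_act_quad: assumes "g \<in> Spin" shows "quad (vec_act g v) = quad v"
proof -
  let ?x = "g (e_basis {})"
  have "quad (vec_act g v) *s ?x = quad v *s ?x"
    using vec_act_intertwines [OF assms, of v] Spin_linear(2) [OF assms, of "quad v" "e_basis {}"]
    by (simp add: clifford_square [symmetric] intertwines_def fun_eq_iff)
  moreover have "?x \<noteq> 0"
    using spin_inv_apply(1) [OF assms, of "e_basis {}"] Spin_zero [OF spin_inv(1) [OF assms]]
    by (auto simp: e_basis_def axis_eq_0_iff)
  ultimately show ?thesis by simp
qed

lemma isotropic_frame_vec_act:
  assumes "g \<in> Spin" shows "isotropic_frame (vec_act g u, vec_act g v) \<longleftrightarrow> isotropic_frame (u, v)"
proof -
  have "a *s vec_act g u + b *s vec_act g v = vec_act g (a *s u + b *s v)" for a b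
    by (simp add: vec_act_linear assms)
  moreover have "vec_act g w = 0 \<longleftrightarrow> w = 0" for w
    using vec_act_inv(1) [OF assms, of w] vec_act_linear(2) [OF spin_inv(1) [OF assms], of 0 0]
      vec_act_linear(2) [OF assms, of 0 0] by auto
  ultimately show ?thesis by (simp add: isotropic_frame_def vec_act_quad assms)
qed

section \<open>The action on sections\<close>

lemma section_act_linear:
  "section_act g (s + t) = section_act g s + section_act g t"
  "section_act g (fun_scale c s) = fun_scale c (section_act g s)"
  by (auto simp: section_act_def fun_scale_def fun_eq_iff)

lemma section_act_comp:
  "g \<in> Spin \<Longrightarrow> h \<in> Spin \<Longrightarrow> section_act (g \<circ> h) s = section_act g (section_act h s)"
  by (auto simp: section_act_def fun_eq_iff spin_inv_comp vec_act_comp spin_inv)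

lemma section_act_id [simp]: "section_act id s = s"
proof -
  have "spin_inv id = id" using Spin.inv_one by simp
  thus ?thesis unfolding section_act_def by simp
qed

text \<open>Evaluates a translated section by pulling the frame back, with the inverse hidden in the
  intertwining relations.\<close>

lemma section_act_eval:
  assumes "g \<in> Spin" "intertwines g u u'" "intertwines g v v'"
  shows "section_act g s (u', v') = s (u, v)"
  using assms by (simp add: section_act_def vec_act_inv_eqI)

section \<open>Equivariant maps on fourth symmetric powers\<close>

lemma sym_embed_linear: "sym_embed (x + y) = sym_embed x + sym_embed y" "sym_embed (c *s x) = sym_scale c (sym_embed x)"
  by (simp_all add: sym_embed_def sym_scale_def single_add sum.distrib sum_distrib_left mult_single)

lemma sym_scale_mult: "sym_scale c p * q = sym_scale c (p * q)" "p * sym_scale c q = sym_scale c (p * q)"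
  by (simp_all add: sym_scale_def mult_ac)

definition sym4 :: "spinor \<Rightarrow> spinor \<Rightarrow> spinor \<Rightarrow> spinor \<Rightarrow> sym_algebra" where
  "sym4 x y z w = sym_embed x * sym_embed y * sym_embed z * sym_embed w"

lemma sym4_commute: "sym4 x y z w = sym4 y x z w" "sym4 x y z w = sym4 x z y w" "sym4 x y z w = sym4 x y w z"
  by (simp_all add: sym4_def mult_ac)

lemma sym4_linear:
  "sym4 (x + x') y z w = sym4 x y z w + sym4 x' y z w" "sym4 (c *s x) y z w = sym_scale c (sym4 x y z w)"
  by (simp_all add: sym4_def sym_embed_linear sym_scale_mult algebra_simps)

lemma sym4_in: "x \<in> half_spin \<Longrightarrow> y \<in> half_spin \<Longrightarrow> z \<in> half_spin \<Longrightarrow> w \<in> half_spin \<Longrightarrow> sym4 x y z w \<in> S4_half_spin"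
  unfolding S4_half_spin_def sym4_def by (rule sym_vs.span_base) blast

lemma sym_embed_power4: "sym_embed x ^ 4 = sym4 x x x x"
  by (simp add: sym4_def power4_eq_xxxx)

locale equivariant_map =
  fixes \<Gamma> :: "sym_algebra \<Rightarrow> (V \<times> V \<Rightarrow> complex)"
  assumes \<Gamma>: "nonzero_equivariant_map \<Gamma>"
begin

definition G :: "spinor \<Rightarrow> spinor \<Rightarrow> spinor \<Rightarrow> spinor \<Rightarrow> V \<times> V \<Rightarrow> complex" where
  "G x y z w = \<Gamma> (sym4 x y z w)"

lemma G_commute: "G x y z w = G y x z w" "G x y z w = G x z y w" "G x y z w = G x y w z"
  unfolding G_def using sym4_commute by metis+

lemma G_linear1:
  assumes "x \<in> half_spin" "x' \<in> half_spin" "y \<in> half_spin" "z \<in> half_spin" "w \<in> half_spin"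
  shows "G (x + x') y z w = G x y z w + G x' y z w" "G (c *s x) y z w = fun_scale c (G x y z w)"
  using \<Gamma> assms sym4_in unfolding nonzero_equivariant_map_def linear_on_def G_def sym4_linear by blast+

lemma G_linear2:
  assumes "x \<in> half_spin" "x' \<in> half_spin" "y \<in> half_spin" "z \<in> half_spin" "w \<in> half_spin"
  shows "G y (x + x') z w = G y x z w + G y x' z w" "G y (c *s x) z w = fun_scale c (G y x z w)"
  using G_linear1 assms G_commute(1) by metis+

lemma G_linear3:
  assumes "x \<in> half_spin" "x' \<in> half_spin" "y \<in> half_spin" "z \<in> half_spin" "w \<in> half_spin"
  shows "G y z (x + x') w = G y z x w + G y z x' w" "G y z (c *s x) w = fun_scale c (G y z x w)"
  using G_linear2 assms G_commute(2) by metis+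

lemma G_linear4:
  assumes "x \<in> half_spin" "x' \<in> half_spin" "y \<in> half_spin" "z \<in> half_spin" "w \<in> half_spin"
  shows "G y z w (x + x') = G y z w x + G y z w x'" "G y z w (c *s x) = fun_scale c (G y z w x)"
  using G_linear3 assms G_commute(3) by metis+

lemma G_equivariant:
  assumes "g \<in> Spin" "x \<in> half_spin" "y \<in> half_spin" "z \<in> half_spin" "w \<in> half_spin"
  shows "G (g x) (g y) (g z) (g w) = section_act g (G x y z w)"
  using \<Gamma> assms unfolding nonzero_equivariant_map_def G_def sym4_def by blast

lemma G_quadric:
  assumes "x \<in> half_spin" "y \<in> half_spin" "z \<in> half_spin" "w \<in> half_spin"
  shows "G x y z w \<in> quadric_sections"
  using \<Gamma> sym4_in [OF assms] unfolding nonzero_equivariant_map_def G_def by blast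

text \<open>Products span the fourth symmetric power. The induction also carries membership, since
  linearity of \<open>\<Gamma>\<close> is available only on \<open>S4_half_spin\<close>.\<close>

lemma G_nonzero: "\<exists>x\<in>half_spin. \<exists>y\<in>half_spin. \<exists>z\<in>half_spin. \<exists>w\<in>half_spin. G x y z w \<noteq> 0"
proof (rule ccontr)
  assume "\<not> ?thesis"
  hence 0: "\<Gamma> (sym_embed x * sym_embed y * sym_embed z * sym_embed w) = 0"
    if "x \<in> half_spin" "y \<in> half_spin" "z \<in> half_spin" "w \<in> half_spin" for x y z w
    using that unfolding G_def sym4_def by blast
  have lin: "linear_on sym_scale fun_scale S4_half_spin \<Gamma>" using \<Gamma> by (simp add: nonzero_equivariant_map_def)
  have "\<Gamma> p = 0 \<and> p \<in> S4_half_spin" if "p \<in> S4_half_spin" for p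
    using that unfolding S4_half_spin_def
  proof (induction rule: sym_vs.span_induct_alt)
    case base
    have "\<Gamma> (sym_scale 0 0) = fun_scale 0 (\<Gamma> 0)"
      using lin sym_vs.span_zero unfolding linear_on_def S4_half_spin_def by blast
    thus ?case by (auto simp: fun_scale_def fun_eq_iff sym_vs.span_zero)
  next
    case (step c x y)
    have x: "x \<in> S4_half_spin" unfolding S4_half_spin_def by (rule sym_vs.span_base) (rule step(1))
    have "\<Gamma> x = 0" using step(1) 0 by blast
    hence "\<Gamma> (sym_scale c x) = 0"
      using lin x unfolding linear_on_def by (auto simp: fun_scale_def fun_eq_iff)
    moreover have cx: "sym_scale c x \<in> S4_half_spin" using x unfolding S4_half_spin_def by (rule sym_vs.span_scale)
    moreover have "\<Gamma> (sym_scale c x + y) = \<Gamma> (sym_scale c x) + \<Gamma> y"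
      using lin cx step(2) unfolding linear_on_def S4_half_spin_def by blast
    ultimately show ?case using step(2) unfolding S4_half_spin_def by (simp add: sym_vs.span_add)
  qed
  thus False using \<Gamma> unfolding nonzero_equivariant_map_def by blast
qed

end

section \<open>The Cartan subspace\<close>

text \<open>Mutually orthogonal vectors of norm 1. Up to sign, Clifford multiplication by
  \<open>wvec i\<close> toggles \<open>i\<close> in the index set of a basis spinor.\<close>

definition wvec :: "8 \<Rightarrow> V" where "wvec i = ebas i + fbas i"

lemma quad_bas [simp]: "quad (ebas i) = 0" "quad (fbas i) = 0"
  using polar_self [of "ebas i"] polar_self [of "fbas i"] by simp_all

lemma quad_wvec [simp]: "quad (wvec i) = 1"
  by (simp add: wvec_def quad_add)

lemma polar_wvec: "polar (wvec i) (wvec j) = (if i = j then 2 else 0)"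
  by (auto simp: wvec_def polar_linear)

lemma clifford_wvec_basis:
  "clifford (wvec i) (e_basis I) = wedge_sign i I *s e_basis (if i \<in> I then I - {i} else insert i I)"
  by (simp add: wvec_def clifford_add_left wedge_e_basis contract_f_basis)

text \<open>Subsets encoded by eight truth values, so that Clifford products of basis spinors are
  evaluated by simplification.\<close>

definition index_set :: "bool \<Rightarrow> bool \<Rightarrow> bool \<Rightarrow> bool \<Rightarrow> bool \<Rightarrow> bool \<Rightarrow> bool \<Rightarrow> bool \<Rightarrow> 8 set" where
  "index_set b0 b1 b2 b3 b4 b5 b6 b7 = {i. i = 0 \<and> b0 \<or> i = 1 \<and> b1 \<or> i = 2 \<and> b2 \<or> i = 3 \<and> b3 \<or>
     i = 4 \<and> b4 \<or> i = 5 \<and> b5 \<or> i = 6 \<and> b6 \<or> i = 7 \<and> b7}"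

definition bvec :: "bool \<Rightarrow> bool \<Rightarrow> bool \<Rightarrow> bool \<Rightarrow> bool \<Rightarrow> bool \<Rightarrow> bool \<Rightarrow> bool \<Rightarrow> spinor" where
  "bvec b0 b1 b2 b3 b4 b5 b6 b7 = e_basis (index_set b0 b1 b2 b3 b4 b5 b6 b7)"

lemma index_set_mem [simp]:
  "0 \<in> index_set b0 b1 b2 b3 b4 b5 b6 b7 \<longleftrightarrow> b0"
  "1 \<in> index_set b0 b1 b2 b3 b4 b5 b6 b7 \<longleftrightarrow> b1"
  "2 \<in> index_set b0 b1 b2 b3 b4 b5 b6 b7 \<longleftrightarrow> b2"
  "3 \<in> index_set b0 b1 b2 b3 b4 b5 b6 b7 \<longleftrightarrow> b3"
  "4 \<in> index_set b0 b1 b2 b3 b4 b5 b6 b7 \<longleftrightarrow> b4"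
  "5 \<in> index_set b0 b1 b2 b3 b4 b5 b6 b7 \<longleftrightarrow> b5"
  "6 \<in> index_set b0 b1 b2 b3 b4 b5 b6 b7 \<longleftrightarrow> b6"
  "7 \<in> index_set b0 b1 b2 b3 b4 b5 b6 b7 \<longleftrightarrow> b7"
  by (simp_all add: index_set_def)

lemma set_8_eqI: "(\<And>i. i \<in> {0,1,2,3,4,5,6,7::8} \<Longrightarrow> i \<in> I \<longleftrightarrow> i \<in> J) \<Longrightarrow> I = J"
  unfolding UNIV_8 [symmetric] by blast

lemma clifford_wvec_bvec [simp]:
  "clifford (wvec 0) (bvec b0 b1 b2 b3 b4 b5 b6 b7) = (1) *s bvec (\<not> b0) b1 b2 b3 b4 b5 b6 b7"
  "clifford (wvec 1) (bvec b0 b1 b2 b3 b4 b5 b6 b7) = ((if b0 then -1 else 1)) *s bvec b0 (\<not> b1) b2 b3 b4 b5 b6 b7"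
  "clifford (wvec 2) (bvec b0 b1 b2 b3 b4 b5 b6 b7) = ((if b0 then -1 else 1)*(if b1 then -1 else 1)) *s bvec b0 b1 (\<not> b2) b3 b4 b5 b6 b7"
  "clifford (wvec 3) (bvec b0 b1 b2 b3 b4 b5 b6 b7) = ((if b0 then -1 else 1)*(if b1 then -1 else 1)*(if b2 then -1 else 1)) *s bvec b0 b1 b2 (\<not> b3) b4 b5 b6 b7"
  "clifford (wvec 4) (bvec b0 b1 b2 b3 b4 b5 b6 b7) = ((if b0 then -1 else 1)*(if b1 then -1 else 1)*(if b2 then -1 else 1)*(if b3 then -1 else 1)) *s bvec b0 b1 b2 b3 (\<not> b4) b5 b6 b7"
  "clifford (wvec 5) (bvec b0 b1 b2 b3 b4 b5 b6 b7) = ((if b0 then -1 else 1)*(if b1 then -1 else 1)*(if b2 then -1 else 1)*(if b3 then -1 else 1)*(if b4 then -1 else 1)) *s bvec b0 b1 b2 b3 b4 (\<not> b5) b6 b7"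
  "clifford (wvec 6) (bvec b0 b1 b2 b3 b4 b5 b6 b7) = ((if b0 then -1 else 1)*(if b1 then -1 else 1)*(if b2 then -1 else 1)*(if b3 then -1 else 1)*(if b4 then -1 else 1)*(if b5 then -1 else 1)) *s bvec b0 b1 b2 b3 b4 b5 (\<not> b6) b7"
  "clifford (wvec 7) (bvec b0 b1 b2 b3 b4 b5 b6 b7) = ((if b0 then -1 else 1)*(if b1 then -1 else 1)*(if b2 then -1 else 1)*(if b3 then -1 else 1)*(if b4 then -1 else 1)*(if b5 then -1 else 1)*(if b6 then -1 else 1)) *s bvec b0 b1 b2 b3 b4 b5 b6 (\<not> b7)"
proof -
  have c: "card {j \<in> I. j < i} = (\<Sum>j | j < i. of_bool (j \<in> I))" for i :: 8 and I
    by (simp add: Collect_conj_eq Int_commute)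
  have l: "{j. j < 1} = {0::8}" "{j. j < 2} = {0,1::8}" "{j. j < 3} = {0,1,2::8}" "{j. j < 4} = {0,1,2,3::8}"
    "{j. j < 5} = {0,1,2,3,4::8}" "{j. j < 6} = {0,1,2,3,4,5::8}" "{j. j < 7} = {0,1,2,3,4,5,6::8}" "{j. j < 0} = ({}::8 set)"
    by (rule set_8_eqI; auto)+
  have s: "(if i \<in> I then I - {i} else insert i I) = {j. if j = i then i \<notin> I else j \<in> I}" for i :: 8 and I by auto
  have "{j. if j = 0 then 0 \<notin> index_set b0 b1 b2 b3 b4 b5 b6 b7 else j \<in> index_set b0 b1 b2 b3 b4 b5 b6 b7} = index_set (\<not> b0) b1 b2 b3 b4 b5 b6 b7"
    by (rule set_8_eqI) auto
  thus "clifford (wvec 0) (bvec b0 b1 b2 b3 b4 b5 b6 b7) = (1) *s bvec (\<not> b0) b1 b2 b3 b4 b5 b6 b7"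
    unfolding bvec_def clifford_wvec_basis s wedge_sign_def c l by (simp add: power_add)
  have "{j. if j = 1 then 1 \<notin> index_set b0 b1 b2 b3 b4 b5 b6 b7 else j \<in> index_set b0 b1 b2 b3 b4 b5 b6 b7} = index_set b0 (\<not> b1) b2 b3 b4 b5 b6 b7"
    by (rule set_8_eqI) auto
  thus "clifford (wvec 1) (bvec b0 b1 b2 b3 b4 b5 b6 b7) = ((if b0 then -1 else 1)) *s bvec b0 (\<not> b1) b2 b3 b4 b5 b6 b7"
    unfolding bvec_def clifford_wvec_basis s wedge_sign_def c l by (simp add: power_add)
  have "{j. if j = 2 then 2 \<notin> index_set b0 b1 b2 b3 b4 b5 b6 b7 else j \<in> index_set b0 b1 b2 b3 b4 b5 b6 b7} = index_set b0 b1 (\<not> b2) b3 b4 b5 b6 b7"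
    by (rule set_8_eqI) auto
  thus "clifford (wvec 2) (bvec b0 b1 b2 b3 b4 b5 b6 b7) = ((if b0 then -1 else 1)*(if b1 then -1 else 1)) *s bvec b0 b1 (\<not> b2) b3 b4 b5 b6 b7"
    unfolding bvec_def clifford_wvec_basis s wedge_sign_def c l by (simp add: power_add)
  have "{j. if j = 3 then 3 \<notin> index_set b0 b1 b2 b3 b4 b5 b6 b7 else j \<in> index_set b0 b1 b2 b3 b4 b5 b6 b7} = index_set b0 b1 b2 (\<not> b3) b4 b5 b6 b7"
    by (rule set_8_eqI) auto
  thus "clifford (wvec 3) (bvec b0 b1 b2 b3 b4 b5 b6 b7) = ((if b0 then -1 else 1)*(if b1 then -1 else 1)*(if b2 then -1 else 1)) *s bvec b0 b1 b2 (\<not> b3) b4 b5 b6 b7"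
    unfolding bvec_def clifford_wvec_basis s wedge_sign_def c l by (simp add: power_add)
  have "{j. if j = 4 then 4 \<notin> index_set b0 b1 b2 b3 b4 b5 b6 b7 else j \<in> index_set b0 b1 b2 b3 b4 b5 b6 b7} = index_set b0 b1 b2 b3 (\<not> b4) b5 b6 b7"
    by (rule set_8_eqI) auto
  thus "clifford (wvec 4) (bvec b0 b1 b2 b3 b4 b5 b6 b7) = ((if b0 then -1 else 1)*(if b1 then -1 else 1)*(if b2 then -1 else 1)*(if b3 then -1 else 1)) *s bvec b0 b1 b2 b3 (\<not> b4) b5 b6 b7"
    unfolding bvec_def clifford_wvec_basis s wedge_sign_def c l by (simp add: power_add)
  have "{j. if j = 5 then 5 \<notin> index_set b0 b1 b2 b3 b4 b5 b6 b7 else j \<in> index_set b0 b1 b2 b3 b4 b5 b6 b7} = index_set b0 b1 b2 b3 b4 (\<not> b5) b6 b7"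
    by (rule set_8_eqI) auto
  thus "clifford (wvec 5) (bvec b0 b1 b2 b3 b4 b5 b6 b7) = ((if b0 then -1 else 1)*(if b1 then -1 else 1)*(if b2 then -1 else 1)*(if b3 then -1 else 1)*(if b4 then -1 else 1)) *s bvec b0 b1 b2 b3 b4 (\<not> b5) b6 b7"
    unfolding bvec_def clifford_wvec_basis s wedge_sign_def c l by (simp add: power_add)
  have "{j. if j = 6 then 6 \<notin> index_set b0 b1 b2 b3 b4 b5 b6 b7 else j \<in> index_set b0 b1 b2 b3 b4 b5 b6 b7} = index_set b0 b1 b2 b3 b4 b5 (\<not> b6) b7"
    by (rule set_8_eqI) auto
  thus "clifford (wvec 6) (bvec b0 b1 b2 b3 b4 b5 b6 b7) = ((if b0 then -1 else 1)*(if b1 then -1 else 1)*(if b2 then -1 else 1)*(if b3 then -1 else 1)*(if b4 then -1 else 1)*(if b5 then -1 else 1)) *s bvec b0 b1 b2 b3 b4 b5 (\<not> b6) b7"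
    unfolding bvec_def clifford_wvec_basis s wedge_sign_def c l by (simp add: power_add)
  have "{j. if j = 7 then 7 \<notin> index_set b0 b1 b2 b3 b4 b5 b6 b7 else j \<in> index_set b0 b1 b2 b3 b4 b5 b6 b7} = index_set b0 b1 b2 b3 b4 b5 b6 (\<not> b7)"
    by (rule set_8_eqI) auto
  thus "clifford (wvec 7) (bvec b0 b1 b2 b3 b4 b5 b6 b7) = ((if b0 then -1 else 1)*(if b1 then -1 else 1)*(if b2 then -1 else 1)*(if b3 then -1 else 1)*(if b4 then -1 else 1)*(if b5 then -1 else 1)*(if b6 then -1 else 1)) *s bvec b0 b1 b2 b3 b4 b5 b6 (\<not> b7)"
    unfolding bvec_def clifford_wvec_basis s wedge_sign_def c l by (simp add: power_add)
qed


text \<open>A maximal torus in half-weights: spinors are scaled by products of \<open>s i\<close>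
  and inverses, whereas \<open>ebas i\<close> is scaled by the square of \<open>s i\<close>.\<close>

definition torus :: "(8 \<Rightarrow> complex) \<Rightarrow> spinor \<Rightarrow> spinor" where
  "torus s x = (\<chi> I. (\<Prod>i\<in>UNIV. if i \<in> I then s i else inverse (s i)) * x $ I)"

lemma torus_basis: "torus s (e_basis I) = (\<Prod>i\<in>UNIV. if i \<in> I then s i else inverse (s i)) *s e_basis I"
  by (simp add: torus_def e_basis_def axis_def vec_eq_iff)

lemma torus_comp: "torus s \<circ> torus t = torus (\<lambda>i. s i * t i)"
  by (auto simp: torus_def vec_eq_iff fun_eq_iff prod.distrib [symmetric] mult.assoc [symmetric] intro!: prod.cong)

lemma Spin_eqI:
  assumes "g \<in> Spin" "\<And>x y. f (x + y) = f x + f y" "\<And>c x. f (c *s x) = c *s f x" "\<And>I. f (e_basis I) = g (e_basis I)"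
  shows "f = g"
proof
  fix x
  have 0: "f 0 = 0" using assms(3) [of 0 0] by simp
  have "f (\<Sum>I\<in>A. x $ I *s e_basis I) = g (\<Sum>I\<in>A. x $ I *s e_basis I)" for A
    using assms by (induction A rule: infinite_finite_induct) (simp_all add: Spin_linear Spin_zero 0)
  from this [of UNIV] show "f x = g x" unfolding spinor_expand [of x, symmetric] .
qed

text \<open>A product of two unit vectors from the hyperbolic plane of \<open>i\<close>:
  \<open>wvec i\<close> toggles \<open>i\<close>, and the other factor toggles it back with weight
  \<open>a\<close> or its inverse.\<close>

lemma torus_single_in_Spin: assumes "a \<noteq> 0" shows "torus (\<lambda>j. if j = i then a else 1) \<in> Spin"
proof -
  let ?g = "clifford (a *s ebas i + inverse a *s fbas i) \<circ> clifford (wvec i)"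
  have g: "?g \<in> Spin"
    by (rule Spin_pair) (use assms in \<open>simp_all add: quad_add quad_scale polar_linear\<close>)
  have p: "(\<Prod>j\<in>UNIV. if j \<in> I then if j = i then a else 1 else inverse (if j = i then a else 1)) = (if i \<in> I then a else inverse a)" for I
  proof -
    have "(\<Prod>j\<in>UNIV. if j \<in> I then if j = i then a else 1 else inverse (if j = i then a else 1)) = (\<Prod>j\<in>UNIV. if j = i then if i \<in> I then a else inverse a else 1)"
      by (rule prod.cong) auto
    thus ?thesis by simp
  qed
  have "torus (\<lambda>j. if j = i then a else 1) (e_basis I) = ?g (e_basis I)" for I
    unfolding torus_basis p
    by (simp add: clifford_wvec_basis clifford_scale clifford_add_left clifford_scale_left wedge_e_basis contract_f_basis insert_absorb mult_ac)
  hence "torus (\<lambda>j. if j = i then a else 1) = ?g"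
    by (intro Spin_eqI g) (auto simp: torus_def vec_eq_iff algebra_simps)
  thus ?thesis using g by simp
qed

lemma torus_in_Spin: assumes "\<And>i. s i \<noteq> 0" shows "torus s \<in> Spin"
proof -
  have "torus (\<lambda>j. if j \<in> A then s j else 1) \<in> Spin" if "finite A" for A
    using that
  proof (induction A rule: finite_induct)
    case empty
    have "torus (\<lambda>j. 1) = id" by (auto simp: torus_def vec_eq_iff fun_eq_iff cong: if_cong)
    thus ?case using Spin_id by (simp only: empty_iff if_False)
  next
    case (insert i A)
    have *: "torus (\<lambda>j. if j \<in> insert i A then s j else 1) = torus (\<lambda>j. if j = i then s i else 1) \<circ> torus (\<lambda>j. if j \<in> A then s j else 1)"
      unfolding torus_comp using insert by (auto intro!: arg_cong [of _ _ torus])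
    show ?case unfolding * by (rule Spin_comp [OF torus_single_in_Spin [OF assms] insert(3)])
  qed
  from this [of UNIV] show ?thesis by simp
qed

text \<open>Toggling \<open>i\<close> exchanges \<open>s i\<close> and its inverse in the weight of
  a spinor, which accounts for the square.\<close>

lemma torus_intertwines:
  assumes "\<And>i. s i \<noteq> 0"
  shows "intertwines (torus s) (ebas i) ((s i)\<^sup>2 *s ebas i)" "intertwines (torus s) (fbas i) (inverse ((s i)\<^sup>2) *s fbas i)"
proof -
  let ?p = "\<lambda>I. \<Prod>i\<in>UNIV. if i \<in> I then s i else inverse (s i)"
  have r: "?p I = (if i \<in> I then s i else inverse (s i)) * (\<Prod>j\<in>UNIV - {i}. if j \<in> I then s j else inverse (s j))" for I
    by (subst prod.remove [of _ i]) auto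
  have m: "(\<Prod>j\<in>UNIV - {i}. if j \<in> I - {i} then s j else inverse (s j)) = (\<Prod>j\<in>UNIV - {i}. if j \<in> I then s j else inverse (s j))"
    "(\<Prod>j\<in>UNIV - {i}. if j \<in> insert i I then s j else inverse (s j)) = (\<Prod>j\<in>UNIV - {i}. if j \<in> I then s j else inverse (s j))" for I
    by (rule prod.cong; simp)+
  have e: "?p I = (s i)\<^sup>2 * ?p (I - {i})" if "i \<in> I" for I
    using that assms [of i] unfolding r m by (simp add: power2_eq_square)
  have f: "?p I = inverse ((s i)\<^sup>2) * ?p (insert i I)" if "i \<notin> I" for I
    using that assms [of i] unfolding r m by (simp add: power2_eq_square)
  have "(torus s (wedge_e i x)) $ I = ((s i)\<^sup>2 *s wedge_e i (torus s x)) $ I" for x I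
    unfolding torus_def by (simp add: wedge_e_nth e)
  moreover have "(torus s (contract_f i x)) $ I = (inverse ((s i)\<^sup>2) *s contract_f i (torus s x)) $ I" for x I
    unfolding torus_def by (simp add: contract_f_nth f)
  ultimately show "intertwines (torus s) (ebas i) ((s i)\<^sup>2 *s ebas i)" "intertwines (torus s) (fbas i) (inverse ((s i)\<^sup>2) *s fbas i)"
    unfolding intertwines_def by (auto simp: fun_eq_iff clifford_scale_left vec_eq_iff simp del: vector_smult_component)
qed

lemma prod_8: "(\<Prod>i\<in>UNIV. f (i::8)) = f 0 * f 1 * f 2 * f 3 * f 4 * f 5 * f 6 * f 7"
  unfolding UNIV_8 by (simp add: mult.assoc)

lemma sum_8: "(\<Sum>i\<in>UNIV. f (i::8)) = f 0 + f 1 + f 2 + f 3 + f 4 + f 5 + f 6 + f 7"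
  unfolding UNIV_8 by (simp add: add.assoc)

lemma torus_cis_bvec:
  "torus (\<lambda>i. cis (t i)) (bvec b0 b1 b2 b3 b4 b5 b6 b7) = cis ((if b0 then t 0 else - t 0) + (if b1 then t 1 else - t 1) + (if b2 then t 2 else - t 2) + (if b3 then t 3 else - t 3) + (if b4 then t 4 else - t 4) + (if b5 then t 5 else - t 5) + (if b6 then t 6 else - t 6) + (if b7 then t 7 else - t 7)) *s bvec b0 b1 b2 b3 b4 b5 b6 b7"
  unfolding bvec_def torus_basis prod_8 by (simp add: cis_mult if_distrib [of cis] flip: if_distrib [of cis] cong: if_cong)


text \<open>Indices \<open>0, \<dots>, 7\<close> are read as vectors of \<open>\<F>\<^sub>2\<^sup>3\<close> via their binary digits; \<open>dot\<close> is the standard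
  bilinear form. With it, the basis of the Cartan subspace is uniformly \<open>H \<kappa> = e\<^sub>S + e\<^sub>S\<^sub>'\<close> with \<open>S = \<kappa>\<^sup>\<bottom>\<close> and
  complement \<open>S'\<close>.\<close>

definition dot :: "8 \<Rightarrow> 8 \<Rightarrow> bool" where
  "dot k i \<longleftrightarrow> (((k \<in> {1,3,5,7} \<and> i \<in> {1,3,5,7}) \<noteq> (k \<in> {2,3,6,7} \<and> i \<in> {2,3,6,7})) \<noteq> (k \<in> {4,5,6,7} \<and> i \<in> {4,5,6,7}))"

definition H :: "8 \<Rightarrow> spinor" where
  "H k = e_basis {i. \<not> dot k i} + e_basis {i. dot k i}"

lemma H_bvec:
  "H 0 = bvec True True True True True True True True + bvec False False False False False False False False"
  "H 1 = bvec True False True False True False True False + bvec False True False True False True False True"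
  "H 2 = bvec True True False False True True False False + bvec False False True True False False True True"
  "H 3 = bvec True False False True True False False True + bvec False True True False False True True False"
  "H 4 = bvec True True True True False False False False + bvec False False False False True True True True"
  "H 5 = bvec True False True False False True False True + bvec False True False True True False True False"
  "H 6 = bvec True True False False False False True True + bvec False False True True True True False False"
  "H 7 = bvec True False False True False True True False + bvec False True True False True False False True"
  unfolding H_def bvec_def
  by (rule arg_cong2 [where f = "(+)"]; rule arg_cong [where f = e_basis]; unfold set_eq_iff all_8; simp add: dot_def)+

lemma cartan_span: "cartan = vec.span (range H)"
proof -
  have e: "{i. dot 0 i} = {}"
    "{i. \<not> dot 0 i} = {0,1,2,3,4,5,6,7}"
    "{i. \<not> dot 1 i} = {0,2,4,6}" "{i. dot 1 i} = {1,3,5,7}"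
    "{i. \<not> dot 2 i} = {0,1,4,5}" "{i. dot 2 i} = {2,3,6,7}"
    "{i. \<not> dot 3 i} = {0,3,4,7}" "{i. dot 3 i} = {1,2,5,6}"
    "{i. \<not> dot 4 i} = {0,1,2,3}" "{i. dot 4 i} = {4,5,6,7}"
    "{i. \<not> dot 5 i} = {0,2,5,7}" "{i. dot 5 i} = {1,3,4,6}"
    "{i. \<not> dot 6 i} = {0,1,6,7}" "{i. dot 6 i} = {2,3,4,5}"
    "{i. \<not> dot 7 i} = {0,3,5,6}" "{i. dot 7 i} = {1,2,4,7}"
    unfolding set_eq_iff all_8 by (simp_all add: dot_def)
  have "range H = {H 4, H 2, H 1, H 7, H 5, H 3, H 6, H 0}"
    unfolding UNIV_8 by auto
  thus ?thesis unfolding cartan_def H_def e by (simp only: add.commute)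
qed

section \<open>Coordinates on the Cartan subspace\<close>

definition cpt :: "(8 \<Rightarrow> complex) \<Rightarrow> spinor" where "cpt z = (\<Sum>k\<in>UNIV. z k *s H k)"

definition coord :: "spinor \<Rightarrow> 8 \<Rightarrow> complex" where "coord x k = x $ {i. \<not> dot k i}"

lemma dot_0 [simp]: "\<not> dot k 0" by (simp add: dot_def)

lemma dot_table [simp]:
  "\<not> dot 0 1" "\<not> dot 0 2" "\<not> dot 0 3" "\<not> dot 0 4" "\<not> dot 0 5" "\<not> dot 0 6" "\<not> dot 0 7"
  "dot 1 1" "\<not> dot 1 2" "dot 1 3" "\<not> dot 1 4" "dot 1 5" "\<not> dot 1 6" "dot 1 7"
  "\<not> dot 2 1" "dot 2 2" "dot 2 3" "\<not> dot 2 4" "\<not> dot 2 5" "dot 2 6" "dot 2 7"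
  "dot 3 1" "dot 3 2" "\<not> dot 3 3" "\<not> dot 3 4" "dot 3 5" "dot 3 6" "\<not> dot 3 7"
  "\<not> dot 4 1" "\<not> dot 4 2" "\<not> dot 4 3" "dot 4 4" "dot 4 5" "dot 4 6" "dot 4 7"
  "dot 5 1" "\<not> dot 5 2" "dot 5 3" "dot 5 4" "\<not> dot 5 5" "dot 5 6" "\<not> dot 5 7"
  "\<not> dot 6 1" "dot 6 2" "dot 6 3" "dot 6 4" "dot 6 5" "\<not> dot 6 6" "\<not> dot 6 7"
  "dot 7 1" "dot 7 2" "\<not> dot 7 3" "dot 7 4" "\<not> dot 7 5" "\<not> dot 7 6" "dot 7 7"
  unfolding dot_def by simp_all

lemma dot_inject: "(\<And>i. dot k i \<longleftrightarrow> dot l i) \<Longrightarrow> k = l"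
proof -
  have "\<forall>k. \<forall>l. (dot k 1 = dot l 1 \<and> dot k 2 = dot l 2 \<and> dot k 4 = dot l 4) \<longrightarrow> k = l"
    unfolding all_8 by simp
  thus "(\<And>i. dot k i \<longleftrightarrow> dot l i) \<Longrightarrow> k = l" by blast
qed

text \<open>A set of zeros of \<open>dot k\<close> contains 0 and its complement does not, so the
  coefficient at this set sees one summand of \<open>H k\<close> and nothing of the other basis
  vectors.\<close>

lemma H_nth: "H l $ {i. \<not> dot k i} = (if k = l then 1 else 0)"
proof -
  have "{i. \<not> dot k i} \<noteq> {i. dot l i}" using dot_0 [of k] dot_0 [of l] by blast
  moreover have "{i. \<not> dot k i} = {i. \<not> dot l i} \<longleftrightarrow> k = l" using dot_inject [of k l] by blast
  ultimately show ?thesis by (simp add: H_def e_basis_def axis_def)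
qed

lemma coord_linear: "coord (x + y) k = coord x k + coord y k" "coord (c *s x) k = c * coord x k"
  by (simp_all add: coord_def)

lemma coord_cpt [simp]: "coord (cpt z) = z"
proof
  fix k
  have "coord (cpt z) k = (\<Sum>l\<in>UNIV. if k = l then z l else 0)"
    unfolding coord_def cpt_def by (simp add: H_nth if_distrib cong: if_cong)
  thus "coord (cpt z) k = z k" by simp
qed

lemma cpt_linear: "cpt (\<lambda>k. z k + y k) = cpt z + cpt y" "cpt (\<lambda>k. c * z k) = c *s cpt z"
  by (simp_all add: cpt_def vec.scale_left_distrib sum.distrib vec.scale_sum_right)

lemma cpt_in_cartan [simp]: "cpt z \<in> cartan"
  unfolding cpt_def cartan_span by (intro vec.span_sum vec.span_scale vec.span_base) simp

lemma cpt_single: "cpt (\<lambda>l. if l = k then 1 else 0) = H k"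
proof -
  have "cpt (\<lambda>l. if l = k then 1 else 0) = (\<Sum>l\<in>UNIV. if l = k then H l else 0)"
    unfolding cpt_def by (rule sum.cong) auto
  thus ?thesis by simp
qed

lemma cpt_coord: assumes "x \<in> cartan" shows "cpt (coord x) = x"
proof -
  have "\<exists>z. x = cpt z"
    using assms unfolding cartan_span
  proof (induction rule: vec.span_induct_alt)
    case base
    have "(0::spinor) = cpt (\<lambda>k. 0)" by (simp add: cpt_def)
    thus ?case by blast
  next
    case (step c x y)
    then obtain k z where "x = H k" "y = cpt z" by blast
    hence "c *s x + y = cpt (\<lambda>l. c * (if l = k then 1 else 0) + z l)"
      unfolding cpt_linear by (simp only: cpt_single)
    thus ?case by blast
  qed
  thus ?thesis by auto
qed

lemma H_in_cartan [simp]: "H k \<in> cartan"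
  unfolding cartan_span by (rule vec.span_base) simp

lemma cartan_half_spin: assumes "x \<in> cartan" shows "x \<in> half_spin"
proof -
  have "\<forall>k. even (card {i. dot k i}) \<and> even (card {i. \<not> dot k i})"
  proof -
    have c: "card {i. P i} = (\<Sum>i\<in>UNIV. of_bool (P i))" for P :: "8 \<Rightarrow> bool" by simp
    show ?thesis unfolding c sum_8 all_8 by simp
  qed
  hence H: "H k \<in> half_spin" for k
    by (auto simp: half_spin_def H_def e_basis_def axis_def)
  have 0: "0 \<in> half_spin" by (simp add: half_spin_def)
  have "cpt z \<in> half_spin" for z
    unfolding cpt_def sum_8 by (intro half_spin_subspace H)
  thus ?thesis using cpt_coord [OF assms] by metis
qed

lemma Spin_ext_cartan:
  assumes "g \<in> Spin" "\<And>k. g (H k) = (\<Sum>l\<in>UNIV. m k l *s H l)"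
  shows "g (cpt z) = cpt (\<lambda>l. \<Sum>k\<in>UNIV. z k * m k l)"
proof -
  have "g (cpt z) = (\<Sum>k\<in>UNIV. z k *s (\<Sum>l\<in>UNIV. m k l *s H l))"
    unfolding cpt_def by (simp add: Spin_sum assms Spin_linear(2))
  also have "\<dots> = (\<Sum>l\<in>UNIV. \<Sum>k\<in>UNIV. (z k * m k l) *s H l)"
    by (subst sum.swap) (simp add: vec.scale_sum_right)
  finally show ?thesis by (simp add: cpt_def vec.scale_sum_left)
qed

text \<open>The two summands of \<open>H k\<close> are complementary and have positive sign, while
  summands for different \<open>k\<close> are never complementary. In these coordinates the
  invariant form is therefore twice the standard one.\<close>

lemma spinor_form_cpt: "spinor_form (cpt z) (cpt y) = 2 * (\<Sum>k\<in>UNIV. z k * y k)"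
proof -
  let ?s = "\<lambda>I. \<Prod>i\<in>I. (-1) ^ nat8 i :: complex"
  have e: "spinor_form (e_basis I) (e_basis J) = (if J = - I then ?s I else 0)" for I J
  proof -
    have "spinor_form (e_basis I) (e_basis J) = (\<Sum>K\<in>UNIV. if K = I then if J = - K then ?s K else 0 else 0)"
      unfolding spinor_form_def by (rule sum.cong) (auto simp: e_basis_def axis_def)
    thus ?thesis by simp
  qed
  have n: "nat8 0 = 0" "nat8 1 = 1" "nat8 2 = 2" "nat8 3 = 3" "nat8 4 = 4" "nat8 5 = 5" "nat8 6 = 6" "nat8 7 = 7"
  proof -
    have c: "nat8 i = (\<Sum>j\<in>UNIV. of_bool (j < i))" for i by (simp add: nat8_def)
    show "nat8 0 = 0" "nat8 1 = 1" "nat8 2 = 2" "nat8 3 = 3" "nat8 4 = 4" "nat8 5 = 5" "nat8 6 = 6" "nat8 7 = 7"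
      unfolding c sum_8 by simp_all
  qed
  have s: "?s {i. P i} = (\<Prod>i\<in>UNIV. if P i then (-1) ^ nat8 i else 1)" for P :: "8 \<Rightarrow> bool"
    using prod.inter_filter [of UNIV "\<lambda>i. (-1) ^ nat8 i :: complex" P] by simp
  have "\<forall>k. ?s {i. dot k i} = 1 \<and> ?s {i. \<not> dot k i} = 1"
    unfolding s prod_8 n all_8 by simp
  moreover have "{i. dot l i} = - {i. \<not> dot k i} \<longleftrightarrow> k = l" "{i. \<not> dot l i} = - {i. dot k i} \<longleftrightarrow> k = l"
    "{i. dot l i} \<noteq> - {i. dot k i}" "{i. \<not> dot l i} \<noteq> - {i. \<not> dot k i}" for k l
    using dot_inject [of k l] dot_0 [of k] dot_0 [of l] by blast+
  ultimately have HH: "spinor_form (H k) (H l) = (if k = l then 2 else 0)" for k l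
    unfolding H_def spinor_form_linear e by simp
  have s1: "spinor_form (\<Sum>k\<in>A. f k) y = (\<Sum>k\<in>A. spinor_form (f k) y)" for A f y
    using spinor_form_linear(2) [of 0 0 y] by (induction A rule: infinite_finite_induct) (simp_all add: spinor_form_linear)
  have s2: "spinor_form y (\<Sum>k\<in>A. f k) = (\<Sum>k\<in>A. spinor_form y (f k))" for A f y
    using spinor_form_linear(4) [of y 0 0] by (induction A rule: infinite_finite_induct) (simp_all add: spinor_form_linear)
  have "spinor_form (cpt z) (cpt y) = (\<Sum>k\<in>UNIV. \<Sum>l\<in>UNIV. z k * (y l * spinor_form (H k) (H l)))"
  proof -
    have 1: "spinor_form (cpt z) x = (\<Sum>k\<in>UNIV. z k * spinor_form (H k) x)" for x
      by (simp add: cpt_def s1 spinor_form_linear)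
    have 2: "spinor_form (H k) (cpt y) = (\<Sum>l\<in>UNIV. y l * spinor_form (H k) (H l))" for k
      by (simp add: cpt_def s2 spinor_form_linear)
    show ?thesis by (simp only: 1 2 sum_distrib_left)
  qed
  also have "\<dots> = (\<Sum>k\<in>UNIV. \<Sum>l\<in>UNIV. if k = l then 2 * (z k * y l) else 0)"
    unfolding HH by (intro sum.cong refl) auto
  finally show ?thesis by (simp add: sum_distrib_left)
qed

section \<open>Elements of the normalizer\<close>

text \<open>The Weyl group in coordinates, as functions, so that relations between its elements can
  be checked entry by entry.\<close>

definition cartan_maps :: "((8 \<Rightarrow> complex) \<Rightarrow> 8 \<Rightarrow> complex) set" where
  "cartan_maps = {A. \<exists>g\<in>normalizer_c. \<forall>z. g (cpt z) = cpt (A z)}"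

text \<open>The right inverse \<open>B\<close> provides surjectivity of \<open>g\<close> on the
  Cartan subspace.\<close>

lemma cartan_mapsI:
  assumes "g \<in> Spin" "\<And>z. g (cpt z) = cpt (A z)" "\<And>z. A (B z) = z"
  shows "g \<in> normalizer_c" "A \<in> cartan_maps"
proof -
  have "g ` cartan = cartan"
  proof (intro equalityI subsetI)
    fix x assume "x \<in> g ` cartan"
    thus "x \<in> cartan" using assms(2) cpt_coord cpt_in_cartan by (metis imageE)
  next
    fix x assume "x \<in> cartan"
    hence "x = g (cpt (B (coord x)))" by (simp add: assms(2,3) cpt_coord)
    thus "x \<in> g ` cartan" by (rule image_eqI) simp
  qed
  thus "g \<in> normalizer_c" using assms(1) by (simp add: normalizer_c_def)
  thus "A \<in> cartan_maps" unfolding cartan_maps_def using assms(2) by blast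
qed

lemma normalizer_comp: "g \<in> normalizer_c \<Longrightarrow> h \<in> normalizer_c \<Longrightarrow> g \<circ> h \<in> normalizer_c"
proof -
  assume "g \<in> normalizer_c" "h \<in> normalizer_c"
  thus ?thesis using Spin_comp [of g h] image_comp [of g h cartan] unfolding normalizer_c_def by simp
qed

lemma cartan_maps_comp: "A \<in> cartan_maps \<Longrightarrow> B \<in> cartan_maps \<Longrightarrow> A \<circ> B \<in> cartan_maps"
proof -
  assume "A \<in> cartan_maps" "B \<in> cartan_maps"
  then obtain g h where gh: "g \<in> normalizer_c" "\<And>z. g (cpt z) = cpt (A z)" "h \<in> normalizer_c" "\<And>z. h (cpt z) = cpt (B z)"
    unfolding cartan_maps_def by blast
  hence "\<forall>z. (g \<circ> h) (cpt z) = cpt ((A \<circ> B) z)" by simp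
  thus ?thesis unfolding cartan_maps_def using normalizer_comp [OF gh(1,3)] by blast
qed

section \<open>Reflections in the coordinates\<close>

definition flip :: "8 \<Rightarrow> (8 \<Rightarrow> complex) \<Rightarrow> 8 \<Rightarrow> complex" where
  "flip k z = (\<lambda>l. if l = k then - z l else z l)"

text \<open>The angles are pi/8 times the character of F_2^3 given by \<open>k\<close>. The phase on
  a summand of \<open>H l\<close> is then pi/8 times an inner product of two characters: 0 for
  distinct \<open>k\<close> and \<open>l\<close>, and plus or minus pi for equal ones.\<close>

definition flip_spin :: "8 \<Rightarrow> spinor \<Rightarrow> spinor" where
  "flip_spin k = torus (\<lambda>i. cis (if dot k i then - (pi/8) else pi/8))"

lemma flip_spin_in: "flip_spin k \<in> Spin"
  unfolding flip_spin_def by (rule torus_in_Spin) simp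

lemma cis_minus_pi: "cis (- pi) = -1"
  using cis_pi by (simp add: cis_cnj [symmetric])

lemma flip_spin_H: "flip_spin k (H l) = (if l = k then - H l else H l)"
proof -
  have lin: "flip_spin k (x + y) = flip_spin k x + flip_spin k y" for k x y
    using Spin_linear(1) [OF flip_spin_in] .
  have "\<forall>k. \<forall>l. flip_spin k (H l) = (if l = k then - H l else H l)"
    unfolding all_8 by (intro conjI; simp only: H_bvec lin; simp add: flip_spin_def torus_cis_bvec cis_minus_pi)
  thus ?thesis by blast
qed

lemma flip_spin_cpt: "flip_spin k (cpt z) = cpt (flip k z)"
proof -
  have "flip_spin k (cpt z) = (\<Sum>l\<in>UNIV. z l *s flip_spin k (H l))"
    unfolding cpt_def by (simp add: Spin_sum flip_spin_in Spin_linear(2))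
  thus ?thesis unfolding cpt_def by (auto simp: flip_spin_H flip_def intro!: sum.cong)
qed

lemma flip_flip [simp]: "flip k (flip k z) = z" by (auto simp: flip_def)

lemma flip_in: "flip_spin k \<in> normalizer_c" "flip k \<in> cartan_maps"
  using cartan_mapsI [OF flip_spin_in flip_spin_cpt flip_flip] by auto

text \<open>Simultaneous rotations by a right angle in four planes \<open>\<langle>w\<^sub>i, w\<^sub>j\<rangle>\<close>. These act on the
  Cartan subspace by matrices with entries \<open>0, \<plusminus>1/2\<close>.\<close>

definition wpair :: "8 \<Rightarrow> 8 \<Rightarrow> spinor \<Rightarrow> spinor" where
  "wpair i j x = clifford (wvec i) (clifford (wvec j) x)"

definition rot :: "8 \<Rightarrow> 8 \<Rightarrow> spinor \<Rightarrow> spinor" where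
  "rot i j x = of_real (1 / sqrt 2) *s (x + wpair i j x)"

lemma sqrt_2_sq: "complex_of_real (sqrt 2) * complex_of_real (sqrt 2) = 2"
  by (simp flip: of_real_mult)

text \<open>Since \<open>wvec i\<close> squares to 1, the sum of the identity and
  \<open>wpair i j\<close> factors as \<open>wvec i\<close> times
  \<open>wvec i + wvec j\<close>.\<close>

lemma rot_eq: "i \<noteq> j \<Longrightarrow> rot i j = clifford (wvec i) \<circ> clifford (of_real (1 / sqrt 2) *s (wvec i + wvec j))"
  by (auto simp: rot_def wpair_def clifford_add_left clifford_scale_left clifford_scale clifford_add clifford_square)

lemma rot_in_Spin: "i \<noteq> j \<Longrightarrow> rot i j \<in> Spin"
  unfolding rot_eq by (rule Spin_pair)
    (simp_all add: quad_scale quad_add polar_linear polar_wvec power2_eq_square field_simps sqrt_2_sq vec.scale_right_distrib)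

lemma wpair_linear: "wpair i j (x + y) = wpair i j x + wpair i j y" "wpair i j (c *s x) = c *s wpair i j x"
  "wpair i j (- x) = - wpair i j x"
  by (simp_all add: wpair_def clifford_add clifford_scale)

lemma wvec_anticomm: "i \<noteq> j \<Longrightarrow> clifford (wvec i) (clifford (wvec j) x) = - clifford (wvec j) (clifford (wvec i) x)"
  using clifford_anticomm [of "wvec i" "wvec j" x] by (simp add: polar_wvec eq_neg_iff_add_eq_0)

lemma wpair_square: "i \<noteq> j \<Longrightarrow> wpair i j (wpair i j x) = - x"
  unfolding wpair_def by (subst wvec_anticomm) (simp_all add: clifford_square)

lemma wpair_commute: "distinct [i, j, k, l] \<Longrightarrow> wpair i j (wpair k l x) = wpair k l (wpair i j x)"
  unfolding wpair_def
  by (simp add: wvec_anticomm [of i k] wvec_anticomm [of i l] wvec_anticomm [of j k] wvec_anticomm [of j l])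

text \<open>Write A, B, C, D for the four commuting pairs, each of square -1, and expand (1 + A)(1 +
  B)(1 + C)(1 + D). From ABCD x = x, each triple product is minus the missing factor and cancels it,
  and the six double products coincide in pairs, such as CD = AB.\<close>

lemma rot4:
  assumes d: "distinct [a, a', b, b', c, c', d, d']"
    and one: "wpair a a' (wpair b b' (wpair c c' (wpair d d' x))) = x"
  shows "rot a a' (rot b b' (rot c c' (rot d d' x))) =
    (1/2) *s (x + wpair a a' (wpair b b' x) + wpair a a' (wpair c c' x) + wpair a a' (wpair d d' x))"
proof -
  let ?A = "wpair a a'" and ?B = "wpair b b'" and ?C = "wpair c c'" and ?D = "wpair d d'"
  have comm: "?B (?A y) = ?A (?B y)" "?C (?A y) = ?A (?C y)" "?D (?A y) = ?A (?D y)"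
    "?C (?B y) = ?B (?C y)" "?D (?B y) = ?B (?D y)" "?D (?C y) = ?C (?D y)" for y
    using d by (auto intro!: wpair_commute)
  have sq: "?A (?A y) = - y" "?B (?B y) = - y" "?C (?C y) = - y" "?D (?D y) = - y" for y
    using d by (auto intro!: wpair_square)
  have bcd: "?B (?C (?D x)) = - ?A x" using arg_cong [OF one, of ?A] sq(1) by (metis minus_minus)
  have acd: "?A (?C (?D x)) = - ?B x"
    using arg_cong [OF one, of ?B] by (simp add: comm sq wpair_linear) (metis minus_minus)
  have abd: "?A (?B (?D x)) = - ?C x"
    using arg_cong [OF one, of ?C] by (simp add: comm sq wpair_linear) (metis minus_minus)
  have abc: "?A (?B (?C x)) = - ?D x"
    using arg_cong [OF one, of ?D] by (simp add: comm sq wpair_linear) (metis minus_minus)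
  have bc: "?B (?C x) = ?A (?D x)"
    using arg_cong [OF abc, of ?A] by (simp add: sq wpair_linear)
  have bd: "?B (?D x) = ?A (?C x)"
    using arg_cong [OF abd, of ?A] by (simp add: sq wpair_linear)
  have cd: "?C (?D x) = ?A (?B x)"
    using arg_cong [OF one, of "\<lambda>x. ?A (?B x)"] by (simp add: comm sq wpair_linear)
  have S: "(x + ?D x) + ?C (x + ?D x) + ?B ((x + ?D x) + ?C (x + ?D x)) +
      ?A ((x + ?D x) + ?C (x + ?D x) + ?B ((x + ?D x) + ?C (x + ?D x))) = 2 *s (x + ?A (?B x) + ?A (?C x) + ?A (?D x))"
    unfolding wpair_linear unfolding one unfolding bcd acd abd abc unfolding bc bd cd by (simp add: vec_eq_iff)
  have "rot a a' (rot b b' (rot c c' (rot d d' x))) = (1/4) *s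
    ((x + ?D x) + ?C (x + ?D x) + ?B ((x + ?D x) + ?C (x + ?D x)) +
      ?A ((x + ?D x) + ?C (x + ?D x) + ?B ((x + ?D x) + ?C (x + ?D x))))"
  proof -
    let ?s = "complex_of_real (1 / sqrt 2)"
    have "?s * (?s * (?s * ?s)) = 1/4" by (simp add: field_simps sqrt_2_sq)
    moreover have "rot i j (t *s y) = (?s * t) *s (y + wpair i j y)" for i j t y
      by (simp add: rot_def wpair_linear vec.scale_right_distrib mult.commute)
    ultimately show ?thesis unfolding rot_def [of d d'] by (simp only:)
  qed
  thus ?thesis unfolding S by simp
qed

definition vec8 :: "complex \<Rightarrow> complex \<Rightarrow> complex \<Rightarrow> complex \<Rightarrow> complex \<Rightarrow> complex \<Rightarrow> complex \<Rightarrow> complex \<Rightarrow> 8 \<Rightarrow> complex" where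
  "vec8 a b c d e f g h = (\<lambda>_. 0)(0 := a, 1 := b, 2 := c, 3 := d, 4 := e, 5 := f, 6 := g, 7 := h)"

lemma vec8_nth [simp]:
  "vec8 a b c d e f g h 0 = a" "vec8 a b c d e f g h 1 = b" "vec8 a b c d e f g h 2 = c" "vec8 a b c d e f g h 3 = d"
  "vec8 a b c d e f g h 4 = e" "vec8 a b c d e f g h 5 = f" "vec8 a b c d e f g h 6 = g" "vec8 a b c d e f g h 7 = h"
  by (simp_all add: vec8_def)

lemma fun_8_eqI: "f 0 = g 0 \<Longrightarrow> f 1 = g 1 \<Longrightarrow> f 2 = g 2 \<Longrightarrow> f 3 = g 3 \<Longrightarrow> f 4 = g 4 \<Longrightarrow> f 5 = g 5 \<Longrightarrow>
  f 6 = g 6 \<Longrightarrow> f 7 = g 7 \<Longrightarrow> f = (g :: 8 \<Rightarrow> 'a)"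
  unfolding fun_eq_iff all_8 by blast

text \<open>The square of a single \<open>rot\<close> is the corresponding \<open>wpair\<close>, so
  the square of the fourfold product is the product of the four pairs, which is the identity on the
  Cartan subspace. This is why \<open>M\<close> is an involution.\<close>

lemma rot4_cartan_maps:
  assumes d: "distinct [a, a', b, b', c, c', d, d']"
    and one: "\<And>k. wpair a a' (wpair b b' (wpair c c' (wpair d d' (H k)))) = H k"
    and m: "\<And>k. H k + wpair a a' (wpair b b' (H k)) + wpair a a' (wpair c c' (H k)) + wpair a a' (wpair d d' (H k)) = 2 *s cpt (M (\<lambda>l. if l = k then 1 else 0))"
    and lin: "\<And>z. M z = (\<lambda>l. \<Sum>k\<in>UNIV. z k * M (\<lambda>l. if l = k then 1 else 0) l)" "\<And>z. M (M z) = z"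
  shows "rot a a' \<circ> rot b b' \<circ> rot c c' \<circ> rot d d' \<in> normalizer_c" "M \<in> cartan_maps"
proof -
  let ?g = "rot a a' \<circ> rot b b' \<circ> rot c c' \<circ> rot d d'"
  have g: "?g \<in> Spin" using d by (auto intro!: Spin_comp rot_in_Spin simp del: o_apply)
  have gH: "?g (H k) = cpt (M (\<lambda>l. if l = k then 1 else 0))" for k
  proof -
    have "?g (H k) = (1/2) *s (H k + wpair a a' (wpair b b' (H k)) + wpair a a' (wpair c c' (H k)) + wpair a a' (wpair d d' (H k)))"
      using rot4 [OF d one] by simp
    thus ?thesis unfolding m by (simp add: vec_eq_iff)
  qed
  have "?g (cpt z) = cpt (M z)" for z
    using Spin_ext_cartan [OF g gH [unfolded cpt_def], of z] lin(1) [of z] by simp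
  note * = cartan_mapsI [OF g this lin(2)]
  show "?g \<in> normalizer_c" by (rule *(1))
  show "M \<in> cartan_maps" by (rule *(2))
qed

text \<open>The pairs rotated are the cosets of {0, 1} in F_2^3; \<open>hmat2\<close> to
  \<open>hmat7\<close> use the cosets of {0, 2} to {0, 7}. Each row is, up to signs, half the sum of
  the coordinates over an affine plane.\<close>

definition hmat1 :: "(8 \<Rightarrow> complex) \<Rightarrow> 8 \<Rightarrow> complex" where
  "hmat1 z = vec8 ((z 0 + z 2 + z 4 + z 6) / 2) ((z 1 + z 3 + z 5 + z 7) / 2) ((z 0 + z 2 - z 4 - z 6) / 2) ((z 1 + z 3 - z 5 - z 7) / 2)
     ((z 0 - z 2 + z 4 - z 6) / 2) ((z 1 - z 3 + z 5 - z 7) / 2) ((z 0 - z 2 - z 4 + z 6) / 2) ((z 1 - z 3 - z 5 + z 7) / 2)"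

lemma hmat1: "rot 0 1 \<circ> rot 2 3 \<circ> rot 4 5 \<circ> rot 6 7 \<in> normalizer_c" "hmat1 \<in> cartan_maps"
proof -
  let ?M = "hmat1"
  have 1: "\<forall>k. wpair 0 1 (wpair 2 3 (wpair 4 5 (wpair 6 7 (H k)))) = H k"
    unfolding all_8 H_bvec wpair_def by (simp add: clifford_add clifford_diff clifford_scale add.commute)
  have 2: "\<forall>k. H k + wpair 0 1 (wpair 2 3 (H k)) + wpair 0 1 (wpair 4 5 (H k))
     + wpair 0 1 (wpair 6 7 (H k)) = 2 *s cpt (?M (\<lambda>l. if l = k then 1 else 0))"
    unfolding all_8 H_bvec wpair_def cpt_def sum_8 hmat1_def by (simp add: clifford_add clifford_diff clifford_scale vec_eq_iff)
  have 3: "?M z = (\<lambda>l. \<Sum>k\<in>UNIV. z k * ?M (\<lambda>l. if l = k then 1 else 0) l)" for z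
    unfolding sum_8 hmat1_def by (rule fun_8_eqI) (simp_all add: field_simps)
  have 4: "?M (?M z) = z" for z
    unfolding hmat1_def by (rule fun_8_eqI) (simp_all add: field_simps)
  show "rot 0 1 \<circ> rot 2 3 \<circ> rot 4 5 \<circ> rot 6 7 \<in> normalizer_c" "?M \<in> cartan_maps"
    using rot4_cartan_maps [OF _ 1 [rule_format] 2 [rule_format] 3 4] by simp_all
qed

definition hmat2 :: "(8 \<Rightarrow> complex) \<Rightarrow> 8 \<Rightarrow> complex" where
  "hmat2 z = vec8 ((z 0 + z 1 - z 4 + z 5) / 2) ((z 0 + z 1 + z 4 - z 5) / 2) ((z 2 + z 3 + z 6 - z 7) / 2) ((z 2 + z 3 - z 6 + z 7) / 2)
     ((- z 0 + z 1 + z 4 + z 5) / 2) ((z 0 - z 1 + z 4 + z 5) / 2) ((z 2 - z 3 + z 6 + z 7) / 2) ((- z 2 + z 3 + z 6 + z 7) / 2)"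

lemma hmat2: "rot 0 2 \<circ> rot 1 3 \<circ> rot 4 6 \<circ> rot 5 7 \<in> normalizer_c" "hmat2 \<in> cartan_maps"
proof -
  let ?M = "hmat2"
  have 1: "\<forall>k. wpair 0 2 (wpair 1 3 (wpair 4 6 (wpair 5 7 (H k)))) = H k"
    unfolding all_8 H_bvec wpair_def by (simp add: clifford_add clifford_diff clifford_scale add.commute)
  have 2: "\<forall>k. H k + wpair 0 2 (wpair 1 3 (H k)) + wpair 0 2 (wpair 4 6 (H k))
     + wpair 0 2 (wpair 5 7 (H k)) = 2 *s cpt (?M (\<lambda>l. if l = k then 1 else 0))"
    unfolding all_8 H_bvec wpair_def cpt_def sum_8 hmat2_def by (simp add: clifford_add clifford_diff clifford_scale vec_eq_iff)
  have 3: "?M z = (\<lambda>l. \<Sum>k\<in>UNIV. z k * ?M (\<lambda>l. if l = k then 1 else 0) l)" for z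
    unfolding sum_8 hmat2_def by (rule fun_8_eqI) (simp_all add: field_simps)
  have 4: "?M (?M z) = z" for z
    unfolding hmat2_def by (rule fun_8_eqI) (simp_all add: field_simps)
  show "rot 0 2 \<circ> rot 1 3 \<circ> rot 4 6 \<circ> rot 5 7 \<in> normalizer_c" "?M \<in> cartan_maps"
    using rot4_cartan_maps [OF _ 1 [rule_format] 2 [rule_format] 3 4] by simp_all
qed

definition hmat3 :: "(8 \<Rightarrow> complex) \<Rightarrow> 8 \<Rightarrow> complex" where
  "hmat3 z = vec8 ((z 0 + z 3 - z 4 - z 7) / 2) ((z 1 + z 2 - z 5 - z 6) / 2) ((z 1 + z 2 + z 5 + z 6) / 2) ((z 0 + z 3 + z 4 + z 7) / 2)
     ((- z 0 + z 3 + z 4 - z 7) / 2) ((- z 1 + z 2 + z 5 - z 6) / 2) ((- z 1 + z 2 - z 5 + z 6) / 2) ((- z 0 + z 3 - z 4 + z 7) / 2)"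

lemma hmat3: "rot 0 3 \<circ> rot 2 1 \<circ> rot 4 7 \<circ> rot 6 5 \<in> normalizer_c" "hmat3 \<in> cartan_maps"
proof -
  let ?M = "hmat3"
  have 1: "\<forall>k. wpair 0 3 (wpair 2 1 (wpair 4 7 (wpair 6 5 (H k)))) = H k"
    unfolding all_8 H_bvec wpair_def by (simp add: clifford_add clifford_diff clifford_scale add.commute)
  have 2: "\<forall>k. H k + wpair 0 3 (wpair 2 1 (H k)) + wpair 0 3 (wpair 4 7 (H k))
     + wpair 0 3 (wpair 6 5 (H k)) = 2 *s cpt (?M (\<lambda>l. if l = k then 1 else 0))"
    unfolding all_8 H_bvec wpair_def cpt_def sum_8 hmat3_def by (simp add: clifford_add clifford_diff clifford_scale vec_eq_iff)
  have 3: "?M z = (\<lambda>l. \<Sum>k\<in>UNIV. z k * ?M (\<lambda>l. if l = k then 1 else 0) l)" for z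
    unfolding sum_8 hmat3_def by (rule fun_8_eqI) (simp_all add: field_simps)
  have 4: "?M (?M z) = z" for z
    unfolding hmat3_def by (rule fun_8_eqI) (simp_all add: field_simps)
  show "rot 0 3 \<circ> rot 2 1 \<circ> rot 4 7 \<circ> rot 6 5 \<in> normalizer_c" "?M \<in> cartan_maps"
    using rot4_cartan_maps [OF _ 1 [rule_format] 2 [rule_format] 3 4] by simp_all
qed

definition hmat4 :: "(8 \<Rightarrow> complex) \<Rightarrow> 8 \<Rightarrow> complex" where
  "hmat4 z = vec8 ((z 0 - z 1 - z 2 - z 3) / 2) ((- z 0 + z 1 - z 2 - z 3) / 2) ((- z 0 - z 1 + z 2 - z 3) / 2) ((- z 0 - z 1 - z 2 + z 3) / 2)
     ((z 4 - z 5 + z 6 + z 7) / 2) ((- z 4 + z 5 + z 6 + z 7) / 2) ((z 4 + z 5 + z 6 - z 7) / 2) ((z 4 + z 5 - z 6 + z 7) / 2)"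

lemma hmat4: "rot 0 4 \<circ> rot 1 5 \<circ> rot 2 6 \<circ> rot 3 7 \<in> normalizer_c" "hmat4 \<in> cartan_maps"
proof -
  let ?M = "hmat4"
  have 1: "\<forall>k. wpair 0 4 (wpair 1 5 (wpair 2 6 (wpair 3 7 (H k)))) = H k"
    unfolding all_8 H_bvec wpair_def by (simp add: clifford_add clifford_diff clifford_scale add.commute)
  have 2: "\<forall>k. H k + wpair 0 4 (wpair 1 5 (H k)) + wpair 0 4 (wpair 2 6 (H k))
     + wpair 0 4 (wpair 3 7 (H k)) = 2 *s cpt (?M (\<lambda>l. if l = k then 1 else 0))"
    unfolding all_8 H_bvec wpair_def cpt_def sum_8 hmat4_def by (simp add: clifford_add clifford_diff clifford_scale vec_eq_iff)
  have 3: "?M z = (\<lambda>l. \<Sum>k\<in>UNIV. z k * ?M (\<lambda>l. if l = k then 1 else 0) l)" for z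
    unfolding sum_8 hmat4_def by (rule fun_8_eqI) (simp_all add: field_simps)
  have 4: "?M (?M z) = z" for z
    unfolding hmat4_def by (rule fun_8_eqI) (simp_all add: field_simps)
  show "rot 0 4 \<circ> rot 1 5 \<circ> rot 2 6 \<circ> rot 3 7 \<in> normalizer_c" "?M \<in> cartan_maps"
    using rot4_cartan_maps [OF _ 1 [rule_format] 2 [rule_format] 3 4] by simp_all
qed

definition hmat5 :: "(8 \<Rightarrow> complex) \<Rightarrow> 8 \<Rightarrow> complex" where
  "hmat5 z = vec8 ((z 0 - z 2 - z 5 + z 7) / 2) ((z 1 - z 3 - z 4 + z 6) / 2) ((- z 0 + z 2 - z 5 + z 7) / 2) ((- z 1 + z 3 - z 4 + z 6) / 2)
     ((- z 1 - z 3 + z 4 + z 6) / 2) ((- z 0 - z 2 + z 5 + z 7) / 2) ((z 1 + z 3 + z 4 + z 6) / 2) ((z 0 + z 2 + z 5 + z 7) / 2)"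

lemma hmat5: "rot 0 5 \<circ> rot 2 7 \<circ> rot 4 1 \<circ> rot 6 3 \<in> normalizer_c" "hmat5 \<in> cartan_maps"
proof -
  let ?M = "hmat5"
  have 1: "\<forall>k. wpair 0 5 (wpair 2 7 (wpair 4 1 (wpair 6 3 (H k)))) = H k"
    unfolding all_8 H_bvec wpair_def by (simp add: clifford_add clifford_diff clifford_scale add.commute)
  have 2: "\<forall>k. H k + wpair 0 5 (wpair 2 7 (H k)) + wpair 0 5 (wpair 4 1 (H k))
     + wpair 0 5 (wpair 6 3 (H k)) = 2 *s cpt (?M (\<lambda>l. if l = k then 1 else 0))"
    unfolding all_8 H_bvec wpair_def cpt_def sum_8 hmat5_def by (simp add: clifford_add clifford_diff clifford_scale vec_eq_iff)
  have 3: "?M z = (\<lambda>l. \<Sum>k\<in>UNIV. z k * ?M (\<lambda>l. if l = k then 1 else 0) l)" for z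
    unfolding sum_8 hmat5_def by (rule fun_8_eqI) (simp_all add: field_simps)
  have 4: "?M (?M z) = z" for z
    unfolding hmat5_def by (rule fun_8_eqI) (simp_all add: field_simps)
  show "rot 0 5 \<circ> rot 2 7 \<circ> rot 4 1 \<circ> rot 6 3 \<in> normalizer_c" "?M \<in> cartan_maps"
    using rot4_cartan_maps [OF _ 1 [rule_format] 2 [rule_format] 3 4] by simp_all
qed

definition hmat6 :: "(8 \<Rightarrow> complex) \<Rightarrow> 8 \<Rightarrow> complex" where
  "hmat6 z = vec8 ((z 0 - z 1 - z 6 - z 7) / 2) ((- z 0 + z 1 - z 6 - z 7) / 2) ((z 2 - z 3 + z 4 + z 5) / 2) ((- z 2 + z 3 + z 4 + z 5) / 2)
     ((z 2 + z 3 + z 4 - z 5) / 2) ((z 2 + z 3 - z 4 + z 5) / 2) ((- z 0 - z 1 + z 6 - z 7) / 2) ((- z 0 - z 1 - z 6 + z 7) / 2)"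

lemma hmat6: "rot 0 6 \<circ> rot 1 7 \<circ> rot 4 2 \<circ> rot 5 3 \<in> normalizer_c" "hmat6 \<in> cartan_maps"
proof -
  let ?M = "hmat6"
  have 1: "\<forall>k. wpair 0 6 (wpair 1 7 (wpair 4 2 (wpair 5 3 (H k)))) = H k"
    unfolding all_8 H_bvec wpair_def by (simp add: clifford_add clifford_diff clifford_scale add.commute)
  have 2: "\<forall>k. H k + wpair 0 6 (wpair 1 7 (H k)) + wpair 0 6 (wpair 4 2 (H k))
     + wpair 0 6 (wpair 5 3 (H k)) = 2 *s cpt (?M (\<lambda>l. if l = k then 1 else 0))"
    unfolding all_8 H_bvec wpair_def cpt_def sum_8 hmat6_def by (simp add: clifford_add clifford_diff clifford_scale vec_eq_iff)
  have 3: "?M z = (\<lambda>l. \<Sum>k\<in>UNIV. z k * ?M (\<lambda>l. if l = k then 1 else 0) l)" for z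
    unfolding sum_8 hmat6_def by (rule fun_8_eqI) (simp_all add: field_simps)
  have 4: "?M (?M z) = z" for z
    unfolding hmat6_def by (rule fun_8_eqI) (simp_all add: field_simps)
  show "rot 0 6 \<circ> rot 1 7 \<circ> rot 4 2 \<circ> rot 5 3 \<in> normalizer_c" "?M \<in> cartan_maps"
    using rot4_cartan_maps [OF _ 1 [rule_format] 2 [rule_format] 3 4] by simp_all
qed

definition hmat7 :: "(8 \<Rightarrow> complex) \<Rightarrow> 8 \<Rightarrow> complex" where
  "hmat7 z = vec8 ((z 0 - z 3 + z 5 - z 6) / 2) ((z 1 - z 2 + z 4 - z 7) / 2) ((- z 1 + z 2 + z 4 - z 7) / 2) ((- z 0 + z 3 + z 5 - z 6) / 2)
     ((z 1 + z 2 + z 4 + z 7) / 2) ((z 0 + z 3 + z 5 + z 6) / 2) ((- z 0 - z 3 + z 5 + z 6) / 2) ((- z 1 - z 2 + z 4 + z 7) / 2)"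

lemma hmat7: "rot 0 7 \<circ> rot 2 5 \<circ> rot 4 3 \<circ> rot 6 1 \<in> normalizer_c" "hmat7 \<in> cartan_maps"
proof -
  let ?M = "hmat7"
  have 1: "\<forall>k. wpair 0 7 (wpair 2 5 (wpair 4 3 (wpair 6 1 (H k)))) = H k"
    unfolding all_8 H_bvec wpair_def by (simp add: clifford_add clifford_diff clifford_scale add.commute)
  have 2: "\<forall>k. H k + wpair 0 7 (wpair 2 5 (H k)) + wpair 0 7 (wpair 4 3 (H k))
     + wpair 0 7 (wpair 6 1 (H k)) = 2 *s cpt (?M (\<lambda>l. if l = k then 1 else 0))"
    unfolding all_8 H_bvec wpair_def cpt_def sum_8 hmat7_def by (simp add: clifford_add clifford_diff clifford_scale vec_eq_iff)
  have 3: "?M z = (\<lambda>l. \<Sum>k\<in>UNIV. z k * ?M (\<lambda>l. if l = k then 1 else 0) l)" for z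
    unfolding sum_8 hmat7_def by (rule fun_8_eqI) (simp_all add: field_simps)
  have 4: "?M (?M z) = z" for z
    unfolding hmat7_def by (rule fun_8_eqI) (simp_all add: field_simps)
  show "rot 0 7 \<circ> rot 2 5 \<circ> rot 4 3 \<circ> rot 6 1 \<in> normalizer_c" "?M \<in> cartan_maps"
    using rot4_cartan_maps [OF _ 1 [rule_format] 2 [rule_format] 3 4] by simp_all
qed


text \<open>Orthogonal reflection in the vector with entries 1/2 on an affine plane. Its squared
  length is 1, so each entry of the plane loses half of the sum over the plane.\<close>

definition blk_refl :: "8 \<Rightarrow> bool \<Rightarrow> (8 \<Rightarrow> complex) \<Rightarrow> 8 \<Rightarrow> complex" where
  "blk_refl v c z = (\<lambda>k. if dot v k = c then z k - (\<Sum>l\<in>UNIV. if dot v l = c then z l else 0) / 2 else z k)"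

text \<open>The reflection in the root \<open>(1/2) (z\<^sub>a + z\<^sub>b + z\<^sub>c + z\<^sub>d)\<close> is conjugate to a coordinate flip.\<close>

lemma blk_refl_in_cartan_maps: assumes "v \<noteq> 0" shows "blk_refl v c \<in> cartan_maps"
proof -
  have "hmat1 \<circ> flip 0 \<circ> hmat1 \<in> cartan_maps"
    by (intro cartan_maps_comp flip_in hmat1)
  moreover have "(hmat1 \<circ> flip 0 \<circ> hmat1) z = blk_refl 1 False z" for z
    by (rule fun_8_eqI) (simp_all add: blk_refl_def hmat1_def flip_def sum_8 field_simps)
  ultimately have r10: "blk_refl 1 False \<in> cartan_maps"
    by (metis ext)
  have "hmat1 \<circ> flip 1 \<circ> hmat1 \<in> cartan_maps"
    by (intro cartan_maps_comp flip_in hmat1)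
  moreover have "(hmat1 \<circ> flip 1 \<circ> hmat1) z = blk_refl 1 True z" for z
    by (rule fun_8_eqI) (simp_all add: blk_refl_def hmat1_def flip_def sum_8 field_simps)
  ultimately have r11: "blk_refl 1 True \<in> cartan_maps"
    by (metis ext)
  \<comment> \<open>Row 0 of \<open>hmat2\<close> has its minus sign at coordinate 4, and
    conjugation by \<open>flip 4\<close> corrects it. The flips in the remaining cases likewise sit
    at the minus signs of the row selected by the middle flip.\<close>
  have "flip 4 \<circ> hmat2 \<circ> flip 0 \<circ> hmat2 \<circ> flip 4 \<in> cartan_maps"
    by (intro cartan_maps_comp flip_in hmat2)
  moreover have "(flip 4 \<circ> hmat2 \<circ> flip 0 \<circ> hmat2 \<circ> flip 4) z = blk_refl 2 False z" for z
    by (rule fun_8_eqI) (simp_all add: blk_refl_def hmat2_def flip_def sum_8 field_simps)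
  ultimately have r20: "blk_refl 2 False \<in> cartan_maps"
    by (metis ext)
  have "flip 7 \<circ> hmat2 \<circ> flip 2 \<circ> hmat2 \<circ> flip 7 \<in> cartan_maps"
    by (intro cartan_maps_comp flip_in hmat2)
  moreover have "(flip 7 \<circ> hmat2 \<circ> flip 2 \<circ> hmat2 \<circ> flip 7) z = blk_refl 2 True z" for z
    by (rule fun_8_eqI) (simp_all add: blk_refl_def hmat2_def flip_def sum_8 field_simps)
  ultimately have r21: "blk_refl 2 True \<in> cartan_maps"
    by (metis ext)
  have "flip 4 \<circ> flip 7 \<circ> hmat3 \<circ> flip 0 \<circ> hmat3 \<circ> flip 4 \<circ> flip 7 \<in> cartan_maps"
    by (intro cartan_maps_comp flip_in hmat3)
  moreover have "(flip 4 \<circ> flip 7 \<circ> hmat3 \<circ> flip 0 \<circ> hmat3 \<circ> flip 4 \<circ> flip 7) z = blk_refl 3 False z" for z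
    by (rule fun_8_eqI) (simp_all add: blk_refl_def hmat3_def flip_def sum_8 field_simps)
  ultimately have r30: "blk_refl 3 False \<in> cartan_maps"
    by (metis ext)
  have "flip 5 \<circ> flip 6 \<circ> hmat3 \<circ> flip 1 \<circ> hmat3 \<circ> flip 5 \<circ> flip 6 \<in> cartan_maps"
    by (intro cartan_maps_comp flip_in hmat3)
  moreover have "(flip 5 \<circ> flip 6 \<circ> hmat3 \<circ> flip 1 \<circ> hmat3 \<circ> flip 5 \<circ> flip 6) z = blk_refl 3 True z" for z
    by (rule fun_8_eqI) (simp_all add: blk_refl_def hmat3_def flip_def sum_8 field_simps)
  ultimately have r31: "blk_refl 3 True \<in> cartan_maps"
    by (metis ext)
  have "flip 1 \<circ> flip 2 \<circ> flip 3 \<circ> hmat4 \<circ> flip 0 \<circ> hmat4 \<circ> flip 1 \<circ> flip 2 \<circ> flip 3 \<in> cartan_maps"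
    by (intro cartan_maps_comp flip_in hmat4)
  moreover have "(flip 1 \<circ> flip 2 \<circ> flip 3 \<circ> hmat4 \<circ> flip 0 \<circ> hmat4 \<circ> flip 1 \<circ> flip 2 \<circ> flip 3) z = blk_refl 4 False z" for z
    by (rule fun_8_eqI) (simp_all add: blk_refl_def hmat4_def flip_def sum_8 field_simps)
  ultimately have r40: "blk_refl 4 False \<in> cartan_maps"
    by (metis ext)
  have "flip 5 \<circ> hmat4 \<circ> flip 4 \<circ> hmat4 \<circ> flip 5 \<in> cartan_maps"
    by (intro cartan_maps_comp flip_in hmat4)
  moreover have "(flip 5 \<circ> hmat4 \<circ> flip 4 \<circ> hmat4 \<circ> flip 5) z = blk_refl 4 True z" for z
    by (rule fun_8_eqI) (simp_all add: blk_refl_def hmat4_def flip_def sum_8 field_simps)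
  ultimately have r41: "blk_refl 4 True \<in> cartan_maps"
    by (metis ext)
  have "flip 2 \<circ> flip 5 \<circ> hmat5 \<circ> flip 0 \<circ> hmat5 \<circ> flip 2 \<circ> flip 5 \<in> cartan_maps"
    by (intro cartan_maps_comp flip_in hmat5)
  moreover have "(flip 2 \<circ> flip 5 \<circ> hmat5 \<circ> flip 0 \<circ> hmat5 \<circ> flip 2 \<circ> flip 5) z = blk_refl 5 False z" for z
    by (rule fun_8_eqI) (simp_all add: blk_refl_def hmat5_def flip_def sum_8 field_simps)
  ultimately have r50: "blk_refl 5 False \<in> cartan_maps"
    by (metis ext)
  have "flip 3 \<circ> flip 4 \<circ> hmat5 \<circ> flip 1 \<circ> hmat5 \<circ> flip 3 \<circ> flip 4 \<in> cartan_maps"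
    by (intro cartan_maps_comp flip_in hmat5)
  moreover have "(flip 3 \<circ> flip 4 \<circ> hmat5 \<circ> flip 1 \<circ> hmat5 \<circ> flip 3 \<circ> flip 4) z = blk_refl 5 True z" for z
    by (rule fun_8_eqI) (simp_all add: blk_refl_def hmat5_def flip_def sum_8 field_simps)
  ultimately have r51: "blk_refl 5 True \<in> cartan_maps"
    by (metis ext)
  have "flip 1 \<circ> flip 6 \<circ> flip 7 \<circ> hmat6 \<circ> flip 0 \<circ> hmat6 \<circ> flip 1 \<circ> flip 6 \<circ> flip 7 \<in> cartan_maps"
    by (intro cartan_maps_comp flip_in hmat6)
  moreover have "(flip 1 \<circ> flip 6 \<circ> flip 7 \<circ> hmat6 \<circ> flip 0 \<circ> hmat6 \<circ> flip 1 \<circ> flip 6 \<circ> flip 7) z = blk_refl 6 False z" for z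
    by (rule fun_8_eqI) (simp_all add: blk_refl_def hmat6_def flip_def sum_8 field_simps)
  ultimately have r60: "blk_refl 6 False \<in> cartan_maps"
    by (metis ext)
  have "flip 3 \<circ> hmat6 \<circ> flip 2 \<circ> hmat6 \<circ> flip 3 \<in> cartan_maps"
    by (intro cartan_maps_comp flip_in hmat6)
  moreover have "(flip 3 \<circ> hmat6 \<circ> flip 2 \<circ> hmat6 \<circ> flip 3) z = blk_refl 6 True z" for z
    by (rule fun_8_eqI) (simp_all add: blk_refl_def hmat6_def flip_def sum_8 field_simps)
  ultimately have r61: "blk_refl 6 True \<in> cartan_maps"
    by (metis ext)
  have "flip 3 \<circ> flip 6 \<circ> hmat7 \<circ> flip 0 \<circ> hmat7 \<circ> flip 3 \<circ> flip 6 \<in> cartan_maps"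
    by (intro cartan_maps_comp flip_in hmat7)
  moreover have "(flip 3 \<circ> flip 6 \<circ> hmat7 \<circ> flip 0 \<circ> hmat7 \<circ> flip 3 \<circ> flip 6) z = blk_refl 7 False z" for z
    by (rule fun_8_eqI) (simp_all add: blk_refl_def hmat7_def flip_def sum_8 field_simps)
  ultimately have r70: "blk_refl 7 False \<in> cartan_maps"
    by (metis ext)
  have "flip 2 \<circ> flip 7 \<circ> hmat7 \<circ> flip 1 \<circ> hmat7 \<circ> flip 2 \<circ> flip 7 \<in> cartan_maps"
    by (intro cartan_maps_comp flip_in hmat7)
  moreover have "(flip 2 \<circ> flip 7 \<circ> hmat7 \<circ> flip 1 \<circ> hmat7 \<circ> flip 2 \<circ> flip 7) z = blk_refl 7 True z" for z
    by (rule fun_8_eqI) (simp_all add: blk_refl_def hmat7_def flip_def sum_8 field_simps)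
  ultimately have r71: "blk_refl 7 True \<in> cartan_maps"
    by (metis ext)
  have "\<forall>v. v \<noteq> 0 \<longrightarrow> blk_refl v True \<in> cartan_maps \<and> blk_refl v False \<in> cartan_maps"
    unfolding all_8 using r10 r11 r20 r21 r30 r31 r40 r41 r50 r51 r60 r61 r70 r71 by simp
  thus ?thesis using assms by (cases c) auto
qed

section \<open>Elements of the spin group fixing the Cartan subspace pointwise\<close>

definition fixes_cartan :: "(spinor \<Rightarrow> spinor) \<Rightarrow> bool" where
  "fixes_cartan g \<longleftrightarrow> g \<in> Spin \<and> (\<forall>x\<in>cartan. g x = x)"

lemma fixes_cartanI: assumes "g \<in> Spin" "\<And>k. g (H k) = H k" shows "fixes_cartan g"
proof -
  have "g (cpt z) = cpt z" for z
    unfolding cpt_def by (simp add: Spin_sum assms Spin_linear(2))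
  thus ?thesis unfolding fixes_cartan_def using assms(1) cpt_coord by metis
qed

text \<open>Together with the \<open>wvec i\<close> an orthogonal basis of \<open>V\<close> on which
  products of the \<open>wvec j\<close> act diagonally; the rotations \<open>rot\<close> fix each of
  these vectors.\<close>

definition uvec :: "8 \<Rightarrow> V" where "uvec i = ebas i - fbas i"

lemma polar_uvec_wvec [simp]: "polar (uvec i) (wvec j) = 0"
  by (simp add: uvec_def wvec_def polar_linear polar_diff)

lemma bas_uw: "ebas i = (1/2) *s wvec i + (1/2) *s uvec i" "fbas i = (1/2) *s wvec i + (-1/2) *s uvec i"
  by (simp_all add: wvec_def uvec_def vec_eq_iff)

lemma intertwines_inv: assumes "g \<in> Spin" "intertwines g u v" shows "intertwines (spin_inv g) v u"
proof -
  have "spin_inv g (clifford v x) = clifford u (spin_inv g x)" for x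
  proof -
    have "clifford v x = g (clifford u (spin_inv g x))"
      using assms by (simp add: intertwines_def fun_eq_iff spin_inv_apply)
    thus ?thesis using assms(1) by (simp add: spin_inv_apply)
  qed
  thus ?thesis by (auto simp: intertwines_def)
qed

text \<open>The two reflections are in vectors at an angle of pi/4, so their product turns by
  pi/2.\<close>

lemma intertwines_rot:
  assumes "i \<noteq> j"
  shows "intertwines (rot i j) (wvec k) (if k = i then - wvec j else if k = j then wvec i else wvec k)"
    "intertwines (rot i j) (uvec k) (uvec k)"
proof -
  let ?s = "complex_of_real (1 / sqrt 2)" and ?b = "complex_of_real (1 / sqrt 2) *s (wvec i + wvec j)"
  have s: "2 * (?s * ?s) = 1" by (simp add: field_simps sqrt_2_sq)
  have b: "quad ?b = 1"
    using s assms by (simp add: quad_scale quad_add polar_wvec polar_linear power2_eq_square vec.scale_right_distrib)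
  have *: "intertwines (rot i j) v (polar (polar v ?b *s ?b - v) (wvec i) *s wvec i - (polar v ?b *s ?b - v))" for v
    unfolding rot_eq [OF assms] by (rule intertwines_comp [OF intertwines_clifford intertwines_clifford [OF b]]) simp
  have bw: "(2 * ?s) *s ?b = wvec i + wvec j"
    using s by (simp add: mult.assoc)
  have p: "polar (wvec i) ?b = 2 * ?s" "polar (wvec j) ?b = 2 * ?s" "k \<noteq> i \<Longrightarrow> k \<noteq> j \<Longrightarrow> polar (wvec k) ?b = 0" "polar (uvec k) ?b = 0"
    using assms by (simp_all add: polar_linear polar_wvec)
  show "intertwines (rot i j) (uvec k) (uvec k)" using * [of "uvec k"] unfolding p by simp
  show "intertwines (rot i j) (wvec k) (if k = i then - wvec j else if k = j then wvec i else wvec k)"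
  proof -
    consider "k = i" | "k = j" | "k \<noteq> i" "k \<noteq> j" by blast
    thus ?thesis
    proof cases
      case 1
      show ?thesis using * [of "wvec i"] 1 assms unfolding p bw by (simp add: polar_wvec)
    next
      case 2
      have "2 *s wvec i - wvec i = wvec i" by (simp add: vec_eq_iff)
      thus ?thesis using * [of "wvec j"] 2 assms unfolding p bw by (simp add: polar_wvec)
    next
      case 3
      thus ?thesis using * [of "wvec k"] unfolding p(3) [OF 3] by (simp add: polar_wvec)
    qed
  qed
qed

text \<open>Acts on \<open>V\<close> by -1 on the span of the \<open>wvec i\<close> and by 1 on that
  of the \<open>uvec i\<close>, and so exchanges E and F up to sign.\<close>

definition full_rev :: "spinor \<Rightarrow> spinor" where
  "full_rev = cliff_prod (map wvec [0,1,2,3,4,5,6,7])"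

lemma full_rev_in: "full_rev \<in> Spin"
  unfolding full_rev_def by (rule SpinI) auto

lemma full_rev_fixes: "fixes_cartan full_rev"
proof (rule fixes_cartanI [OF full_rev_in])
  have "\<forall>k. full_rev (H k) = H k"
    unfolding all_8 H_bvec full_rev_def by (simp add: clifford_add clifford_diff clifford_scale add.commute)
  thus "full_rev (H k) = H k" for k by blast
qed

lemma intertwines_wvec_prod:
  "intertwines (cliff_prod (map wvec js)) (uvec i) ((-1) ^ length js *s uvec i)"
  "intertwines (cliff_prod (map wvec js)) (wvec i) ((\<Prod>j\<leftarrow>js. if j = i then 1 else -1) *s wvec i)"
proof (induction js)
  case Nil
  have "intertwines id v v" for v by (simp add: intertwines_def)
  thus "intertwines (cliff_prod (map wvec [])) (uvec i) ((-1) ^ length [] *s uvec i)"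
    "intertwines (cliff_prod (map wvec [])) (wvec i) ((\<Prod>j\<leftarrow>[]. if j = i then 1 else -1) *s wvec i)"
    unfolding list.map cliff_prod_simps by simp_all
next
  case (Cons j js)
  have lin: "intertwines (clifford w) (c *s v) (c *s (polar v w *s w - v))" if "quad w = 1" for w c v
    using intertwines_clifford [OF that, of "c *s v"]
    by (simp add: polar_linear vector_ssub_ldistrib)
  have "intertwines (clifford (wvec j)) ((-1) ^ length js *s uvec i) ((-1) ^ length (j # js) *s uvec i)"
    using lin [of "wvec j" "(-1) ^ length js" "uvec i"] by simp
  from intertwines_comp [OF this Cons(1)]
  show "intertwines (cliff_prod (map wvec (j # js))) (uvec i) ((-1) ^ length (j # js) *s uvec i)"
    unfolding list.map cliff_prod_simps .
  have "(p * 2) *s wvec i - p *s wvec i = p *s wvec i" for p by (simp add: vec_eq_iff)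
  hence "intertwines (clifford (wvec j)) ((\<Prod>j\<leftarrow>js. if j = i then 1 else -1) *s wvec i) ((\<Prod>j\<leftarrow>(j # js). if j = i then 1 else -1) *s wvec i)"
    using lin [of "wvec j" "\<Prod>j\<leftarrow>js. if j = i then 1 else -1" "wvec i"] by (auto simp: polar_wvec)
  from intertwines_comp [OF this Cons(2)]
  show "intertwines (cliff_prod (map wvec (j # js))) (wvec i) ((\<Prod>j\<leftarrow>(j # js). if j = i then 1 else -1) *s wvec i)"
    unfolding list.map cliff_prod_simps .
qed

lemma full_rev_intertwines:
  "intertwines full_rev (ebas i) (- fbas i)" "intertwines full_rev (fbas i) (- ebas i)"
proof -
  have u: "intertwines full_rev (uvec i) (uvec i)"
    using intertwines_wvec_prod(1) [of "[0,1,2,3,4,5,6,7]" i] by (simp only: full_rev_def) simp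
  have "\<forall>i::8. (\<Prod>j\<leftarrow>[0,1,2,3,4,5,6,7]. if j = i then 1 else -1) = (-1::complex)"
    unfolding all_8 by simp
  hence w: "intertwines full_rev (wvec i) (-1 *s wvec i)"
    using intertwines_wvec_prod(2) [of "[0,1,2,3,4,5,6,7]" i] unfolding full_rev_def by (simp only:)
  note lin = intertwines_linear [OF full_rev_in]
  have "intertwines full_rev (ebas i) ((1/2) *s (-1 *s wvec i) + (1/2) *s uvec i)"
    unfolding bas_uw by (intro lin u w)
  moreover have "intertwines full_rev (fbas i) ((1/2) *s (-1 *s wvec i) + (-1/2) *s uvec i)"
    unfolding bas_uw by (intro lin u w)
  moreover have "(1/2) *s (-1 *s wvec i) + (1/2) *s uvec i = - fbas i" "(1/2) *s (-1 *s wvec i) + (-1/2) *s uvec i = - ebas i"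
    by (simp_all add: wvec_def uvec_def vec_eq_iff)
  ultimately show "intertwines full_rev (ebas i) (- fbas i)" "intertwines full_rev (fbas i) (- ebas i)" by simp_all
qed

text \<open>On \<open>V\<close> the sign character of \<open>k\<close>. On a summand of
  \<open>H l\<close>, for nonzero \<open>k\<close>, the phase is pi/2 times a signed count of the
  four indices with \<open>dot k i\<close>; the count is 0 or plus or minus 4.\<close>

definition tau :: "8 \<Rightarrow> spinor \<Rightarrow> spinor" where
  "tau k = torus (\<lambda>i. cis (if dot k i then pi/2 else 0))"

text \<open>Scales E by i and F by -i. The phase on a basis spinor is pi/4 times the difference
  between the sizes of its set and of the complement: 0 in degree 4, plus or minus 2 pi in degrees 0
  and 8.\<close>

definition ctor :: "spinor \<Rightarrow> spinor" where "ctor = torus (\<lambda>i. cis (pi/4))"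

lemma cis_minus_2pi: "cis (- (2 * pi)) = 1" "cis (- (pi * 2)) = 1" "cis (pi * 2) = 1"
  using cis_cnj [of "2 * pi"] cis_2pi by (simp_all add: mult.commute)

lemma tau_in: "tau k \<in> Spin" unfolding tau_def by (rule torus_in_Spin) simp
lemma ctor_in: "ctor \<in> Spin" unfolding ctor_def by (rule torus_in_Spin) simp

lemma tau_fixes: "fixes_cartan (tau 1)" "fixes_cartan (tau 2)" "fixes_cartan (tau 4)"
proof -
  have lin: "tau k (x + y) = tau k x + tau k y" for k x y using Spin_linear(1) [OF tau_in] .
  have "\<forall>k. tau 1 (H k) = H k" "\<forall>k. tau 2 (H k) = H k" "\<forall>k. tau 4 (H k) = H k"
    unfolding all_8 H_bvec lin by (simp_all add: tau_def torus_cis_bvec cis_minus_2pi)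
  thus "fixes_cartan (tau 1)" "fixes_cartan (tau 2)" "fixes_cartan (tau 4)"
    by (auto intro!: fixes_cartanI tau_in)
qed

lemma ctor_fixes: "fixes_cartan ctor"
proof -
  have lin: "ctor (x + y) = ctor x + ctor y" for x y using Spin_linear(1) [OF ctor_in] .
  have "\<forall>k. ctor (H k) = H k"
    unfolding all_8 H_bvec lin by (simp add: ctor_def torus_cis_bvec cis_minus_2pi)
  thus ?thesis by (auto intro!: fixes_cartanI ctor_in)
qed

lemma tau_intertwines:
  "intertwines (tau k) (ebas i) ((if dot k i then -1 else 1) *s ebas i)" "intertwines (tau k) (fbas i) ((if dot k i then -1 else 1) *s fbas i)"
proof -
  have "(cis (if dot k i then pi/2 else 0))\<^sup>2 = (if dot k i then -1 else 1)" by (simp add: power2_eq_square cis_mult)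
  thus "intertwines (tau k) (ebas i) ((if dot k i then -1 else 1) *s ebas i)" "intertwines (tau k) (fbas i) ((if dot k i then -1 else 1) *s fbas i)"
    using torus_intertwines [of "\<lambda>i. cis (if dot k i then pi/2 else 0)" i] unfolding tau_def by (auto split: if_splits)
qed

lemma ctor_intertwines: "intertwines ctor (ebas i) (\<i> *s ebas i)" "intertwines ctor (fbas i) (- \<i> *s fbas i)"
proof -
  have "(cis (pi/4))\<^sup>2 = \<i>" by (simp add: power2_eq_square cis_mult)
  thus "intertwines ctor (ebas i) (\<i> *s ebas i)" "intertwines ctor (fbas i) (- \<i> *s fbas i)"
    using torus_intertwines [of "\<lambda>i. cis (pi/4)" i] unfolding ctor_def by simp_all
qed

lemma ctor_uw: "intertwines ctor (wvec i) (\<i> *s uvec i)" "intertwines ctor (uvec i) (\<i> *s wvec i)"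
proof -
  note lin = intertwines_linear [OF ctor_in]
  have "intertwines ctor (ebas i + fbas i) (\<i> *s ebas i + - \<i> *s fbas i)"
    by (intro lin ctor_intertwines)
  moreover have "intertwines ctor (ebas i + (-1) *s fbas i) (\<i> *s ebas i + (-1) *s (- \<i> *s fbas i))"
    by (intro lin ctor_intertwines)
  ultimately show "intertwines ctor (wvec i) (\<i> *s uvec i)" "intertwines ctor (uvec i) (\<i> *s wvec i)"
    by (simp_all add: wvec_def uvec_def vector_ssub_ldistrib vec.scale_right_distrib)
qed

text \<open>A source of further elements of the pointwise stabilizer: conjugates of
  \<open>ctor\<close> will move the basis vectors of \<open>V\<close> by translations.\<close>

lemma normalizer_conj_fixes:
  assumes "R \<in> normalizer_c" "fixes_cartan k" shows "fixes_cartan (R \<circ> k \<circ> spin_inv R)"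
proof -
  have R: "R \<in> Spin" "R ` cartan = cartan" using assms(1) by (auto simp: normalizer_c_def)
  have k: "k \<in> Spin" "\<And>x. x \<in> cartan \<Longrightarrow> k x = x" using assms(2) by (auto simp: fixes_cartan_def)
  have "spin_inv R x \<in> cartan" if "x \<in> cartan" for x
    using that R spin_inv_apply(1) [OF R(1)] by (metis imageE)
  hence "(R \<circ> k \<circ> spin_inv R) x = x" if "x \<in> cartan" for x
    using that k(2) R(1) by (simp add: spin_inv_apply)
  moreover have "R \<circ> k \<circ> spin_inv R \<in> Spin"
    by (intro Spin_comp R k spin_inv)
  ultimately show ?thesis unfolding fixes_cartan_def by blast
qed

text \<open>\<open>ctor\<close> exchanges \<open>wvec\<close> and \<open>uvec\<close> of one index
  up to the factor i, and \<open>R\<close> moves \<open>wvec i\<close> to \<open>wvec j\<close>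
  while fixing every \<open>uvec\<close>. The conjugate thus links \<open>uvec i\<close> with
  \<open>wvec j\<close>, and with that \<open>ebas i\<close> with \<open>fbas j\<close>.\<close>

lemma conj_ctor_intertwines:
  assumes "R \<in> Spin" "intertwines R (wvec i) (- wvec j)" "intertwines R (wvec j) (wvec i)"
    "\<And>k. intertwines R (uvec k) (uvec k)"
  defines "k \<equiv> R \<circ> ctor \<circ> spin_inv R"
  shows "intertwines k (ebas i) (- \<i> *s fbas j)" "intertwines k (fbas i) (\<i> *s ebas j)"
    "intertwines k (ebas j) (\<i> *s fbas i)" "intertwines k (fbas j) (- \<i> *s ebas i)"
proof -
  note l1 = intertwines_linear [OF assms(1)] and l2 = intertwines_linear [OF spin_inv(1) [OF assms(1)]]
    and l3 = intertwines_linear [OF ctor_in]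
  have R': "intertwines (spin_inv R) (wvec j) ((-1) *s wvec i)" "intertwines (spin_inv R) (wvec i) (wvec j)"
    "intertwines (spin_inv R) (uvec k) (uvec k)" for k
  proof -
    have "intertwines (spin_inv R) ((-1) *s (- wvec j)) ((-1) *s wvec i)"
      by (intro l2 intertwines_inv assms)
    thus "intertwines (spin_inv R) (wvec j) ((-1) *s wvec i)" by simp
  qed (intro intertwines_inv assms)+
  have k: "k \<in> Spin" unfolding k_def by (intro Spin_comp assms ctor_in spin_inv)
  note lk = intertwines_linear [OF k]
  have u: "intertwines k (uvec i) (\<i> *s (- wvec j))" "intertwines k (uvec j) (\<i> *s wvec i)"
    unfolding k_def by (rule intertwines_comp [OF _ R'(3)], rule intertwines_comp [OF _ ctor_uw(2)], intro l1 assms)+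
  have w: "intertwines k (wvec i) (\<i> *s uvec j)" "intertwines k (wvec j) ((-1) *s (\<i> *s uvec i))"
    unfolding k_def
    by (rule intertwines_comp [OF _ R'(2)], rule intertwines_comp [OF _ ctor_uw(1)], intro l1 assms)
       (rule intertwines_comp [OF _ R'(1)], rule intertwines_comp [OF _ l3(2) [OF ctor_uw(1)]], intro l1 assms)
  have *: "intertwines k (ebas i) ((1/2) *s (\<i> *s uvec j) + (1/2) *s (\<i> *s (- wvec j)))"
    "intertwines k (fbas i) ((1/2) *s (\<i> *s uvec j) + (-1/2) *s (\<i> *s (- wvec j)))"
    "intertwines k (ebas j) ((1/2) *s ((-1) *s (\<i> *s uvec i)) + (1/2) *s (\<i> *s wvec i))"
    "intertwines k (fbas j) ((1/2) *s ((-1) *s (\<i> *s uvec i)) + (-1/2) *s (\<i> *s wvec i))"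
    unfolding bas_uw by (intro lk u w)+
  have e: "(1/2) *s (\<i> *s uvec j) + (1/2) *s (\<i> *s (- wvec j)) = - \<i> *s fbas j"
    "(1/2) *s (\<i> *s uvec j) + (-1/2) *s (\<i> *s (- wvec j)) = \<i> *s ebas j"
    "(1/2) *s ((-1) *s (\<i> *s uvec i)) + (1/2) *s (\<i> *s wvec i) = \<i> *s fbas i"
    "(1/2) *s ((-1) *s (\<i> *s uvec i)) + (-1/2) *s (\<i> *s wvec i) = - \<i> *s ebas i"
    by (simp_all add: wvec_def uvec_def vec_eq_iff algebra_simps)
  show "intertwines k (ebas i) (- \<i> *s fbas j)" "intertwines k (fbas i) (\<i> *s ebas j)"
    "intertwines k (ebas j) (\<i> *s fbas i)" "intertwines k (fbas j) (- \<i> *s ebas i)"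
    using * unfolding e by simp_all
qed

lemma intertwines_rot4:
  assumes "distinct [a, a', b, b', c, c', d, d']"
  defines "R \<equiv> rot a a' \<circ> rot b b' \<circ> rot c c' \<circ> rot d d'"
  shows "R \<in> Spin" "\<And>k. intertwines R (uvec k) (uvec k)"
    "\<And>i j. (i, j) \<in> {(a, a'), (b, b'), (c, c'), (d, d')} \<Longrightarrow> intertwines R (wvec i) (- wvec j) \<and> intertwines R (wvec j) (wvec i)"
proof -
  have n: "a \<noteq> a'" "b \<noteq> b'" "c \<noteq> c'" "d \<noteq> d'" using assms(1) by auto
  show "R \<in> Spin" unfolding R_def by (intro Spin_comp rot_in_Spin n)
  show "intertwines R (uvec k) (uvec k)" for k
    unfolding R_def by (intro intertwines_comp) (rule intertwines_rot(2) [OF n(4)] intertwines_rot(2) [OF n(3)] intertwines_rot(2) [OF n(2)] intertwines_rot(2) [OF n(1)])+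
  have un: "intertwines (rot p q) (- v) (- w)" if "p \<noteq> q" "intertwines (rot p q) v w" for p q v w
    using intertwines_linear(2) [OF rot_in_Spin [OF that(1)] that(2), of "-1"] by simp
  have st: "intertwines (rot p q) (wvec k) (wvec k)" "intertwines (rot p q) (- wvec k) (- wvec k)" if "p \<noteq> q" "k \<noteq> p" "k \<noteq> q" for p q k
    using intertwines_rot(1) [OF that(1), of k] un [OF that(1), of "wvec k" "wvec k"] that by auto
  have mv: "intertwines (rot p q) (wvec p) (- wvec q)" "intertwines (rot p q) (wvec q) (wvec p)" if "p \<noteq> q" for p q
    using intertwines_rot(1) [OF that, of p] intertwines_rot(1) [OF that, of q] that by auto
  show "intertwines R (wvec i) (- wvec j) \<and> intertwines R (wvec j) (wvec i)" if ij: "(i, j) \<in> {(a, a'), (b, b'), (c, c'), (d, d')}" for i j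
  proof -
    consider "i = a" "j = a'" | "i = b" "j = b'" | "i = c" "j = c'" | "i = d" "j = d'" using ij by blast
    thus ?thesis
    proof cases
      case 1 thus ?thesis unfolding R_def using assms(1)
        by (auto intro!: intertwines_comp [OF intertwines_comp [OF intertwines_comp [OF mv(1) st(1)] st(1)] st(1)] intertwines_comp [OF intertwines_comp [OF intertwines_comp [OF mv(2) st(1)] st(1)] st(1)])
    next
      case 2 thus ?thesis unfolding R_def using assms(1)
        by (auto intro!: intertwines_comp [OF intertwines_comp [OF intertwines_comp [OF st(2) mv(1)] st(1)] st(1)] intertwines_comp [OF intertwines_comp [OF intertwines_comp [OF st(1) mv(2)] st(1)] st(1)])
    next
      case 3 thus ?thesis unfolding R_def using assms(1)
        by (auto intro!: intertwines_comp [OF intertwines_comp [OF intertwines_comp [OF st(2) st(2)] mv(1)] st(1)] intertwines_comp [OF intertwines_comp [OF intertwines_comp [OF st(1) st(1)] mv(2)] st(1)])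
    next
      case 4 thus ?thesis unfolding R_def using assms(1)
        by (auto intro!: intertwines_comp [OF intertwines_comp [OF intertwines_comp [OF st(2) st(2)] st(2)] mv(1)] intertwines_comp [OF intertwines_comp [OF intertwines_comp [OF st(1) st(1)] st(1)] mv(2)])
    qed
  qed
qed

section \<open>The upper bound for the dimension\<close>

unbundle bit_operations_syntax

text \<open>Numbers the basis of \<open>V\<close> by F_2^4: the low three bits are the index, and
  bit 3 distinguishes F from E. \<open>XOR\<close> is addition, and adding 8 exchanges dual basis
  vectors.\<close>

definition ix :: "nat \<Rightarrow> 8 + 8" where
  "ix n = (if n < 8 then Inl (of_nat n) else Inr (of_nat (n - 8)))"

lemma all_16: "(\<forall>n<16. P n) \<longleftrightarrow> P 0 \<and> P 1 \<and> P 2 \<and> P 3 \<and> P 4 \<and> P 5 \<and> P 6 \<and> P 7 \<and> P 8 \<and> P 9 \<and> P 10 \<and> P 11 \<and>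
  P 12 \<and> P 13 \<and> P 14 \<and> P (15::nat)"
proof -
  have "n < 16 \<longleftrightarrow> n \<in> {0,1,2,3,4,5,6,7,8,9,10,11,12,13,14,15}" for n :: nat
    unfolding insert_iff empty_iff by presburger
  hence "(\<forall>n<16. P n) \<longleftrightarrow> (\<forall>n\<in>{0,1,2,3,4,5,6,7,8,9,10,11,12,13,14,15::nat}. P n)" by blast
  thus ?thesis by simp
qed

lemma bij_ix: "bij_betw ix {..<16} UNIV"
proof -
  have t: "ix 0 = Inl 0" "ix 1 = Inl 1" "ix 2 = Inl 2" "ix 3 = Inl 3" "ix 4 = Inl 4" "ix 5 = Inl 5" "ix 6 = Inl 6" "ix 7 = Inl 7" "ix 8 = Inr 0" "ix 9 = Inr 1" "ix 10 = Inr 2" "ix 11 = Inr 3" "ix 12 = Inr 4" "ix 13 = Inr 5" "ix 14 = Inr 6" "ix 15 = Inr 7"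
    by (simp_all add: ix_def)
  have "\<forall>i. Inl i \<in> ix ` {0,1,2,3,4,5,6,7}" "\<forall>i. Inr i \<in> ix ` {8,9,10,11,12,13,14,15}"
    unfolding all_8 image_insert t by simp_all
  moreover have "{0,1,2,3,4,5,6,7} \<subseteq> {..<16::nat}" "{8,9,10,11,12,13,14,15} \<subseteq> {..<16::nat}" by simp_all
  ultimately have "j \<in> ix ` {..<16}" for j by (cases j) blast+
  hence s: "ix ` {..<16} = UNIV" by auto
  have "card (ix ` {..<16}) = card {..<16::nat}" unfolding s by simp
  hence "inj_on ix {..<16}" by (intro eq_card_imp_inj_on) auto
  thus ?thesis using s by (simp add: bij_betw_def)
qed

lemma ix_inject: "a < 16 \<Longrightarrow> b < 16 \<Longrightarrow> ix a = ix b \<longleftrightarrow> a = b"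
  using bij_ix unfolding bij_betw_def inj_on_def by blast

definition bas16 :: "nat \<Rightarrow> V" where "bas16 n = axis (ix n) 1"

lemma bas16_simps: "n < 8 \<Longrightarrow> bas16 n = ebas (of_nat n)" "\<not> n < 8 \<Longrightarrow> bas16 n = fbas (of_nat (n - 8))"
  by (simp_all add: bas16_def ix_def ebas_def fbas_def)

lemma bas16_expand: "(\<Sum>n<16. u $ ix n *s bas16 n) = u"
proof -
  have "(\<Sum>n<16. u $ ix n *s bas16 n) = (\<Sum>j\<in>UNIV. u $ j *s axis j 1)"
    unfolding bas16_def by (rule sum.reindex_bij_betw [OF bij_ix, of "\<lambda>j. u $ j *s axis j 1"])
  thus ?thesis by (simp add: basis_expansion)
qed

lemma xor_less_16: "a < 16 \<Longrightarrow> b < 16 \<Longrightarrow> a XOR b < (16::nat)"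
proof -
  assume "a < 16" "b < 16"
  hence "take_bit 4 (a XOR b) = a XOR b" by (simp add: take_bit_xor take_bit_nat_eq_self)
  thus ?thesis using take_bit_nat_less_exp [of 4 "a XOR b"] by simp
qed

lemma xor_cancel [simp]: "a XOR (a XOR b) = (b::nat)" "(b XOR a) XOR a = b"
  by (simp_all add: xor.assoc [symmetric]) (simp add: xor.assoc)

lemma xor_eq_0_iff: "a XOR b = 0 \<longleftrightarrow> a = (b::nat)"
  by (metis xor_cancel(2) xor.left_neutral xor_self_eq)

section \<open>Products of two Pluecker coordinates and signed translations\<close>

definition pl :: "nat \<Rightarrow> nat \<Rightarrow> V \<times> V \<Rightarrow> complex" where
  "pl a b = pluecker (ix a) (ix b)"

definition pl2 :: "nat \<Rightarrow> nat \<Rightarrow> nat \<Rightarrow> nat \<Rightarrow> V \<times> V \<Rightarrow> complex" where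
  "pl2 a b c d p = (if isotropic_frame p then pl a b p * pl c d p else 0)"

lemma quadric_sections_pl2: "quadric_sections = fun_vs.span {pl2 a b c d | a b c d. a < 16 \<and> b < 16 \<and> c < 16 \<and> d < 16}"
proof -
  have ex: "\<exists>a<16. j = ix a" for j
    using bij_betw_imp_surj_on [OF bij_ix] by (metis imageE lessThan_iff UNIV_I)
  have e: "pl2 a b c d = (\<lambda>p. if isotropic_frame p then pluecker (ix a) (ix b) p * pluecker (ix c) (ix d) p else 0)" for a b c d
    by (simp add: fun_eq_iff pl2_def pl_def)
  have "{(\<lambda>p. if isotropic_frame p then pluecker i j p * pluecker k l p else 0) | i j k l. True}
     = {pl2 a b c d | a b c d. a < 16 \<and> b < 16 \<and> c < 16 \<and> d < 16}"
  proof (intro equalityI subsetI)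
    fix s :: "V \<times> V \<Rightarrow> complex"
    assume "s \<in> {(\<lambda>p. if isotropic_frame p then pluecker i j p * pluecker k l p else 0) | i j k l. True}"
    then obtain i j k l where s: "s = (\<lambda>p. if isotropic_frame p then pluecker i j p * pluecker k l p else 0)" by blast
    obtain a b c d where "a < 16" "i = ix a" "b < 16" "j = ix b" "c < 16" "k = ix c" "d < 16" "l = ix d"
      using ex [of i] ex [of j] ex [of k] ex [of l] by blast
    thus "s \<in> {pl2 a b c d | a b c d. a < 16 \<and> b < 16 \<and> c < 16 \<and> d < 16}" unfolding s by (auto simp: e)
  qed (auto simp: e)
  thus ?thesis unfolding quadric_sections_def by simp
qed

text \<open>Elements acting on \<open>V\<close> as signed translations: \<open>t\<close> is the
  translation, \<open>P\<close> a character of F_2^4, and \<open>c\<close> a fourth root of unity,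
  which cancels in products of two Pluecker coordinates because these have four indices.\<close>

definition monomial :: "(spinor \<Rightarrow> spinor) \<Rightarrow> nat \<Rightarrow> complex \<Rightarrow> (nat \<Rightarrow> bool) \<Rightarrow> bool" where
  "monomial g t c P \<longleftrightarrow> fixes_cartan g \<and> t < 16 \<and> c ^ 4 = 1 \<and> (\<forall>a b. P (a XOR b) \<longleftrightarrow> P a \<noteq> P b) \<and>
     (\<forall>n<16. intertwines g (bas16 n) ((c * (if P n then -1 else 1)) *s bas16 (n XOR t)))"

lemma monomial_nth:
  assumes "monomial g t c P" "m < 16"
  shows "vec_act g u $ ix (m XOR t) = c * (if P m then -1 else 1) * u $ ix m"
proof -
  have g: "g \<in> Spin" and t: "t < 16" using assms(1) by (auto simp: monomial_def fixes_cartan_def)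
  have b: "vec_act g (bas16 n) = (c * (if P n then -1 else 1)) *s bas16 (n XOR t)" if "n < 16" for n
    using assms that g unfolding monomial_def by (blast intro: vec_act_eqI)
  have s: "vec_act g (sum f A) = (\<Sum>n\<in>A. vec_act g (f n))" for f and A :: "nat set"
    using vec_act_linear(2) [OF g, of 0 0]
    by (induction A rule: infinite_finite_induct) (simp_all add: vec_act_linear [OF g])
  have "vec_act g u = vec_act g (\<Sum>n<16. u $ ix n *s bas16 n)" by (simp only: bas16_expand)
  also have "\<dots> = (\<Sum>n<16. (u $ ix n * (c * (if P n then -1 else 1))) *s bas16 (n XOR t))"
    unfolding s by (intro sum.cong refl) (simp add: vec_act_linear [OF g] b)
  also have "\<dots> $ ix (m XOR t) = (\<Sum>n<16. if n = m then c * (if P m then -1 else 1) * u $ ix m else 0)"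
  proof -
    have "(n XOR t = m XOR t) = (n = m)" "(m XOR t = n XOR t) = (n = m)" for n by (metis xor_cancel(2))+
    hence "bas16 (n XOR t) $ ix (m XOR t) = (if n = m then 1 else 0)" if "n < 16" for n
      using that assms(2) t by (simp add: bas16_def axis_def ix_inject xor_less_16)
    thus ?thesis unfolding sum_component vector_smult_component by (intro sum.cong) auto
  qed
  finally show ?thesis using assms(2) by simp
qed

text \<open>Each of the four indices contributes \<open>c\<close> and a sign; the scalars multiply
  to 1 and the signs to the character of the sum of the indices.\<close>

lemma monomial_pl2:
  assumes "monomial g t c P" "a < 16" "b < 16" "d < 16" "e < 16"
  shows "section_act g (pl2 a b d e) = fun_scale (if P (a XOR b XOR d XOR e) then -1 else 1) (pl2 (a XOR t) (b XOR t) (d XOR t) (e XOR t))"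
proof
  fix p :: "V \<times> V"
  obtain u' v' where p: "p = (u', v')" by (cases p)
  have g: "g \<in> Spin" using assms(1) by (auto simp: monomial_def fixes_cartan_def)
  define u where "u = vec_act (spin_inv g) u'"
  define v where "v = vec_act (spin_inv g) v'"
  have uv: "u' = vec_act g u" "v' = vec_act g v" unfolding u_def v_def by (simp_all add: vec_act_inv g)
  let ?s = "\<lambda>n. c * (if P n then -1 else 1)"
  have pl: "pl (m XOR t) (n XOR t) (u', v') = ?s m * ?s n * pl m n (u, v)" if "m < 16" "n < 16" for m n
    unfolding uv pl_def pluecker_def using monomial_nth [OF assms(1) that(1)] monomial_nth [OF assms(1) that(2)]
    by (simp add: algebra_simps)
  have c4: "c * c * c * c = 1" and P: "\<And>a b. P (a XOR b) \<longleftrightarrow> P a \<noteq> P b"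
    using assms(1) by (simp_all add: monomial_def power4_eq_xxxx)
  have "?s a * ?s b * ?s d * ?s e = (c * c * c * c) * (if P (a XOR b XOR d XOR e) then -1 else 1)"
    unfolding P by simp
  hence sgn: "?s a * ?s b * ?s d * ?s e = (if P (a XOR b XOR d XOR e) then -1 else 1)" unfolding c4 by simp
  have "section_act g (pl2 a b d e) p = pl2 a b d e (u, v)"
    unfolding p section_act_def u_def v_def by simp
  also have "\<dots> = (if P (a XOR b XOR d XOR e) then -1 else 1) * pl2 (a XOR t) (b XOR t) (d XOR t) (e XOR t) p"
  proof -
    have "pl (a XOR t) (b XOR t) p * pl (d XOR t) (e XOR t) p = (?s a * ?s b * ?s d * ?s e) * (pl a b (u, v) * pl d e (u, v))"
      unfolding p by (simp only: pl assms) (simp add: mult_ac)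
    moreover have "isotropic_frame p = isotropic_frame (u, v)"
      unfolding p uv by (rule isotropic_frame_vec_act [OF g])
    ultimately show ?thesis unfolding sgn pl2_def by (auto split: if_splits)
  qed
  finally show "section_act g (pl2 a b d e) p = fun_scale (if P (a XOR b XOR d XOR e) then -1 else 1) (pl2 (a XOR t) (b XOR t) (d XOR t) (e XOR t)) p"
    by (simp add: fun_scale_def)
qed

text \<open>The four bits, which generate all characters, occur without translation, and
  \<open>full_rev\<close> supplies the translation by 8.\<close>

lemma monomials:
  "monomial (tau 1) 0 1 (\<lambda>n. bit n 0)" "monomial (tau 2) 0 1 (\<lambda>n. bit n 1)" "monomial (tau 4) 0 1 (\<lambda>n. bit n 2)"
  "monomial ctor 0 \<i> (\<lambda>n. bit n 3)" "monomial full_rev 8 (-1) (\<lambda>n. False)"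
proof -
  have i4: "\<i> ^ 4 = 1" by (simp add: power4_eq_xxxx)
  have t: "\<forall>i. intertwines (tau k) (ebas i) ((if dot k i then -1 else 1) *s ebas i) \<and>
      intertwines (tau k) (fbas i) ((if dot k i then -1 else 1) *s fbas i)" for k
    using tau_intertwines by blast
  have b: "bit (n::nat) 1 \<longleftrightarrow> odd (n div 2)" "bit n 2 \<longleftrightarrow> odd (n div 4)" "bit n 3 \<longleftrightarrow> odd (n div 8)" "bit n 0 \<longleftrightarrow> odd n" for n
    by (simp_all add: bit_nat_def bit_0)
  have X: "\<forall>m n. bit (m XOR n) j \<longleftrightarrow> bit m j \<noteq> bit n j"
    "\<forall>m n. (bit (m XOR n) j \<noteq> bit (m XOR n) k) \<longleftrightarrow> (bit m j \<noteq> bit m k) \<noteq> (bit n j \<noteq> bit n k)" for j k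
    unfolding bit_xor_iff by blast+
  have a: "\<forall>n<16. intertwines (tau 1) (bas16 n) ((1 * (if bit n 0 then -1 else 1)) *s bas16 (n XOR 0))"
    "\<forall>n<16. intertwines (tau 2) (bas16 n) ((1 * (if bit n 1 then -1 else 1)) *s bas16 (n XOR 0))"
    "\<forall>n<16. intertwines (tau 4) (bas16 n) ((1 * (if bit n 2 then -1 else 1)) *s bas16 (n XOR 0))"
    unfolding all_16 using t [of 1, unfolded all_8] t [of 2, unfolded all_8] t [of 4, unfolded all_8]
    by (simp_all add: bas16_simps b)
  have c: "\<forall>n<16. intertwines ctor (bas16 n) ((\<i> * (if bit n 3 then -1 else 1)) *s bas16 (n XOR 0))"
    unfolding all_16 using ctor_intertwines by (simp add: bas16_simps b)
  have r: "\<forall>n<16. intertwines full_rev (bas16 n) ((-1 * (if False then -1 else 1)) *s bas16 (n XOR 8))"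
    unfolding all_16 using full_rev_intertwines by (simp add: bas16_simps)
  show "monomial (tau 1) 0 1 (\<lambda>n. bit n 0)" "monomial (tau 2) 0 1 (\<lambda>n. bit n 1)" "monomial (tau 4) 0 1 (\<lambda>n. bit n 2)"
    unfolding monomial_def by (intro conjI tau_fixes a X; simp)+
  show "monomial ctor 0 \<i> (\<lambda>n. bit n 3)"
    unfolding monomial_def by (intro conjI ctor_fixes c X i4) simp
  show "monomial full_rev 8 (-1) (\<lambda>n. False)"
    unfolding monomial_def by (intro conjI full_rev_fixes r) simp_all
qed

definition trans_conj :: "(spinor \<Rightarrow> spinor) \<Rightarrow> spinor \<Rightarrow> spinor" where
  "trans_conj R = R \<circ> ctor \<circ> spin_inv R"

text \<open>The translations 9, 10, 12 are 8 + 1, 8 + 2, 8 + 4: a conjugate of \<open>ctor\<close>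
  goes from E to F and changes one bit of the index. Together with 8 they generate F_2^4.\<close>

lemma monomials_trans:
  "monomial (trans_conj (rot 0 1 \<circ> rot 2 3 \<circ> rot 4 5 \<circ> rot 6 7)) 9 (- \<i>) (\<lambda>n. bit n 0 \<noteq> bit n 3)"
  "monomial (trans_conj (rot 0 2 \<circ> rot 1 3 \<circ> rot 4 6 \<circ> rot 5 7)) 10 (- \<i>) (\<lambda>n. bit n 1 \<noteq> bit n 3)"
  "monomial (trans_conj (rot 0 4 \<circ> rot 1 5 \<circ> rot 2 6 \<circ> rot 3 7)) 12 (- \<i>) (\<lambda>n. bit n 2 \<noteq> bit n 3)"
proof -
  have i4: "(- \<i>) ^ 4 = 1" by (simp add: power4_eq_xxxx)
  have b: "bit (n::nat) 1 \<longleftrightarrow> odd (n div 2)" "bit n 2 \<longleftrightarrow> odd (n div 4)" "bit n 3 \<longleftrightarrow> odd (n div 8)" "bit n 0 \<longleftrightarrow> odd n" for n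
    by (simp_all add: bit_nat_def bit_0)
  have X: "\<forall>m n. bit (m XOR n) j \<longleftrightarrow> bit m j \<noteq> bit n j"
    "\<forall>m n. (bit (m XOR n) j \<noteq> bit (m XOR n) k) \<longleftrightarrow> (bit m j \<noteq> bit m k) \<noteq> (bit n j \<noteq> bit n k)" for j k
    unfolding bit_xor_iff by blast+
  have k: "intertwines k (ebas i) (- \<i> *s fbas j)" "intertwines k (fbas i) (\<i> *s ebas j)"
      "intertwines k (ebas j) (\<i> *s fbas i)" "intertwines k (fbas j) (- \<i> *s ebas i)"
    if d: "distinct [a, a', b, b', c, c', d, d']" and ij: "(i, j) \<in> {(a, a'), (b, b'), (c, c'), (d, d')}"
      and k: "k = trans_conj (rot a a' \<circ> rot b b' \<circ> rot c c' \<circ> rot d d')" for a a' b b' c c' d d' i j k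
  proof -
    note R = intertwines_rot4 [OF d]
    note * = conj_ctor_intertwines [OF R(1) conjunct1 [OF R(3) [OF ij]] conjunct2 [OF R(3) [OF ij]] R(2)]
    show "intertwines k (ebas i) (- \<i> *s fbas j)" "intertwines k (fbas i) (\<i> *s ebas j)"
      "intertwines k (ebas j) (\<i> *s fbas i)" "intertwines k (fbas j) (- \<i> *s ebas i)"
      unfolding k trans_conj_def by (rule *)+
  qed
  have d: "distinct [0,1,2,3,4,5,6,7::8]" "distinct [0,2,1,3,4,6,5,7::8]" "distinct [0,4,1,5,2,6,3,7::8]" by simp_all
  have a: "\<forall>n<16. intertwines (trans_conj (rot 0 1 \<circ> rot 2 3 \<circ> rot 4 5 \<circ> rot 6 7)) (bas16 n) ((- \<i> * (if bit n 0 \<noteq> bit n 3 then -1 else 1)) *s bas16 (n XOR 9))"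
    unfolding all_16 using k [OF d(1) _ refl, of 0 1] k [OF d(1) _ refl, of 2 3] k [OF d(1) _ refl, of 4 5] k [OF d(1) _ refl, of 6 7]
    by (simp add: bas16_simps b)
  have a': "\<forall>n<16. intertwines (trans_conj (rot 0 2 \<circ> rot 1 3 \<circ> rot 4 6 \<circ> rot 5 7)) (bas16 n) ((- \<i> * (if bit n 1 \<noteq> bit n 3 then -1 else 1)) *s bas16 (n XOR 10))"
    unfolding all_16 using k [OF d(2) _ refl, of 0 2] k [OF d(2) _ refl, of 1 3] k [OF d(2) _ refl, of 4 6] k [OF d(2) _ refl, of 5 7]
    by (simp add: bas16_simps b)
  have a'': "\<forall>n<16. intertwines (trans_conj (rot 0 4 \<circ> rot 1 5 \<circ> rot 2 6 \<circ> rot 3 7)) (bas16 n) ((- \<i> * (if bit n 2 \<noteq> bit n 3 then -1 else 1)) *s bas16 (n XOR 12))"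
    unfolding all_16 using k [OF d(3) _ refl, of 0 4] k [OF d(3) _ refl, of 1 5] k [OF d(3) _ refl, of 2 6] k [OF d(3) _ refl, of 3 7]
    by (simp add: bas16_simps b)
  show "monomial (trans_conj (rot 0 1 \<circ> rot 2 3 \<circ> rot 4 5 \<circ> rot 6 7)) 9 (- \<i>) (\<lambda>n. bit n 0 \<noteq> bit n 3)"
    unfolding monomial_def by (intro conjI normalizer_conj_fixes [OF hmat1(1) ctor_fixes, folded trans_conj_def] a X i4) simp
  show "monomial (trans_conj (rot 0 2 \<circ> rot 1 3 \<circ> rot 4 6 \<circ> rot 5 7)) 10 (- \<i>) (\<lambda>n. bit n 1 \<noteq> bit n 3)"
    unfolding monomial_def by (intro conjI normalizer_conj_fixes [OF hmat2(1) ctor_fixes, folded trans_conj_def] a' X i4) simp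
  show "monomial (trans_conj (rot 0 4 \<circ> rot 1 5 \<circ> rot 2 6 \<circ> rot 3 7)) 12 (- \<i>) (\<lambda>n. bit n 2 \<noteq> bit n 3)"
    unfolding monomial_def by (intro conjI normalizer_conj_fixes [OF hmat4(1) ctor_fixes, folded trans_conj_def] a'' X i4) simp
qed

text \<open>A fixed vector is its own average, s = (s + T s) / 2, so it lies in the span of the
  averaged generators. Using one group element at a time avoids a sum over the whole group.\<close>

lemma span_average:
  assumes s: "s \<in> fun_vs.span B" "T s = s"
    and T: "\<And>x y. T (x + y) = T x + T y" "\<And>c x. T (fun_scale c x) = fun_scale c (T x)"
    and B: "\<And>b. b \<in> B \<Longrightarrow> b + T b \<in> fun_vs.span C"
  shows "s \<in> fun_vs.span C"
proof -
  have "x + T x \<in> fun_vs.span C" if "x \<in> fun_vs.span B" for x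
    using that
  proof (induction rule: fun_vs.span_induct_alt)
    case base
    have "T 0 = 0" using T(2) [of 0 0] by (simp add: fun_vs.scale_zero_left)
    thus ?case by (metis add_0 fun_vs.span_zero)
  next
    case (step c x y)
    have eq: "fun_scale c x + y + T (fun_scale c x + y) = fun_scale c (x + T x) + (y + T y)"
      by (simp add: T fun_vs.scale_right_distrib)
    show ?case unfolding eq by (intro fun_vs.span_add fun_vs.span_scale B step)
  qed
  hence "fun_scale (1/2) (s + s) \<in> fun_vs.span C" using s by (metis fun_vs.span_scale)
  moreover have "fun_scale (1/2) (s + s) = s" by (simp add: fun_scale_def fun_eq_iff)
  ultimately show ?thesis by simp
qed

section \<open>Averaging over signs and translations\<close>

definition translate_sum :: "nat list \<Rightarrow> nat \<Rightarrow> nat \<Rightarrow> nat \<Rightarrow> nat \<Rightarrow> V \<times> V \<Rightarrow> complex" where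
  "translate_sum vs a b c d = (\<Sum>v\<leftarrow>vs. pl2 (a XOR v) (b XOR v) (c XOR v) (d XOR v))"

lemma translate_sum_step:
  assumes m: "monomial g t w P" and lt: "a < 16" "b < 16" "c < 16" "d < 16" "\<forall>v\<in>set vs. v < 16"
    and 0: "a XOR b XOR c XOR d = 0"
  shows "section_act g (translate_sum vs a b c d) = translate_sum (map (\<lambda>v. v XOR t) vs) a b c d"
proof -
  have P0: "\<not> P 0" using m unfolding monomial_def by (metis xor_self_eq)
  have sum0: "section_act g 0 = 0" using section_act_linear(2) [of g 0 0] by (simp add: fun_vs.scale_zero_left)
  have "(a XOR v) XOR (b XOR v) XOR (c XOR v) XOR (d XOR v) = 0" for v
    using 0 by (simp add: xor.assoc xor.left_commute xor.commute)
  hence "section_act g (pl2 (a XOR v) (b XOR v) (c XOR v) (d XOR v)) =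
      pl2 (a XOR v XOR t) (b XOR v XOR t) (c XOR v XOR t) (d XOR v XOR t)" if "v < 16" for v
    using monomial_pl2 [OF m, of "a XOR v" "b XOR v" "c XOR v" "d XOR v"] that lt P0
    by (simp add: xor_less_16 xor.assoc fun_vs.scale_one)
  thus ?thesis
    using lt(5) unfolding translate_sum_def by (induction vs) (simp_all add: sum0 section_act_linear)
qed

text \<open>The sum of all translates of a product whose four indices add up to 0, shifted so that
  one index is 0: \<open>d\<close> is the difference inside each Pluecker coordinate,
  \<open>k\<close> the shift between the two.\<close>

definition avg :: "nat \<Rightarrow> nat \<Rightarrow> V \<times> V \<Rightarrow> complex" where
  "avg d k = translate_sum [0..<16] 0 d k (k XOR d)"

lemma invariant_in_span_avg:
  assumes s: "s \<in> quadric_sections" and inv: "\<And>g. fixes_cartan g \<Longrightarrow> section_act g s = s"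
  shows "s \<in> fun_vs.span {avg d k | d k. d < 16 \<and> k < 16}"
proof -
  \<comment> \<open>\<open>Q S\<close> consists of the products whose index sum has zero bits at the
    positions in \<open>S\<close>. Averaging over a bit character cancels the products with that bit
    set and keeps the others.\<close>
  define Q where "Q S = {pl2 a b c d | a b c d. a < 16 \<and> b < 16 \<and> c < 16 \<and> d < 16 \<and> (\<forall>t\<in>S. \<not> bit (a XOR b XOR c XOR d) t)}" for S
  have mon: "section_act g s = s" if "monomial g t w P" for g t w P
    using that inv by (auto simp: monomial_def)
  have step: "s \<in> fun_vs.span (Q (insert t S))" if "s \<in> fun_vs.span (Q S)" "monomial g 0 w (\<lambda>n. bit n t)" for g t w S
  proof (rule span_average [OF that(1) mon [OF that(2)] section_act_linear])
    fix x assume "x \<in> Q S"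
    then obtain a b c d where x: "x = pl2 a b c d" "a < 16" "b < 16" "c < 16" "d < 16" "\<forall>t\<in>S. \<not> bit (a XOR b XOR c XOR d) t"
      unfolding Q_def by blast
    show "x + section_act g x \<in> fun_vs.span (Q (insert t S))"
    proof (cases "bit (a XOR b XOR c XOR d) t")
      case True
      have "x + section_act g x = 0"
        using monomial_pl2 [OF that(2) x(2-5)] True by (simp add: x(1) fun_scale_def fun_eq_iff)
      thus ?thesis by (simp add: fun_vs.span_zero)
    next
      case False
      hence "x \<in> Q (insert t S)" using x unfolding Q_def by blast
      moreover have "section_act g x = x"
        using monomial_pl2 [OF that(2) x(2-5)] False by (simp add: x(1) fun_scale_def fun_eq_iff)
      ultimately show ?thesis by (metis fun_vs.span_add fun_vs.span_base)
    qed
  qed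
  have "s \<in> fun_vs.span (Q {})" using s unfolding quadric_sections_pl2 Q_def by simp
  from step [OF step [OF step [OF step [OF this monomials(1)] monomials(2)] monomials(3)] monomials(4)]
  have Q: "s \<in> fun_vs.span (Q {3, 2, 1, 0})" .
  \<comment> \<open>Averaging over a translation doubles the list of shifts; after four steps it
    runs through all of F_2^4.\<close>
  define R where "R vs = {translate_sum vs a b c d | a b c d. a < 16 \<and> b < 16 \<and> c < 16 \<and> d < 16 \<and> a XOR b XOR c XOR d = 0}" for vs
  have "Q {3, 2, 1, 0} = R [0]"
  proof -
    have bits: "(\<forall>t\<in>{3,2,1,0}. \<not> bit n t) \<longleftrightarrow> n = 0" if "n < 16" for n :: nat
    proof
      assume n: "\<forall>t\<in>{3,2,1,0}. \<not> bit n t"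
      have "\<not> bit n t" for t
      proof (cases "t < 4")
        case True
        hence "t \<in> {3,2,1,0}" by auto
        thus ?thesis using n by blast
      next
        case False
        have "take_bit 4 n = n" using that by (simp add: take_bit_nat_eq_self)
        thus ?thesis using False by (metis bit_take_bit_iff)
      qed
      thus "n = 0" by (intro bit_eqI) simp
    qed simp
    have ts: "translate_sum [0] a b c d = pl2 a b c d" for a b c d by (simp add: translate_sum_def)
    have "(a < 16 \<and> b < 16 \<and> c < 16 \<and> d < 16 \<and> (\<forall>t\<in>{3,2,1,0}. \<not> bit (a XOR b XOR c XOR d) t))
      = (a < 16 \<and> b < 16 \<and> c < 16 \<and> d < 16 \<and> a XOR b XOR c XOR d = 0)" for a b c d :: nat
      using bits [of "a XOR b XOR c XOR d"] xor_less_16 by blast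
    thus ?thesis unfolding Q_def R_def ts by (simp only:)
  qed
  with Q have R0: "s \<in> fun_vs.span (R [0])" by simp
  have stepR: "s \<in> fun_vs.span (R (vs @ map (\<lambda>v. v XOR t) vs))"
    if "s \<in> fun_vs.span (R vs)" "monomial g t w P" "\<forall>v\<in>set vs. v < 16" for g t w P vs
  proof (rule span_average [OF that(1) mon [OF that(2)] section_act_linear])
    fix x assume "x \<in> R vs"
    then obtain a b c d where x: "x = translate_sum vs a b c d" "a < 16" "b < 16" "c < 16" "d < 16" "a XOR b XOR c XOR d = 0"
      unfolding R_def by blast
    have "x + section_act g x = translate_sum (vs @ map (\<lambda>v. v XOR t) vs) a b c d"
      unfolding x(1) translate_sum_step [OF that(2) x(2-5) that(3) x(6)] by (simp add: translate_sum_def)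
    thus "x + section_act g x \<in> fun_vs.span (R (vs @ map (\<lambda>v. v XOR t) vs))"
      using x(2-6) by (intro fun_vs.span_base) (auto simp: R_def)
  qed
  have e1: "[0] @ map (\<lambda>v. v XOR 8) [0] = [0, 8::nat]" by simp
  have R1: "s \<in> fun_vs.span (R [0, 8])" using stepR [OF R0 monomials(5)] unfolding e1 by simp
  have e2: "[0, 8] @ map (\<lambda>v. v XOR 9) [0, 8] = [0, 8, 9, 1::nat]" by simp
  have R2: "s \<in> fun_vs.span (R [0, 8, 9, 1])" using stepR [OF R1 monomials_trans(1)] unfolding e2 by simp
  have e3: "[0, 8, 9, 1] @ map (\<lambda>v. v XOR 10) [0, 8, 9, 1] = [0, 8, 9, 1, 10, 2, 3, 11::nat]" by simp
  have R3: "s \<in> fun_vs.span (R [0, 8, 9, 1, 10, 2, 3, 11])" using stepR [OF R2 monomials_trans(2)] unfolding e3 by simp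
  have e4: "[0, 8, 9, 1, 10, 2, 3, 11] @ map (\<lambda>v. v XOR 12) [0, 8, 9, 1, 10, 2, 3, 11] = [0, 8, 9, 1, 10, 2, 3, 11, 12, 4, 5, 13, 6, 14, 15, 7::nat]" by simp
  have R4: "s \<in> fun_vs.span (R [0, 8, 9, 1, 10, 2, 3, 11, 12, 4, 5, 13, 6, 14, 15, 7])" using stepR [OF R3 monomials_trans(3)] unfolding e4 by simp
  have perm: "translate_sum [0, 8, 9, 1, 10, 2, 3, 11, 12, 4, 5, 13, 6, 14, 15, 7] = translate_sum [0..<16]"
  proof -
    have d: "translate_sum vs a b c d = (\<Sum>v\<in>set vs. pl2 (a XOR v) (b XOR v) (c XOR v) (d XOR v))" if "distinct vs" for vs a b c d
      unfolding translate_sum_def using that by (rule sum_list_distinct_conv_sum_set)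
    have s: "set [0, 8, 9, 1, 10, 2, 3, 11, 12, 4, 5, 13, 6, 14, 15, 7] = set [0..<16::nat]"
      using all_16 [of "\<lambda>n. n \<in> set [0, 8, 9, 1, 10, 2, 3, 11, 12, 4, 5, 13, 6, 14, 15, 7]"] by auto
    show ?thesis by (intro ext, subst d, simp, subst d, simp, simp only: s)
  qed
  \<comment> \<open>The full sum is invariant under translation, which allows the first index to be
    moved to 0.\<close>
  have shift: "translate_sum [0..<16] (a XOR w) (b XOR w) (c XOR w) (d XOR w) = translate_sum [0..<16] a b c d" if "w < 16" for a b c d w
  proof -
    have "(\<Sum>v\<in>{0..<16}. pl2 (a XOR w XOR v) (b XOR w XOR v) (c XOR w XOR v) (d XOR w XOR v)) =
       (\<Sum>v\<in>{0..<16}. pl2 (a XOR v) (b XOR v) (c XOR v) (d XOR v))"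
      by (rule sum.reindex_bij_witness [of _ "\<lambda>v. w XOR v" "\<lambda>v. w XOR v"]) (use that in \<open>auto simp: xor_less_16\<close>)
    thus ?thesis unfolding translate_sum_def by (simp add: interv_sum_list_conv_sum_set_nat xor.assoc)
  qed
  have "R [0, 8, 9, 1, 10, 2, 3, 11, 12, 4, 5, 13, 6, 14, 15, 7] \<subseteq> {avg d k | d k. d < 16 \<and> k < 16}"
  proof
    fix x assume "x \<in> R [0, 8, 9, 1, 10, 2, 3, 11, 12, 4, 5, 13, 6, 14, 15, 7]"
    then obtain a b c d where x: "x = translate_sum [0..<16] a b c d" "a < 16" "b < 16" "c < 16" "d < 16" "a XOR b XOR c XOR d = 0"
      unfolding R_def perm by blast
    have "d = a XOR b XOR c" using x(6) by (metis xor.assoc xor_eq_0_iff)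
    hence "d XOR a = (c XOR a) XOR (b XOR a)" by (simp add: xor.assoc xor.left_commute xor.commute)
    hence "x = avg (b XOR a) (c XOR a)"
      unfolding x(1) avg_def using shift [OF x(2), of a b c d] by simp
    moreover have "b XOR a < 16" "c XOR a < 16" using x by (simp_all add: xor_less_16)
    ultimately show "x \<in> {avg d k | d k. d < 16 \<and> k < 16}" by blast
  qed
  thus ?thesis using R4 fun_vs.span_mono by blast
qed

section \<open>Relations among the averaged products\<close>

lemma pl_antisym: "pl b a p = - pl a b p"
  by (cases p) (simp add: pl_def pluecker_def)

lemma avg_eq: "avg d k p = (\<Sum>v<16. pl2 v (d XOR v) (k XOR v) (k XOR d XOR v) p)"
proof -
  have "avg d k p = (\<Sum>v\<leftarrow>[0..<16]. pl2 v (d XOR v) (k XOR v) (k XOR d XOR v) p)"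
  proof -
    have "(\<Sum>v\<leftarrow>vs. f v) p = (\<Sum>v\<leftarrow>vs. f v p)" for vs and f :: "nat \<Rightarrow> V \<times> V \<Rightarrow> complex"
      by (induction vs) simp_all
    thus ?thesis unfolding avg_def translate_sum_def by (simp add: xor.assoc)
  qed
  thus ?thesis by (simp add: interv_sum_list_conv_sum_set_nat atLeast0LessThan)
qed

lemma avg_0: "avg 0 k = 0"
proof -
  have "pl a a p = 0" for a p using pl_antisym [of a a p] by simp
  hence "pl2 a a c d p = 0" for a c d p by (simp add: pl2_def)
  thus ?thesis by (simp add: fun_eq_iff avg_eq)
qed

text \<open>Antisymmetry of the second Pluecker coordinate.\<close>

lemma avg_swap: "avg d (k XOR d) = - avg d k"
proof -
  have "pl2 v (d XOR v) (k XOR d XOR v) (k XOR v) p = - pl2 v (d XOR v) (k XOR v) (k XOR d XOR v) p" for v p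
    by (simp add: pl2_def pl_antisym [of "k XOR d XOR v"])
  thus ?thesis by (simp add: fun_eq_iff avg_eq sum_negf xor.assoc)
qed

text \<open>The three-term Pluecker relation, summed over all translates.\<close>

lemma avg_pluecker: "avg d k = avg k d - avg (k XOR d) d"
proof -
  have "pl a b p * pl c d p - pl a c p * pl b d p + pl a d p * pl b c p = 0" for a b c d p
    by (cases p) (simp add: pl_def pluecker_def algebra_simps)
  hence "pl2 v (d XOR v) (k XOR v) (k XOR d XOR v) p = pl2 v (k XOR v) (d XOR v) (d XOR k XOR v) p
      - pl2 v ((k XOR d) XOR v) (d XOR v) (d XOR (k XOR d) XOR v) p" for v p
    by (simp add: pl2_def xor.assoc xor.commute xor.left_commute algebra_simps add_eq_0_iff)
  thus ?thesis by (simp add: fun_eq_iff avg_eq sum_subtractf)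
qed

text \<open>Indices differing by 8 are dual, so the double sum expands into products of polar forms
  of the two frame vectors, and these vanish on an isotropic plane.\<close>

lemma avg_isotropic: "(\<Sum>d<16. avg d 8) = 0"
proof
  fix p :: "V \<times> V"
  obtain u v where p: "p = (u, v)" by (cases p)
  let ?b = "\<lambda>x y. \<Sum>n<16. x $ ix n * y $ ix (n XOR 8)"
  have polar: "polar x y = ?b x y" for x y
  proof -
    have "{..<16} = {0,1,2,3,4,5,6,7,8,9,10,11,12,13,14,15::nat}" using all_16 [of "\<lambda>n. n \<in> {0,1,2,3,4,5,6,7,8,9,10,11,12,13,14,15}"] by auto
    thus ?thesis by (simp add: polar_def sum_8 ix_def add_ac)
  qed
  have "(\<Sum>d<16. avg d 8 p) = (\<Sum>w<16. \<Sum>d<16. pl2 w (d XOR w) (8 XOR w) (8 XOR d XOR w) p)"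
    unfolding avg_eq by (rule sum.swap)
  also have "\<dots> = (\<Sum>a<16. \<Sum>b<16. pl2 a b (a XOR 8) (b XOR 8) p)"
  proof (rule sum.cong [OF refl])
    fix w assume "w \<in> {..<16::nat}"
    thus "(\<Sum>d<16. pl2 w (d XOR w) (8 XOR w) (8 XOR d XOR w) p) = (\<Sum>b<16. pl2 w b (w XOR 8) (b XOR 8) p)"
      by (intro sum.reindex_bij_witness [of _ "\<lambda>b. b XOR w" "\<lambda>d. d XOR w"])
         (auto simp: xor_less_16, simp add: xor.assoc xor.commute xor.left_commute)
  qed
  also have "\<dots> = 0"
  proof (cases "isotropic_frame p")
    case True
    have q: "quad (a *s u + b *s v) = 0" for a b using True unfolding p isotropic_frame_def by auto
    have "polar u u = 0" "polar v v = 0" "polar u v = 0"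
      using q [of 1 0] q [of 0 1] q [of 1 1] by (simp_all add: polar_self quad_add)
    hence b: "?b u u = 0" "?b v v = 0" "?b u v = 0" "?b v u = 0" by (simp_all add: polar [symmetric] polar_commute)
    have "(\<Sum>a<16. \<Sum>b<16. pl2 a b (a XOR 8) (b XOR 8) p)
      = (\<Sum>a<16. \<Sum>b<16. (u $ ix a * u $ ix (a XOR 8)) * (v $ ix b * v $ ix (b XOR 8)) + (v $ ix a * v $ ix (a XOR 8)) * (u $ ix b * u $ ix (b XOR 8))
          - (u $ ix a * v $ ix (a XOR 8)) * (v $ ix b * u $ ix (b XOR 8)) - (v $ ix a * u $ ix (a XOR 8)) * (u $ ix b * v $ ix (b XOR 8)))"
      using True by (intro sum.cong refl) (simp add: p pl2_def pl_def pluecker_def algebra_simps)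
    also have "\<dots> = ?b u u * ?b v v + ?b v v * ?b u u - ?b u v * ?b v u - ?b v u * ?b u v"
      by (simp only: sum_product sum.distrib sum_subtractf)
    finally show ?thesis unfolding b by simp
  qed (simp add: pl2_def)
  moreover have "(\<Sum>d\<in>A. f d) p = (\<Sum>d\<in>A. f d p)" for A and f :: "nat \<Rightarrow> V \<times> V \<Rightarrow> complex"
    by (induction A rule: infinite_finite_induct) simp_all
  ultimately show "(\<Sum>d<16. avg d 8) p = 0 p" by simp
qed

text \<open>The condition \<open>a < b < a XOR b\<close> lists each two-dimensional subspace of
  F_2^4 once, and each contributes two sums. Among the sums with \<open>k = 0\<close>, the isotropy
  relation expresses the one for \<open>d = 8\<close>.\<close>

definition avg_basis :: "(V \<times> V \<Rightarrow> complex) set" where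
  "avg_basis = (\<lambda>d. avg d 0) ` ({1..<16} - {8}) \<union> (\<lambda>(a, b). avg a b) ` {(a, b). 0 < a \<and> a < b \<and> b < a XOR b \<and> a XOR b < 16}
     \<union> (\<lambda>(a, b). avg b a) ` {(a, b). 0 < a \<and> a < b \<and> b < a XOR b \<and> a XOR b < 16}"

lemma avg_basis_card: "finite avg_basis" "card avg_basis \<le> 84"
proof -
  let ?P = "\<lambda>(a, b). 0 < a \<and> a < b \<and> b < a XOR b \<and> a XOR b < (16::nat)"
  have e: "{(a, b). 0 < a \<and> a < b \<and> b < a XOR b \<and> a XOR b < 16} = set (filter ?P (List.product [0..<16] [0..<16]))"
    by auto
  \<comment> \<open>The number of two-dimensional subspaces of F_2^4, that is 15 * 14 / 6.\<close>
  have l: "length (filter ?P (List.product [0..<16] [0..<16])) = 35" by code_simp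
  have f: "finite {(a, b). 0 < a \<and> a < b \<and> b < a XOR b \<and> a XOR b < (16::nat)}" unfolding e by simp
  have c: "card {(a, b). 0 < a \<and> a < b \<and> b < a XOR b \<and> a XOR b < (16::nat)} \<le> 35"
    unfolding e l [symmetric] by (rule card_length)
  show "finite avg_basis" unfolding avg_basis_def using f by simp
  have "card ((\<lambda>d. avg d 0) ` ({1..<16} - {8})) \<le> card ({1..<16} - {8::nat})" by (rule card_image_le) simp
  hence "card ((\<lambda>d. avg d 0) ` ({1..<16} - {8})) \<le> 14" by simp
  moreover have "card ((\<lambda>(a, b). avg a b) ` {(a, b). 0 < a \<and> a < b \<and> b < a XOR b \<and> a XOR b < 16}) \<le> 35"
    "card ((\<lambda>(a, b). avg b a) ` {(a, b). 0 < a \<and> a < b \<and> b < a XOR b \<and> a XOR b < 16}) \<le> 35"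
    using card_image_le [OF f] c le_trans by blast+
  ultimately have "card ((\<lambda>d. avg d 0) ` ({1..<16} - {8})) + card ((\<lambda>(a, b). avg a b) ` {(a, b). 0 < a \<and> a < b \<and> b < a XOR b \<and> a XOR b < 16})
     + card ((\<lambda>(a, b). avg b a) ` {(a, b). 0 < a \<and> a < b \<and> b < a XOR b \<and> a XOR b < 16}) \<le> 84" by linarith
  thus "card avg_basis \<le> 84" unfolding avg_basis_def
    by (meson card_Un_le add_le_mono1 le_trans)
qed

text \<open>For a subspace with nonzero vectors a, b, c the six sums agree in pairs up to sign by
  \<open>avg_swap\<close>, and the Pluecker relation eliminates one of the three that
  remain.\<close>

lemma avg_in_span: assumes "d < 16" "k < 16" shows "avg d k \<in> fun_vs.span avg_basis"
proof -
  let ?S = "fun_vs.span avg_basis"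
  have neg: "- x \<in> ?S" if "x \<in> ?S" for x using that by (rule fun_vs.span_neg)
  have sorted: "avg a b \<in> ?S \<and> avg b a \<in> ?S \<and> avg a (a XOR b) \<in> ?S \<and> avg b (a XOR b) \<in> ?S \<and> avg (a XOR b) a \<in> ?S \<and> avg (a XOR b) b \<in> ?S"
    if "0 < a" "a < b" "b < a XOR b" "a XOR b < 16" for a b
  proof -
    have ab: "avg a b \<in> ?S" "avg b a \<in> ?S"
      using that by (auto intro!: fun_vs.span_base simp: avg_basis_def)
    have ac: "avg a (a XOR b) \<in> ?S" "avg b (a XOR b) \<in> ?S"
      using neg [OF ab(1)] neg [OF ab(2)] avg_swap [of a b] avg_swap [of b a] by (simp_all add: xor.commute)
    have "avg (a XOR b) a = avg a (a XOR b) - avg b (a XOR b)"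
      using avg_pluecker [of "a XOR b" a] by simp
    hence ca: "avg (a XOR b) a \<in> ?S" using ac by (simp add: fun_vs.span_diff)
    have "avg (a XOR b) b \<in> ?S"
      using neg [OF ca] avg_swap [of "a XOR b" a] by simp
    thus ?thesis using ab ac ca by blast
  qed
  have distinct: "avg d k \<in> ?S" if "0 < d" "d < 16" "0 < k" "k < 16" "d \<noteq> k" for d k
  proof -
    let ?c = "d XOR k"
    note nd = that(5)
    have c: "?c < 16" "?c \<noteq> 0" "?c \<noteq> d" "?c \<noteq> k"
      using that by (auto simp: xor_less_16 xor_eq_0_iff) (metis xor_cancel(1) xor.right_neutral xor_eq_0_iff xor.commute less_irrefl)+
    have s: "k XOR ?c = d" "?c XOR k = d" "?c XOR d = k" "d XOR ?c = k" "k XOR d = ?c"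
      by (simp_all add: xor.assoc xor.commute xor.left_commute)
    consider "d < k" "k < ?c" | "d < ?c" "?c < k" | "k < d" "d < ?c" | "k < ?c" "?c < d" | "?c < d" "d < k" | "?c < k" "k < d"
    proof -
      have "d < k \<or> k < d" "d < ?c \<or> ?c < d" "k < ?c \<or> ?c < k" using c(3,4) nd by (metis nat_neq_iff)+
      thus thesis using that by blast
    qed
    thus ?thesis
    proof cases
      case 1 thus ?thesis using sorted [of d k] that c by simp
    next
      case 2 thus ?thesis using sorted [of d ?c] that c s by simp
    next
      case 3 thus ?thesis using sorted [of k d] that c s by simp
    next
      case 4 thus ?thesis using sorted [of k ?c] that c s by simp
    next
      case 5 thus ?thesis using sorted [of ?c d] that c s by simp
    next
      case 6 thus ?thesis using sorted [of ?c k] that c s by simp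
    qed
  qed
  have zero: "avg d 0 \<in> ?S" if d16: "d < 16" for d
  proof -
    consider "d = 0" | "d = 8" | "d \<in> {1..<16} - {8}" using d16 by force
    thus ?thesis
    proof cases
      case 1 thus ?thesis by (metis avg_0 fun_vs.span_zero)
    next
      case 2
      \<comment> \<open>The isotropy relation is solved for \<open>avg 8 8\<close>, which is minus
        \<open>avg 8 0\<close>.\<close>
      have "(\<Sum>d\<in>{..<16} - {8}. avg d 8) \<in> ?S"
      proof (rule fun_vs.span_sum)
        fix d assume "d \<in> {..<16} - {8::nat}"
        thus "avg d 8 \<in> ?S" using distinct [of d 8] avg_0 fun_vs.span_zero by (cases "d = 0") auto
      qed
      moreover have "(\<Sum>d<16. avg d 8) = avg 8 8 + (\<Sum>d\<in>{..<16} - {8}. avg d 8)"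
        by (rule sum.remove) simp_all
      ultimately have "avg 8 8 \<in> ?S"
        unfolding avg_isotropic using neg by (metis add.inverse_unique add.commute)
      thus ?thesis using neg avg_swap [of 8 8] 2 by (simp add: eq_neg_iff_add_eq_0) (metis add.commute neg_eq_iff_add_eq_0)
    next
      case 3 thus ?thesis by (auto intro!: fun_vs.span_base simp: avg_basis_def)
    qed
  qed
  consider "d = 0" | "k = 0" | "0 < d" "k = d" | "0 < d" "0 < k" "d \<noteq> k" by blast
  thus ?thesis
  proof cases
    case 1 thus ?thesis by (metis avg_0 fun_vs.span_zero)
  next
    case 2 thus ?thesis using zero assms by simp
  next
    case 3
    have "avg d d = - avg d 0" using avg_swap [of d 0] by simp
    thus ?thesis using neg zero assms 3 by simp
  next
    case 4 thus ?thesis using distinct assms by simp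
  qed
qed

theorem invariant_in_span_avg_basis:
  assumes "s \<in> quadric_sections" "\<And>g. fixes_cartan g \<Longrightarrow> section_act g s = s"
  shows "s \<in> fun_vs.span avg_basis"
proof -
  have "fun_vs.span {avg d k | d k. d < 16 \<and> k < 16} \<subseteq> fun_vs.span avg_basis"
    using avg_in_span by (intro fun_vs.span_minimal fun_vs.subspace_span) auto
  thus ?thesis using invariant_in_span_avg [OF assms] by blast
qed

section \<open>Quartic forms in eight variables\<close>

type_synonym form = "(8 \<Rightarrow> complex) \<Rightarrow> complex"

definition pow4 :: "(8 \<Rightarrow> complex) \<Rightarrow> form" where
  "pow4 a z = (\<Sum>k\<in>UNIV. a k * z k) ^ 4"

text \<open>Spanned by fourth powers of linear forms, so that linear identities are checked on
  \<open>pow4\<close> only; \<open>monomial_quartics\<close> recovers the monomials.\<close>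

definition quartics :: "form set" where "quartics = fun_vs.span (range pow4)"

text \<open>Polarization by alternating signs. The sixteen sign patterns and the 24 orderings of
  four arguments give 384.\<close>

definition polz :: "form \<Rightarrow> (8 \<Rightarrow> complex) \<Rightarrow> (8 \<Rightarrow> complex) \<Rightarrow> (8 \<Rightarrow> complex) \<Rightarrow> (8 \<Rightarrow> complex) \<Rightarrow> complex" where
  "polz F x y u v = (\<Sum>p\<in>{1,-1}. \<Sum>q\<in>{1,-1}. \<Sum>r\<in>{1,-1}. \<Sum>s\<in>{1,-1}.
     p * q * r * s * F (\<lambda>m. p * x m + q * y m + r * u m + s * v m)) / 384"

definition delta :: "8 \<Rightarrow> 8 \<Rightarrow> complex" where "delta i = (\<lambda>k. if k = i then 1 else 0)"

definition coeff4 :: "form \<Rightarrow> 8 \<Rightarrow> 8 \<Rightarrow> 8 \<Rightarrow> 8 \<Rightarrow> complex" where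
  "coeff4 F i j k l = polz F (delta i) (delta j) (delta k) (delta l)"

lemma sum_pm: "(\<Sum>p\<in>{1,-1}. f p) = f 1 + f (-1 :: complex)"
  by simp

lemma polarization_4:
  "(\<Sum>p\<in>{1,-1}. \<Sum>q\<in>{1,-1}. \<Sum>r\<in>{1,-1}. \<Sum>s\<in>{1,-1}. p * q * r * s * (p * x + q * y + r * u + s * v) ^ 4) = 384 * (x * y * u * (v::complex))"
  unfolding sum_pm by (simp add: power4_eq_xxxx algebra_simps)

lemma polz_linear:
  "polz (F + G) x y u v = polz F x y u v + polz G x y u v" "polz (fun_scale c F) x y u v = c * polz F x y u v"
  unfolding polz_def sum_pm by (simp_all add: fun_scale_def algebra_simps add_divide_distrib diff_divide_distrib)

lemma coeff4_linear:
  "coeff4 (F + G) i j k l = coeff4 F i j k l + coeff4 G i j k l" "coeff4 (fun_scale c F) i j k l = c * coeff4 F i j k l"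
  "coeff4 0 i j k l = 0"
  using polz_linear(2) [of 0 0] by (simp_all add: coeff4_def polz_linear fun_vs.scale_zero_left)

lemma polz_pow4: "polz (pow4 a) x y u v =
  (\<Sum>k\<in>UNIV. a k * x k) * (\<Sum>k\<in>UNIV. a k * y k) * (\<Sum>k\<in>UNIV. a k * u k) * (\<Sum>k\<in>UNIV. a k * v k)"
proof -
  have "pow4 a (\<lambda>m. p * x m + q * y m + r * u m + s * v m) = (p * (\<Sum>k\<in>UNIV. a k * x k) + q * (\<Sum>k\<in>UNIV. a k * y k) +
     r * (\<Sum>k\<in>UNIV. a k * u k) + s * (\<Sum>k\<in>UNIV. a k * v k)) ^ 4" for p q r s
    by (simp add: pow4_def sum_distrib_left sum.distrib algebra_simps)
  thus ?thesis unfolding polz_def by (simp only: polarization_4) simp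
qed

lemma coeff4_pow4: "coeff4 (pow4 a) i j k l = a i * a j * a k * a l"
proof -
  have "(\<Sum>k\<in>UNIV. a k * delta i k) = a i" for i
    unfolding delta_def by (simp add: if_distrib cong: if_cong)
  thus ?thesis by (simp add: coeff4_def polz_pow4)
qed

lemma quartics_induct [consumes 1, case_names zero step]:
  assumes "F \<in> quartics" "P 0" "\<And>c a F. F \<in> quartics \<Longrightarrow> P F \<Longrightarrow> P (fun_scale c (pow4 a) + F)"
  shows "P F"
proof -
  have "F \<in> quartics \<and> P F"
    using assms(1) unfolding quartics_def
  proof (induction rule: fun_vs.span_induct_alt)
    case base thus ?case using assms(2) fun_vs.span_zero by blast
  next
    case (step c x y)
    then obtain a where a: "x = pow4 a" by blast
    have y: "y \<in> quartics" "P y" using step(2) unfolding quartics_def by auto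
    have "fun_scale c x + y \<in> fun_vs.span (range pow4)"
      by (rule fun_vs.span_add [OF fun_vs.span_scale [OF fun_vs.span_base [OF step(1)]] y(1) [unfolded quartics_def]])
    thus ?case using assms(3) [OF y, of c a] unfolding a by blast
  qed
  thus ?thesis ..
qed

lemma quartics_subspace: "fun_vs.subspace quartics"
  unfolding quartics_def by (rule fun_vs.subspace_span)

lemma pow4_quartics [simp]: "pow4 a \<in> quartics"
  unfolding quartics_def by (rule fun_vs.span_base) simp

lemma quartic_expand:
  assumes "F \<in> quartics"
  shows "F z = (\<Sum>i\<in>UNIV. \<Sum>j\<in>UNIV. \<Sum>k\<in>UNIV. \<Sum>l\<in>UNIV. coeff4 F i j k l * z i * z j * z k * z l)"
  using assms
proof (induction rule: quartics_induct)
  case zero thus ?case by (simp only: coeff4_linear) simp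
next
  case (step c a F)
  let ?s = "\<Sum>k\<in>UNIV. a k * z k"
  have p: "(\<Sum>i\<in>UNIV. \<Sum>j\<in>UNIV. \<Sum>k\<in>UNIV. \<Sum>l\<in>UNIV. (c * (a i * a j * a k * a l)) * z i * z j * z k * z l) = c * ?s ^ 4"
  proof -
    have "c * ?s ^ 4 = c * (?s * (?s * (?s * ?s)))" by (simp add: power4_eq_xxxx)
    also have "\<dots> = (\<Sum>i\<in>UNIV. \<Sum>j\<in>UNIV. \<Sum>k\<in>UNIV. \<Sum>l\<in>UNIV. (c * (a i * a j * a k * a l)) * z i * z j * z k * z l)"
      by (subst sum_product)+ (simp add: sum_distrib_left mult_ac)
    finally show ?thesis by simp
  qed
  have "(fun_scale c (pow4 a) + F) z = c * ?s ^ 4 + F z" by (simp add: fun_scale_def pow4_def)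
  thus ?case unfolding p [symmetric] step(2) coeff4_linear coeff4_pow4 distrib_right sum.distrib by simp
qed

text \<open>Contraction of the coefficient tensors. It is bilinear rather than Hermitian, and
  reproducing: pairing with \<open>pow4 a\<close> evaluates at \<open>a\<close>.\<close>

definition form_inner :: "form \<Rightarrow> form \<Rightarrow> complex" where
  "form_inner F G = (\<Sum>i\<in>UNIV. \<Sum>j\<in>UNIV. \<Sum>k\<in>UNIV. \<Sum>l\<in>UNIV. coeff4 F i j k l * coeff4 G i j k l)"

lemma form_inner_linear:
  "form_inner F (G + G') = form_inner F G + form_inner F G'" "form_inner F (fun_scale c G) = c * form_inner F G"
  "form_inner F 0 = 0"
  by (simp_all add: form_inner_def coeff4_linear distrib_left sum.distrib sum_distrib_left mult_ac)

lemma form_inner_pow4: "F \<in> quartics \<Longrightarrow> form_inner F (pow4 a) = F a"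
  unfolding form_inner_def coeff4_pow4 by (subst quartic_expand [of F a]) (simp_all add: mult_ac)

section \<open>Self-adjoint substitutions\<close>

definition self_adjoint :: "((8 \<Rightarrow> complex) \<Rightarrow> 8 \<Rightarrow> complex) \<Rightarrow> bool" where
  "self_adjoint s \<longleftrightarrow> (\<forall>a z. (\<Sum>k\<in>UNIV. a k * s z k) = (\<Sum>k\<in>UNIV. s a k * z k))"

lemma pow4_comp: "self_adjoint s \<Longrightarrow> pow4 a \<circ> s = pow4 (s a)"
  by (auto simp: self_adjoint_def pow4_def)

lemma comp_linear: "(F + G) \<circ> s = (F \<circ> s) + (G \<circ> s)" "(fun_scale c F) \<circ> s = fun_scale c (F \<circ> s)" "(F - G) \<circ> s = (F \<circ> s) - (G \<circ> s)" "0 \<circ> s = 0"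
  by (auto simp: fun_scale_def)

lemma quartics_comp: assumes "self_adjoint s" "F \<in> quartics" shows "F \<circ> s \<in> quartics"
  using assms(2)
proof (induction rule: quartics_induct)
  case zero thus ?case unfolding comp_linear using quartics_subspace by (rule fun_vs.subspace_0)
next
  case (step c a F)
  thus ?case unfolding comp_linear pow4_comp [OF assms(1)]
    by (intro fun_vs.subspace_add [OF quartics_subspace] fun_vs.subspace_scale [OF quartics_subspace] pow4_quartics)
qed

text \<open>If \<open>G\<close> is the fourth power \<open>pow4 a\<close>, both sides are the value
  of \<open>F\<close> at \<open>s a\<close>, by the reproducing property.\<close>

lemma form_inner_adjoint:
  assumes "self_adjoint s" "F \<in> quartics" "G \<in> quartics"
  shows "form_inner F (G \<circ> s) = form_inner (F \<circ> s) G"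
  using assms(3)
proof (induction rule: quartics_induct)
  case zero thus ?case unfolding comp_linear form_inner_linear by simp
next
  case (step c a G)
  have "form_inner F (pow4 a \<circ> s) = form_inner (F \<circ> s) (pow4 a)"
    unfolding pow4_comp [OF assms(1)] by (simp add: form_inner_pow4 assms quartics_comp)
  show ?case unfolding comp_linear form_inner_linear \<open>form_inner F (pow4 a \<circ> s) = _\<close> step(2) ..
qed

lemma flip_self_adjoint: "self_adjoint (flip k)"
  unfolding self_adjoint_def by (auto simp: flip_def intro!: sum.cong)

lemma blk_refl_self_adjoint: "self_adjoint (blk_refl v c)"
proof -
  have "(\<Sum>k\<in>UNIV. a k * blk_refl v c z k) = (\<Sum>k\<in>UNIV. a k * z k) - (\<Sum>k\<in>UNIV. if dot v k = c then a k else 0) * (\<Sum>l\<in>UNIV. if dot v l = c then z l else 0) / 2" for a z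
  proof -
    have "(\<Sum>k\<in>UNIV. a k * blk_refl v c z k) = (\<Sum>k\<in>UNIV. a k * z k - (if dot v k = c then a k else 0) * ((\<Sum>l\<in>UNIV. if dot v l = c then z l else 0) / 2))"
      by (intro sum.cong) (auto simp: blk_refl_def algebra_simps)
    thus ?thesis unfolding sum_subtractf sum_distrib_right [symmetric] by simp
  qed
  from this this [of z a] show ?thesis unfolding self_adjoint_def by (simp add: mult.commute)
qed

section \<open>Antisymmetrization in four variables\<close>

definition prod0246 :: form where "prod0246 z = z 0 * z 2 * z 4 * z 6"

text \<open>The polynomial coefficient: a squarefree monomial collects 24 equal entries of the
  symmetric tensor.\<close>

definition coeff0246 :: "form \<Rightarrow> complex" where "coeff0246 F = 24 * coeff4 F 0 2 4 6"

definition alt_part :: "8 \<Rightarrow> form \<Rightarrow> form" where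
  "alt_part k F = fun_scale (1/2) (F - (F \<circ> flip k))"

lemma alt_part_linear: "alt_part k (F + G) = alt_part k F + alt_part k G" "alt_part k (fun_scale c F) = fun_scale c (alt_part k F)"
  by (simp_all add: alt_part_def fun_scale_def fun_eq_iff algebra_simps)

text \<open>A quartic form that is odd in each of four variables is a multiple of their
  product.\<close>

lemma alt_part_0246:
  assumes "F \<in> quartics"
  shows "alt_part 0 (alt_part 2 (alt_part 4 (alt_part 6 F))) = fun_scale (coeff0246 F) prod0246"
  using assms
proof (induction rule: quartics_induct)
  case zero
  have "alt_part k 0 = 0" for k using alt_part_linear(2) [of k 0 0] by (simp only: fun_vs.scale_zero_left)
  thus ?case by (simp only: coeff0246_def coeff4_linear mult_zero_right fun_vs.scale_zero_left)
next
  case (step c a F)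
  have "alt_part 0 (alt_part 2 (alt_part 4 (alt_part 6 (pow4 a)))) z = fun_scale (coeff0246 (pow4 a)) prod0246 z" for z
  proof -
    define t where "t = a 1 * z 1 + a 3 * z 3 + a 5 * z 5 + a 7 * z 7"
    have p: "pow4 a y = (a 0 * y 0 + a 2 * y 2 + a 4 * y 4 + a 6 * y 6 + (a 1 * y 1 + a 3 * y 3 + a 5 * y 5 + a 7 * y 7)) ^ 4" for y
      by (simp add: pow4_def sum_8 add_ac)
    have f: "flip 0 y 0 = - y 0" "flip 0 y 1 = y 1" "flip 0 y 2 = y 2" "flip 0 y 3 = y 3" "flip 0 y 4 = y 4" "flip 0 y 5 = y 5" "flip 0 y 6 = y 6" "flip 0 y 7 = y 7" "flip 2 y 0 = y 0" "flip 2 y 1 = y 1" "flip 2 y 2 = - y 2" "flip 2 y 3 = y 3" "flip 2 y 4 = y 4" "flip 2 y 5 = y 5" "flip 2 y 6 = y 6" "flip 2 y 7 = y 7" "flip 4 y 0 = y 0" "flip 4 y 1 = y 1" "flip 4 y 2 = y 2" "flip 4 y 3 = y 3" "flip 4 y 4 = - y 4" "flip 4 y 5 = y 5" "flip 4 y 6 = y 6" "flip 4 y 7 = y 7" "flip 6 y 0 = y 0" "flip 6 y 1 = y 1" "flip 6 y 2 = y 2" "flip 6 y 3 = y 3" "flip 6 y 4 = y 4" "flip 6 y 5 = y 5" "flip 6 y 6 = - y 6" "flip 6 y 7 = y 7" for y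
      by (simp_all add: flip_def)
    \<comment> \<open>Flattens the four nested halved differences into one signed sum of sixteen
      terms.\<close>
    have h: "(1/2) * ((1/2) * ((1/2) * ((1/2) * (b1 - b2) - (1/2) * (b3 - b4)) - (1/2) * ((1/2) * (b5 - b6) - (1/2) * (b7 - b8)))
      - (1/2) * ((1/2) * ((1/2) * (c1 - c2) - (1/2) * (c3 - c4)) - (1/2) * ((1/2) * (c5 - c6) - (1/2) * (c7 - c8)))) = c"
      if "((b1 - b2 - b3 + b4 - (b5 - b6 - b7 + b8)) - (c1 - c2 - c3 + c4 - (c5 - c6 - c7 + c8))) = 16 * c"
      for b1 b2 b3 b4 b5 b6 b7 b8 c1 c2 c3 c4 c5 c6 c7 c8 c :: complex using that by algebra
    show ?thesis
      unfolding alt_part_def fun_scale_def minus_apply comp_apply p f coeff0246_def coeff4_pow4 prod0246_def t_def [symmetric]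
      by (rule h) algebra
  qed
  hence A: "alt_part 0 (alt_part 2 (alt_part 4 (alt_part 6 (pow4 a)))) = fun_scale (coeff0246 (pow4 a)) prod0246" by blast
  have C: "coeff0246 (fun_scale c (pow4 a) + F) = c * coeff0246 (pow4 a) + coeff0246 F"
    by (simp only: coeff0246_def coeff4_linear) (simp add: algebra_simps)
  show ?case unfolding alt_part_linear step(2) A C by (simp add: fun_scale_def fun_eq_iff algebra_simps)
qed

lemma alt_part_eq: assumes "\<And>z. F (flip k z) = - F z" shows "alt_part k F = F"
  unfolding alt_part_def fun_scale_def minus_apply comp_apply assms by simp

text \<open>The identity \<open>polarization_4\<close>, read as an expression of a monomial by
  fourth powers.\<close>

lemma monomial_quartics: "(\<lambda>z. z i * z j * z k * z l) \<in> quartics"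
proof -
  have d: "(\<Sum>m\<in>UNIV. (p * delta i m + q * delta j m + r * delta k m + s * delta l m) * z m) = p * z i + q * z j + r * z k + s * z l" for p q r s and z :: "8 \<Rightarrow> complex"
  proof -
    have "(\<Sum>m\<in>UNIV. c * delta i m * z m) = c * z i" for c i
    proof -
      have "(\<Sum>m\<in>UNIV. c * delta i m * z m) = (\<Sum>m\<in>UNIV. if m = i then c * z m else 0)"
        by (rule sum.cong) (auto simp: delta_def)
      thus ?thesis by simp
    qed
    thus ?thesis by (simp add: distrib_right sum.distrib)
  qed
  have "(\<lambda>z. z i * z j * z k * z l) = fun_scale (1/384) (\<Sum>p\<in>{1,-1}. \<Sum>q\<in>{1,-1}. \<Sum>r\<in>{1,-1}. \<Sum>s\<in>{1,-1}.
     fun_scale (p * q * r * s) (pow4 (\<lambda>m. p * delta i m + q * delta j m + r * delta k m + s * delta l m)))"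
  proof
    fix z :: "8 \<Rightarrow> complex"
    have s: "(\<Sum>x\<in>A. f x) z = (\<Sum>x\<in>A. f x z)" for A and f :: "complex \<Rightarrow> form"
      by (induction A rule: infinite_finite_induct) simp_all
    show "z i * z j * z k * z l = fun_scale (1/384) (\<Sum>p\<in>{1,-1}. \<Sum>q\<in>{1,-1}. \<Sum>r\<in>{1,-1}. \<Sum>s\<in>{1,-1}.
     fun_scale (p * q * r * s) (pow4 (\<lambda>m. p * delta i m + q * delta j m + r * delta k m + s * delta l m))) z"
      unfolding fun_scale_def [of "1/384"] s fun_scale_def pow4_def d polarization_4 by simp
  qed
  also have "\<dots> \<in> quartics" unfolding quartics_def
    by (intro fun_vs.span_scale fun_vs.span_sum fun_vs.span_base) simp
  finally show ?thesis .
qed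

lemma prod0246_quartics: "prod0246 \<in> quartics"
  using monomial_quartics [of 0 2 4 6] by (simp add: prod0246_def [abs_def])

section \<open>The Macdonald representation\<close>

text \<open>The generators are reflections, hence self-adjoint for \<open>form_inner\<close>, and
  each is realized by an element of the normalizer.\<close>

inductive_set orbit :: "form set" where
  orbit_prod: "prod0246 \<in> orbit"
| orbit_flip: "F \<in> orbit \<Longrightarrow> F \<circ> flip k \<in> orbit"
| orbit_refl: "F \<in> orbit \<Longrightarrow> v \<noteq> 0 \<Longrightarrow> F \<circ> blk_refl v c \<in> orbit"

definition macdonald :: "form set" where "macdonald = fun_vs.span orbit"

lemma orbit_quartics: "F \<in> orbit \<Longrightarrow> F \<in> quartics"
proof (induction rule: orbit.induct)
  case orbit_prod show ?case by (rule prod0246_quartics)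
next
  case (orbit_flip F k) show ?case by (rule quartics_comp [OF flip_self_adjoint orbit_flip.IH])
next
  case (orbit_refl F v c) show ?case by (rule quartics_comp [OF blk_refl_self_adjoint orbit_refl.IH])
qed

lemma macdonald_subspace: "fun_vs.subspace macdonald"
  unfolding macdonald_def by (rule fun_vs.subspace_span)

lemma macdonald_quartics: "macdonald \<subseteq> quartics"
  unfolding macdonald_def using orbit_quartics by (intro fun_vs.span_minimal quartics_subspace) blast

lemma macdonald_comp:
  assumes "F \<in> macdonald" shows "F \<circ> flip k \<in> macdonald" "v \<noteq> 0 \<Longrightarrow> F \<circ> blk_refl v c \<in> macdonald"
proof -
  have *: "F \<circ> s \<in> macdonald" if "\<And>G. G \<in> orbit \<Longrightarrow> G \<circ> s \<in> orbit" for s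
    using assms unfolding macdonald_def
  proof (induction rule: fun_vs.span_induct_alt)
    case base thus ?case unfolding comp_linear by (rule fun_vs.span_zero)
  next
    case (step c x y)
    show ?case unfolding comp_linear
      by (rule fun_vs.span_add [OF fun_vs.span_scale [OF fun_vs.span_base [OF that [OF step(1)]]] step(2)])
  qed
  show "F \<circ> flip k \<in> macdonald" by (rule *) (rule orbit_flip)
  show "v \<noteq> 0 \<Longrightarrow> F \<circ> blk_refl v c \<in> macdonald" by (rule *) (rule orbit_refl)
qed

text \<open>Complex conjugation of forms fixes the orbit, so the symmetric bilinear form
  \<open>form_inner\<close> is nondegenerate on its span.\<close>

definition conj_form :: "form \<Rightarrow> form" where "conj_form F z = cnj (F (\<lambda>k. cnj (z k)))"

lemma conj_form_linear: "conj_form (F + G) = conj_form F + conj_form G" "conj_form (fun_scale c F) = fun_scale (cnj c) (conj_form F)" "conj_form 0 = 0"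
  by (auto simp: conj_form_def fun_scale_def)

lemma conj_form_orbit: "F \<in> orbit \<Longrightarrow> conj_form F = F"
proof (induction rule: orbit.induct)
  case orbit_prod thus ?case by (simp add: conj_form_def prod0246_def fun_eq_iff)
next
  case (orbit_flip F k)
  have "cnj (flip k z l) = flip k (\<lambda>k. cnj (z k)) l" for z l by (simp add: flip_def)
  hence eq: "conj_form (F \<circ> flip k) = conj_form F \<circ> flip k" by (simp add: conj_form_def fun_eq_iff)
  show ?case by (simp only: eq orbit_flip.IH)
next
  case (orbit_refl F v c)
  have "cnj (blk_refl v c z l) = blk_refl v c (\<lambda>k. cnj (z k)) l" for z l by (simp add: blk_refl_def if_distrib cong: if_cong)
  hence eq: "conj_form (F \<circ> blk_refl v c) = conj_form F \<circ> blk_refl v c" by (simp add: conj_form_def fun_eq_iff)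
  show ?case by (simp only: eq orbit_refl.IH)
qed

lemma conj_form_macdonald: "F \<in> macdonald \<Longrightarrow> conj_form F \<in> macdonald"
  unfolding macdonald_def
proof (induction rule: fun_vs.span_induct_alt)
  case base thus ?case unfolding conj_form_linear by (rule fun_vs.span_zero)
next
  case (step c x y)
  show ?case unfolding conj_form_linear conj_form_orbit [OF step(1)]
    by (rule fun_vs.span_add [OF fun_vs.span_scale [OF fun_vs.span_base [OF step(1)]] step(2)])
qed

lemma coeff4_conj_form: "coeff4 (conj_form F) i j k l = cnj (coeff4 F i j k l)"
proof -
  have e: "p * q * r * s * conj_form F (\<lambda>m. p * delta i m + q * delta j m + r * delta k m + s * delta l m)
      = cnj (p * q * r * s * F (\<lambda>m. p * delta i m + q * delta j m + r * delta k m + s * delta l m))"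
    if "p \<in> {1,-1}" "q \<in> {1,-1}" "r \<in> {1,-1}" "s \<in> {1,-1}" for p q r s
  proof -
    have c: "cnj p = p" "cnj q = q" "cnj r = r" "cnj s = s" using that by auto
    have "cnj (delta i m) = delta i m" for i m by (simp add: delta_def)
    thus ?thesis by (simp add: conj_form_def c)
  qed
  have "polz (conj_form F) (delta i) (delta j) (delta k) (delta l) = (\<Sum>p\<in>{1,-1}. \<Sum>q\<in>{1,-1}. \<Sum>r\<in>{1,-1}. \<Sum>s\<in>{1,-1}.
     cnj (p * q * r * s * F (\<lambda>m. p * delta i m + q * delta j m + r * delta k m + s * delta l m))) / 384"
    unfolding polz_def by (rule arg_cong2 [where f = "(/)", OF _ refl]) ((rule sum.cong [OF refl])+, rule e; assumption)
  also have "\<dots> = cnj (polz F (delta i) (delta j) (delta k) (delta l))"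
    unfolding polz_def by (simp only: complex_cnj_divide cnj_sum complex_cnj_numeral)
  finally show ?thesis unfolding coeff4_def .
qed

text \<open>Pairing \<open>F\<close> with its conjugate gives the sum of the squared moduli of its
  coefficients.\<close>

lemma macdonald_nondegenerate:
  assumes "F \<in> macdonald" "\<And>G. G \<in> orbit \<Longrightarrow> form_inner F G = 0" shows "F = 0"
proof -
  have "form_inner F G = 0" if "G \<in> macdonald" for G
    using that unfolding macdonald_def
    by (induction rule: fun_vs.span_induct_alt) (simp_all only: form_inner_linear assms(2) mult_zero_right add_0)
  hence "form_inner F (conj_form F) = 0" using conj_form_macdonald [OF assms(1)] by blast
  hence "(\<Sum>i\<in>UNIV. \<Sum>j\<in>UNIV. \<Sum>k\<in>UNIV. \<Sum>l\<in>UNIV. complex_of_real ((cmod (coeff4 F i j k l))\<^sup>2)) = 0"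
    unfolding form_inner_def coeff4_conj_form complex_norm_square .
  hence "complex_of_real (\<Sum>i\<in>UNIV. \<Sum>j\<in>UNIV. \<Sum>k\<in>UNIV. \<Sum>l\<in>UNIV. (cmod (coeff4 F i j k l))\<^sup>2) = 0"
    by simp
  hence "(\<Sum>i\<in>UNIV. \<Sum>j\<in>UNIV. \<Sum>k\<in>UNIV. \<Sum>l\<in>UNIV. (cmod (coeff4 F i j k l))\<^sup>2) = 0"
    unfolding of_real_eq_0_iff .
  hence "coeff4 F i j k l = 0" for i j k l
    by (simp add: sum_nonneg_eq_0_iff sum_nonneg)
  hence "F z = 0" for z using quartic_expand [of F z] assms(1) macdonald_quartics by auto
  thus ?thesis by (simp add: fun_eq_iff)
qed

lemma form_inner_prod0246:
  assumes "F \<in> quartics" shows "form_inner F prod0246 = coeff0246 F / 24"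
proof -
  have m: "form_inner (pow4 a) prod0246 = coeff0246 (pow4 a) / 24" for a
  proof -
    have "form_inner (pow4 a) prod0246 = form_inner prod0246 (pow4 a)" by (simp add: form_inner_def mult.commute)
    thus ?thesis by (simp add: form_inner_pow4 prod0246_quartics prod0246_def coeff0246_def coeff4_pow4)
  qed
  have lin: "form_inner (fun_scale c F + G) H = c * form_inner F H + form_inner G H" for c F G H
    by (simp add: form_inner_def coeff4_linear algebra_simps sum.distrib sum_distrib_left)
  show ?thesis using assms
  proof (induction rule: quartics_induct)
    case zero show ?case by (simp only: form_inner_def coeff0246_def coeff4_linear) simp
  next
    case (step c a F)
    have cf: "coeff0246 (fun_scale c (pow4 a) + F) = c * coeff0246 (pow4 a) + coeff0246 F"
      by (simp only: coeff0246_def coeff4_linear) (simp add: algebra_simps)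
    show ?case unfolding lin m step(2) cf by (simp add: add_divide_distrib)
  qed
qed

theorem macdonald_generated:
  assumes U: "fun_vs.subspace U" "U \<subseteq> macdonald"
    and closed: "\<And>F k. F \<in> U \<Longrightarrow> F \<circ> flip k \<in> U" "\<And>F v c. F \<in> U \<Longrightarrow> v \<noteq> 0 \<Longrightarrow> F \<circ> blk_refl v c \<in> U"
    and ne: "F \<in> U" "F \<noteq> 0"
  shows "prod0246 \<in> U"
proof (rule ccontr)
  assume P: "prod0246 \<notin> U"
  have anti: "alt_part k G \<in> U" if "G \<in> U" for k G
    unfolding alt_part_def by (intro fun_vs.subspace_scale [OF U(1)] fun_vs.subspace_diff [OF U(1)] closed that)
  have C: "coeff0246 G = 0" if "G \<in> U" for G
  proof (rule ccontr)
    assume c: "coeff0246 G \<noteq> 0"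
    have "alt_part 0 (alt_part 2 (alt_part 4 (alt_part 6 G))) \<in> U" by (intro anti that)
    moreover have "G \<in> quartics" using that U(2) macdonald_quartics by blast
    ultimately have "fun_scale (coeff0246 G) prod0246 \<in> U" by (simp only: alt_part_0246)
    hence "fun_scale (1 / coeff0246 G) (fun_scale (coeff0246 G) prod0246) \<in> U"
      by (rule fun_vs.subspace_scale [OF U(1)])
    thus False using P c by simp
  qed
  have q: "G \<in> quartics" if "G \<in> U" for G using that U(2) macdonald_quartics by blast
  \<comment> \<open>Keeping \<open>G\<close> arbitrary in the induction lets each reflection move
    from the orbit element onto \<open>G\<close>, until the pairing with \<open>prod0246\<close>
    remains, which is a multiple of \<open>coeff0246\<close>.\<close>
  have "form_inner G E = 0" if "E \<in> orbit" "G \<in> U" for E G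
    using that
  proof (induction arbitrary: G rule: orbit.induct)
    case orbit_prod
    thus ?case by (simp add: form_inner_prod0246 q C)
  next
    case (orbit_flip E k)
    show ?case unfolding form_inner_adjoint [OF flip_self_adjoint q [OF orbit_flip.prems] orbit_quartics [OF orbit_flip.hyps]]
      by (rule orbit_flip.IH [OF closed(1) [OF orbit_flip.prems]])
  next
    case (orbit_refl E v c)
    show ?case unfolding form_inner_adjoint [OF blk_refl_self_adjoint q [OF orbit_refl.prems] orbit_quartics [OF orbit_refl.hyps(1)]]
      by (rule orbit_refl.IH [OF closed(2) [OF orbit_refl.prems orbit_refl.hyps(2)]])
  qed
  hence "F = 0" using macdonald_nondegenerate ne(1) U(2) by blast
  thus False using ne(2) by simp
qed

section \<open>The dimension of the Macdonald representation\<close>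

definition mono :: "8 set \<Rightarrow> form" where "mono X z = (\<Prod>k\<in>X. z k)"

text \<open>The indices other than \<open>e\<close> and \<open>f\<close> form three pairs that
  complete them to affine planes; in every use \<open>{c, d}\<close> and \<open>{a, b}\<close> are
  two of these pairs.\<close>

definition sqdiff :: "8 \<Rightarrow> 8 \<Rightarrow> 8 \<Rightarrow> 8 \<Rightarrow> 8 \<Rightarrow> 8 \<Rightarrow> form" where
  "sqdiff e f c d a b z = z e * z f * ((z c)\<^sup>2 + (z d)\<^sup>2 - (z a)\<^sup>2 - (z b)\<^sup>2)"

text \<open>Minus sixteen times Brahmagupta's expression for the squared area of a cyclic
  quadrilateral with these four sides, with the term in the product of the sides left out.\<close>

definition heron :: "8 \<Rightarrow> 8 \<Rightarrow> 8 \<Rightarrow> 8 \<Rightarrow> form" where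
  "heron a b c d z = z a ^ 4 + z b ^ 4 + z c ^ 4 + z d ^ 4 - 2 * ((z a)\<^sup>2 * (z b)\<^sup>2 + (z a)\<^sup>2 * (z c)\<^sup>2 + (z a)\<^sup>2 * (z d)\<^sup>2
     + (z b)\<^sup>2 * (z c)\<^sup>2 + (z b)\<^sup>2 * (z d)\<^sup>2 + (z c)\<^sup>2 * (z d)\<^sup>2)"

lemma blk_refl_block:
  assumes "\<And>k. dot v k = col \<longleftrightarrow> k \<in> {a,b,c,d}" "distinct [a,b,c,d]"
  shows "blk_refl v col z k = (if k \<in> {a,b,c,d} then z k - (z a + z b + z c + z d) / 2 else z k)"
proof -
  have "(\<Sum>l\<in>UNIV. if dot v l = col then z l else 0) = (\<Sum>l\<in>{a,b,c,d}. z l)"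
    unfolding assms(1) by (rule sum.mono_neutral_cong_right) auto
  thus ?thesis using assms by (simp add: blk_refl_def add.assoc)
qed

text \<open>The reflection turns ab into ((c + d)^2 - (a - b)^2) / 4. The part odd in c is cd / 2,
  which yields the new monomial; removing it together with ab / 2 leaves the difference of
  squares.\<close>

lemma block_step:
  assumes v: "v \<noteq> 0" and blk: "\<And>k. dot v k = col \<longleftrightarrow> k \<in> {a,b,c,d}" and d: "distinct [a,b,c,d,e,f]"
    and F: "mono {a,b,e,f} \<in> macdonald"
  shows "mono {c,d,e,f} \<in> macdonald" "sqdiff e f c d a b \<in> macdonald"
proof -
  note scale = fun_vs.subspace_scale [OF macdonald_subspace] and diff = fun_vs.subspace_diff [OF macdonald_subspace]
  define F1 where "F1 = mono {a,b,e,f} \<circ> blk_refl v col"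
  have F1: "F1 \<in> macdonald" unfolding F1_def by (rule macdonald_comp(2) [OF F v])
  have F2: "F1 - (F1 \<circ> flip c) \<in> macdonald" by (intro diff F1 macdonald_comp)
  have F1z: "F1 z = (z a - (z a + z b + z c + z d) / 2) * (z b - (z a + z b + z c + z d) / 2) * z e * z f" for z
  proof -
    have "distinct [a,b,c,d]" using d by simp
    note r = blk_refl_block [OF blk this]
    have ne: "e \<notin> {a,b,c,d}" "f \<notin> {a,b,c,d}" using d by auto
    have "blk_refl v col z a = z a - (z a + z b + z c + z d) / 2" "blk_refl v col z b = z b - (z a + z b + z c + z d) / 2"
      by (simp_all add: r)
    moreover have "blk_refl v col z e = z e" "blk_refl v col z f = z f"
      using ne by (simp_all only: r if_False)
    moreover have "F1 z = blk_refl v col z a * blk_refl v col z b * blk_refl v col z e * blk_refl v col z f"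
      using d by (simp add: F1_def mono_def mult.assoc)
    ultimately show ?thesis by (simp only:)
  qed
  have m: "mono {c,d,e,f} z = z c * z d * z e * z f" "mono {a,b,e,f} z = z a * z b * z e * z f" for z
    using d by (simp_all add: mono_def mult.assoc)
  have fl: "flip c z a = z a" "flip c z b = z b" "flip c z c = - z c" "flip c z d = z d" "flip c z e = z e" "flip c z f = z f" for z
    using d by (auto simp: flip_def)
  have 1: "F1 - (F1 \<circ> flip c) = mono {c,d,e,f}"
  proof
    fix z show "(F1 - (F1 \<circ> flip c)) z = mono {c,d,e,f} z"
      unfolding minus_apply comp_apply F1z fl m by (simp add: field_simps)
  qed
  show G: "mono {c,d,e,f} \<in> macdonald" using F2 unfolding 1 .
  have "sqdiff e f c d a b = fun_scale 4 (F1 - fun_scale (1/2) (mono {a,b,e,f}) - fun_scale (1/2) (mono {c,d,e,f}))"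
  proof
    fix z show "sqdiff e f c d a b z = fun_scale 4 (F1 - fun_scale (1/2) (mono {a,b,e,f}) - fun_scale (1/2) (mono {c,d,e,f})) z"
      unfolding fun_scale_def minus_apply F1z m sqdiff_def by (simp add: field_simps power2_eq_square)
  qed
  moreover have "fun_scale 4 (F1 - fun_scale (1/2) (mono {a,b,e,f}) - fun_scale (1/2) (mono {c,d,e,f})) \<in> macdonald"
    by (intro scale diff F1 F G)
  ultimately show "sqdiff e f c d a b \<in> macdonald" by (simp only:)
qed

text \<open>The reflected product is the product of the half-sum minus each side, which is
  Brahmagupta's expression; half of the original product is its unwanted term.\<close>

lemma block_heron:
  assumes v: "v \<noteq> 0" and blk: "\<And>k. dot v k = col \<longleftrightarrow> k \<in> {a,b,c,d}" and d: "distinct [a,b,c,d]"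
    and F: "mono {a,b,c,d} \<in> macdonald"
  shows "heron a b c d \<in> macdonald"
proof -
  define F1 where "F1 = mono {a,b,c,d} \<circ> blk_refl v col"
  have F1: "F1 \<in> macdonald" unfolding F1_def by (rule macdonald_comp(2) [OF F v])
  have m: "mono {a,b,c,d} z = z a * z b * z c * z d" for z
    using d by (simp add: mono_def mult.assoc)
  have F1z: "F1 z = (z a - (z a + z b + z c + z d) / 2) * (z b - (z a + z b + z c + z d) / 2) * (z c - (z a + z b + z c + z d) / 2) * (z d - (z a + z b + z c + z d) / 2)" for z
    using d by (simp add: F1_def m blk_refl_block [OF blk d])
  have "heron a b c d = fun_scale (-16) (F1 - fun_scale (1/2) (mono {a,b,c,d}))"
  proof
    fix z show "heron a b c d z = fun_scale (-16) (F1 - fun_scale (1/2) (mono {a,b,c,d})) z"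
      unfolding fun_scale_def minus_apply F1z m heron_def by algebra
  qed
  moreover have "fun_scale (-16) (F1 - fun_scale (1/2) (mono {a,b,c,d})) \<in> macdonald"
    by (intro fun_vs.subspace_scale [OF macdonald_subspace] fun_vs.subspace_diff [OF macdonald_subspace] F1 F)
  ultimately show ?thesis by (simp only:)
qed

text \<open>Sets enter through equations, so that a monomial can be used with its indices in the
  order that the block dictates.\<close>

lemma block_step':
  assumes F: "mono W \<in> macdonald" and v: "v \<noteq> 0" and blk: "\<forall>k. dot v k = col \<longleftrightarrow> k \<in> {a,b,c,d}" and d: "distinct [a,b,c,d,e,f]"
    and W: "W = {a,b,e,f}"
  shows "Y = {c,d,e,f} \<Longrightarrow> mono Y \<in> macdonald" "sqdiff e f c d a b \<in> macdonald"
  using block_step [OF v blk [rule_format] d F [unfolded W]] by (simp_all only:)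

lemma block_heron':
  assumes F: "mono {a,b,c,d} \<in> macdonald" and v: "v \<noteq> 0" and blk: "\<forall>k. dot v k = col \<longleftrightarrow> k \<in> {a,b,c,d}" and d: "distinct [a,b,c,d]"
  shows "heron a b c d \<in> macdonald"
  using block_heron [OF v blk [rule_format] d F] .

text \<open>The fourteen affine planes of F_2^3. If a block meets a plane in a pair, exchanging that
  pair for the rest of the block gives another plane; twelve are one step away from {0,2,4,6}, and
  its complement takes two.\<close>

lemma mono_macdonald:
  "mono {0,2,4,6} \<in> macdonald"
  "mono {1,2,5,6} \<in> macdonald"
  "mono {0,3,4,7} \<in> macdonald"
  "mono {2,3,6,7} \<in> macdonald"
  "mono {0,1,4,5} \<in> macdonald"
  "mono {1,3,4,6} \<in> macdonald"
  "mono {0,2,5,7} \<in> macdonald"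
  "mono {4,5,6,7} \<in> macdonald"
  "mono {0,1,2,3} \<in> macdonald"
  "mono {1,2,4,7} \<in> macdonald"
  "mono {0,3,5,6} \<in> macdonald"
  "mono {2,3,4,5} \<in> macdonald"
  "mono {0,1,6,7} \<in> macdonald"
  "mono {1,3,5,7} \<in> macdonald"
proof -
  have "mono {0,2,4,6} = prod0246" by (rule ext) (simp add: mono_def prod0246_def mult.assoc)
  thus w0246: "mono {0,2,4,6} \<in> macdonald" unfolding macdonald_def using orbit_prod fun_vs.span_base by metis
  show w1256: "mono {1,2,5,6} \<in> macdonald"
    by (rule block_step'(1) [OF w0246, of 2 False 0 4 1 5 2 6]) (simp, simp add: all_8, simp, blast, blast)
  show w0347: "mono {0,3,4,7} \<in> macdonald"
    by (rule block_step'(1) [OF w0246, of 2 True 2 6 3 7 0 4]) (simp, simp add: all_8, simp, blast, blast)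
  show w2367: "mono {2,3,6,7} \<in> macdonald"
    by (rule block_step'(1) [OF w0246, of 3 False 0 4 3 7 2 6]) (simp, simp add: all_8, simp, blast, blast)
  show w0145: "mono {0,1,4,5} \<in> macdonald"
    by (rule block_step'(1) [OF w0246, of 3 True 2 6 1 5 0 4]) (simp, simp add: all_8, simp, blast, blast)
  show w1346: "mono {1,3,4,6} \<in> macdonald"
    by (rule block_step'(1) [OF w0246, of 4 False 0 2 1 3 4 6]) (simp, simp add: all_8, simp, blast, blast)
  show w0257: "mono {0,2,5,7} \<in> macdonald"
    by (rule block_step'(1) [OF w0246, of 4 True 4 6 5 7 0 2]) (simp, simp add: all_8, simp, blast, blast)
  show w4567: "mono {4,5,6,7} \<in> macdonald"
    by (rule block_step'(1) [OF w0246, of 5 False 0 2 5 7 4 6]) (simp, simp add: all_8, simp, blast, blast)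
  show w0123: "mono {0,1,2,3} \<in> macdonald"
    by (rule block_step'(1) [OF w0246, of 5 True 4 6 1 3 0 2]) (simp, simp add: all_8, simp, blast, blast)
  show w1247: "mono {1,2,4,7} \<in> macdonald"
    by (rule block_step'(1) [OF w0246, of 6 False 0 6 1 7 2 4]) (simp, simp add: all_8, simp, blast, blast)
  show w0356: "mono {0,3,5,6} \<in> macdonald"
    by (rule block_step'(1) [OF w0246, of 6 True 2 4 3 5 0 6]) (simp, simp add: all_8, simp, blast, blast)
  show w2345: "mono {2,3,4,5} \<in> macdonald"
    by (rule block_step'(1) [OF w0246, of 7 False 0 6 3 5 2 4]) (simp, simp add: all_8, simp, blast, blast)
  show w0167: "mono {0,1,6,7} \<in> macdonald"
    by (rule block_step'(1) [OF w0246, of 7 True 2 4 1 7 0 6]) (simp, simp add: all_8, simp, blast, blast)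
  show w1357: "mono {1,3,5,7} \<in> macdonald"
    by (rule block_step'(1) [OF w1256, of 2 True 2 6 3 7 1 5]) (simp, simp add: all_8, simp, blast, blast)
qed

text \<open>For each pair of linear factors the two listed differences subtract the same pair of
  squares, so that a single evaluation can separate them.\<close>

definition basis_forms :: "form list" where
  "basis_forms = [mono {0,2,4,6}, mono {1,2,5,6}, mono {0,3,4,7}, mono {2,3,6,7},
    mono {0,1,4,5}, mono {1,3,4,6}, mono {0,2,5,7}, mono {4,5,6,7},
    mono {0,1,2,3}, mono {1,2,4,7}, mono {0,3,5,6}, mono {2,3,4,5},
    mono {0,1,6,7}, mono {1,3,5,7}, sqdiff 0 1 2 3 6 7, sqdiff 0 1 4 5 6 7,
    sqdiff 0 2 1 3 5 7, sqdiff 0 2 4 6 5 7, sqdiff 0 3 1 2 5 6, sqdiff 0 3 4 7 5 6,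
    sqdiff 0 4 1 5 3 7, sqdiff 0 4 2 6 3 7, sqdiff 0 5 1 4 3 6, sqdiff 0 5 2 7 3 6,
    sqdiff 0 6 1 7 3 5, sqdiff 0 6 2 4 3 5, sqdiff 0 7 1 6 3 4, sqdiff 0 7 2 5 3 4,
    sqdiff 1 2 0 3 5 6, sqdiff 1 2 4 7 5 6, sqdiff 1 3 0 2 5 7, sqdiff 1 3 4 6 5 7,
    sqdiff 1 4 0 5 3 6, sqdiff 1 4 2 7 3 6, sqdiff 1 5 0 4 3 7, sqdiff 1 5 2 6 3 7,
    sqdiff 1 6 0 7 3 4, sqdiff 1 6 2 5 3 4, sqdiff 1 7 0 6 3 5, sqdiff 1 7 2 4 3 5,
    sqdiff 2 3 0 1 6 7, sqdiff 2 3 4 5 6 7, sqdiff 2 4 0 6 3 5, sqdiff 2 4 1 7 3 5,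
    sqdiff 2 5 0 7 3 4, sqdiff 2 5 1 6 3 4, sqdiff 2 6 0 4 3 7, sqdiff 2 6 1 5 3 7,
    sqdiff 2 7 0 5 3 6, sqdiff 2 7 1 4 3 6, sqdiff 3 4 0 7 2 5, sqdiff 3 4 1 6 2 5,
    sqdiff 3 5 0 6 2 4, sqdiff 3 5 1 7 2 4, sqdiff 3 6 0 5 2 7, sqdiff 3 6 1 4 2 7,
    sqdiff 3 7 0 4 2 6, sqdiff 3 7 1 5 2 6, sqdiff 4 5 0 1 6 7, sqdiff 4 5 2 3 6 7,
    sqdiff 4 6 0 2 5 7, sqdiff 4 6 1 3 5 7, sqdiff 4 7 0 3 5 6, sqdiff 4 7 1 2 5 6,
    sqdiff 5 6 0 3 4 7, sqdiff 5 6 1 2 4 7, sqdiff 5 7 0 2 4 6, sqdiff 5 7 1 3 4 6,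
    sqdiff 6 7 0 1 4 5, sqdiff 6 7 2 3 4 5, heron 0 2 4 6, heron 1 3 5 7,
    heron 0 1 4 5, heron 2 3 6 7, heron 0 3 4 7, heron 1 2 5 6,
    heron 0 1 2 3, heron 4 5 6 7, heron 0 2 5 7, heron 1 3 4 6,
    heron 0 1 6 7, heron 2 3 4 5, heron 0 3 5 6, heron 1 2 4 7]"

lemma basis_forms_macdonald: "set basis_forms \<subseteq> macdonald"
proof -
  \<comment> \<open>Here and below the linear factors with the subtracted pair form the initial
    plane, and the added with the subtracted pair form the block.\<close>
  have s012: "sqdiff 0 1 2 3 6 7 \<in> macdonald"
    by (rule block_step'(2) [OF mono_macdonald(13), of 2 True]) (simp, simp add: all_8, simp, blast)
  have s014: "sqdiff 0 1 4 5 6 7 \<in> macdonald"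
    by (rule block_step'(2) [OF mono_macdonald(13), of 4 True]) (simp, simp add: all_8, simp, blast)
  have s021: "sqdiff 0 2 1 3 5 7 \<in> macdonald"
    by (rule block_step'(2) [OF mono_macdonald(7), of 1 True]) (simp, simp add: all_8, simp, blast)
  have s024: "sqdiff 0 2 4 6 5 7 \<in> macdonald"
    by (rule block_step'(2) [OF mono_macdonald(7), of 4 True]) (simp, simp add: all_8, simp, blast)
  have s031: "sqdiff 0 3 1 2 5 6 \<in> macdonald"
    by (rule block_step'(2) [OF mono_macdonald(11), of 3 True]) (simp, simp add: all_8, simp, blast)
  have s034: "sqdiff 0 3 4 7 5 6 \<in> macdonald"
    by (rule block_step'(2) [OF mono_macdonald(11), of 4 True]) (simp, simp add: all_8, simp, blast)
  have s041: "sqdiff 0 4 1 5 3 7 \<in> macdonald"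
    by (rule block_step'(2) [OF mono_macdonald(3), of 1 True]) (simp, simp add: all_8, simp, blast)
  have s042: "sqdiff 0 4 2 6 3 7 \<in> macdonald"
    by (rule block_step'(2) [OF mono_macdonald(3), of 2 True]) (simp, simp add: all_8, simp, blast)
  have s051: "sqdiff 0 5 1 4 3 6 \<in> macdonald"
    by (rule block_step'(2) [OF mono_macdonald(11), of 5 True]) (simp, simp add: all_8, simp, blast)
  have s052: "sqdiff 0 5 2 7 3 6 \<in> macdonald"
    by (rule block_step'(2) [OF mono_macdonald(11), of 2 True]) (simp, simp add: all_8, simp, blast)
  have s061: "sqdiff 0 6 1 7 3 5 \<in> macdonald"
    by (rule block_step'(2) [OF mono_macdonald(11), of 1 True]) (simp, simp add: all_8, simp, blast)
  have s062: "sqdiff 0 6 2 4 3 5 \<in> macdonald"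
    by (rule block_step'(2) [OF mono_macdonald(11), of 6 True]) (simp, simp add: all_8, simp, blast)
  have s071: "sqdiff 0 7 1 6 3 4 \<in> macdonald"
    by (rule block_step'(2) [OF mono_macdonald(3), of 5 True]) (simp, simp add: all_8, simp, blast)
  have s072: "sqdiff 0 7 2 5 3 4 \<in> macdonald"
    by (rule block_step'(2) [OF mono_macdonald(3), of 6 True]) (simp, simp add: all_8, simp, blast)
  have s120: "sqdiff 1 2 0 3 5 6 \<in> macdonald"
    by (rule block_step'(2) [OF mono_macdonald(2), of 7 False]) (simp, simp add: all_8, simp, blast)
  have s124: "sqdiff 1 2 4 7 5 6 \<in> macdonald"
    by (rule block_step'(2) [OF mono_macdonald(2), of 4 True]) (simp, simp add: all_8, simp, blast)
  have s130: "sqdiff 1 3 0 2 5 7 \<in> macdonald"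
    by (rule block_step'(2) [OF mono_macdonald(14), of 5 False]) (simp, simp add: all_8, simp, blast)
  have s134: "sqdiff 1 3 4 6 5 7 \<in> macdonald"
    by (rule block_step'(2) [OF mono_macdonald(14), of 4 True]) (simp, simp add: all_8, simp, blast)
  have s140: "sqdiff 1 4 0 5 3 6 \<in> macdonald"
    by (rule block_step'(2) [OF mono_macdonald(6), of 7 False]) (simp, simp add: all_8, simp, blast)
  have s142: "sqdiff 1 4 2 7 3 6 \<in> macdonald"
    by (rule block_step'(2) [OF mono_macdonald(6), of 2 True]) (simp, simp add: all_8, simp, blast)
  have s150: "sqdiff 1 5 0 4 3 7 \<in> macdonald"
    by (rule block_step'(2) [OF mono_macdonald(14), of 3 False]) (simp, simp add: all_8, simp, blast)
  have s152: "sqdiff 1 5 2 6 3 7 \<in> macdonald"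
    by (rule block_step'(2) [OF mono_macdonald(14), of 2 True]) (simp, simp add: all_8, simp, blast)
  have s160: "sqdiff 1 6 0 7 3 4 \<in> macdonald"
    by (rule block_step'(2) [OF mono_macdonald(6), of 3 False]) (simp, simp add: all_8, simp, blast)
  have s162: "sqdiff 1 6 2 5 3 4 \<in> macdonald"
    by (rule block_step'(2) [OF mono_macdonald(6), of 6 True]) (simp, simp add: all_8, simp, blast)
  have s170: "sqdiff 1 7 0 6 3 5 \<in> macdonald"
    by (rule block_step'(2) [OF mono_macdonald(14), of 7 False]) (simp, simp add: all_8, simp, blast)
  have s172: "sqdiff 1 7 2 4 3 5 \<in> macdonald"
    by (rule block_step'(2) [OF mono_macdonald(14), of 6 True]) (simp, simp add: all_8, simp, blast)
  have s230: "sqdiff 2 3 0 1 6 7 \<in> macdonald"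
    by (rule block_step'(2) [OF mono_macdonald(4), of 6 False]) (simp, simp add: all_8, simp, blast)
  have s234: "sqdiff 2 3 4 5 6 7 \<in> macdonald"
    by (rule block_step'(2) [OF mono_macdonald(4), of 4 True]) (simp, simp add: all_8, simp, blast)
  have s240: "sqdiff 2 4 0 6 3 5 \<in> macdonald"
    by (rule block_step'(2) [OF mono_macdonald(12), of 7 False]) (simp, simp add: all_8, simp, blast)
  have s241: "sqdiff 2 4 1 7 3 5 \<in> macdonald"
    by (rule block_step'(2) [OF mono_macdonald(12), of 1 True]) (simp, simp add: all_8, simp, blast)
  have s250: "sqdiff 2 5 0 7 3 4 \<in> macdonald"
    by (rule block_step'(2) [OF mono_macdonald(12), of 3 False]) (simp, simp add: all_8, simp, blast)
  have s251: "sqdiff 2 5 1 6 3 4 \<in> macdonald"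
    by (rule block_step'(2) [OF mono_macdonald(12), of 5 True]) (simp, simp add: all_8, simp, blast)
  have s260: "sqdiff 2 6 0 4 3 7 \<in> macdonald"
    by (rule block_step'(2) [OF mono_macdonald(4), of 3 False]) (simp, simp add: all_8, simp, blast)
  have s261: "sqdiff 2 6 1 5 3 7 \<in> macdonald"
    by (rule block_step'(2) [OF mono_macdonald(4), of 1 True]) (simp, simp add: all_8, simp, blast)
  have s270: "sqdiff 2 7 0 5 3 6 \<in> macdonald"
    by (rule block_step'(2) [OF mono_macdonald(4), of 7 False]) (simp, simp add: all_8, simp, blast)
  have s271: "sqdiff 2 7 1 4 3 6 \<in> macdonald"
    by (rule block_step'(2) [OF mono_macdonald(4), of 5 True]) (simp, simp add: all_8, simp, blast)
  have s340: "sqdiff 3 4 0 7 2 5 \<in> macdonald"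
    by (rule block_step'(2) [OF mono_macdonald(12), of 5 False]) (simp, simp add: all_8, simp, blast)
  have s341: "sqdiff 3 4 1 6 2 5 \<in> macdonald"
    by (rule block_step'(2) [OF mono_macdonald(12), of 3 True]) (simp, simp add: all_8, simp, blast)
  have s350: "sqdiff 3 5 0 6 2 4 \<in> macdonald"
    by (rule block_step'(2) [OF mono_macdonald(12), of 1 False]) (simp, simp add: all_8, simp, blast)
  have s351: "sqdiff 3 5 1 7 2 4 \<in> macdonald"
    by (rule block_step'(2) [OF mono_macdonald(12), of 7 True]) (simp, simp add: all_8, simp, blast)
  have s360: "sqdiff 3 6 0 5 2 7 \<in> macdonald"
    by (rule block_step'(2) [OF mono_macdonald(4), of 5 False]) (simp, simp add: all_8, simp, blast)
  have s361: "sqdiff 3 6 1 4 2 7 \<in> macdonald"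
    by (rule block_step'(2) [OF mono_macdonald(4), of 7 True]) (simp, simp add: all_8, simp, blast)
  have s370: "sqdiff 3 7 0 4 2 6 \<in> macdonald"
    by (rule block_step'(2) [OF mono_macdonald(4), of 1 False]) (simp, simp add: all_8, simp, blast)
  have s371: "sqdiff 3 7 1 5 2 6 \<in> macdonald"
    by (rule block_step'(2) [OF mono_macdonald(4), of 3 True]) (simp, simp add: all_8, simp, blast)
  have s450: "sqdiff 4 5 0 1 6 7 \<in> macdonald"
    by (rule block_step'(2) [OF mono_macdonald(8), of 6 False]) (simp, simp add: all_8, simp, blast)
  have s452: "sqdiff 4 5 2 3 6 7 \<in> macdonald"
    by (rule block_step'(2) [OF mono_macdonald(8), of 2 True]) (simp, simp add: all_8, simp, blast)
  have s460: "sqdiff 4 6 0 2 5 7 \<in> macdonald"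
    by (rule block_step'(2) [OF mono_macdonald(8), of 5 False]) (simp, simp add: all_8, simp, blast)
  have s461: "sqdiff 4 6 1 3 5 7 \<in> macdonald"
    by (rule block_step'(2) [OF mono_macdonald(8), of 1 True]) (simp, simp add: all_8, simp, blast)
  have s470: "sqdiff 4 7 0 3 5 6 \<in> macdonald"
    by (rule block_step'(2) [OF mono_macdonald(8), of 7 False]) (simp, simp add: all_8, simp, blast)
  have s471: "sqdiff 4 7 1 2 5 6 \<in> macdonald"
    by (rule block_step'(2) [OF mono_macdonald(8), of 3 True]) (simp, simp add: all_8, simp, blast)
  have s560: "sqdiff 5 6 0 3 4 7 \<in> macdonald"
    by (rule block_step'(2) [OF mono_macdonald(8), of 3 False]) (simp, simp add: all_8, simp, blast)
  have s561: "sqdiff 5 6 1 2 4 7 \<in> macdonald"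
    by (rule block_step'(2) [OF mono_macdonald(8), of 7 True]) (simp, simp add: all_8, simp, blast)
  have s570: "sqdiff 5 7 0 2 4 6 \<in> macdonald"
    by (rule block_step'(2) [OF mono_macdonald(8), of 1 False]) (simp, simp add: all_8, simp, blast)
  have s571: "sqdiff 5 7 1 3 4 6 \<in> macdonald"
    by (rule block_step'(2) [OF mono_macdonald(8), of 5 True]) (simp, simp add: all_8, simp, blast)
  have s670: "sqdiff 6 7 0 1 4 5 \<in> macdonald"
    by (rule block_step'(2) [OF mono_macdonald(8), of 2 False]) (simp, simp add: all_8, simp, blast)
  have s672: "sqdiff 6 7 2 3 4 5 \<in> macdonald"
    by (rule block_step'(2) [OF mono_macdonald(8), of 6 True]) (simp, simp add: all_8, simp, blast)
  have h0246: "heron 0 2 4 6 \<in> macdonald"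
    by (rule block_heron' [OF mono_macdonald(1), of 1 False]) (simp, simp add: all_8, simp)
  have h1357: "heron 1 3 5 7 \<in> macdonald"
    by (rule block_heron' [OF mono_macdonald(14), of 1 True]) (simp, simp add: all_8, simp)
  have h0145: "heron 0 1 4 5 \<in> macdonald"
    by (rule block_heron' [OF mono_macdonald(5), of 2 False]) (simp, simp add: all_8, simp)
  have h2367: "heron 2 3 6 7 \<in> macdonald"
    by (rule block_heron' [OF mono_macdonald(4), of 2 True]) (simp, simp add: all_8, simp)
  have h0347: "heron 0 3 4 7 \<in> macdonald"
    by (rule block_heron' [OF mono_macdonald(3), of 3 False]) (simp, simp add: all_8, simp)
  have h1256: "heron 1 2 5 6 \<in> macdonald"
    by (rule block_heron' [OF mono_macdonald(2), of 3 True]) (simp, simp add: all_8, simp)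
  have h0123: "heron 0 1 2 3 \<in> macdonald"
    by (rule block_heron' [OF mono_macdonald(9), of 4 False]) (simp, simp add: all_8, simp)
  have h4567: "heron 4 5 6 7 \<in> macdonald"
    by (rule block_heron' [OF mono_macdonald(8), of 4 True]) (simp, simp add: all_8, simp)
  have h0257: "heron 0 2 5 7 \<in> macdonald"
    by (rule block_heron' [OF mono_macdonald(7), of 5 False]) (simp, simp add: all_8, simp)
  have h1346: "heron 1 3 4 6 \<in> macdonald"
    by (rule block_heron' [OF mono_macdonald(6), of 5 True]) (simp, simp add: all_8, simp)
  have h0167: "heron 0 1 6 7 \<in> macdonald"
    by (rule block_heron' [OF mono_macdonald(13), of 6 False]) (simp, simp add: all_8, simp)
  have h2345: "heron 2 3 4 5 \<in> macdonald"
    by (rule block_heron' [OF mono_macdonald(12), of 6 True]) (simp, simp add: all_8, simp)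
  have h0356: "heron 0 3 5 6 \<in> macdonald"
    by (rule block_heron' [OF mono_macdonald(11), of 7 False]) (simp, simp add: all_8, simp)
  have h1247: "heron 1 2 4 7 \<in> macdonald"
    by (rule block_heron' [OF mono_macdonald(10), of 7 True]) (simp, simp add: all_8, simp)
  show ?thesis unfolding basis_forms_def using mono_macdonald
    s012 s014 s021 s024 s031 s034 s041 s042 s051 s052 s061 s062 s071 s072 s120 s124 s130 s134 s140 s142 s150 s152 s160 s162 s170 s172 s230 s234 s240 s241 s250 s251 s260 s261 s270 s271 s340 s341 s350 s351 s360 s361 s370 s371 s450 s452 s460 s461 s470 s471 s560 s561 s570 s571 s670 s672 h0246 h1357 h0145 h2367 h0347 h1256 h0123 h4567 h0257 h1346 h0167 h2345 h0356 h1247 by (simp only: list.set insert_subset empty_subsetI simp_thms)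
qed

section \<open>Linear independence of the 84 forms\<close>

primrec lincomb :: "(nat \<Rightarrow> complex) \<Rightarrow> nat \<Rightarrow> form list \<Rightarrow> form" where
  "lincomb c n [] z = 0"
| "lincomb c n (F # Fs) z = c n * F z + lincomb c (n + 1) Fs z"

lemma lincomb_sum: "lincomb c n Fs z = (\<Sum>k<length Fs. c (n + k) * (Fs ! k) z)"
  by (induction Fs arbitrary: n) (simp_all add: sum.lessThan_Suc_shift del: sum.lessThan_Suc)

lemma basis_forms_independent:
  assumes S: "\<And>z. (\<Sum>k<84. c k * (basis_forms ! k) z) = 0" and "k < 84"
  shows "c k = 0"
proof -
  have E: "c 0 * (z 0 * z 2 * z 4 * z 6) + c 1 * (z 1 * z 2 * z 5 * z 6) + c 2 * (z 0 * z 3 * z 4 * z 7) + c 3 * (z 2 * z 3 * z 6 * z 7)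
    + c 4 * (z 0 * z 1 * z 4 * z 5) + c 5 * (z 1 * z 3 * z 4 * z 6) + c 6 * (z 0 * z 2 * z 5 * z 7) + c 7 * (z 4 * z 5 * z 6 * z 7)
    + c 8 * (z 0 * z 1 * z 2 * z 3) + c 9 * (z 1 * z 2 * z 4 * z 7) + c 10 * (z 0 * z 3 * z 5 * z 6) + c 11 * (z 2 * z 3 * z 4 * z 5)
    + c 12 * (z 0 * z 1 * z 6 * z 7) + c 13 * (z 1 * z 3 * z 5 * z 7) + c 14 * (sqdiff 0 1 2 3 6 7 z) + c 15 * (sqdiff 0 1 4 5 6 7 z)
    + c 16 * (sqdiff 0 2 1 3 5 7 z) + c 17 * (sqdiff 0 2 4 6 5 7 z) + c 18 * (sqdiff 0 3 1 2 5 6 z) + c 19 * (sqdiff 0 3 4 7 5 6 z)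
    + c 20 * (sqdiff 0 4 1 5 3 7 z) + c 21 * (sqdiff 0 4 2 6 3 7 z) + c 22 * (sqdiff 0 5 1 4 3 6 z) + c 23 * (sqdiff 0 5 2 7 3 6 z)
    + c 24 * (sqdiff 0 6 1 7 3 5 z) + c 25 * (sqdiff 0 6 2 4 3 5 z) + c 26 * (sqdiff 0 7 1 6 3 4 z) + c 27 * (sqdiff 0 7 2 5 3 4 z)
    + c 28 * (sqdiff 1 2 0 3 5 6 z) + c 29 * (sqdiff 1 2 4 7 5 6 z) + c 30 * (sqdiff 1 3 0 2 5 7 z) + c 31 * (sqdiff 1 3 4 6 5 7 z)
    + c 32 * (sqdiff 1 4 0 5 3 6 z) + c 33 * (sqdiff 1 4 2 7 3 6 z) + c 34 * (sqdiff 1 5 0 4 3 7 z) + c 35 * (sqdiff 1 5 2 6 3 7 z)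
    + c 36 * (sqdiff 1 6 0 7 3 4 z) + c 37 * (sqdiff 1 6 2 5 3 4 z) + c 38 * (sqdiff 1 7 0 6 3 5 z) + c 39 * (sqdiff 1 7 2 4 3 5 z)
    + c 40 * (sqdiff 2 3 0 1 6 7 z) + c 41 * (sqdiff 2 3 4 5 6 7 z) + c 42 * (sqdiff 2 4 0 6 3 5 z) + c 43 * (sqdiff 2 4 1 7 3 5 z)
    + c 44 * (sqdiff 2 5 0 7 3 4 z) + c 45 * (sqdiff 2 5 1 6 3 4 z) + c 46 * (sqdiff 2 6 0 4 3 7 z) + c 47 * (sqdiff 2 6 1 5 3 7 z)
    + c 48 * (sqdiff 2 7 0 5 3 6 z) + c 49 * (sqdiff 2 7 1 4 3 6 z) + c 50 * (sqdiff 3 4 0 7 2 5 z) + c 51 * (sqdiff 3 4 1 6 2 5 z)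
    + c 52 * (sqdiff 3 5 0 6 2 4 z) + c 53 * (sqdiff 3 5 1 7 2 4 z) + c 54 * (sqdiff 3 6 0 5 2 7 z) + c 55 * (sqdiff 3 6 1 4 2 7 z)
    + c 56 * (sqdiff 3 7 0 4 2 6 z) + c 57 * (sqdiff 3 7 1 5 2 6 z) + c 58 * (sqdiff 4 5 0 1 6 7 z) + c 59 * (sqdiff 4 5 2 3 6 7 z)
    + c 60 * (sqdiff 4 6 0 2 5 7 z) + c 61 * (sqdiff 4 6 1 3 5 7 z) + c 62 * (sqdiff 4 7 0 3 5 6 z) + c 63 * (sqdiff 4 7 1 2 5 6 z)
    + c 64 * (sqdiff 5 6 0 3 4 7 z) + c 65 * (sqdiff 5 6 1 2 4 7 z) + c 66 * (sqdiff 5 7 0 2 4 6 z) + c 67 * (sqdiff 5 7 1 3 4 6 z)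
    + c 68 * (sqdiff 6 7 0 1 4 5 z) + c 69 * (sqdiff 6 7 2 3 4 5 z) + c 70 * (heron 0 2 4 6 z) + c 71 * (heron 1 3 5 7 z)
    + c 72 * (heron 0 1 4 5 z) + c 73 * (heron 2 3 6 7 z) + c 74 * (heron 0 3 4 7 z) + c 75 * (heron 1 2 5 6 z)
    + c 76 * (heron 0 1 2 3 z) + c 77 * (heron 4 5 6 7 z) + c 78 * (heron 0 2 5 7 z) + c 79 * (heron 1 3 4 6 z)
    + c 80 * (heron 0 1 6 7 z) + c 81 * (heron 2 3 4 5 z) + c 82 * (heron 0 3 5 6 z) + c 83 * (heron 1 2 4 7 z) = 0" for z
  proof -
    have "length basis_forms = 84" by (simp add: basis_forms_def)
    hence "lincomb c 0 basis_forms z = 0" using S [of z] by (simp add: lincomb_sum)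
    moreover have "mono {a,b,d,e} z = z a * z b * z d * z e" if "distinct [a,b,d,e]" for a b d e
      using that by (simp add: mono_def mult.assoc)
    ultimately show ?thesis unfolding basis_forms_def lincomb.simps
      by (simp add: add.assoc mult.assoc del: One_nat_def)
  qed

  \<comment> \<open>At unit vectors and at sums of two of them only Heron forms survive. Such a form
    is 1 at the unit vectors of its plane; at a sum of two it is 1 if exactly one of them belongs to
    the plane and 0 otherwise.\<close>
  have e0: "c 70 + c 72 + c 74 + c 76 + c 78 + c 80 + c 82 = 0" using E [of "vec8 1 0 0 0 0 0 0 0"] by (simp add: heron_def sqdiff_def add_ac)
  have e1: "c 71 + c 72 + c 75 + c 76 + c 79 + c 80 + c 83 = 0" using E [of "vec8 0 1 0 0 0 0 0 0"] by (simp add: heron_def sqdiff_def add_ac)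
  have e2: "c 70 + c 73 + c 75 + c 76 + c 78 + c 81 + c 83 = 0" using E [of "vec8 0 0 1 0 0 0 0 0"] by (simp add: heron_def sqdiff_def add_ac)
  have e3: "c 71 + c 73 + c 74 + c 76 + c 79 + c 81 + c 82 = 0" using E [of "vec8 0 0 0 1 0 0 0 0"] by (simp add: heron_def sqdiff_def add_ac)
  have e4: "c 70 + c 72 + c 74 + c 77 + c 79 + c 81 + c 83 = 0" using E [of "vec8 0 0 0 0 1 0 0 0"] by (simp add: heron_def sqdiff_def add_ac)
  have e5: "c 71 + c 72 + c 75 + c 77 + c 78 + c 81 + c 82 = 0" using E [of "vec8 0 0 0 0 0 1 0 0"] by (simp add: heron_def sqdiff_def add_ac)
  have e6: "c 70 + c 73 + c 75 + c 77 + c 79 + c 80 + c 82 = 0" using E [of "vec8 0 0 0 0 0 0 1 0"] by (simp add: heron_def sqdiff_def add_ac)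
  have e7: "c 71 + c 73 + c 74 + c 77 + c 78 + c 80 + c 83 = 0" using E [of "vec8 0 0 0 0 0 0 0 1"] by (simp add: heron_def sqdiff_def add_ac)
  have e01: "c 70 + c 71 + c 74 + c 75 + c 78 + c 79 + c 82 + c 83 = 0" using E [of "vec8 1 1 0 0 0 0 0 0"] by (simp add: heron_def sqdiff_def add_ac)
  have e02: "c 72 + c 73 + c 74 + c 75 + c 80 + c 81 + c 82 + c 83 = 0" using E [of "vec8 1 0 1 0 0 0 0 0"] by (simp add: heron_def sqdiff_def add_ac)
  have e03: "c 70 + c 71 + c 72 + c 73 + c 78 + c 79 + c 80 + c 81 = 0" using E [of "vec8 1 0 0 1 0 0 0 0"] by (simp add: heron_def sqdiff_def add_ac)
  have e04: "c 76 + c 77 + c 78 + c 79 + c 80 + c 81 + c 82 + c 83 = 0" using E [of "vec8 1 0 0 0 1 0 0 0"] by (simp add: heron_def sqdiff_def add_ac)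
  have e05: "c 70 + c 71 + c 74 + c 75 + c 76 + c 77 + c 80 + c 81 = 0" using E [of "vec8 1 0 0 0 0 1 0 0"] by (simp add: heron_def sqdiff_def add_ac)
  have e06: "c 72 + c 73 + c 74 + c 75 + c 76 + c 77 + c 78 + c 79 = 0" using E [of "vec8 1 0 0 0 0 0 1 0"] by (simp add: heron_def sqdiff_def add_ac)
  have z70: "c 70 = 0" using e0 e2 e4 e6 e02 e04 e06 by algebra
  have z71: "c 71 = 0" using e1 e3 e5 e7 e02 e04 e06 by algebra
  have z72: "c 72 = 0" using e0 e1 e4 e5 e01 e04 e05 by algebra
  have z73: "c 73 = 0" using e2 e3 e6 e7 e01 e04 e05 by algebra
  have z74: "c 74 = 0" using e1 e2 e5 e6 e01 e02 e05 e06 by algebra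
  have z75: "c 75 = 0" using e0 e3 e4 e7 e01 e02 e05 e06 by algebra
  have z76: "c 76 = 0" using e0 e1 e2 e3 e01 e02 e03 by algebra
  have z77: "c 77 = 0" using e4 e5 e6 e7 e01 e02 e03 by algebra
  have z78: "c 78 = 0" using e1 e3 e4 e6 e01 e03 e04 e06 by algebra
  have z79: "c 79 = 0" using e0 e2 e5 e7 e01 e03 e04 e06 by algebra
  have z80: "c 80 = 0" using e2 e3 e4 e5 e02 e03 e04 e05 by algebra
  have z81: "c 81 = 0" using e0 e1 e6 e7 e02 e03 e04 e05 by algebra
  have z82: "c 82 = 0" using e0 e3 e5 e6 e03 e05 e06 by algebra
  have z83: "c 83 = 0" using e1 e2 e4 e7 e03 e05 e06 by algebra
  note hz = z70 z71 z72 z73 z74 z75 z76 z77 z78 z79 z80 z81 z82 z83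
  \<comment> \<open>Adding the values at two points that differ in one sign removes what is odd in
    that coordinate. With three nonzero coordinates and no Heron forms left, one
    \<open>sqdiff\<close> remains: its linear factors are the other two coordinates and its added
    pair contains the one with the changed sign.\<close>
  have z14: "c 14 = 0"
    using arg_cong2 [of _ _ _ _ "(+)", OF E [of "vec8 1 1 1 0 0 0 0 0"] E [of "vec8 1 1 (-1) 0 0 0 0 0"]]
    by (simp add: sqdiff_def hz algebra_simps)
  have z15: "c 15 = 0"
    using arg_cong2 [of _ _ _ _ "(+)", OF E [of "vec8 1 1 0 0 1 0 0 0"] E [of "vec8 1 1 0 0 (-1) 0 0 0"]]
    by (simp add: sqdiff_def hz algebra_simps)
  have z16: "c 16 = 0"
    using arg_cong2 [of _ _ _ _ "(+)", OF E [of "vec8 1 1 1 0 0 0 0 0"] E [of "vec8 1 (-1) 1 0 0 0 0 0"]]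
    by (simp add: sqdiff_def hz algebra_simps)
  have z17: "c 17 = 0"
    using arg_cong2 [of _ _ _ _ "(+)", OF E [of "vec8 1 0 1 0 1 0 0 0"] E [of "vec8 1 0 1 0 (-1) 0 0 0"]]
    by (simp add: sqdiff_def hz algebra_simps)
  have z18: "c 18 = 0"
    using arg_cong2 [of _ _ _ _ "(+)", OF E [of "vec8 1 1 0 1 0 0 0 0"] E [of "vec8 1 (-1) 0 1 0 0 0 0"]]
    by (simp add: sqdiff_def hz algebra_simps)
  have z19: "c 19 = 0"
    using arg_cong2 [of _ _ _ _ "(+)", OF E [of "vec8 1 0 0 1 1 0 0 0"] E [of "vec8 1 0 0 1 (-1) 0 0 0"]]
    by (simp add: sqdiff_def hz algebra_simps)
  have z20: "c 20 = 0"
    using arg_cong2 [of _ _ _ _ "(+)", OF E [of "vec8 1 1 0 0 1 0 0 0"] E [of "vec8 1 (-1) 0 0 1 0 0 0"]]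
    by (simp add: sqdiff_def hz algebra_simps)
  have z21: "c 21 = 0"
    using arg_cong2 [of _ _ _ _ "(+)", OF E [of "vec8 1 0 1 0 1 0 0 0"] E [of "vec8 1 0 (-1) 0 1 0 0 0"]]
    by (simp add: sqdiff_def hz algebra_simps)
  have z22: "c 22 = 0"
    using arg_cong2 [of _ _ _ _ "(+)", OF E [of "vec8 1 1 0 0 0 1 0 0"] E [of "vec8 1 (-1) 0 0 0 1 0 0"]]
    by (simp add: sqdiff_def hz algebra_simps)
  have z23: "c 23 = 0"
    using arg_cong2 [of _ _ _ _ "(+)", OF E [of "vec8 1 0 1 0 0 1 0 0"] E [of "vec8 1 0 (-1) 0 0 1 0 0"]]
    by (simp add: sqdiff_def hz algebra_simps)
  have z24: "c 24 = 0"
    using arg_cong2 [of _ _ _ _ "(+)", OF E [of "vec8 1 1 0 0 0 0 1 0"] E [of "vec8 1 (-1) 0 0 0 0 1 0"]]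
    by (simp add: sqdiff_def hz algebra_simps)
  have z25: "c 25 = 0"
    using arg_cong2 [of _ _ _ _ "(+)", OF E [of "vec8 1 0 1 0 0 0 1 0"] E [of "vec8 1 0 (-1) 0 0 0 1 0"]]
    by (simp add: sqdiff_def hz algebra_simps)
  have z26: "c 26 = 0"
    using arg_cong2 [of _ _ _ _ "(+)", OF E [of "vec8 1 1 0 0 0 0 0 1"] E [of "vec8 1 (-1) 0 0 0 0 0 1"]]
    by (simp add: sqdiff_def hz algebra_simps)
  have z27: "c 27 = 0"
    using arg_cong2 [of _ _ _ _ "(+)", OF E [of "vec8 1 0 1 0 0 0 0 1"] E [of "vec8 1 0 (-1) 0 0 0 0 1"]]
    by (simp add: sqdiff_def hz algebra_simps)
  have z28: "c 28 = 0"
    using arg_cong2 [of _ _ _ _ "(+)", OF E [of "vec8 1 1 1 0 0 0 0 0"] E [of "vec8 (-1) 1 1 0 0 0 0 0"]]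
    by (simp add: sqdiff_def hz algebra_simps)
  have z29: "c 29 = 0"
    using arg_cong2 [of _ _ _ _ "(+)", OF E [of "vec8 0 1 1 0 1 0 0 0"] E [of "vec8 0 1 1 0 (-1) 0 0 0"]]
    by (simp add: sqdiff_def hz algebra_simps)
  have z30: "c 30 = 0"
    using arg_cong2 [of _ _ _ _ "(+)", OF E [of "vec8 1 1 0 1 0 0 0 0"] E [of "vec8 (-1) 1 0 1 0 0 0 0"]]
    by (simp add: sqdiff_def hz algebra_simps)
  have z31: "c 31 = 0"
    using arg_cong2 [of _ _ _ _ "(+)", OF E [of "vec8 0 1 0 1 1 0 0 0"] E [of "vec8 0 1 0 1 (-1) 0 0 0"]]
    by (simp add: sqdiff_def hz algebra_simps)
  have z32: "c 32 = 0"
    using arg_cong2 [of _ _ _ _ "(+)", OF E [of "vec8 1 1 0 0 1 0 0 0"] E [of "vec8 (-1) 1 0 0 1 0 0 0"]]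
    by (simp add: sqdiff_def hz algebra_simps)
  have z33: "c 33 = 0"
    using arg_cong2 [of _ _ _ _ "(+)", OF E [of "vec8 0 1 1 0 1 0 0 0"] E [of "vec8 0 1 (-1) 0 1 0 0 0"]]
    by (simp add: sqdiff_def hz algebra_simps)
  have z34: "c 34 = 0"
    using arg_cong2 [of _ _ _ _ "(+)", OF E [of "vec8 1 1 0 0 0 1 0 0"] E [of "vec8 (-1) 1 0 0 0 1 0 0"]]
    by (simp add: sqdiff_def hz algebra_simps)
  have z35: "c 35 = 0"
    using arg_cong2 [of _ _ _ _ "(+)", OF E [of "vec8 0 1 1 0 0 1 0 0"] E [of "vec8 0 1 (-1) 0 0 1 0 0"]]
    by (simp add: sqdiff_def hz algebra_simps)
  have z36: "c 36 = 0"
    using arg_cong2 [of _ _ _ _ "(+)", OF E [of "vec8 1 1 0 0 0 0 1 0"] E [of "vec8 (-1) 1 0 0 0 0 1 0"]]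
    by (simp add: sqdiff_def hz algebra_simps)
  have z37: "c 37 = 0"
    using arg_cong2 [of _ _ _ _ "(+)", OF E [of "vec8 0 1 1 0 0 0 1 0"] E [of "vec8 0 1 (-1) 0 0 0 1 0"]]
    by (simp add: sqdiff_def hz algebra_simps)
  have z38: "c 38 = 0"
    using arg_cong2 [of _ _ _ _ "(+)", OF E [of "vec8 1 1 0 0 0 0 0 1"] E [of "vec8 (-1) 1 0 0 0 0 0 1"]]
    by (simp add: sqdiff_def hz algebra_simps)
  have z39: "c 39 = 0"
    using arg_cong2 [of _ _ _ _ "(+)", OF E [of "vec8 0 1 1 0 0 0 0 1"] E [of "vec8 0 1 (-1) 0 0 0 0 1"]]
    by (simp add: sqdiff_def hz algebra_simps)
  have z40: "c 40 = 0"
    using arg_cong2 [of _ _ _ _ "(+)", OF E [of "vec8 1 0 1 1 0 0 0 0"] E [of "vec8 (-1) 0 1 1 0 0 0 0"]]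
    by (simp add: sqdiff_def hz algebra_simps)
  have z41: "c 41 = 0"
    using arg_cong2 [of _ _ _ _ "(+)", OF E [of "vec8 0 0 1 1 1 0 0 0"] E [of "vec8 0 0 1 1 (-1) 0 0 0"]]
    by (simp add: sqdiff_def hz algebra_simps)
  have z42: "c 42 = 0"
    using arg_cong2 [of _ _ _ _ "(+)", OF E [of "vec8 1 0 1 0 1 0 0 0"] E [of "vec8 (-1) 0 1 0 1 0 0 0"]]
    by (simp add: sqdiff_def hz algebra_simps)
  have z43: "c 43 = 0"
    using arg_cong2 [of _ _ _ _ "(+)", OF E [of "vec8 0 1 1 0 1 0 0 0"] E [of "vec8 0 (-1) 1 0 1 0 0 0"]]
    by (simp add: sqdiff_def hz algebra_simps)
  have z44: "c 44 = 0"
    using arg_cong2 [of _ _ _ _ "(+)", OF E [of "vec8 1 0 1 0 0 1 0 0"] E [of "vec8 (-1) 0 1 0 0 1 0 0"]]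
    by (simp add: sqdiff_def hz algebra_simps)
  have z45: "c 45 = 0"
    using arg_cong2 [of _ _ _ _ "(+)", OF E [of "vec8 0 1 1 0 0 1 0 0"] E [of "vec8 0 (-1) 1 0 0 1 0 0"]]
    by (simp add: sqdiff_def hz algebra_simps)
  have z46: "c 46 = 0"
    using arg_cong2 [of _ _ _ _ "(+)", OF E [of "vec8 1 0 1 0 0 0 1 0"] E [of "vec8 (-1) 0 1 0 0 0 1 0"]]
    by (simp add: sqdiff_def hz algebra_simps)
  have z47: "c 47 = 0"
    using arg_cong2 [of _ _ _ _ "(+)", OF E [of "vec8 0 1 1 0 0 0 1 0"] E [of "vec8 0 (-1) 1 0 0 0 1 0"]]
    by (simp add: sqdiff_def hz algebra_simps)
  have z48: "c 48 = 0"
    using arg_cong2 [of _ _ _ _ "(+)", OF E [of "vec8 1 0 1 0 0 0 0 1"] E [of "vec8 (-1) 0 1 0 0 0 0 1"]]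
    by (simp add: sqdiff_def hz algebra_simps)
  have z49: "c 49 = 0"
    using arg_cong2 [of _ _ _ _ "(+)", OF E [of "vec8 0 1 1 0 0 0 0 1"] E [of "vec8 0 (-1) 1 0 0 0 0 1"]]
    by (simp add: sqdiff_def hz algebra_simps)
  have z50: "c 50 = 0"
    using arg_cong2 [of _ _ _ _ "(+)", OF E [of "vec8 1 0 0 1 1 0 0 0"] E [of "vec8 (-1) 0 0 1 1 0 0 0"]]
    by (simp add: sqdiff_def hz algebra_simps)
  have z51: "c 51 = 0"
    using arg_cong2 [of _ _ _ _ "(+)", OF E [of "vec8 0 1 0 1 1 0 0 0"] E [of "vec8 0 (-1) 0 1 1 0 0 0"]]
    by (simp add: sqdiff_def hz algebra_simps)
  have z52: "c 52 = 0"
    using arg_cong2 [of _ _ _ _ "(+)", OF E [of "vec8 1 0 0 1 0 1 0 0"] E [of "vec8 (-1) 0 0 1 0 1 0 0"]]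
    by (simp add: sqdiff_def hz algebra_simps)
  have z53: "c 53 = 0"
    using arg_cong2 [of _ _ _ _ "(+)", OF E [of "vec8 0 1 0 1 0 1 0 0"] E [of "vec8 0 (-1) 0 1 0 1 0 0"]]
    by (simp add: sqdiff_def hz algebra_simps)
  have z54: "c 54 = 0"
    using arg_cong2 [of _ _ _ _ "(+)", OF E [of "vec8 1 0 0 1 0 0 1 0"] E [of "vec8 (-1) 0 0 1 0 0 1 0"]]
    by (simp add: sqdiff_def hz algebra_simps)
  have z55: "c 55 = 0"
    using arg_cong2 [of _ _ _ _ "(+)", OF E [of "vec8 0 1 0 1 0 0 1 0"] E [of "vec8 0 (-1) 0 1 0 0 1 0"]]
    by (simp add: sqdiff_def hz algebra_simps)
  have z56: "c 56 = 0"
    using arg_cong2 [of _ _ _ _ "(+)", OF E [of "vec8 1 0 0 1 0 0 0 1"] E [of "vec8 (-1) 0 0 1 0 0 0 1"]]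
    by (simp add: sqdiff_def hz algebra_simps)
  have z57: "c 57 = 0"
    using arg_cong2 [of _ _ _ _ "(+)", OF E [of "vec8 0 1 0 1 0 0 0 1"] E [of "vec8 0 (-1) 0 1 0 0 0 1"]]
    by (simp add: sqdiff_def hz algebra_simps)
  have z58: "c 58 = 0"
    using arg_cong2 [of _ _ _ _ "(+)", OF E [of "vec8 1 0 0 0 1 1 0 0"] E [of "vec8 (-1) 0 0 0 1 1 0 0"]]
    by (simp add: sqdiff_def hz algebra_simps)
  have z59: "c 59 = 0"
    using arg_cong2 [of _ _ _ _ "(+)", OF E [of "vec8 0 0 1 0 1 1 0 0"] E [of "vec8 0 0 (-1) 0 1 1 0 0"]]
    by (simp add: sqdiff_def hz algebra_simps)
  have z60: "c 60 = 0"
    using arg_cong2 [of _ _ _ _ "(+)", OF E [of "vec8 1 0 0 0 1 0 1 0"] E [of "vec8 (-1) 0 0 0 1 0 1 0"]]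
    by (simp add: sqdiff_def hz algebra_simps)
  have z61: "c 61 = 0"
    using arg_cong2 [of _ _ _ _ "(+)", OF E [of "vec8 0 1 0 0 1 0 1 0"] E [of "vec8 0 (-1) 0 0 1 0 1 0"]]
    by (simp add: sqdiff_def hz algebra_simps)
  have z62: "c 62 = 0"
    using arg_cong2 [of _ _ _ _ "(+)", OF E [of "vec8 1 0 0 0 1 0 0 1"] E [of "vec8 (-1) 0 0 0 1 0 0 1"]]
    by (simp add: sqdiff_def hz algebra_simps)
  have z63: "c 63 = 0"
    using arg_cong2 [of _ _ _ _ "(+)", OF E [of "vec8 0 1 0 0 1 0 0 1"] E [of "vec8 0 (-1) 0 0 1 0 0 1"]]
    by (simp add: sqdiff_def hz algebra_simps)
  have z64: "c 64 = 0"
    using arg_cong2 [of _ _ _ _ "(+)", OF E [of "vec8 1 0 0 0 0 1 1 0"] E [of "vec8 (-1) 0 0 0 0 1 1 0"]]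
    by (simp add: sqdiff_def hz algebra_simps)
  have z65: "c 65 = 0"
    using arg_cong2 [of _ _ _ _ "(+)", OF E [of "vec8 0 1 0 0 0 1 1 0"] E [of "vec8 0 (-1) 0 0 0 1 1 0"]]
    by (simp add: sqdiff_def hz algebra_simps)
  have z66: "c 66 = 0"
    using arg_cong2 [of _ _ _ _ "(+)", OF E [of "vec8 1 0 0 0 0 1 0 1"] E [of "vec8 (-1) 0 0 0 0 1 0 1"]]
    by (simp add: sqdiff_def hz algebra_simps)
  have z67: "c 67 = 0"
    using arg_cong2 [of _ _ _ _ "(+)", OF E [of "vec8 0 1 0 0 0 1 0 1"] E [of "vec8 0 (-1) 0 0 0 1 0 1"]]
    by (simp add: sqdiff_def hz algebra_simps)
  have z68: "c 68 = 0"
    using arg_cong2 [of _ _ _ _ "(+)", OF E [of "vec8 1 0 0 0 0 0 1 1"] E [of "vec8 (-1) 0 0 0 0 0 1 1"]]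
    by (simp add: sqdiff_def hz algebra_simps)
  have z69: "c 69 = 0"
    using arg_cong2 [of _ _ _ _ "(+)", OF E [of "vec8 0 0 1 0 0 0 1 1"] E [of "vec8 0 0 (-1) 0 0 0 1 1"]]
    by (simp add: sqdiff_def hz algebra_simps)
  note sz = z14 z15 z16 z17 z18 z19 z20 z21 z22 z23 z24 z25 z26 z27 z28 z29 z30 z31 z32 z33 z34 z35 z36 z37 z38 z39 z40 z41 z42 z43 z44 z45 z46 z47 z48 z49 z50 z51 z52 z53 z54 z55 z56 z57 z58 z59 z60 z61 z62 z63 z64 z65 z66 z67 z68 z69
  \<comment> \<open>The indicator of an affine plane isolates the monomial of that plane.\<close>
  have z0: "c 0 = 0" using E [of "vec8 1 0 1 0 1 0 1 0"] by (simp add: hz sz)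
  have z1: "c 1 = 0" using E [of "vec8 0 1 1 0 0 1 1 0"] by (simp add: hz sz)
  have z2: "c 2 = 0" using E [of "vec8 1 0 0 1 1 0 0 1"] by (simp add: hz sz)
  have z3: "c 3 = 0" using E [of "vec8 0 0 1 1 0 0 1 1"] by (simp add: hz sz)
  have z4: "c 4 = 0" using E [of "vec8 1 1 0 0 1 1 0 0"] by (simp add: hz sz)
  have z5: "c 5 = 0" using E [of "vec8 0 1 0 1 1 0 1 0"] by (simp add: hz sz)
  have z6: "c 6 = 0" using E [of "vec8 1 0 1 0 0 1 0 1"] by (simp add: hz sz)
  have z7: "c 7 = 0" using E [of "vec8 0 0 0 0 1 1 1 1"] by (simp add: hz sz)
  have z8: "c 8 = 0" using E [of "vec8 1 1 1 1 0 0 0 0"] by (simp add: hz sz)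
  have z9: "c 9 = 0" using E [of "vec8 0 1 1 0 1 0 0 1"] by (simp add: hz sz)
  have z10: "c 10 = 0" using E [of "vec8 1 0 0 1 0 1 1 0"] by (simp add: hz sz)
  have z11: "c 11 = 0" using E [of "vec8 0 0 1 1 1 1 0 0"] by (simp add: hz sz)
  have z12: "c 12 = 0" using E [of "vec8 1 1 0 0 0 0 1 1"] by (simp add: hz sz)
  have z13: "c 13 = 0" using E [of "vec8 0 1 0 1 0 1 0 1"] by (simp add: hz sz)
  have "\<forall>k\<in>{..<84}. c k = 0" by (simp add: lessThan_nat_numeral lessThan_Suc hz sz z0 z1 z2 z3 z4 z5 z6 z7 z8 z9 z10 z11 z12 z13 z0 [unfolded One_nat_def] z1 [unfolded One_nat_def])
  thus ?thesis using assms(2) by simp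
qed

section \<open>Transitivity of the spin group on isotropic frames\<close>

text \<open>The span of the hyperbolic planes with index in \<open>S\<close>. Working inside it
  keeps its orthogonal complement fixed, as needed when the second vector of a frame is
  moved.\<close>

definition supported :: "8 set \<Rightarrow> V set" where
  "supported S = {v. \<forall>i. i \<notin> S \<longrightarrow> v $ Inl i = 0 \<and> v $ Inr i = 0}"

lemma supported_closed:
  "u \<in> supported S \<Longrightarrow> v \<in> supported S \<Longrightarrow> u + v \<in> supported S" "u \<in> supported S \<Longrightarrow> v \<in> supported S \<Longrightarrow> u - v \<in> supported S"
  "u \<in> supported S \<Longrightarrow> c *s u \<in> supported S" "i \<in> S \<Longrightarrow> ebas i \<in> supported S" "i \<in> S \<Longrightarrow> fbas i \<in> supported S"
  "i \<in> S \<Longrightarrow> wvec i \<in> supported S"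
  by (auto simp: supported_def wvec_def)

lemma intertwines_perp: "quad w = 1 \<Longrightarrow> polar x w = 0 \<Longrightarrow> intertwines (clifford w) x (- x)"
  using intertwines_clifford [of w x] by simp

lemma intertwines_pair_perp:
  assumes "quad w = 1" "quad w' = 1" "polar x w = 0" "polar x w' = 0"
  shows "intertwines (clifford w \<circ> clifford w') x x"
  using intertwines_comp [OF intertwines_perp [of w "- x"] intertwines_perp [of w' x]] assms by simp

text \<open>The reflection in \<open>u - ebas s\<close> exchanges the two isotropic vectors. The
  norm of this difference is minus their polar product, hence nonzero, and a complex square root
  normalizes it.\<close>

lemma reflection_to_basis:
  assumes "quad u = 0" "u $ Inr s \<noteq> 0" "u \<in> supported S" "s \<in> S"
  shows "\<exists>w. quad w = 1 \<and> w \<in> supported S \<and> intertwines (clifford w) u (- ebas s)"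
proof -
  define x where "x = u - ebas s"
  have qx: "quad x = - u $ Inr s"
    using quad_add [of x "ebas s"] assms(1) unfolding x_def by (simp add: polar_diff eq_neg_iff_add_eq_0)
  define l where "l = csqrt (1 / quad x)"
  have l: "l * l * quad x = 1" using assms(2) qx unfolding l_def by (simp flip: power2_eq_square)
  define w where "w = l *s x"
  have qw: "quad w = 1" using l by (simp add: w_def quad_scale power2_eq_square)
  have "polar u x = quad x" unfolding qx unfolding x_def by (simp add: polar_diff polar_self assms(1))
  hence "polar u w *s w = (l * l * quad x) *s x" by (simp add: w_def polar_linear mult_ac)
  hence "polar u w *s w - u = - ebas s" unfolding l by (simp add: x_def)
  hence "intertwines (clifford w) u (- ebas s)" using intertwines_clifford [OF qw, of u] by simp
  moreover have "w \<in> supported S" unfolding w_def x_def using assms by (intro supported_closed)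
  ultimately show ?thesis using qw by blast
qed

text \<open>The number of reflections has to be even. If \<open>u\<close> already pairs with
  \<open>ebas s\<close>, the second reflection is in \<open>wvec t\<close>, which is orthogonal to
  \<open>ebas s\<close>; otherwise a preliminary reflection makes the pairing nonzero.\<close>

lemma spin_to_basis:
  assumes u: "quad u = 0" "u \<noteq> 0" "u \<in> supported S" and s: "s \<in> S" "t \<in> S" "s \<noteq> t"
  shows "\<exists>g\<in>Spin. \<exists>c. c \<noteq> 0 \<and> intertwines g u (c *s ebas s) \<and> (\<forall>x. (\<forall>w\<in>supported S. polar x w = 0) \<longrightarrow> intertwines g x x)"
proof (cases "u $ Inr s = 0")
  case False
  obtain w where w: "quad w = 1" "w \<in> supported S" "intertwines (clifford w) u (- ebas s)"
    using reflection_to_basis [OF u(1) False u(3) s(1)] by blast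
  have "intertwines (clifford (wvec t) \<circ> clifford w) u (1 *s ebas s)"
  proof -
    have "polar (- ebas s) (wvec t) = 0" using s by (simp add: wvec_def polar_linear)
    from intertwines_comp [OF intertwines_perp [OF quad_wvec this] w(3)] show ?thesis by simp
  qed
  thus ?thesis
    using Spin_pair [OF quad_wvec w(1), of t] intertwines_pair_perp [OF quad_wvec w(1), of _ t] w(2) supported_closed(6) [OF s(2)]
    by (intro bexI [of _ "clifford (wvec t) \<circ> clifford w"] exI [of _ 1]) auto
next
  case True
  \<comment> \<open>After the reflection in \<open>r\<close> the \<open>Inr s\<close> coordinate is
    the product of \<open>polar u r\<close> and that coordinate of \<open>r\<close>, so both are
    required to be nonzero.\<close>
  have "\<exists>r. quad r = 1 \<and> r \<in> supported S \<and> polar u r \<noteq> 0 \<and> r $ Inr s \<noteq> 0"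
  proof (cases "u $ Inl s = 0")
    case False
    thus ?thesis using True s by (intro exI [of _ "wvec s"]) (simp add: supported_closed wvec_def polar_linear quad_add)
  next
    case Tl: True
    obtain j where j: "u $ Inl j \<noteq> 0 \<or> u $ Inr j \<noteq> 0"
      using u(2) V_expand [of u] by (metis (no_types, lifting) add.right_neutral sum.neutral vec.scale_zero_left)
    have jS: "j \<in> S" "j \<noteq> s" using j u(3) True Tl by (auto simp: supported_def)
    show ?thesis
    proof (cases "u $ Inl j = 0")
      case False
      thus ?thesis using True Tl jS s
        by (intro exI [of _ "wvec s + fbas j"]) (simp add: supported_closed quad_add polar_linear wvec_def)
    next
      case Z: True
      hence "u $ Inr j \<noteq> 0" using j by simp
      thus ?thesis using True Tl jS s
        by (intro exI [of _ "wvec s + ebas j"]) (simp add: supported_closed quad_add polar_linear wvec_def)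
    qed
  qed
  then obtain r where r: "quad r = 1" "r \<in> supported S" "polar u r \<noteq> 0" "r $ Inr s \<noteq> 0" by blast
  define u1 where "u1 = polar u r *s r - u"
  have i1: "intertwines (clifford r) u u1" unfolding u1_def by (rule intertwines_clifford [OF r(1)])
  have "quad (polar u r *s r + (-1) *s u) = 0"
    by (simp only: quad_add quad_scale polar_linear r u) (simp add: polar_commute [of r u] power2_eq_square)
  hence "quad u1 = 0" by (simp add: u1_def)
  moreover have "u1 $ Inr s \<noteq> 0" using r True by (simp add: u1_def)
  moreover have "u1 \<in> supported S" unfolding u1_def using r u by (intro supported_closed)
  ultimately obtain w where w: "quad w = 1" "w \<in> supported S" "intertwines (clifford w) u1 (- ebas s)"
    using reflection_to_basis s(1) by blast
  have "intertwines (clifford w \<circ> clifford r) u ((-1) *s ebas s)"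
    using intertwines_comp [OF w(3) i1] by simp
  thus ?thesis
    using Spin_pair [OF w(1) r(1)] intertwines_pair_perp [OF w(1) r(1)] w(2) r(2)
    by (intro bexI [of _ "clifford w \<circ> clifford r"] exI [of _ "-1"]) auto
qed

text \<open>Once the first vector is a multiple of \<open>ebas 0\<close>, the second is isotropic
  and orthogonal to it. Its component off index 0 is moved to \<open>ebas 1\<close> by an element
  fixing \<open>ebas 0\<close>; the image is a basis of the standard plane.\<close>

lemma frame_transitive:
  assumes "isotropic_frame (u, v)"
  shows "\<exists>g\<in>Spin. \<exists>a b c. a \<noteq> 0 \<and> c \<noteq> 0 \<and> vec_act g u = a *s ebas 0 \<and> vec_act g v = b *s ebas 0 + c *s ebas 1"
proof -
  have ind: "a = 0 \<and> b = 0" if "a *s u + b *s v = 0" for a b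
    using assms that unfolding isotropic_frame_def by blast
  have iso: "quad (a *s u + b *s v) = 0" for a b
    using assms unfolding isotropic_frame_def by blast
  have u: "quad u = 0" "u \<noteq> 0" using iso [of 1 0] ind [of 1 0] by auto
  have "u \<in> supported UNIV" by (simp add: supported_def)
  then obtain g a where g: "g \<in> Spin" "a \<noteq> 0" "intertwines g u (a *s ebas 0)"
    using spin_to_basis [OF u, of UNIV 0 1] by auto
  define v1 where "v1 = vec_act g v"
  have gu: "vec_act g u = a *s ebas 0" by (rule vec_act_eqI [OF g(1,3)])
  have q: "quad (x *s (a *s ebas 0) + y *s v1) = 0" for x y
    using vec_act_quad [OF g(1), of "x *s u + y *s v"] iso by (simp add: vec_act_linear [OF g(1)] gu v1_def)
  have q1: "quad v1 = 0" using q [of 0 1] by simp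
  have v0: "v1 $ Inr 0 = 0" using q [of 1 1] q1 g(2) by (simp add: quad_add quad_scale polar_linear)
  define v2 where "v2 = v1 - v1 $ Inl 0 *s ebas 0"
  have v12: "v1 = v1 $ Inl 0 *s ebas 0 + v2" by (simp add: v2_def)
  have "quad (v1 + (- (v1 $ Inl 0)) *s ebas 0) = 0"
    by (simp only: quad_add quad_scale polar_linear q1) (simp add: v0)
  hence q2: "quad v2 = 0" by (simp add: v2_def)
  have s2: "v2 \<in> supported (- {0})" using v0 by (auto simp: supported_def v2_def)
  have "v2 \<noteq> 0"
  proof
    assume "v2 = 0"
    hence "vec_act g v = (v1 $ Inl 0 / a) *s vec_act g u" using v12 g(2) by (simp add: v1_def [symmetric] gu)
    hence "vec_act g v = vec_act g ((v1 $ Inl 0 / a) *s u)" by (simp add: vec_act_linear [OF g(1)])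
    hence "v = (v1 $ Inl 0 / a) *s u" using vec_act_inv(1) [OF g(1)] by metis
    hence "(v1 $ Inl 0 / a) *s u + (-1) *s v = 0" by simp
    thus False using ind by fastforce
  qed
  then obtain h c where h: "h \<in> Spin" "c \<noteq> 0" "intertwines h v2 (c *s ebas 1)"
      "\<And>x. (\<forall>w\<in>supported (- {0}). polar x w = 0) \<Longrightarrow> intertwines h x x"
    using spin_to_basis [OF q2 _ s2, of 1 2] by auto
  have "intertwines h (ebas 0) (ebas 0)" by (rule h(4)) (simp add: supported_def)
  hence h0: "vec_act h (ebas 0) = ebas 0" by (rule vec_act_eqI [OF h(1)])
  have h2: "vec_act h v2 = c *s ebas 1" by (rule vec_act_eqI [OF h(1,3)])
  have "vec_act (h \<circ> g) u = a *s ebas 0"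
    by (simp add: vec_act_comp h g gu vec_act_linear h0)
  moreover have "vec_act (h \<circ> g) v = v1 $ Inl 0 *s ebas 0 + c *s ebas 1"
  proof -
    have "vec_act (h \<circ> g) v = vec_act h v1" by (simp add: vec_act_comp h g v1_def)
    also have "\<dots> = v1 $ Inl 0 *s vec_act h (ebas 0) + vec_act h v2"
      by (subst v12) (simp only: vec_act_linear [OF h(1)])
    finally show ?thesis unfolding h0 h2 .
  qed
  ultimately show ?thesis using Spin_comp [OF h(1) g(1)] g(2) h(2) by blast
qed

text \<open>Pluecker coordinates scale by the determinant of the change of basis, a quadric section
  by its square.\<close>

lemma quadric_section_frame:
  assumes "s \<in> quadric_sections" "a \<noteq> 0" "c \<noteq> 0"
  shows "s (a *s u, b *s u + c *s v) = (a * c)\<^sup>2 * s (u, v)"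
proof -
  have fr: "isotropic_frame (a *s u, b *s u + c *s v) \<longleftrightarrow> isotropic_frame (u, v)"
  proof -
    have e: "x *s (a *s u) + y *s (b *s u + c *s v) = (x * a + y * b) *s u + (y * c) *s v" for x y
      by (simp add: vec.scale_left_distrib vec.scale_right_distrib)
    have e': "x *s u + y *s v = ((x - y * b / c) / a) *s (a *s u) + (y / c) *s (b *s u + c *s v)" for x y
      using assms unfolding e by (simp add: field_simps)
    show ?thesis
    proof
      assume A: "isotropic_frame (a *s u, b *s u + c *s v)"
      show "isotropic_frame (u, v)" unfolding isotropic_frame_def prod.case
      proof (intro conjI allI impI)
        fix x y assume "x *s u + y *s v = 0"
        hence "(x - y * b / c) / a = 0 \<and> y / c = 0" using A unfolding e' [of x y] isotropic_frame_def by blast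
        thus "x = 0" "y = 0" using assms by auto
      next
        fix x y show "quad (x *s u + y *s v) = 0" using A unfolding e' [of x y] isotropic_frame_def by blast
      qed
    next
      assume A: "isotropic_frame (u, v)"
      show "isotropic_frame (a *s u, b *s u + c *s v)" unfolding isotropic_frame_def prod.case
      proof (intro conjI allI impI)
        fix x y assume "x *s (a *s u) + y *s (b *s u + c *s v) = 0"
        hence "x * a + y * b = 0 \<and> y * c = 0" using A unfolding e isotropic_frame_def by blast
        thus "x = 0" "y = 0" using assms by auto
      next
        fix x y show "quad (x *s (a *s u) + y *s (b *s u + c *s v)) = 0" using A unfolding e isotropic_frame_def by blast
      qed
    qed
  qed
  show ?thesis using assms(1) unfolding quadric_sections_def
  proof (induction rule: fun_vs.span_induct_alt)
    case base thus ?case by simp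
  next
    case (step k x y)
    then obtain i j l m where x: "x = (\<lambda>p. if isotropic_frame p then pluecker i j p * pluecker l m p else 0)" by blast
    have "x (a *s u, b *s u + c *s v) = (a * c)\<^sup>2 * x (u, v)"
      unfolding x fr by (simp add: pluecker_def power2_eq_square algebra_simps)
    thus ?case using step(2) by (simp add: fun_scale_def distrib_left)
  qed
qed

section \<open>Nonvanishing at the standard frame\<close>

context equivariant_map
begin

definition q :: "spinor \<Rightarrow> spinor \<Rightarrow> spinor \<Rightarrow> spinor \<Rightarrow> complex" where
  "q x y z w = G x y z w (ebas 0, ebas 1)"

lemma q_commute: "q x y z w = q y x z w" "q x y z w = q x z y w" "q x y z w = q x y w z"
  unfolding q_def using G_commute by metis+

lemma q_linear:
  assumes "x \<in> half_spin" "x' \<in> half_spin" "y \<in> half_spin" "z \<in> half_spin" "w \<in> half_spin"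
  shows "q (a *s x + b *s x') y z w = a * q x y z w + b * q x' y z w" "q y (a *s x + b *s x') z w = a * q y x z w + b * q y x' z w"
    "q y z (a *s x + b *s x') w = a * q y z x w + b * q y z x' w" "q y z w (a *s x + b *s x') = a * q y z w x + b * q y z w x'"
  using assms unfolding q_def
  by (simp_all add: G_linear1 G_linear2 G_linear3 G_linear4 half_spin_subspace fun_scale_def)

lemma q_scale:
  assumes "x \<in> half_spin" "y \<in> half_spin" "z \<in> half_spin" "w \<in> half_spin"
  shows "q (a *s x) y z w = a * q x y z w" "q y (a *s x) z w = a * q y x z w"
    "q y z (a *s x) w = a * q y z x w" "q y z w (a *s x) = a * q y z w x"
  using q_linear [of x x y z w a 0] assms by simp_all

lemma q_invariant:
  assumes "g \<in> Spin" "intertwines g (ebas 0) (ebas 0)" "intertwines g (ebas 1) (ebas 1)"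
    "x \<in> half_spin" "y \<in> half_spin" "z \<in> half_spin" "w \<in> half_spin"
  shows "q (g x) (g y) (g z) (g w) = q x y z w"
  unfolding q_def using G_equivariant assms section_act_eval [OF assms(1-3)] by simp

text \<open>A nonzero value can only occur at an isotropic frame, and transitivity carries it to the
  standard plane.\<close>

lemma q_nonzero: "\<exists>x\<in>half_spin. \<exists>y\<in>half_spin. \<exists>z\<in>half_spin. \<exists>w\<in>half_spin. q x y z w \<noteq> 0"
proof -
  obtain x y z w where x: "x \<in> half_spin" "y \<in> half_spin" "z \<in> half_spin" "w \<in> half_spin" "G x y z w \<noteq> 0"
    using G_nonzero by blast
  then obtain p where "G x y z w p \<noteq> 0" by (auto simp: fun_eq_iff)
  moreover obtain u v where p: "p = (u, v)" by (cases p)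
  ultimately have uv: "G x y z w (u, v) \<noteq> 0" by simp
  have "isotropic_frame (u, v)"
  proof (rule ccontr)
    assume n: "\<not> isotropic_frame (u, v)"
    have "s (u, v) = 0" if "s \<in> quadric_sections" for s
      using that unfolding quadric_sections_def
      by (induction rule: fun_vs.span_induct_alt) (use n in \<open>auto simp: fun_scale_def\<close>)
    thus False using uv G_quadric x by blast
  qed
  then obtain g a b c where g: "g \<in> Spin" "a \<noteq> 0" "c \<noteq> 0" "vec_act g u = a *s ebas 0" "vec_act g v = b *s ebas 0 + c *s ebas 1"
    using frame_transitive by blast
  have "intertwines g u (a *s ebas 0)" "intertwines g v (b *s ebas 0 + c *s ebas 1)"
    using vec_act_intertwines [OF g(1)] g(4,5) by metis+
  hence "section_act g (G x y z w) (a *s ebas 0, b *s ebas 0 + c *s ebas 1) = G x y z w (u, v)"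
    by (rule section_act_eval [OF g(1)])
  hence "G (g x) (g y) (g z) (g w) (a *s ebas 0, b *s ebas 0 + c *s ebas 1) \<noteq> 0"
    using uv G_equivariant [OF g(1) x(1-4)] by simp
  moreover have gx: "g x \<in> half_spin" "g y \<in> half_spin" "g z \<in> half_spin" "g w \<in> half_spin"
    using Spin_half_spin [OF g(1)] x by auto
  ultimately have "q (g x) (g y) (g z) (g w) \<noteq> 0"
    unfolding q_def using quadric_section_frame [OF G_quadric [OF gx] g(2,3)] by simp
  thus ?thesis using gx by blast
qed

end

text \<open>Adjacent transpositions generate all permutations: the required head is moved to the
  front step by step, then the tail is treated.\<close>

lemma adjacent_swaps:
  assumes "P xs" "mset xs = mset ys" "\<And>us x y vs. P (us @ [x, y] @ vs) \<Longrightarrow> P (us @ [y, x] @ vs)"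
  shows "P ys"
  using assms
proof (induction ys arbitrary: P xs)
  case Nil thus ?case by simp
next
  case (Cons y ys)
  have "y \<in> set xs" using Cons.prems(2) by (metis list.set_intros(1) mset_eq_setD)
  then obtain us vs where xs: "xs = us @ y # vs" by (meson split_list)
  have "P (us @ y # vs) \<Longrightarrow> P (y # us @ vs)" for us vs
  proof (induction us arbitrary: vs rule: rev_induct)
    case (snoc x us)
    thus ?case using Cons.prems(3) [of us x y vs] by (metis append.assoc append_Cons append_Nil)
  qed simp
  hence "P (y # us @ vs)" using Cons.prems(1) xs by blast
  moreover have "mset (us @ vs) = mset ys" using Cons.prems(2) unfolding xs by simp
  moreover have "P (y # us @ [a, b] @ vs) \<Longrightarrow> P (y # us @ [b, a] @ vs)" for us a b vs
    using Cons.prems(3) [of "y # us"] by simp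
  ultimately show ?case using Cons.IH [of "\<lambda>zs. P (y # zs)" "us @ vs"] by blast
qed

section \<open>Values on basis spinors and their vanishing\<close>

definition tog :: "8 set \<Rightarrow> 8 set \<Rightarrow> 8 set" where "tog D I = {k. (k \<in> I) \<noteq> (k \<in> D)}"

lemma tog_tog [simp]: "tog D (tog D I) = I" by (auto simp: tog_def)

text \<open>A basis spinor up to sign, which is enough to decide whether a value of \<open>q\<close>
  vanishes.\<close>

definition signed_basis :: "spinor \<Rightarrow> 8 set \<Rightarrow> bool" where
  "signed_basis x I \<longleftrightarrow> x = e_basis I \<or> x = - e_basis I"

lemma wedge_sign_cases: "wedge_sign i I = 1 \<or> wedge_sign i I = -1"
  unfolding wedge_sign_def by (metis neg_one_even_power neg_one_odd_power)

lemma signed_basis_clifford: "signed_basis x I \<Longrightarrow> signed_basis (clifford (wvec i) x) (tog {i} I)"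
proof -
  have "(if i \<in> I then I - {i} else insert i I) = tog {i} I" by (auto simp: tog_def)
  hence "clifford (wvec i) (e_basis I) = wedge_sign i I *s e_basis (tog {i} I)"
    by (simp only: clifford_wvec_basis)
  thus "signed_basis x I \<Longrightarrow> signed_basis (clifford (wvec i) x) (tog {i} I)"
    using wedge_sign_cases [of i I] by (auto simp: signed_basis_def)
qed

lemma signed_basis_wpair:
  assumes "signed_basis x I" "i \<noteq> j" shows "signed_basis (wpair i j x) (tog {i, j} I)"
proof -
  have "tog {i} (tog {j} I) = tog {i, j} I" using assms(2) by (auto simp: tog_def)
  thus ?thesis unfolding wpair_def using signed_basis_clifford [OF signed_basis_clifford [OF assms(1)]] by metis
qed

lemma e_basis_half_spin: "even (card I) \<Longrightarrow> e_basis I \<in> half_spin"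
  by (auto simp: half_spin_def e_basis_def axis_def)

lemma half_spin_uminus: "x \<in> half_spin \<Longrightarrow> - x \<in> half_spin"
  by (simp add: half_spin_def)

lemma signed_basis_half_spin: "signed_basis x I \<Longrightarrow> even (card I) \<Longrightarrow> x \<in> half_spin"
  using e_basis_half_spin half_spin_uminus by (auto simp: signed_basis_def)

lemma wpair_in_Spin: "wpair i j \<in> Spin"
proof -
  have "wpair i j = clifford (wvec i) \<circ> clifford (wvec j)" by (auto simp: wpair_def)
  thus ?thesis using Spin_pair by (simp only: quad_wvec)
qed

lemma even_card_tog: "even (card I) \<Longrightarrow> i \<noteq> j \<Longrightarrow> even (card (tog {i,j} I))"
proof -
  have t: "even (card (tog {i} I)) \<longleftrightarrow> odd (card I)" for i I
  proof (cases "i \<in> I")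
    case True
    hence "tog {i} I = I - {i}" by (auto simp: tog_def)
    thus ?thesis using card.remove [OF _ True] by (metis even_Suc finite)
  next
    case False
    hence "tog {i} I = insert i I" by (auto simp: tog_def)
    thus ?thesis using False by simp
  qed
  assume "even (card I)" "i \<noteq> j"
  moreover have "tog {i} (tog {j} I) = tog {i, j} I" using \<open>i \<noteq> j\<close> by (auto simp: tog_def)
  ultimately show ?thesis using t [of i "tog {j} I"] t [of j I] by simp
qed

lemma wpair_perp: assumes "i \<notin> {0,1}" "j \<notin> {0,1}" "k \<in> {0,1}"
  shows "polar (ebas k) (wvec i) = 0" "polar (ebas k) (a *s wvec i + b *s wvec j) = 0"
  using assms by (auto simp: wvec_def polar_linear)

context equivariant_map
begin

definition vanishes :: "8 set \<Rightarrow> 8 set \<Rightarrow> 8 set \<Rightarrow> 8 set \<Rightarrow> bool" where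
  "vanishes I J K L \<longleftrightarrow> q (e_basis I) (e_basis J) (e_basis K) (e_basis L) = 0"

lemma vanishes_commute: "vanishes I J K L \<longleftrightarrow> vanishes J I K L" "vanishes I J K L \<longleftrightarrow> vanishes I K J L" "vanishes I J K L \<longleftrightarrow> vanishes I J L K"
  unfolding vanishes_def using q_commute by metis+

lemma q_uminus:
  assumes "x \<in> half_spin" "y \<in> half_spin" "z \<in> half_spin" "w \<in> half_spin"
  shows "q (- x) y z w = - q x y z w" "q x (- y) z w = - q x y z w" "q x y (- z) w = - q x y z w" "q x y z (- w) = - q x y z w"
  using q_scale(1) [of x y z w "-1"] q_scale(2) [of y x z w "-1"] q_scale(3) [of z x y w "-1"] q_scale(4) [of w x y z "-1"] assms by simp_all

lemma q_signed:
  assumes "even (card I)" "even (card J)" "even (card K)" "even (card L)"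
    "signed_basis x I" "signed_basis y J" "signed_basis z K" "signed_basis w L"
  shows "q x y z w = 0 \<longleftrightarrow> vanishes I J K L"
proof -
  note e = e_basis_half_spin [OF assms(1)] e_basis_half_spin [OF assms(2)] e_basis_half_spin [OF assms(3)] e_basis_half_spin [OF assms(4)]
  note m = e [THEN half_spin_uminus]
  show ?thesis using assms(5-8) unfolding signed_basis_def vanishes_def
    by (elim disjE) (simp_all add: q_uminus e m)
qed

text \<open>Invariance under the torus element that scales index \<open>i\<close> only. For
  \<open>i\<close> outside {0, 1} the frame is fixed, so the weights must balance; otherwise the
  section scales by 1/16, which forces all four sets to omit \<open>i\<close>. The scaling factor 2
  is no root of unity, so exponents can be compared.\<close>

lemma weights:
  assumes ev: "even (card I)" "even (card J)" "even (card K)" "even (card L)" and nz: "\<not> vanishes I J K L"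
  shows "i \<in> {0,1} \<Longrightarrow> i \<notin> I \<and> i \<notin> J \<and> i \<notin> K \<and> i \<notin> L"
    "i \<notin> {0,1} \<Longrightarrow> of_bool (i \<in> I) + of_bool (i \<in> J) + of_bool (i \<in> K) + of_bool (i \<in> L) = (2::nat)"
proof -
  define s where "s = (\<lambda>j. if j = i then 2 else 1 :: complex)"
  have s: "s j \<noteq> 0" for j by (simp add: s_def)
  define f where "f = (\<lambda>A. if i \<in> A then 2 else 1/2 :: complex)"
  have T: "torus s \<in> Spin" by (rule torus_in_Spin) (rule s)
  have Te: "torus s (e_basis A) = f A *s e_basis A" for A
  proof -
    have "(\<Prod>j\<in>UNIV. if j \<in> A then s j else inverse (s j)) = (\<Prod>j\<in>UNIV. if j = i then f A else 1)"
      by (rule prod.cong) (auto simp: s_def f_def)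
    thus ?thesis by (simp add: torus_basis)
  qed
  note e = e_basis_half_spin [OF ev(1)] e_basis_half_spin [OF ev(2)] e_basis_half_spin [OF ev(3)] e_basis_half_spin [OF ev(4)]
  let ?Q = "q (e_basis I) (e_basis J) (e_basis K) (e_basis L)"
  have sc: "q (torus s (e_basis I)) (torus s (e_basis J)) (torus s (e_basis K)) (torus s (e_basis L)) = f I * f J * f K * f L * ?Q"
    unfolding Te by (simp add: q_scale e half_spin_subspace)
  have Q: "?Q \<noteq> 0" using nz by (simp add: vanishes_def)
  note tw = torus_intertwines(1) [of s, OF s]
  note lin = intertwines_linear(2) [OF T]
  have Geq: "q (torus s (e_basis I)) (torus s (e_basis J)) (torus s (e_basis K)) (torus s (e_basis L)) =
     section_act (torus s) (G (e_basis I) (e_basis J) (e_basis K) (e_basis L)) (ebas 0, ebas 1)"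
    unfolding q_def by (simp only: G_equivariant [OF T e])
  have Gq: "G (e_basis I) (e_basis J) (e_basis K) (e_basis L) \<in> quadric_sections" by (rule G_quadric [OF e])
  show "i \<in> {0,1} \<Longrightarrow> i \<notin> I \<and> i \<notin> J \<and> i \<notin> K \<and> i \<notin> L"
  proof -
    assume i: "i \<in> {0,1}"
    have "f I * f J * f K * f L * ?Q = (1/16) * ?Q"
    proof (cases "i = 0")
      case True
      have 0: "intertwines (torus s) ((1/4) *s ebas 0 + 0 *s ebas 1) (ebas 0)" using lin [OF tw, of "1/4" 0] True by (simp add: s_def)
      have 1: "intertwines (torus s) (0 *s ebas 0 + 1 *s ebas 1) (ebas 1)"
      proof -
        have "s 1 = 1" using True by (simp add: s_def)
        thus ?thesis using tw [of 1] by simp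
      qed
      show ?thesis using quadric_section_frame [OF Gq, of "1/4" 1 "ebas 0" 0 "ebas 1"] section_act_eval [OF T 0 1]
        unfolding sc [symmetric] Geq by (simp add: q_def power2_eq_square)
    next
      case False
      hence i1: "i = 1" using i by simp
      have 0: "intertwines (torus s) (ebas 0) (ebas 0)" using tw [of 0] i1 by (simp add: s_def)
      have 1: "intertwines (torus s) (0 *s ebas 0 + (1/4) *s ebas 1) (ebas 1)" using lin [OF tw, of "1/4" 1] i1 by (simp add: s_def)
      show ?thesis using quadric_section_frame [OF Gq, of 1 "1/4" "ebas 0" 0 "ebas 1"] section_act_eval [OF T 0 1]
        unfolding sc [symmetric] Geq by (simp add: q_def power2_eq_square)
    qed
    hence "f I * f J * f K * f L = 1/16" using Q by (metis mult_right_cancel)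
    thus ?thesis unfolding f_def by (auto split: if_splits)
  qed
  show "i \<notin> {0,1} \<Longrightarrow> of_bool (i \<in> I) + of_bool (i \<in> J) + of_bool (i \<in> K) + of_bool (i \<in> L) = (2::nat)"
  proof -
    assume i: "i \<notin> {0,1}"
    have "intertwines (torus s) (ebas 0) (ebas 0)" "intertwines (torus s) (ebas 1) (ebas 1)"
      using tw [of 0] tw [of 1] i by (auto simp: s_def)
    hence "f I * f J * f K * f L * ?Q = ?Q" using q_invariant [OF T _ _ e] unfolding sc by blast
    hence "f I * f J * f K * f L = 1" using Q by simp
    thus ?thesis unfolding f_def by (auto split: if_splits)
  qed
qed

lemma vanishesI:
  assumes "even (card I)" "even (card J)" "even (card K)" "even (card L)" "i \<notin> {0,1}"
    "of_bool (i \<in> I) + of_bool (i \<in> J) + of_bool (i \<in> K) + of_bool (i \<in> L) \<noteq> (2::nat)"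
  shows "vanishes I J K L"
  using weights(2) [OF assms(1-4) _ assms(5)] assms(6) by blast

text \<open>Infinitesimal invariance under the Lie algebra element given by
  \<open>wpair i j\<close>, extracted from invariance under the elements c + s
  \<open>wpair i j\<close> with c^2 + s^2 = 1.\<close>

lemma q_lie:
  assumes ij: "i \<noteq> j" "i \<notin> {0,1}" "j \<notin> {0,1}"
    and h: "x \<in> half_spin" "y \<in> half_spin" "z \<in> half_spin" "w \<in> half_spin"
  shows "q (wpair i j x) y z w + q x (wpair i j y) z w + q x y (wpair i j z) w + q x y z (wpair i j w) = 0"
proof -
  let ?X = "wpair i j"
  have hX: "?X x \<in> half_spin" "?X y \<in> half_spin" "?X z \<in> half_spin" "?X w \<in> half_spin"
    using Spin_half_spin [OF wpair_in_Spin] h by auto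
  define s1 s2 s3 s4 where "s1 = q (?X x) y z w + q x (?X y) z w + q x y (?X z) w + q x y z (?X w)"
    and "s2 = q (?X x) (?X y) z w + q (?X x) y (?X z) w + q (?X x) y z (?X w) + q x (?X y) (?X z) w + q x (?X y) z (?X w) + q x y (?X z) (?X w)"
    and "s3 = q x (?X y) (?X z) (?X w) + q (?X x) y (?X z) (?X w) + q (?X x) (?X y) z (?X w) + q (?X x) (?X y) (?X z) w"
    and "s4 = q (?X x) (?X y) (?X z) (?X w)"
  have E: "c ^ 4 * q x y z w + c ^ 3 * s * s1 + c ^ 2 * s ^ 2 * s2 + c * s ^ 3 * s3 + s ^ 4 * s4 = q x y z w" if cs: "c * c + s * s = 1" for c s
  proof -
    define R where "R = clifford (wvec i) \<circ> clifford (c *s wvec i + s *s wvec j)"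
    have qw: "quad (c *s wvec i + s *s wvec j) = 1"
      using cs ij by (simp add: quad_add quad_scale polar_linear polar_wvec power2_eq_square)
    have R: "R \<in> Spin" unfolding R_def by (rule Spin_pair [OF quad_wvec qw])
    have fix': "intertwines R (ebas k) (ebas k)" if "k \<in> {0,1}" for k
      unfolding R_def using wpair_perp [OF ij(2,3) that] by (intro intertwines_pair_perp qw quad_wvec)
    have Rx: "R v = c *s v + s *s ?X v" for v
      by (simp add: R_def wpair_def clifford_add clifford_add_left clifford_scale clifford_scale_left clifford_square)
    have "q (R x) (R y) (R z) (R w) = q x y z w" by (rule q_invariant [OF R fix' fix' h]) simp_all
    moreover have "q (R x) (R y) (R z) (R w) = c ^ 4 * q x y z w + c ^ 3 * s * s1 + c ^ 2 * s ^ 2 * s2 + c * s ^ 3 * s3 + s ^ 4 * s4"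
      unfolding Rx s1_def s2_def s3_def s4_def
      by (simp add: q_linear h hX half_spin_subspace power4_eq_xxxx power3_eq_cube power2_eq_square algebra_simps)
    ultimately show ?thesis by simp
  qed
  have "s1 = 0"
    \<comment> \<open>Opposite signs of s isolate the odd part, c^2 s1 + s^2 s3 = 0. The two
      Pythagorean ratios are different, so s1 = 0.\<close>
    using E [of "3/5" "4/5"] E [of "3/5" "-4/5"] E [of "4/5" "3/5"] E [of "4/5" "-3/5"]
    by (simp add: power4_eq_xxxx power3_eq_cube power2_eq_square field_simps) algebra
  thus ?thesis by (simp add: s1_def)
qed

text \<open>\<open>wpair i j\<close> is itself a spin element fixing the frame, and it toggles both
  indices in all four sets.\<close>

lemma vanishes_tog:
  assumes ij: "i \<noteq> j" "i \<notin> {0,1}" "j \<notin> {0,1}" and ev: "even (card I)" "even (card J)" "even (card K)" "even (card L)"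
  shows "vanishes (tog {i,j} I) (tog {i,j} J) (tog {i,j} K) (tog {i,j} L) \<longleftrightarrow> vanishes I J K L"
proof -
  have b: "signed_basis (e_basis A) A" for A by (simp add: signed_basis_def)
  note e = e_basis_half_spin [OF ev(1)] e_basis_half_spin [OF ev(2)] e_basis_half_spin [OF ev(3)] e_basis_half_spin [OF ev(4)]
  have "intertwines (wpair i j) (ebas k) (ebas k)" if "k \<in> {0,1}" for k
  proof -
    have "wpair i j = clifford (wvec i) \<circ> clifford (wvec j)" by (auto simp: wpair_def)
    thus ?thesis using wpair_perp(1) [OF ij(2,3) that] wpair_perp(1) [OF ij(3,2) that]
      by (simp only: intertwines_pair_perp quad_wvec)
  qed
  hence "q (wpair i j (e_basis I)) (wpair i j (e_basis J)) (wpair i j (e_basis K)) (wpair i j (e_basis L)) = q (e_basis I) (e_basis J) (e_basis K) (e_basis L)"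
    by (intro q_invariant wpair_in_Spin e) simp_all
  moreover have "q (wpair i j (e_basis I)) (wpair i j (e_basis J)) (wpair i j (e_basis K)) (wpair i j (e_basis L)) = 0
    \<longleftrightarrow> vanishes (tog {i,j} I) (tog {i,j} J) (tog {i,j} K) (tog {i,j} L)"
    by (intro q_signed even_card_tog ev ij signed_basis_wpair b)
  ultimately show ?thesis by (simp add: vanishes_def)
qed

lemma vanishes_lie:
  assumes ij: "i \<noteq> j" "i \<notin> {0,1}" "j \<notin> {0,1}" and ev: "even (card I)" "even (card J)" "even (card K)" "even (card L)"
    and v: "vanishes (tog {i,j} I) J K L" "vanishes I (tog {i,j} J) K L" "vanishes I J (tog {i,j} K) L"
  shows "vanishes I J K (tog {i,j} L)"
proof -
  have b: "signed_basis (e_basis A) A" for A by (simp add: signed_basis_def)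
  note e = e_basis_half_spin [OF ev(1)] e_basis_half_spin [OF ev(2)] e_basis_half_spin [OF ev(3)] e_basis_half_spin [OF ev(4)]
  note t = even_card_tog [OF _ ij(1)] and w = signed_basis_wpair [OF b ij(1)]
  have "q (wpair i j (e_basis I)) (e_basis J) (e_basis K) (e_basis L) = 0"
    using q_signed [OF t [OF ev(1)] ev(2-4) w b b b] v(1) by blast
  moreover have "q (e_basis I) (wpair i j (e_basis J)) (e_basis K) (e_basis L) = 0"
    using q_signed [OF ev(1) t [OF ev(2)] ev(3,4) b w b b] v(2) by blast
  moreover have "q (e_basis I) (e_basis J) (wpair i j (e_basis K)) (e_basis L) = 0"
    using q_signed [OF ev(1,2) t [OF ev(3)] ev(4) b b w b] v(3) by blast
  ultimately have "q (e_basis I) (e_basis J) (e_basis K) (wpair i j (e_basis L)) = 0"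
    using q_lie [OF ij e] by simp
  thus ?thesis using q_signed [OF ev(1-3) t [OF ev(4)] b b b w] by blast
qed

text \<open>The weight considerations leave three kinds of monomials; those of the first kind
  correspond to perfect matchings of the six remaining indices.\<close>

definition matching_zero :: "8 \<Rightarrow> 8 \<Rightarrow> 8 \<Rightarrow> 8 \<Rightarrow> 8 \<Rightarrow> 8 \<Rightarrow> bool" where
  "matching_zero a b c d m n \<longleftrightarrow> vanishes {} {c,d,m,n} {a,b,m,n} {a,b,c,d}"

lemma matching_sym:
  "matching_zero a b c d m n \<longleftrightarrow> matching_zero b a c d m n" "matching_zero a b c d m n \<longleftrightarrow> matching_zero c d a b m n"
  "matching_zero a b c d m n \<longleftrightarrow> matching_zero a b m n c d"
  unfolding matching_zero_def using vanishes_commute by (simp_all add: insert_commute)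

text \<open>In the Lie relation of \<open>j\<close> and \<open>k\<close> at the four chosen sets,
  toggling the first set or the third gives a forbidden weight. The other two terms are the
  matchings ij|kl|mn and ik|jl|mn.\<close>

lemma matching_exchange:
  assumes d: "distinct [i,j,k,l,m,n]" "{i,j,k,l,m,n} \<inter> {0,1} = {}" and z: "matching_zero i j k l m n"
  shows "matching_zero i k j l m n"
proof -
  have "vanishes {} {j,l,m,n} {i,j,k,l} (tog {j,k} {i,j,m,n})"
  proof (rule vanishes_lie)
    show "j \<noteq> k" "j \<notin> {0,1}" "k \<notin> {0,1}" using d by auto
    show "even (card ({}::8 set))" "even (card {j,l,m,n})" "even (card {i,j,k,l})" "even (card {i,j,m,n})" using d by auto
    have t: "tog {j,k} {} = {j,k}" "tog {j,k} {j,l,m,n} = {k,l,m,n}" "tog {j,k} {i,j,k,l} = {i,l}"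
      using d(1) by (auto simp: tog_def)
    show "vanishes (tog {j,k} {}) {j,l,m,n} {i,j,k,l} {i,j,m,n}"
      unfolding t by (rule vanishesI [of _ _ _ _ j]) (use d in auto)
    show "vanishes {} (tog {j,k} {j,l,m,n}) {i,j,k,l} {i,j,m,n}"
      unfolding t using z vanishes_commute(3) unfolding matching_zero_def by blast
    show "vanishes {} {j,l,m,n} (tog {j,k} {i,j,k,l}) {i,j,m,n}"
      unfolding t by (rule vanishesI [of _ _ _ _ k]) (use d in auto)
  qed
  moreover have "tog {j,k} {i,j,m,n} = {i,k,m,n}" using d(1) by (auto simp: tog_def)
  moreover have "{i,k,j,l} = {i,j,k,l}" by auto
  ultimately show ?thesis unfolding matching_zero_def using vanishes_commute(3) by metis
qed

text \<open>A matching does not change within a pair or between pairs, and the exchange covers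
  neighbours from different pairs; so every adjacent transposition of the six indices preserves
  vanishing.\<close>

lemma matching_all:
  assumes base: "matching_zero 2 3 4 5 6 7" and d: "distinct [a,b,c,d,m,n]" "{a,b,c,d,m,n} = {2,3,4,5,6,7}"
  shows "matching_zero a b c d m n"
proof -
  define P where "P xs \<longleftrightarrow> (\<exists>a b c d m n. xs = [a,b,c,d,m,n] \<and> distinct [a,b,c,d,m,n] \<and> {a,b,c,d,m,n} \<inter> {0,1} = {} \<and> matching_zero a b c d m n)" for xs
  have "P [2,3,4,5,6,7]" using base unfolding P_def by simp
  hence "P [a,b,c,d,m,n]"
  proof (rule adjacent_swaps)
    have "distinct [2,3,4,5,6,7::8]" "set [2,3,4,5,6,7::8] = set [a,b,c,d,m,n]" using d(2) by simp_all
    thus "mset [2,3,4,5,6,7] = mset [a,b,c,d,m,n]"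
      by (simp only: set_eq_iff_mset_eq_distinct [OF _ d(1)])
    fix us x y vs assume "P (us @ [x, y] @ vs)"
    then obtain a b c d m n where e: "us @ [x, y] @ vs = [a,b,c,d,m,n]"
      and p: "distinct [a,b,c,d,m,n]" "{a,b,c,d,m,n} \<inter> {0,1} = {}" "matching_zero a b c d m n"
      unfolding P_def by (elim exE conjE) (rule that)
    have swaps: "P [b,a,c,d,m,n]" "P [a,c,b,d,m,n]" "P [a,b,d,c,m,n]" "P [a,b,c,m,d,n]" "P [a,b,c,d,n,m]"
    proof -
      have x: "matching_zero a c b d m n" by (rule matching_exchange [OF p])
      have r: "matching_zero c d m n a b \<longleftrightarrow> matching_zero a b c d m n" for a b c d m n
        using matching_sym(2) [of c d m n a b] matching_sym(3) [of m n c d a b] matching_sym(2) [of m n a b c d]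
          matching_sym(3) [of a b m n c d] matching_sym(3) [of c d m n a b] matching_sym(2) [of c d a b m n] by blast
      have "distinct [c,d,m,n,a,b]" "{c,d,m,n,a,b} \<inter> {0,1} = {}" using p(1,2) by auto
      from matching_exchange [OF this] have "matching_zero c m d n a b" using p(3) r by blast
      hence y: "matching_zero a b c m d n" using r by blast
      have "matching_zero b a c d m n" by (rule matching_sym(1) [THEN iffD1, OF p(3)])
      moreover have "matching_zero c d a b m n" by (rule matching_sym(2) [THEN iffD1, OF p(3)])
      hence "matching_zero a b d c m n" using matching_sym(1,2) by blast
      moreover have "matching_zero m n a b c d" using p(3) r by blast
      hence "matching_zero n m a b c d" by (rule matching_sym(1) [THEN iffD1])
      hence "matching_zero a b c d n m" using r by blast
      ultimately
      show "P [b,a,c,d,m,n]" "P [a,c,b,d,m,n]" "P [a,b,d,c,m,n]" "P [a,b,c,m,d,n]" "P [a,b,c,d,n,m]"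
        unfolding P_def using x y p(1,2) by auto
    qed
    have "length us + length vs = 4" using arg_cong [OF e, of length] by simp
    then consider "length us = 0" | "length us = 1" | "length us = 2" | "length us = 3" | "length us = 4" by linarith
    thus "P (us @ [y, x] @ vs)"
      using e swaps by cases (auto simp: numeral_eq_Suc length_Suc_conv)
  qed
  thus ?thesis unfolding P_def by auto
qed

text \<open>With A, B, C the operators of the three pairs, this is the Lie relation of A at the
  spinors \<open>\<omega>\<close>, ABC \<open>\<omega>\<close>, B \<open>\<omega>\<close>, C
  \<open>\<omega>\<close>. Toggling \<open>{a, b}\<close> turns the first term into a matching, and
  the second has weight zero at \<open>a\<close>. Signs are carried by the operators.\<close>

lemma matching_lie:
  assumes base: "matching_zero 2 3 4 5 6 7"
    and d: "distinct [a,b,c,d,m,n]" "{a,b,c,d,m,n} = {2,3,4,5,6,7}"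
  defines "\<omega> \<equiv> e_basis {}"
  shows "q \<omega> (wpair a b (wpair c d (wpair m n \<omega>))) (wpair a b (wpair c d \<omega>)) (wpair m n \<omega>)
    + q \<omega> (wpair a b (wpair c d (wpair m n \<omega>))) (wpair c d \<omega>) (wpair a b (wpair m n \<omega>)) = 0"
proof -
  let ?A = "wpair a b" and ?B = "wpair c d" and ?C = "wpair m n"
  have ne: "a \<noteq> b" "c \<noteq> d" "m \<noteq> n" using d(1) by auto
  have "a \<in> {2,3,4,5,6,7}" "b \<in> {2,3,4,5,6,7}" using d(2) by blast+
  hence ab: "a \<notin> {0,1}" "b \<notin> {0,1}" by auto
  have s: "signed_basis \<omega> {}" by (simp add: \<omega>_def signed_basis_def)
  note sA = signed_basis_wpair [OF _ ne(1)] and sB = signed_basis_wpair [OF _ ne(2)] and sC = signed_basis_wpair [OF _ ne(3)]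
  have t: "tog {m,n} {} = {m,n}" "tog {c,d} {} = {c,d}" "tog {a,b} {} = {a,b}" "tog {c,d} {m,n} = {c,d,m,n}"
    "tog {a,b} {c,d,m,n} = {a,b,c,d,m,n}" using d(1) by (auto simp: tog_def)
  have b: "signed_basis (?C \<omega>) {m,n}" "signed_basis (?B \<omega>) {c,d}" "signed_basis (?A \<omega>) {a,b}"
    "signed_basis (?B (?C \<omega>)) {c,d,m,n}" "signed_basis (?A (?B (?C \<omega>))) {a,b,c,d,m,n}"
    using sC [OF s] sB [OF s] sA [OF s] sB [OF sC [OF s]] sA [OF sB [OF sC [OF s]]] unfolding t by auto
  have e: "even (card {m,n})" "even (card {c,d})" "even (card {a,b})" "even (card {c,d,m,n})" "even (card {a,b,c,d,m,n})" "even (card ({} :: 8 set))"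
    using d(1) by auto
  have h: "\<omega> \<in> half_spin" "?A (?B (?C \<omega>)) \<in> half_spin" "?B \<omega> \<in> half_spin" "?C \<omega> \<in> half_spin" "?B (?C \<omega>) \<in> half_spin"
    using signed_basis_half_spin b e s by blast+
  have "vanishes {a,b} {a,b,c,d,m,n} {c,d} {m,n}"
  proof -
    have "tog {a,b} {a,b} = {}" "tog {a,b} {a,b,c,d,m,n} = {c,d,m,n}" "tog {a,b} {c,d} = {a,b,c,d}" "tog {a,b} {m,n} = {a,b,m,n}"
      using d(1) by (auto simp: tog_def)
    moreover have "vanishes {} {c,d,m,n} {a,b,c,d} {a,b,m,n}"
      using matching_all [OF base d] vanishes_commute(3) unfolding matching_zero_def by blast
    ultimately show ?thesis using vanishes_tog [OF ne(1) ab e(3) e(5) e(2) e(1)] by simp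
  qed
  hence 1: "q (?A \<omega>) (?A (?B (?C \<omega>))) (?B \<omega>) (?C \<omega>) = 0"
    using q_signed [OF e(3) e(5) e(2) e(1) b(3) b(5) b(2) b(1)] by blast
  have "vanishes {} {c,d,m,n} {c,d} {m,n}"
    by (rule vanishesI [of _ _ _ _ a]) (use d(1) ab in auto)
  hence "q \<omega> (?B (?C \<omega>)) (?B \<omega>) (?C \<omega>) = 0"
    using q_signed [OF e(6) e(4) e(2) e(1) s b(4) b(2) b(1)] by blast
  hence 2: "q \<omega> (?A (?A (?B (?C \<omega>)))) (?B \<omega>) (?C \<omega>) = 0"
    unfolding wpair_square [OF ne(1)] q_uminus(2) [OF h(1) h(5) h(3) h(4)] by simp
  show ?thesis using q_lie [OF ne(1) ab h(1-4)] unfolding 1 2 by simp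
qed

text \<open>Three values, one for each pair of the matching, have vanishing pairwise sums and are
  therefore zero. Another Lie relation then settles the case of two empty and two full sets.\<close>

lemma vanishes_matching:
  assumes base: "matching_zero 2 3 4 5 6 7"
    and d: "distinct [a,b,c,d,m,n]" "{a,b,c,d,m,n} = {2,3,4,5,6,7}"
  shows "vanishes {} {2,3,4,5,6,7} {a,b} {c,d,m,n}" "vanishes {} {} {2,3,4,5,6,7} {2,3,4,5,6,7}"
proof -
  let ?A = "wpair a b" and ?B = "wpair c d" and ?C = "wpair m n" and ?w = "e_basis {}"
  let ?R = "{2,3,4,5,6,7} :: 8 set"
  have ne: "a \<noteq> b" "c \<noteq> d" "m \<noteq> n" using d(1) by auto
  have R: "{c,d,a,b,m,n} = ?R" "{m,n,a,b,c,d} = ?R" using d(2) by (auto simp: insert_commute)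
  have d': "distinct [c,d,a,b,m,n]" "distinct [m,n,a,b,c,d]" using d(1) by auto
  have com: "?B (?A x) = ?A (?B x)" "?C (?A x) = ?A (?C x)" "?C (?B x) = ?B (?C x)" for x
    using d(1) by (auto intro!: wpair_commute)
  note l = matching_lie [OF base d] matching_lie [OF base d'(1) R(1)] matching_lie [OF base d'(2) R(2)]
  have "q ?w (?A (?B (?C ?w))) (?A ?w) (?B (?C ?w)) = 0"
  proof -
    have z: "x = 0" if "z + y = 0" "z + x = 0" "y + x = 0" for x y z :: complex
    proof -
      have "2 * x = 0" using that by algebra
      thus ?thesis by simp
    qed
    note l = l [unfolded com]
    have "q ?w (?A (?B (?C ?w))) (?B ?w) (?A (?C ?w)) + q ?w (?A (?B (?C ?w))) (?A ?w) (?B (?C ?w)) = 0"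
      unfolding q_commute(3) [of ?w "?A (?B (?C ?w))" "?B ?w" "?A (?C ?w)"] by (rule l(3))
    thus ?thesis using l(1,2) z by blast
  qed
  moreover have s: "signed_basis ?w {}" by (simp add: signed_basis_def)
  note sA = signed_basis_wpair [OF _ ne(1)] and sB = signed_basis_wpair [OF _ ne(2)] and sC = signed_basis_wpair [OF _ ne(3)]
  have t: "tog {m,n} {} = {m,n}" "tog {a,b} {} = {a,b}" "tog {c,d} {m,n} = {c,d,m,n}"
    "tog {a,b} {c,d,m,n} = {a,b,c,d,m,n}" using d(1) by (auto simp: tog_def)
  have b: "signed_basis (?A ?w) {a,b}" "signed_basis (?B (?C ?w)) {c,d,m,n}" "signed_basis (?A (?B (?C ?w))) {a,b,c,d,m,n}"
    using sA [OF s] sB [OF sC [OF s]] sA [OF sB [OF sC [OF s]]] unfolding t by auto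
  have e: "even (card {a,b})" "even (card {c,d,m,n})" "even (card {a,b,c,d,m,n})" "even (card ({} :: 8 set))"
    using d(1) by auto
  ultimately show v: "vanishes {} ?R {a,b} {c,d,m,n}"
    using q_signed [OF e(4) e(3) e(1) e(2) s b(3) b(1) b(2)] unfolding d(2) by blast
  have "a \<in> ?R" "b \<in> ?R" using d(2) by blast+
  hence ab: "a \<notin> {0,1}" "b \<notin> {0,1}" by auto
  have "vanishes {} {} ?R (tog {a,b} {c,d,m,n})"
  proof (rule vanishes_lie [OF ne(1) ab])
    show "even (card ({} :: 8 set))" "even (card ({} :: 8 set))" by simp_all
    show "even (card ?R)" "even (card {c,d,m,n})" using e unfolding d(2) by simp_all
    show "vanishes (tog {a,b} {}) {} ?R {c,d,m,n}" "vanishes {} (tog {a,b} {}) ?R {c,d,m,n}"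
      unfolding t using v vanishes_commute by metis+
    have "tog {a,b} ?R = {c,d,m,n}" unfolding d(2) [symmetric] using d(1) by (auto simp: tog_def)
    moreover have "vanishes {} {} {c,d,m,n} {c,d,m,n}"
      by (rule vanishesI [of _ _ _ _ a]) (use d(1) ab in auto)
    ultimately show "vanishes {} {} (tog {a,b} ?R) {c,d,m,n}" by simp
  qed
  thus "vanishes {} {} ?R ?R" unfolding t d(2) .
qed

text \<open>By \<open>weights\<close> the elements of \<open>I\<close> lie outside {0, 1}, so two of
  them can be toggled in all four sets at once, which shortens \<open>I\<close>.\<close>

lemma vanishes_reduce:
  "even (card I) \<Longrightarrow> even (card J) \<Longrightarrow> even (card K) \<Longrightarrow> even (card L) \<Longrightarrow> \<not> vanishes I J K L \<Longrightarrow>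
   \<exists>J K L. even (card J) \<and> even (card K) \<and> even (card L) \<and> \<not> vanishes {} J K L"
proof (induction "card I" arbitrary: I J K L rule: less_induct)
  case less
  show ?case
  proof (cases "I = {}")
    case True thus ?thesis using less.prems by blast
  next
    case False
    then obtain i where i: "i \<in> I" by blast
    have "I - {i} \<noteq> {}"
    proof
      assume "I - {i} = {}"
      hence "I = {i}" using i by blast
      thus False using less.prems(1) by simp
    qed
    then obtain j where j: "j \<in> I" "i \<noteq> j" by blast
    have r: "i \<notin> {0,1}" "j \<notin> {0,1}" using weights(1) [OF less.prems] i j by blast+
    have "tog {i,j} I = I - {i,j}" using i j by (auto simp: tog_def)
    moreover have "I - {i,j} \<subset> I" using i by blast
    ultimately have lt: "card (tog {i,j} I) < card I" using psubset_card_mono [OF finite] by metis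
    have nv: "\<not> vanishes (tog {i,j} I) (tog {i,j} J) (tog {i,j} K) (tog {i,j} L)"
      using vanishes_tog [OF j(2) r less.prems(1-4)] less.prems(5) by simp
    note ev = less.prems(1-4) [THEN even_card_tog, OF j(2)]
    show ?thesis by (rule less.hyps [OF lt ev nv])
  qed
qed

text \<open>With the first set empty, every remaining index is missing from exactly one of the other
  sets. The missing indices form a partition of six elements into even parts, of sizes 6, 0, 0 or 4,
  2, 0 or 2, 2, 2: the three kinds of monomials.\<close>

lemma vanishes_all:
  assumes base: "matching_zero 2 3 4 5 6 7"
    and ev: "even (card I)" "even (card J)" "even (card K)" "even (card L)"
  shows "vanishes I J K L"
proof (rule ccontr)
  let ?R = "{2,3,4,5,6,7} :: 8 set"
  assume "\<not> vanishes I J K L"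
  then obtain J K L where e: "even (card J)" "even (card K)" "even (card L)" and nz: "\<not> vanishes {} J K L"
    using vanishes_reduce [OF ev] by blast
  define P Q S where "P = ?R - J" and "Q = ?R - K" and "S = ?R - L"
  have "even (card ({} :: 8 set))" by simp
  note w = weights [OF this e nz]
  define R where "R = ?R"
  have UR: "i \<in> R \<longleftrightarrow> i \<notin> {0,1}" for i proof -
    have "\<forall>i. i \<in> R \<longleftrightarrow> i \<notin> {0,1}" unfolding R_def all_8 by simp
    thus ?thesis by blast
  qed
  have sub: "J \<subseteq> R" "K \<subseteq> R" "L \<subseteq> R" using w(1) UR by blast+
  have JKL: "J = R - P" "K = R - Q" "L = R - S" unfolding P_def Q_def S_def R_def [symmetric] using sub by blast+
  have two: "i \<in> J \<and> i \<in> K \<and> i \<notin> L \<or> i \<in> J \<and> i \<notin> K \<and> i \<in> L \<or> i \<notin> J \<and> i \<in> K \<and> i \<in> L" if "i \<in> R" for i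
    using w(2) [OF iffD1 [OF UR that]] by (auto simp: of_bool_def split: if_splits)
  have part: "P \<union> Q \<union> S = R" "P \<inter> Q = {}" "P \<inter> S = {}" "Q \<inter> S = {}"
    unfolding P_def Q_def S_def R_def [symmetric] using two by blast+
  have cR: "card R = 6" by (simp add: R_def)
  have ce: "even (card P)" "even (card Q)" "even (card S)"
    unfolding P_def Q_def S_def R_def [symmetric] using e by (simp_all add: card_Diff_subset sub cR)
  have "card (P \<union> Q \<union> S) = card (P \<union> Q) + card S" by (rule card_Un_disjoint) (use part in auto)
  moreover have "card (P \<union> Q) = card P + card Q" by (rule card_Un_disjoint) (use part in auto)
  ultimately have cs: "card P + card Q + card S = 6" using part(1) cR by simp
  note part = part [unfolded R_def] and JKL = JKL [unfolded R_def] and cR = cR [unfolded R_def]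
  have ti: "vanishes {} {} ?R ?R" by (rule vanishes_matching(2) [OF base, of 2 3 4 5 6 7]) simp_all
  have tii: "vanishes {} ?R A B" if "A \<union> B = ?R" "A \<inter> B = {}" "even (card A)" "card A \<le> 2" for A B
  proof (cases "card A = 0")
    case True
    hence "A = {}" "B = ?R" using that(1) by auto
    thus ?thesis by (simp only: vanishes_commute(2) [of "{}" ?R "{}"] ti)
  next
    case False
    hence "card A = 2" using that(3,4) False by presburger
    then obtain a b where A: "A = {a,b}" "a \<noteq> b" by (auto simp: card_2_iff)
    have "card A + card B = 6" using card_Un_disjoint [of A B] that(1,2) cR by simp
    hence cB: "card B = 4" using \<open>card A = 2\<close> by simp
    obtain xs where xs: "set xs = B" "distinct xs" using finite_distinct_list [of B] by auto
    hence "length xs = 4" using cB distinct_card by fastforce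
    then obtain c d m n where x: "xs = [c,d,m,n]" by (auto simp: numeral_eq_Suc length_Suc_conv)
    have B: "B = {c,d,m,n}" using xs x by auto
    have "distinct [a,b,c,d,m,n]" using xs x A that(2) by auto
    moreover have "{a,b,c,d,m,n} = ?R" using that(1) unfolding A B by auto
    ultimately show ?thesis unfolding A(1) B by (rule vanishes_matching(1) [OF base])
  qed
  have t2: "vanishes {} ?R A B" if AB: "A \<union> B = ?R" "A \<inter> B = {}" "even (card A)" "even (card B)" for A B
  proof (cases "card A \<le> 2")
    case True thus ?thesis using tii that by blast
  next
    case False
    have "card A + card B = 6" using card_Un_disjoint [of A B] that(1,2) cR by simp
    hence "card B \<le> 2" using False that(3) by presburger
    hence "vanishes {} ?R B A"
    proof (rule tii [rotated 3])
      show "B \<union> A = ?R" using AB(1) by (subst Un_commute)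
      show "B \<inter> A = {}" using AB(2) by (subst Int_commute)
    qed (rule AB(4))
    thus ?thesis by (simp only: vanishes_commute(3) [of "{}" ?R A B])
  qed
  have "P = {} \<or> Q = {} \<or> S = {} \<or> card P = 2 \<and> card Q = 2 \<and> card S = 2"
  proof -
    have "card P = 0 \<or> card Q = 0 \<or> card S = 0 \<or> card P = 2 \<and> card Q = 2 \<and> card S = 2"
      using ce cs by presburger
    thus ?thesis by simp
  qed
  then consider "P = {}" | "Q = {}" | "S = {}" | "card P = 2" "card Q = 2" "card S = 2" by blast
  hence "vanishes {} J K L"
  proof cases
    case 1
    have "vanishes {} ?R K L" by (rule t2) (use part JKL 1 e in blast)+
    thus ?thesis unfolding JKL(1) 1 by simp
  next
    case 2
    have "vanishes {} ?R J L" by (rule t2) (use part JKL 2 e in blast)+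
    moreover have "K = ?R" using JKL(2) 2 by simp
    ultimately show ?thesis by (simp only: vanishes_commute(2) [of "{}" J ?R L])
  next
    case 3
    have "vanishes {} ?R J K" by (rule t2) (use part JKL 3 e in blast)+
    moreover have "L = ?R" using JKL(3) 3 by simp
    ultimately show ?thesis by (simp only: vanishes_commute(3) [of "{}" J K ?R] vanishes_commute(2) [of "{}" J ?R K])
  next
    case 4
    then obtain a b c d m n where x: "P = {a,b}" "a \<noteq> b" "Q = {c,d}" "c \<noteq> d" "S = {m,n}" "m \<noteq> n"
      by (auto simp: card_2_iff)
    have d: "distinct [a,b,c,d,m,n]" using part(2-4) x by auto
    moreover have R: "{a,b,c,d,m,n} = ?R" unfolding part(1) [symmetric] x by auto
    ultimately have "matching_zero a b c d m n" by (rule matching_all [OF base])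
    moreover have "J = {c,d,m,n}" "K = {a,b,m,n}" "L = {a,b,c,d}"
      unfolding JKL R [symmetric] x using d by auto
    ultimately show ?thesis unfolding matching_zero_def by simp
  qed
  thus False using nz by blast
qed

lemma matching_nonzero: "\<not> matching_zero 2 3 4 5 6 7"
proof
  assume z: "matching_zero 2 3 4 5 6 7"
  \<comment> \<open>Linear extension from even basis spinors in one argument, used below for each of
    the four arguments.\<close>
  have step: "f x = 0" if x: "x \<in> half_spin" and f: "\<And>x y a. x \<in> half_spin \<Longrightarrow> y \<in> half_spin \<Longrightarrow> f (a *s x + 1 *s y) = a * f x + 1 * f y"
    "\<And>I. even (card I) \<Longrightarrow> f (e_basis I) = 0" for f :: "spinor \<Rightarrow> complex" and x
  proof -
    have z: "0 \<in> half_spin" by (simp add: half_spin_def)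
    have f0: "f 0 = 0" using f(1) [OF z z, of 1] by simp
    have "f (\<Sum>I\<in>A. x $ I *s e_basis I) = 0 \<and> (\<Sum>I\<in>A. x $ I *s e_basis I) \<in> half_spin" for A
    proof (induction A rule: infinite_finite_induct)
      case (insert I A)
      show ?case
      proof (cases "even (card I)")
        case True
        thus ?thesis using insert f(1) [OF e_basis_half_spin [OF True] conjunct2 [OF insert.IH], of "x $ I"] f(2) [OF True] e_basis_half_spin [OF True]
          by (simp add: half_spin_subspace)
      next
        case False
        hence "x $ I = 0" using x by (simp add: half_spin_def)
        thus ?thesis using insert by simp
      qed
    qed (use f0 z in simp_all)
    thus ?thesis using spinor_expand [of x] by metis
  qed
  have "q x y z w = 0" if h: "x \<in> half_spin" "y \<in> half_spin" "z \<in> half_spin" "w \<in> half_spin" for x y z w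
  proof -
    note v = vanishes_all [OF z, unfolded vanishes_def] and eb = e_basis_half_spin
    have 1: "q x (e_basis J) (e_basis K) (e_basis L) = 0" if "even (card J)" "even (card K)" "even (card L)" for J K L
      by (rule step [OF h(1), where f = "\<lambda>x. q x (e_basis J) (e_basis K) (e_basis L)"]) (assumption | rule eb that q_linear(1) v)+
    have 2: "q x y (e_basis K) (e_basis L) = 0" if "even (card K)" "even (card L)" for K L
      by (rule step [OF h(2), where f = "\<lambda>y. q x y (e_basis K) (e_basis L)"]) (assumption | rule h eb that q_linear(2) 1)+
    have 3: "q x y z (e_basis L) = 0" if "even (card L)" for L
      by (rule step [OF h(3), where f = "\<lambda>z. q x y z (e_basis L)"]) (assumption | rule h eb that q_linear(3) 2)+
    show ?thesis
      by (rule step [OF h(4), where f = "\<lambda>w. q x y z w"]) (assumption | rule h eb q_linear(4) 3)+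
  qed
  thus False using q_nonzero by blast
qed

lemma q_matching_nonzero: "q (e_basis {}) (e_basis {4,5,6,7}) (e_basis {2,3,6,7}) (e_basis {2,3,4,5}) \<noteq> 0"
  using matching_nonzero unfolding matching_zero_def vanishes_def .

end

section \<open>Linear algebra of function spaces and representations\<close>

text \<open>Stated for a family, so that distinctness of its members follows along with
  independence.\<close>

lemma independent_family:
  fixes v :: "nat \<Rightarrow> 'a \<Rightarrow> complex"
  assumes "\<And>c k. (\<Sum>k<n. fun_scale (c k) (v k)) = 0 \<Longrightarrow> k < n \<Longrightarrow> c k = 0"
  shows "fun_vs.independent (v ` {..<n})" "card (v ` {..<n}) = n"
proof -
  have inj: "inj_on v {..<n}"
  proof (rule inj_onI, rule ccontr)
    fix i j assume ij: "i \<in> {..<n}" "j \<in> {..<n}" "v i = v j" "i \<noteq> j"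
    let ?c = "\<lambda>k. if k = i then 1 else if k = j then -1 else (0::complex)"
    have "(\<Sum>k<n. fun_scale (?c k) (v k)) = (\<Sum>k\<in>{i,j}. fun_scale (?c k) (v k))"
      using ij by (intro sum.mono_neutral_right) auto
    also have "\<dots> = 0" using ij by simp
    finally show False using assms [of ?c i] ij by simp
  qed
  thus "card (v ` {..<n}) = n" by (simp add: card_image)
  show "fun_vs.independent (v ` {..<n})"
  proof
    assume "fun_vs.dependent (v ` {..<n})"
    then obtain u k where u: "(\<Sum>x\<in>v ` {..<n}. fun_scale (u x) x) = 0" and k: "k < n" "u (v k) \<noteq> 0"
      by (auto simp: fun_vs.dependent_finite)
    have "(\<Sum>k<n. fun_scale (u (v k)) (v k)) = 0" using u inj by (simp add: sum.reindex)
    from assms [OF this k(1)] k(2) show False by simp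
  qed
qed

text \<open>Otherwise \<open>x\<close> would enlarge \<open>S\<close> to an independent set with
  more elements than the spanning set \<open>E\<close>.\<close>

lemma independent_spanning:
  assumes "fun_vs.independent S" "S \<subseteq> fun_vs.span E" "finite E" "card E \<le> card S" "x \<in> fun_vs.span E"
  shows "x \<in> fun_vs.span S"
proof (rule ccontr)
  assume "x \<notin> fun_vs.span S"
  hence i: "fun_vs.independent (insert x S)" "x \<notin> S"
    using assms(1) fun_vs.independent_insertI fun_vs.span_base by blast+
  have "finite S" using fun_vs.independent_span_bound [OF assms(3,1,2)] by simp
  moreover have "card (insert x S) \<le> card E"
    using fun_vs.independent_span_bound [OF assms(3) i(1)] assms(2,5) by blast
  ultimately show False using i(2) assms(4) by simp
qed

lemma isomorphic_reps_sym:
  assumes "representation G act1 M1" "isomorphic_reps G act1 M1 act2 M2"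
  shows "isomorphic_reps G act2 M2 act1 M1"
proof -
  obtain \<phi> where \<phi>: "linear_on fun_scale fun_scale M1 \<phi>" "bij_betw \<phi> M1 M2"
    "\<And>g x. g \<in> carrier G \<Longrightarrow> x \<in> M1 \<Longrightarrow> \<phi> (act1 g x) = act2 g (\<phi> x)"
    using assms(2) unfolding isomorphic_reps_def by blast
  have sub: "fun_vs.subspace M1" and st: "\<And>g x. g \<in> carrier G \<Longrightarrow> x \<in> M1 \<Longrightarrow> act1 g x \<in> M1"
    using assms(1) unfolding representation_def by blast+
  let ?\<psi> = "inv_into M1 \<phi>"
  have inj: "inj_on \<phi> M1" and im: "\<phi> ` M1 = M2" using \<phi>(2) by (auto simp: bij_betw_def)
  have i: "?\<psi> y \<in> M1" "\<phi> (?\<psi> y) = y" if "y \<in> M2" for y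
    using that im by (auto simp: inv_into_into f_inv_into_f)
  have e: "?\<psi> y = x" if "x \<in> M1" "\<phi> x = y" for x y using that inj by auto
  have "linear_on fun_scale fun_scale M2 ?\<psi>"
    unfolding linear_on_def
  proof (intro conjI ballI allI)
    fix x y assume "x \<in> M2" "y \<in> M2"
    thus "?\<psi> (x + y) = ?\<psi> x + ?\<psi> y"
      using \<phi>(1) i sub by (intro e) (auto simp: linear_on_def intro: fun_vs.subspace_add)
  next
    fix c x assume "x \<in> M2"
    thus "?\<psi> (fun_scale c x) = fun_scale c (?\<psi> x)"
      using \<phi>(1) i sub by (intro e) (auto simp: linear_on_def intro: fun_vs.subspace_scale)
  qed
  moreover have "bij_betw ?\<psi> M2 M1" using \<phi>(2) by (rule bij_betw_inv_into)
  moreover have "?\<psi> (act2 g y) = act1 g (?\<psi> y)" if "g \<in> carrier G" "y \<in> M2" for g y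
    using that i \<phi>(3) st by (intro e) auto
  ultimately show ?thesis unfolding isomorphic_reps_def by blast
qed

text \<open>A stable subspace of the target is pulled back along the isomorphism.\<close>

lemma irreducible_rep_isomorphic:
  assumes irr: "irreducible_rep G act1 M1" and iso: "isomorphic_reps G act1 M1 act2 M2" and rep: "representation G act2 M2"
  shows "irreducible_rep G act2 M2"
proof -
  obtain \<phi> where \<phi>: "linear_on fun_scale fun_scale M1 \<phi>" "bij_betw \<phi> M1 M2"
    "\<And>g x. g \<in> carrier G \<Longrightarrow> x \<in> M1 \<Longrightarrow> \<phi> (act1 g x) = act2 g (\<phi> x)"
    using iso unfolding isomorphic_reps_def by blast
  have rep1: "representation G act1 M1" and ne: "M1 \<noteq> {0}"
    and min: "\<And>U. fun_vs.subspace U \<Longrightarrow> U \<subseteq> M1 \<Longrightarrow> (\<And>g x. g \<in> carrier G \<Longrightarrow> x \<in> U \<Longrightarrow> act1 g x \<in> U) \<Longrightarrow> U = {0} \<or> U = M1"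
    using irr unfolding irreducible_rep_def by blast+
  have sub: "fun_vs.subspace M1" and st: "\<And>g x. g \<in> carrier G \<Longrightarrow> x \<in> M1 \<Longrightarrow> act1 g x \<in> M1"
    using rep1 unfolding representation_def by blast+
  have inj: "inj_on \<phi> M1" and im: "\<phi> ` M1 = M2" using \<phi>(2) by (auto simp: bij_betw_def)
  have 0: "0 \<in> M1" using sub by (rule fun_vs.subspace_0)
  have "\<phi> (fun_scale 0 0) = fun_scale 0 (\<phi> 0)" using \<phi>(1) 0 unfolding linear_on_def by blast
  hence \<phi>0: "\<phi> 0 = 0" by simp
  have "M2 \<noteq> {0}"
  proof
    assume M2: "M2 = {0}"
    have "x = 0" if "x \<in> M1" for x
    proof -
      have "\<phi> x \<in> M2" using that im by blast
      hence "\<phi> x = \<phi> 0" using M2 \<phi>0 by simp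
      thus ?thesis using inj that 0 by (simp add: inj_on_eq_iff)
    qed
    thus False using ne 0 by blast
  qed
  moreover have "U = {0} \<or> U = M2" if U: "fun_vs.subspace U" "U \<subseteq> M2" "\<forall>g\<in>carrier G. act2 g ` U \<subseteq> U" for U
  proof -
    define X where "X = {x \<in> M1. \<phi> x \<in> U}"
    have "fun_vs.subspace X" unfolding X_def
      using sub U(1) \<phi>(1) \<phi>0 unfolding fun_vs.subspace_def linear_on_def by simp
    moreover have "X \<subseteq> M1" by (auto simp: X_def)
    moreover have "act1 g x \<in> X" if "g \<in> carrier G" "x \<in> X" for g x
      using that st \<phi>(3) U(3) unfolding X_def by (auto simp: image_subset_iff)
    ultimately have "X = {0} \<or> X = M1" by (rule min)
    moreover have "U = \<phi> ` X" using U(2) im unfolding X_def by blast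
    ultimately show ?thesis using \<phi>0 im by auto
  qed
  ultimately show ?thesis unfolding irreducible_rep_def using rep by blast
qed

section \<open>The Weyl group and its action on the Cartan subspace\<close>

lemma id_normalizer [simp]: "id \<in> normalizer_c" by (simp add: normalizer_c_def)

lemma normalizer_Spin: "g \<in> normalizer_c \<Longrightarrow> g \<in> Spin" by (simp add: normalizer_c_def)

lemma normalizer_inv: assumes "g \<in> normalizer_c" shows "spin_inv g \<in> normalizer_c"
proof -
  have g: "g \<in> Spin" "g ` cartan = cartan" using assms by (auto simp: normalizer_c_def)
  have "spin_inv g ` g ` cartan = cartan" using spin_inv_apply(1) [OF g(1)] by (simp add: image_image)
  thus ?thesis using g spin_inv(1) by (simp add: normalizer_c_def)
qed

lemma normalizer_subgroup: "subgroup normalizer_c Spin16"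
  by (rule Spin.subgroupI) (auto simp: normalizer_Spin normalizer_inv normalizer_comp intro: id_normalizer)

lemma centralizer_subset: "centralizer_c \<subseteq> normalizer_c"
  by (auto simp: centralizer_c_def normalizer_c_def)

lemma centralizer_subgroup: "subgroup centralizer_c Spin16"
proof (rule Spin.subgroupI)
  show "centralizer_c \<noteq> {}" using Spin_id unfolding centralizer_c_def by fastforce
  fix g assume g: "g \<in> centralizer_c"
  have "spin_inv g h = h" if "h \<in> cartan" for h
    using g that spin_inv_apply(1) [of g h] by (simp add: centralizer_c_def)
  thus "spin_inv g \<in> centralizer_c" using g by (simp add: centralizer_c_def spin_inv(1))
qed (auto simp: centralizer_c_def Spin_comp)

lemma centralizer_normal: "centralizer_c \<lhd> Spin16\<lparr>carrier := normalizer_c\<rparr>"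
proof (rule group.normal_invI)
  show "group (Spin16\<lparr>carrier := normalizer_c\<rparr>)" by (rule Spin.subgroup_imp_group [OF normalizer_subgroup])
  show "subgroup centralizer_c (Spin16\<lparr>carrier := normalizer_c\<rparr>)"
    by (rule Spin.subgroup_incl [OF centralizer_subgroup normalizer_subgroup centralizer_subset])
  fix g c assume "g \<in> carrier (Spin16\<lparr>carrier := normalizer_c\<rparr>)" "c \<in> centralizer_c"
  hence g: "g \<in> normalizer_c" and c: "c \<in> Spin" "\<And>h. h \<in> cartan \<Longrightarrow> c h = h" by (auto simp: centralizer_c_def)
  have "(g \<circ> c \<circ> spin_inv g) h = h" if "h \<in> cartan" for h
  proof -
    have "spin_inv g h \<in> cartan" using normalizer_inv [OF g] that by (auto simp: normalizer_c_def)
    thus ?thesis using c(2) spin_inv_apply(2) [OF normalizer_Spin [OF g]] by simp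
  qed
  moreover have "g \<circ> c \<circ> spin_inv g \<in> Spin" by (intro Spin_comp spin_inv(1) normalizer_Spin g c)
  ultimately have "g \<circ> c \<circ> spin_inv g \<in> centralizer_c" by (simp add: centralizer_c_def)
  thus "g \<otimes>\<^bsub>Spin16\<lparr>carrier := normalizer_c\<rparr>\<^esub> c \<otimes>\<^bsub>Spin16\<lparr>carrier := normalizer_c\<rparr>\<^esub> inv\<^bsub>Spin16\<lparr>carrier := normalizer_c\<rparr>\<^esub> g \<in> centralizer_c"
    using Spin.m_inv_consistent [OF normalizer_subgroup g] by simp
qed

lemma group_Weyl: "group Weyl"
  unfolding Weyl_def by (rule normal.factorgroup_is_group [OF centralizer_normal])

interpretation Weyl: group Weyl by (rule group_Weyl)

lemma Weyl_iff: "w \<in> carrier Weyl \<longleftrightarrow> (\<exists>g\<in>normalizer_c. w = (\<lambda>c. c \<circ> g) ` centralizer_c)"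
  by (auto simp: Weyl_def FactGroup_def RCOSETS_def r_coset_def)

lemma Weyl_element: "g \<in> normalizer_c \<Longrightarrow> \<exists>w\<in>carrier Weyl. g \<in> w"
proof -
  assume g: "g \<in> normalizer_c"
  have "id \<in> centralizer_c" by (simp add: centralizer_c_def)
  hence "g \<in> (\<lambda>c. c \<circ> g) ` centralizer_c" by (metis id_comp image_eqI)
  moreover have "(\<lambda>c. c \<circ> g) ` centralizer_c \<in> carrier Weyl" using g by (auto simp: Weyl_iff)
  ultimately show ?thesis by (rule bexI)
qed

lemma Weyl_normalizer: assumes "w \<in> carrier Weyl" "n \<in> w" shows "n \<in> normalizer_c"
proof -
  obtain g where g: "g \<in> normalizer_c" "w = (\<lambda>c. c \<circ> g) ` centralizer_c" using assms(1) unfolding Weyl_iff by blast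
  then obtain c where "c \<in> centralizer_c" "n = c \<circ> g" using assms(2) by blast
  thus ?thesis using normalizer_comp g(1) centralizer_subset by blast
qed

text \<open>Two representatives differ by a left factor that is trivial on the Cartan
  subspace.\<close>

lemma Weyl_agree: assumes "w \<in> carrier Weyl" "m \<in> w" "n \<in> w" "h \<in> cartan" shows "m h = n h"
proof -
  obtain g where g: "g \<in> normalizer_c" "w = (\<lambda>c. c \<circ> g) ` centralizer_c" using assms(1) unfolding Weyl_iff by blast
  have "g h \<in> cartan" using g(1) assms(4) by (auto simp: normalizer_c_def)
  thus ?thesis using assms(2,3) unfolding g(2) by (auto simp: centralizer_c_def)
qed

lemma Weyl_mult: "m \<in> v \<Longrightarrow> n \<in> w \<Longrightarrow> m \<circ> n \<in> v \<otimes>\<^bsub>Weyl\<^esub> w"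
  by (auto simp: Weyl_def FactGroup_def set_mult_def)

lemma Weyl_one: "\<one>\<^bsub>Weyl\<^esub> = centralizer_c"
  by (simp add: Weyl_def FactGroup_def)

lemma Weyl_inv:
  assumes "w \<in> carrier Weyl" "m \<in> w" "n \<in> inv\<^bsub>Weyl\<^esub> w" "h \<in> cartan" shows "m (n h) = h"
proof -
  have "m \<circ> n \<in> w \<otimes>\<^bsub>Weyl\<^esub> inv\<^bsub>Weyl\<^esub> w" using assms by (intro Weyl_mult)
  hence "m \<circ> n \<in> centralizer_c" using assms(1) by (simp add: Weyl_one)
  thus ?thesis using assms(4) by (auto simp: centralizer_c_def)
qed

lemma coset_rep: assumes "w \<in> carrier Weyl" shows "coset_rep w \<in> w"
proof -
  have "id \<in> centralizer_c" by (simp add: centralizer_c_def)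
  hence "w \<noteq> {}" using assms unfolding Weyl_iff by blast
  thus ?thesis unfolding coset_rep_def by (simp add: some_in_eq)
qed

section \<open>Coordinate matrices of normalizer elements\<close>

definition cmap :: "(spinor \<Rightarrow> spinor) \<Rightarrow> (8 \<Rightarrow> complex) \<Rightarrow> 8 \<Rightarrow> complex" where
  "cmap g z = coord (g (cpt z))"

lemma cmap: assumes "g \<in> normalizer_c" shows "cpt (cmap g z) = g (cpt z)"
proof -
  have "g (cpt z) \<in> cartan" using assms cpt_in_cartan unfolding normalizer_c_def by blast
  thus ?thesis by (simp add: cmap_def cpt_coord)
qed

lemma cmap_comp: "h \<in> normalizer_c \<Longrightarrow> cmap (g \<circ> h) = cmap g \<circ> cmap h"
  by (simp add: fun_eq_iff cmap_def cmap [unfolded cmap_def])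

lemma cmap_id [simp]: "cmap id = id" by (simp add: fun_eq_iff cmap_def)

lemma cartan_maps_cmap: "A \<in> cartan_maps \<Longrightarrow> \<exists>g\<in>normalizer_c. A = cmap g"
proof -
  assume "A \<in> cartan_maps"
  then obtain g where g: "g \<in> normalizer_c" "\<And>z. g (cpt z) = cpt (A z)" by (auto simp: cartan_maps_def)
  have "A = cmap g" by (simp add: fun_eq_iff cmap_def g(2))
  thus ?thesis using g(1) by blast
qed

lemma cmap_orthogonal:
  assumes "g \<in> normalizer_c" shows "(\<Sum>k\<in>UNIV. cmap g z k * cmap g y k) = (\<Sum>k\<in>UNIV. z k * y k)"
  using Spin_form [OF normalizer_Spin [OF assms], of "cpt z" "cpt y"]
  unfolding cmap [OF assms, symmetric] spinor_form_cpt by simp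

text \<open>For an orthogonal map, composing a linear form with the inverse means applying the map
  to its coefficient vector.\<close>

lemma pow4_cmap:
  assumes "m \<in> normalizer_c" "n \<in> normalizer_c" "\<And>h. h \<in> cartan \<Longrightarrow> m (n h) = h"
  shows "pow4 a \<circ> cmap n = pow4 (cmap m a)"
proof
  fix z
  have "cmap m (cmap n z) = z"
    using assms(3) [of "cpt z"] cmap [OF assms(2), of z] unfolding cmap_def [of m] by simp
  hence "(\<Sum>k\<in>UNIV. cmap m a k * z k) = (\<Sum>k\<in>UNIV. a k * cmap n z k)"
    using cmap_orthogonal [OF assms(1), of a "cmap n z"] by simp
  thus "(pow4 a \<circ> cmap n) z = pow4 (cmap m a) z" by (simp add: pow4_def)
qed

section \<open>Forms as functions on the Cartan subspace\<close>

definition lift :: "form \<Rightarrow> spinor \<Rightarrow> complex" where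
  "lift F = on_cartan (\<lambda>h. F (coord h))"

lemma lift_cpt [simp]: "lift F (cpt z) = F z" by (simp add: lift_def on_cartan_def)

lemma lift_linear: "lift (F + F') = lift F + lift F'" "lift (fun_scale c F) = fun_scale c (lift F)" "lift 0 = 0"
  by (auto simp: lift_def on_cartan_def fun_eq_iff fun_scale_def)

lemma lift_inject: "lift F = lift F' \<longleftrightarrow> F = F'"
  by (metis ext lift_cpt)

lemma on_cartan_lift: "on_cartan f = lift (\<lambda>z. f (cpt z))"
  by (auto simp: lift_def on_cartan_def fun_eq_iff cpt_coord)

lemma lift_subspace: assumes "fun_vs.subspace U" shows "fun_vs.subspace (lift ` U)"
  unfolding fun_vs.subspace_def
proof (intro conjI ballI allI)
  show "0 \<in> lift ` U" using fun_vs.subspace_0 [OF assms] lift_linear(3) by (metis image_eqI)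
  fix x y assume "x \<in> lift ` U" "y \<in> lift ` U"
  thus "x + y \<in> lift ` U" using fun_vs.subspace_add [OF assms] lift_linear(1) by (metis (no_types, lifting) image_iff)
next
  fix c x assume "x \<in> lift ` U"
  thus "fun_scale c x \<in> lift ` U" using fun_vs.subspace_scale [OF assms] lift_linear(2) by (metis (no_types, lifting) image_iff)
qed

lemma W_poly_act_linear:
  "W_poly_act w (f + f') = W_poly_act w f + W_poly_act w f'" "W_poly_act w (fun_scale c f) = fun_scale c (W_poly_act w f)"
  by (auto simp: W_poly_act_def on_cartan_def fun_eq_iff fun_scale_def)

text \<open>Frees the action from the chosen representative: any element of the inverse coset
  computes it.\<close>

lemma W_poly_act_lift:
  assumes "w \<in> carrier Weyl" "n \<in> inv\<^bsub>Weyl\<^esub> w"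
  shows "W_poly_act w (lift F) = lift (F \<circ> cmap n)"
proof -
  have i: "inv\<^bsub>Weyl\<^esub> w \<in> carrier Weyl" using assms(1) by simp
  have "lift F (coset_rep (inv\<^bsub>Weyl\<^esub> w) (cpt z)) = F (cmap n z)" for z
    using Weyl_agree [OF i coset_rep [OF i] assms(2) cpt_in_cartan] cmap [OF Weyl_normalizer [OF i assms(2)], of z]
    by (metis lift_cpt)
  thus ?thesis by (simp add: W_poly_act_def on_cartan_lift o_def)
qed

lemma W_poly_act_one: "W_poly_act \<one>\<^bsub>Weyl\<^esub> (lift F) = lift F"
proof -
  have "id \<in> inv\<^bsub>Weyl\<^esub> \<one>\<^bsub>Weyl\<^esub>" unfolding Weyl.inv_one by (simp add: Weyl_one centralizer_c_def)
  from W_poly_act_lift [OF Weyl.one_closed this] show ?thesis by simp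
qed

lemma W_poly_act_mult:
  assumes v: "v \<in> carrier Weyl" and w: "w \<in> carrier Weyl"
  shows "W_poly_act (v \<otimes>\<^bsub>Weyl\<^esub> w) (lift F) = W_poly_act v (W_poly_act w (lift F))"
proof -
  let ?m = "coset_rep (inv\<^bsub>Weyl\<^esub> v)" and ?n = "coset_rep (inv\<^bsub>Weyl\<^esub> w)"
  have i: "inv\<^bsub>Weyl\<^esub> v \<in> carrier Weyl" "inv\<^bsub>Weyl\<^esub> w \<in> carrier Weyl" using v w by auto
  note m = coset_rep [OF i(1)] and n = coset_rep [OF i(2)]
  have "?n \<circ> ?m \<in> inv\<^bsub>Weyl\<^esub> (v \<otimes>\<^bsub>Weyl\<^esub> w)"
    using Weyl_mult [OF n m] v w by (simp add: Weyl.inv_mult_group)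
  from W_poly_act_lift [OF _ this] have "W_poly_act (v \<otimes>\<^bsub>Weyl\<^esub> w) (lift F) = lift (F \<circ> cmap ?n \<circ> cmap ?m)"
    using v w Weyl_normalizer [OF i(1) m] by (simp add: cmap_comp o_assoc)
  also have "\<dots> = W_poly_act v (W_poly_act w (lift F))"
    using W_poly_act_lift [OF w n] W_poly_act_lift [OF v m] by simp
  finally show ?thesis .
qed

lemma flip_spin_coset: assumes "w \<in> carrier Weyl" "flip_spin k \<in> w" shows "coset_rep w (cpt z) = cpt (flip k z)"
  using Weyl_agree [OF assms(1) coset_rep [OF assms(1)] assms(2), of "cpt z"] by (simp add: flip_spin_cpt)

lemma reflection_form_coord: "reflection_form (\<lambda>h. coord h k)"
proof -
  obtain w where w: "w \<in> carrier Weyl" "flip_spin k \<in> w" using Weyl_element [OF flip_in(1)] by blast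
  have "coset_rep w h = h \<longleftrightarrow> coord h k = 0" if "h \<in> cartan" for h
  proof -
    have "coset_rep w h = cpt (flip k (coord h))" using flip_spin_coset [OF w, of "coord h"] cpt_coord [OF that] by simp
    moreover have "cpt (flip k (coord h)) = h \<longleftrightarrow> flip k (coord h) = coord h" using cpt_coord [OF that] by (metis coord_cpt)
    moreover have "flip k (coord h) = coord h \<longleftrightarrow> coord h k = 0" by (auto simp: flip_def fun_eq_iff)
    ultimately show ?thesis by simp
  qed
  hence "{h \<in> cartan. coset_rep w h = h} = {h \<in> cartan. coord h k = 0}" by blast
  moreover have "coord (H k) k \<noteq> 0" unfolding cpt_single [symmetric] by simp
  moreover have "linear_on (*s) (*) cartan (\<lambda>h. coord h k)" by (simp add: linear_on_def coord_linear)
  ultimately show ?thesis unfolding reflection_form_def using w(1) H_in_cartan by blast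
qed

section \<open>The span of the fourth powers\<close>

lemma quartics_sum:
  assumes "finite A" "\<And>i. i \<in> A \<Longrightarrow> f i \<in> quartics" shows "(\<lambda>z. \<Sum>i\<in>A. f i z) \<in> quartics"
  using assms
proof (induction A rule: finite_induct)
  case empty
  have "(\<lambda>z. 0) \<in> quartics" using fun_vs.subspace_0 [OF quartics_subspace] by (simp add: zero_fun_def)
  thus ?case by simp
next
  case (insert i A)
  hence "f i + (\<lambda>z. \<Sum>i\<in>A. f i z) \<in> quartics" by (intro fun_vs.subspace_add [OF quartics_subspace]) auto
  moreover have "f i + (\<lambda>z. \<Sum>i\<in>A. f i z) = (\<lambda>z. \<Sum>i\<in>insert i A. f i z)" using insert by (auto simp: fun_eq_iff)
  ultimately show ?case by simp
qed

lemma quartics_scale: "F \<in> quartics \<Longrightarrow> (\<lambda>z. c * F z) \<in> quartics"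
  using fun_vs.subspace_scale [OF quartics_subspace, of F c] by (simp add: fun_scale_def)

lemma form_inner_commute: "form_inner F F' = form_inner F' F"
  by (simp add: form_inner_def mult.commute)

lemma coeff0246_prod: "coeff0246 prod0246 = 1"
proof -
  have "alt_part k prod0246 = prod0246" if "k \<in> {0,2,4,6}" for k
    by (rule alt_part_eq) (use that in \<open>auto simp: prod0246_def flip_def\<close>)
  hence "fun_scale (coeff0246 prod0246) prod0246 = prod0246"
    using alt_part_0246 [OF prod0246_quartics] by simp
  from fun_cong [OF this, of "\<lambda>_. 1"] show ?thesis by (simp add: fun_scale_def prod0246_def)
qed

context equivariant_map
begin

definition fourth :: "(8 \<Rightarrow> complex) \<Rightarrow> V \<times> V \<Rightarrow> complex" where
  "fourth z = G (cpt z) (cpt z) (cpt z) (cpt z)"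

lemma cpt_half_spin [simp]: "cpt z \<in> half_spin" "H k \<in> half_spin"
  by (simp_all add: cartan_half_spin)

lemma Theta2_fourth: "Theta2 \<Gamma> = fun_vs.span (range fourth)"
proof -
  have "{\<Gamma> (sym_embed h ^ 4) | h. h \<in> cartan} = range fourth"
    unfolding fourth_def G_def sym_embed_power4 by (auto simp: image_iff) (metis cpt_coord)
  thus ?thesis by (simp add: Theta2_def)
qed

lemma fourth_Theta2 [simp]: "fourth z \<in> Theta2 \<Gamma>"
  unfolding Theta2_fourth by (simp add: fun_vs.span_base)

lemma Theta2_subspace: "fun_vs.subspace (Theta2 \<Gamma>)" unfolding Theta2_fourth by simp

lemma Theta2_induct [consumes 1, case_names zero step]:
  assumes "s \<in> Theta2 \<Gamma>" "P 0" "\<And>c z s. s \<in> Theta2 \<Gamma> \<Longrightarrow> P s \<Longrightarrow> P (fun_scale c (fourth z) + s)" shows "P s"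
proof -
  have "s \<in> Theta2 \<Gamma> \<and> P s" using assms(1) unfolding Theta2_fourth
  proof (induction rule: fun_vs.span_induct_alt)
    case base show ?case using assms(2) fun_vs.span_zero by blast
  next
    case (step c x y)
    then obtain z where "x = fourth z" by blast
    thus ?case using step assms(3) [of y c z] unfolding Theta2_fourth
      by (metis fun_vs.span_add fun_vs.span_scale fun_vs.span_base)
  qed
  thus ?thesis by blast
qed

lemma coordinate_quartics_fourth:
  "coordinate_quartics \<Gamma> = {lift (\<lambda>z. \<phi> (fourth z)) | \<phi>. linear_on fun_scale (*) (Theta2 \<Gamma>) \<phi>}"
  by (simp add: coordinate_quartics_def on_cartan_lift fourth_def G_def sym_embed_power4)

lemma section_act_fourth: "g \<in> normalizer_c \<Longrightarrow> section_act g (fourth z) = fourth (cmap g z)"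
  by (simp add: fourth_def cmap G_equivariant [symmetric] normalizer_Spin)

lemma section_act_zero: "section_act g 0 = 0" by (auto simp: section_act_def)

lemma section_act_Theta2: assumes "g \<in> normalizer_c" "s \<in> Theta2 \<Gamma>" shows "section_act g s \<in> Theta2 \<Gamma>"
  using assms(2)
proof (induction rule: Theta2_induct)
  case zero show ?case unfolding section_act_zero by (rule fun_vs.subspace_0 [OF Theta2_subspace])
next
  case (step c z s)
  thus ?case unfolding section_act_linear section_act_fourth [OF assms(1)]
    by (intro fun_vs.subspace_add [OF Theta2_subspace] fun_vs.subspace_scale [OF Theta2_subspace] fourth_Theta2)
qed

text \<open>\<open>Theta2\<close> is spanned by images of points of the Cartan subspace, so an
  element acts on it through its restriction to that subspace.\<close>

lemma section_act_agree:
  assumes "m \<in> normalizer_c" "n \<in> normalizer_c" "\<And>h. h \<in> cartan \<Longrightarrow> m h = n h" "s \<in> Theta2 \<Gamma>"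
  shows "section_act m s = section_act n s"
  using assms(4)
proof (induction rule: Theta2_induct)
  case zero show ?case by (simp only: section_act_zero)
next
  case (step c z s)
  have "cmap m z = cmap n z" using assms(3) by (simp add: cmap_def)
  thus ?case by (simp only: section_act_linear section_act_fourth [OF assms(1)] section_act_fourth [OF assms(2)] step(2))
qed

lemma representation_Theta2: "representation Weyl W_section_act (Theta2 \<Gamma>)"
  unfolding representation_def
proof (intro conjI ballI)
  show "fun_vs.subspace (Theta2 \<Gamma>)" by (rule Theta2_subspace)
next
  fix w assume w: "w \<in> carrier Weyl"
  show "linear_on fun_scale fun_scale (Theta2 \<Gamma>) (W_section_act w)"
    by (simp add: linear_on_def W_section_act_def section_act_linear)
  show "W_section_act w ` Theta2 \<Gamma> \<subseteq> Theta2 \<Gamma>"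
    unfolding W_section_act_def using section_act_Theta2 Weyl_normalizer [OF w coset_rep [OF w]] by blast
next
  fix s assume s: "s \<in> Theta2 \<Gamma>"
  have o: "\<one>\<^bsub>Weyl\<^esub> \<in> carrier Weyl" "id \<in> \<one>\<^bsub>Weyl\<^esub>" by (rule Weyl.one_closed) (simp add: Weyl_one centralizer_c_def)
  have "section_act (coset_rep \<one>\<^bsub>Weyl\<^esub>) s = section_act id s"
    using o s Weyl_agree [OF o(1) coset_rep [OF o(1)] o(2)] Weyl_normalizer [OF o(1) coset_rep [OF o(1)]]
    by (intro section_act_agree) auto
  thus "W_section_act \<one>\<^bsub>Weyl\<^esub> s = s" by (simp add: W_section_act_def)
next
  fix v w s assume v: "v \<in> carrier Weyl" and w: "w \<in> carrier Weyl" and s: "s \<in> Theta2 \<Gamma>"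
  have vw: "v \<otimes>\<^bsub>Weyl\<^esub> w \<in> carrier Weyl" using v w by simp
  note r = coset_rep [OF v] coset_rep [OF w] coset_rep [OF vw]
  note n = Weyl_normalizer [OF v r(1)] Weyl_normalizer [OF w r(2)] Weyl_normalizer [OF vw r(3)]
  have "section_act (coset_rep (v \<otimes>\<^bsub>Weyl\<^esub> w)) s = section_act (coset_rep v \<circ> coset_rep w) s"
    using Weyl_agree [OF vw r(3) Weyl_mult [OF r(1,2)]] n s normalizer_comp by (intro section_act_agree) auto
  thus "W_section_act (v \<otimes>\<^bsub>Weyl\<^esub> w) s = W_section_act v (W_section_act w s)"
    using n by (simp add: W_section_act_def section_act_comp normalizer_Spin)
qed

lemma Theta2_avg_basis: "Theta2 \<Gamma> \<subseteq> fun_vs.span avg_basis"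
proof -
  have "fourth z \<in> fun_vs.span avg_basis" for z
  proof (rule invariant_in_span_avg_basis)
    show "fourth z \<in> quadric_sections" unfolding fourth_def by (rule G_quadric) simp_all
    fix g assume "fixes_cartan g"
    hence "g \<in> Spin" "g (cpt z) = cpt z" by (auto simp: fixes_cartan_def)
    thus "section_act g (fourth z) = fourth z"
      using G_equivariant [of g "cpt z" "cpt z" "cpt z" "cpt z"] by (simp add: fourth_def)
  qed
  thus ?thesis unfolding Theta2_fourth by (intro fun_vs.span_minimal) auto
qed

lemma G_cpt:
  assumes "y \<in> half_spin" "u \<in> half_spin" "v \<in> half_spin"
  shows "G (cpt z) y u v p = (\<Sum>k\<in>UNIV. z k * G (H k) y u v p)"
proof -
  have "(\<Sum>k\<in>A. z k *s H k) \<in> half_spin \<and> G (\<Sum>k\<in>A. z k *s H k) y u v p = (\<Sum>k\<in>A. z k * G (H k) y u v p)" if "finite A" for A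
    using that
  proof (induction A rule: finite_induct)
    case empty
    have "G (0 *s H 0) y u v = fun_scale 0 (G (H 0) y u v)" by (rule G_linear1) (use assms in auto)
    thus ?case by (simp add: half_spin_def)
  next
    case (insert k A)
    thus ?case using assms by (simp add: G_linear1 half_spin_subspace fun_scale_def)
  qed
  from this [of UNIV] show ?thesis by (simp add: cpt_def)
qed

lemma fourth_quartics: "(\<lambda>z. fourth z p) \<in> quartics"
proof -
  have "fourth z p = (\<Sum>i\<in>UNIV. \<Sum>j\<in>UNIV. \<Sum>k\<in>UNIV. \<Sum>l\<in>UNIV. G (H l) (H k) (H j) (H i) p * (z i * z j * z k * z l))" for z
  proof -
    have 2: "G x (cpt z) u v p = (\<Sum>j\<in>UNIV. z j * G x (H j) u v p)" if "x \<in> half_spin" "u \<in> half_spin" "v \<in> half_spin" for x u v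
      unfolding G_commute(1) [of x] by (rule G_cpt) (fact that)+
    have 3: "G x y (cpt z) v p = (\<Sum>j\<in>UNIV. z j * G x y (H j) v p)" if "x \<in> half_spin" "y \<in> half_spin" "v \<in> half_spin" for x y v
      unfolding G_commute(2) [of x y] by (rule 2) (fact that)+
    have 4: "G x y u (cpt z) p = (\<Sum>j\<in>UNIV. z j * G x y u (H j) p)" if "x \<in> half_spin" "y \<in> half_spin" "u \<in> half_spin" for x y u
      unfolding G_commute(3) [of x y u] by (rule 3) (fact that)+
    show ?thesis unfolding fourth_def
      by (simp add: 2 3 4 G_cpt sum_distrib_left mult_ac)
  qed
  moreover have "(\<lambda>z. \<Sum>i\<in>UNIV. \<Sum>j\<in>UNIV. \<Sum>k\<in>UNIV. \<Sum>l\<in>UNIV. G (H l) (H k) (H j) (H i) p * (z i * z j * z k * z l)) \<in> quartics"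
    by (intro quartics_sum quartics_scale monomial_quartics finite)
  ultimately show ?thesis by simp
qed

section \<open>The value at the standard frame\<close>

abbreviation frame :: "V \<times> V" where "frame \<equiv> (ebas 0, ebas 1)"

text \<open>For these \<open>k\<close> the form \<open>dot k\<close> vanishes at 1 as well as at 0,
  so \<open>flip_spin k\<close> scales both frame vectors by exp(i pi/4). The Pluecker vector scales
  by i and a quadric section by -1.\<close>

lemma fourth_flip: assumes "k \<in> {0,2,4,6}" shows "fourth (flip k z) frame = - fourth z frame"
proof -
  define s where "s = (\<lambda>i. cis (if dot k i then - (pi/8) else pi/8))"
  have s: "s i \<noteq> 0" for i by (simp add: s_def)
  have g: "flip_spin k = torus s" by (simp add: flip_spin_def s_def)
  have "\<not> dot k 1" using assms by auto
  hence s01: "s 0 = cis (pi/8)" "s 1 = cis (pi/8)" by (simp_all add: s_def)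
  have "cmap (flip_spin k) z = flip k z" by (simp add: cmap_def flip_spin_cpt)
  hence a: "fourth (flip k z) = section_act (torus s) (fourth z)"
    using section_act_fourth [OF flip_in(1)] g by metis
  have q: "fourth (flip k z) \<in> quadric_sections" unfolding fourth_def by (rule G_quadric) simp_all
  have "fourth (flip k z) ((s 0)\<^sup>2 *s ebas 0, 0 *s ebas 0 + (s 1)\<^sup>2 *s ebas 1) = ((s 0)\<^sup>2 * (s 1)\<^sup>2)\<^sup>2 * fourth (flip k z) frame"
    by (rule quadric_section_frame [OF q]) (simp_all add: s)
  moreover have "((s 0)\<^sup>2 * (s 1)\<^sup>2)\<^sup>2 = -1"
  proof -
    have "((s 0)\<^sup>2 * (s 1)\<^sup>2)\<^sup>2 = cis (pi/8) ^ 8" unfolding s01 by algebra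
    also have "\<dots> = cis (8 * (pi/8))" by (simp only: Complex.DeMoivre) simp
    finally show ?thesis by simp
  qed
  moreover have "fourth (flip k z) ((s 0)\<^sup>2 *s ebas 0, (s 1)\<^sup>2 *s ebas 1) = fourth z frame"
    unfolding a by (rule section_act_eval) (rule torus_in_Spin torus_intertwines(1) [of s] s)+
  ultimately show ?thesis by (simp add: eq_neg_iff_add_eq_0 add.commute)
qed

text \<open>By \<open>weights\<close> only index sets omitting 0 contribute. Each \<open>H k\<close>
  has one such summand, so one of the sixteen terms survives, and it belongs to the matching
  23|45|67.\<close>

lemma q_H_nonzero: "q (H 0) (H 2) (H 4) (H 6) \<noteq> 0"
proof -
  have z: "q (e_basis I) (e_basis J) (e_basis K) (e_basis L) = 0"
    if "even (card I)" "even (card J)" "even (card K)" "even (card L)" "0 \<in> I \<or> 0 \<in> J \<or> 0 \<in> K \<or> 0 \<in> L" for I J K L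
    using weights(1) [OF that(1-4), of 0] that(5) unfolding vanishes_def by blast
  have H: "H 0 = e_basis {0,1,2,3,4,5,6,7} + e_basis {}" "H 2 = e_basis {0,1,4,5} + e_basis {2,3,6,7}"
    "H 4 = e_basis {0,1,2,3} + e_basis {4,5,6,7}" "H 6 = e_basis {0,1,6,7} + e_basis {2,3,4,5}"
    unfolding H_def by (rule arg_cong2 [of _ _ _ _ "\<lambda>A B. e_basis A + e_basis B"]; rule set_8_eqI; auto)+
  have e: "even (card {0,1,2,3,4,5,6,7::8})" "even (card ({}::8 set))" "even (card {0,1,4,5::8})" "even (card {2,3,6,7::8})"
    "even (card {0,1,2,3::8})" "even (card {4,5,6,7::8})" "even (card {0,1,6,7::8})" "even (card {2,3,4,5::8})" by simp_all
  note h = e [THEN e_basis_half_spin]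
  have add: "q (x + x') y u v = q x y u v + q x' y u v" "q y (x + x') u v = q y x u v + q y x' u v"
    "q y u (x + x') v = q y u x v + q y u x' v" "q y u v (x + x') = q y u v x + q y u v x'"
    if "x \<in> half_spin" "x' \<in> half_spin" "y \<in> half_spin" "u \<in> half_spin" "v \<in> half_spin" for x x' y u v
    using q_linear [of x x' y u v 1 1] that by simp_all
  have "q (H 0) (H 2) (H 4) (H 6) = q (e_basis {}) (e_basis {2,3,6,7}) (e_basis {4,5,6,7}) (e_basis {2,3,4,5})"
    unfolding H by (simp only: add h half_spin_subspace z e insert_iff simp_thms add_0_left add_0_right)
  thus ?thesis using q_matching_nonzero q_commute(2) by metis
qed

text \<open>Vanishing on the diagonal of the Cartan subspace would, by polarization in three stages,
  make \<open>q\<close> vanish at any four of its points.\<close>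

lemma fourth_frame_nonzero: "\<exists>z. fourth z frame \<noteq> 0"
proof (rule ccontr)
  assume "\<nexists>z. fourth z frame \<noteq> 0"
  hence "fourth z frame = 0" for z by blast
  hence 0: "q x x x x = 0" if "x \<in> cartan" for x
    using cpt_coord [OF that] unfolding fourth_def q_def by metis
  have sub: "x + c *s y \<in> cartan" if "x \<in> cartan" "y \<in> cartan" for x y c
    using that unfolding cartan_def by (intro vec.span_add vec.span_scale)
  note cs = cartan_half_spin
  have lin: "q (x + c *s y) u v w = q x u v w + c * q y u v w" "q u (x + c *s y) v w = q u x v w + c * q u y v w"
    "q u v (x + c *s y) w = q u v x w + c * q u v y w" "q u v w (x + c *s y) = q u v w x + c * q u v w y"
    if "x \<in> cartan" "y \<in> cartan" "u \<in> cartan" "v \<in> cartan" "w \<in> cartan" for x y u v w c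
    using q_linear [of x y u v w 1 c] that cs by simp_all
  have 1: "q x x x y = 0" if xy: "x \<in> cartan" "y \<in> cartan" for x y
  proof -
    have cm: "q x x y x = q x x x y" "q x y x x = q x x x y" "q y x x x = q x x x y"
      "q x y x y = q x x y y" "q y x x y = q x x y y" "q x y y x = q x x y y" "q y x y x = q x x y y" "q y y x x = q x x y y"
      "q y x y y = q x y y y" "q y y x y = q x y y y" "q y y y x = q x y y y"
      using q_commute by metis+
    have E: "4 * c * q x x x y + 6 * c ^ 2 * q x x y y + 4 * c ^ 3 * q x y y y = 0" for c
    proof -
      have "q (x + c *s y) (x + c *s y) (x + c *s y) (x + c *s y) = 0" by (rule 0 [OF sub [OF xy]])
      hence "q x x x x + 4 * c * q x x x y + 6 * c ^ 2 * q x x y y + 4 * c ^ 3 * q x y y y + c ^ 4 * q y y y y = 0"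
        by (simp add: lin xy sub cm power4_eq_xxxx power3_eq_cube power2_eq_square algebra_simps)
      thus ?thesis by (simp add: 0 xy)
    qed
    \<comment> \<open>The values at 1 and -1 separate the even term from the odd ones, and the value
      at 2 separates the linear from the cubic term.\<close>
    have "12 * q x x x y = 0" using E [of 1] E [of "-1"] E [of 2] by simp algebra
    thus ?thesis by simp
  qed
  have 2: "q x x z y = 0" if xy: "x \<in> cartan" "y \<in> cartan" "z \<in> cartan" for x y z
  proof -
    have cm: "q x z x y = q x x z y" "q z x x y = q x x z y" "q z x z y = q x z z y" "q z z x y = q x z z y"
      using q_commute by metis+
    have E: "3 * c * q x x z y + 3 * c ^ 2 * q x z z y = 0" for c
    proof -
      have "q (x + c *s z) (x + c *s z) (x + c *s z) y = 0" by (rule 1 [OF sub [OF xy(1,3)] xy(2)])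
      hence "q x x x y + 3 * c * q x x z y + 3 * c ^ 2 * q x z z y + c ^ 3 * q z z z y = 0"
        by (simp add: lin xy sub cm power3_eq_cube power2_eq_square algebra_simps)
      thus ?thesis by (simp add: 1 xy)
    qed
    have "6 * q x x z y = 0" using E [of 1] E [of "-1"] by simp
    thus ?thesis by simp
  qed
  have "q x w z y = 0" if xy: "x \<in> cartan" "w \<in> cartan" "z \<in> cartan" "y \<in> cartan" for x w z y
  proof -
    have "q (x + 1 *s w) (x + 1 *s w) z y = 0" by (rule 2 [OF sub [OF xy(1,2)] xy(4,3)])
    hence "q x w z y + q w x z y = 0" using 2 [OF xy(1,4,3)] 2 [OF xy(2,4,3)] by (simp only: lin xy sub) (simp add: add.commute)
    hence "2 * q x w z y = 0" using q_commute(1) [of w x z y] by simp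
    thus ?thesis by simp
  qed
  thus False using q_H_nonzero H_in_cartan by blast
qed

lemma fourth_frame: "\<exists>c. c \<noteq> 0 \<and> (\<forall>z. fourth z frame = c * prod0246 z)"
proof -
  let ?F = "\<lambda>z. fourth z frame"
  have "alt_part k ?F = ?F" if "k \<in> {0,2,4,6}" for k by (rule alt_part_eq) (rule fourth_flip [OF that])
  hence eq: "?F = fun_scale (coeff0246 ?F) prod0246" using alt_part_0246 [OF fourth_quartics, of frame] by simp
  have "fourth z frame = coeff0246 ?F * prod0246 z" for z
    by (rule fun_cong [OF eq, of z, unfolded fun_scale_def])
  thus ?thesis using fourth_frame_nonzero by (metis mult_zero_left)
qed

end

section \<open>Irreducibility and the isomorphism\<close>

lemma sum_fun_apply: "(\<Sum>i\<in>A. f i) x = (\<Sum>i\<in>A. f i x :: complex)"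
  by (induction A rule: infinite_finite_induct) auto

lemma length_basis_forms: "length basis_forms = 84" by (simp add: basis_forms_def)

lemma basis_forms_nth: "k < 84 \<Longrightarrow> basis_forms ! k \<in> macdonald"
  using basis_forms_macdonald nth_mem [of k basis_forms] length_basis_forms by auto

lemma macdonald_subsetI:
  assumes "fun_vs.subspace U" "prod0246 \<in> U" "\<And>F k. F \<in> U \<Longrightarrow> F \<circ> flip k \<in> U"
    "\<And>F v c. F \<in> U \<Longrightarrow> v \<noteq> 0 \<Longrightarrow> F \<circ> blk_refl v c \<in> U"
  shows "macdonald \<subseteq> U"
proof -
  have "F \<in> U" if "F \<in> orbit" for F using that by induction (assumption | rule assms(2-4))+
  thus ?thesis unfolding macdonald_def by (intro fun_vs.span_minimal) (use assms(1) in auto)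
qed

lemma lift_prod0246_nonzero: "lift prod0246 \<noteq> 0"
proof
  assume "lift prod0246 = 0"
  hence "lift prod0246 (cpt (\<lambda>_. 1)) = 0" by simp
  thus False by (simp add: prod0246_def)
qed

lemma fun_scale_apply: "fun_scale c f x = c * f x"
  by (simp add: fun_scale_def)

context equivariant_map
begin

section \<open>Quartics obtained from linear forms on sections\<close>

abbreviation M :: "(spinor \<Rightarrow> complex) set" where "M \<equiv> coordinate_quartics \<Gamma>"

lemma coordinate_quarticsI: "linear_on fun_scale (*) (Theta2 \<Gamma>) \<phi> \<Longrightarrow> lift (\<lambda>z. \<phi> (fourth z)) \<in> M"
  unfolding coordinate_quartics_fourth by blast

lemma coordinate_quarticsE:
  assumes "f \<in> M" obtains \<phi> where "linear_on fun_scale (*) (Theta2 \<Gamma>) \<phi>" "f = lift (\<lambda>z. \<phi> (fourth z))"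
  using assms unfolding coordinate_quartics_fourth by blast

lemma coordinate_subspace: "fun_vs.subspace M"
  unfolding fun_vs.subspace_def
proof (intro conjI ballI allI)
  have "lift (\<lambda>z. (\<lambda>_. 0) (fourth z)) \<in> M" by (rule coordinate_quarticsI) (simp add: linear_on_def)
  moreover have "(0 :: form) = (\<lambda>z. 0)" by (simp add: fun_eq_iff)
  ultimately show "0 \<in> M" using lift_linear(3) by metis
next
  fix f f' assume "f \<in> M" "f' \<in> M"
  then obtain \<phi> \<phi>' where p: "linear_on fun_scale (*) (Theta2 \<Gamma>) \<phi>" "f = lift (\<lambda>z. \<phi> (fourth z))"
    "linear_on fun_scale (*) (Theta2 \<Gamma>) \<phi>'" "f' = lift (\<lambda>z. \<phi>' (fourth z))" by (metis coordinate_quarticsE)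
  have "lift (\<lambda>z. (\<lambda>s. \<phi> s + \<phi>' s) (fourth z)) \<in> M"
    by (rule coordinate_quarticsI) (use p(1,3) in \<open>simp add: linear_on_def algebra_simps\<close>)
  thus "f + f' \<in> M" unfolding p lift_linear(1) [symmetric] by (simp add: plus_fun_def)
next
  fix c f assume "f \<in> M"
  then obtain \<phi> where p: "linear_on fun_scale (*) (Theta2 \<Gamma>) \<phi>" "f = lift (\<lambda>z. \<phi> (fourth z))" by (rule coordinate_quarticsE)
  have "lift (\<lambda>z. (\<lambda>s. c * \<phi> s) (fourth z)) \<in> M"
    by (rule coordinate_quarticsI) (use p(1) in \<open>simp add: linear_on_def algebra_simps\<close>)
  thus "fun_scale c f \<in> M" unfolding p lift_linear(2) [symmetric] by (simp add: fun_scale_def)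
qed

lemma coordinate_comp:
  assumes "lift F \<in> M" "n \<in> normalizer_c" shows "lift (F \<circ> cmap n) \<in> M"
proof -
  obtain \<phi> where p: "linear_on fun_scale (*) (Theta2 \<Gamma>) \<phi>" "lift F = lift (\<lambda>z. \<phi> (fourth z))"
    using assms(1) by (rule coordinate_quarticsE)
  have "lift (\<lambda>z. (\<lambda>s. \<phi> (section_act n s)) (fourth z)) \<in> M"
    by (rule coordinate_quarticsI) (use p(1) assms(2) in \<open>simp add: linear_on_def section_act_linear section_act_Theta2\<close>)
  thus ?thesis using p(2) assms(2) by (simp add: lift_inject o_def section_act_fourth)
qed

lemma macdonald_coordinate: assumes "F \<in> macdonald" shows "lift F \<in> M"
proof -
  have "macdonald \<subseteq> {F. lift F \<in> M}"
  proof (rule macdonald_subsetI)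
    show "fun_vs.subspace {F. lift F \<in> M}"
      using coordinate_subspace unfolding fun_vs.subspace_def by (auto simp: lift_linear)
    obtain c where c: "c \<noteq> 0" "\<And>z. fourth z frame = c * prod0246 z" using fourth_frame by blast
    have "lift (\<lambda>z. (\<lambda>s. s frame / c) (fourth z)) \<in> M"
      by (rule coordinate_quarticsI) (simp add: linear_on_def fun_scale_def add_divide_distrib)
    moreover have "(\<lambda>z. fourth z frame / c) = prod0246" using c by (simp add: fun_eq_iff)
    ultimately show "prod0246 \<in> {F. lift F \<in> M}" by simp
  next
    fix F k assume "F \<in> {F. lift F \<in> M}"
    thus "F \<circ> flip k \<in> {F. lift F \<in> M}"
      using cartan_maps_cmap [OF flip_in(2)] coordinate_comp by (metis mem_Collect_eq)
  next
    fix F :: form and v :: 8 and c assume "F \<in> {F. lift F \<in> M}" "v \<noteq> 0"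
    thus "F \<circ> blk_refl v c \<in> {F. lift F \<in> M}"
      using cartan_maps_cmap [OF blk_refl_in_cartan_maps] coordinate_comp by (metis mem_Collect_eq)
  qed
  thus ?thesis using assms by blast
qed

lemma linear_on_sum:
  assumes "linear_on fun_scale (*) S \<phi>" "fun_vs.subspace S" "finite B" "B \<subseteq> S"
  shows "\<phi> (\<Sum>b\<in>B. fun_scale (r b) b) = (\<Sum>b\<in>B. r b * \<phi> b)"
  using assms(3,4)
proof (induction B rule: finite_induct)
  case empty
  have "\<phi> (fun_scale 0 0) = 0 * \<phi> 0" using assms(1) fun_vs.subspace_0 [OF assms(2)] unfolding linear_on_def by blast
  thus ?case by (simp only: sum.empty fun_vs.scale_zero_left mult_zero_left)
next
  case (insert b B)
  have "(\<Sum>b\<in>B. fun_scale (r b) b) \<in> S" "fun_scale (r b) b \<in> S"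
    using insert.prems assms(2) by (auto intro!: fun_vs.subspace_sum fun_vs.subspace_scale)
  hence "\<phi> (fun_scale (r b) b + (\<Sum>b\<in>B. fun_scale (r b) b)) = \<phi> (fun_scale (r b) b) + \<phi> (\<Sum>b\<in>B. fun_scale (r b) b)"
    using assms(1) unfolding linear_on_def by blast
  moreover have "b \<in> S" "B \<subseteq> S" using insert.prems by auto
  moreover have "\<phi> (fun_scale (r b) b) = r b * \<phi> b" using assms(1) \<open>b \<in> S\<close> unfolding linear_on_def by blast
  ultimately show ?case by (simp only: sum.insert [OF insert.hyps] insert.IH)
qed

lemma basis_forms_lift:
  "fun_vs.independent ((\<lambda>k. lift (basis_forms ! k)) ` {..<84})" "card ((\<lambda>k. lift (basis_forms ! k)) ` {..<84}) = 84"
  "(\<lambda>k. lift (basis_forms ! k)) ` {..<84} \<subseteq> M"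
proof -
  have c: "c k = 0" if s: "(\<Sum>k<84. fun_scale (c k) (lift (basis_forms ! k))) = 0" and "k < 84" for c k
  proof (rule basis_forms_independent)
    fix z
    show "(\<Sum>k<84. c k * (basis_forms ! k) z) = 0"
      using fun_cong [OF s, of "cpt z"] by (simp add: sum_fun_apply fun_scale_def)
  qed fact
  show "fun_vs.independent ((\<lambda>k. lift (basis_forms ! k)) ` {..<84})" "card ((\<lambda>k. lift (basis_forms ! k)) ` {..<84}) = 84"
    using independent_family [where n = 84 and v = "\<lambda>k. lift (basis_forms ! k)"] c by blast+
  show "(\<lambda>k. lift (basis_forms ! k)) ` {..<84} \<subseteq> M"
    using basis_forms_nth macdonald_coordinate by auto
qed

text \<open>The coordinate functions of a basis of \<open>Theta2\<close> span the quartics, which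
  contain 84 independent forms, while the averaged products bound the size of the basis by 84.
  Equality throughout leaves no quartic outside \<open>macdonald\<close>.\<close>

lemma dimension: "fun_vs.dim (Theta2 \<Gamma>) = 84" "M = lift ` macdonald"
proof -
  let ?S = "(\<lambda>k. lift (basis_forms ! k)) ` {..<84}"
  obtain B where B: "B \<subseteq> Theta2 \<Gamma>" "fun_vs.independent B" "Theta2 \<Gamma> \<subseteq> fun_vs.span B" "card B = fun_vs.dim (Theta2 \<Gamma>)"
    using fun_vs.basis_exists by blast
  have fB: "finite B" "card B \<le> 84"
    using fun_vs.independent_span_bound [OF avg_basis_card(1) B(2) subset_trans [OF B(1) Theta2_avg_basis]] avg_basis_card(2) by auto
  \<comment> \<open>The coordinates of \<open>fourth z\<close> with respect to \<open>B\<close>, as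
    quartics in \<open>z\<close>.\<close>
  define e where "e = (\<lambda>b. lift (\<lambda>z. fun_vs.representation B (fourth z) b))"
  have ME: "M \<subseteq> fun_vs.span (e ` B)"
  proof
    fix f assume "f \<in> M"
    then obtain \<phi> where p: "linear_on fun_scale (*) (Theta2 \<Gamma>) \<phi>" "f = lift (\<lambda>z. \<phi> (fourth z))" by (rule coordinate_quarticsE)
    have "\<phi> (fourth z) = (\<Sum>b\<in>B. fun_vs.representation B (fourth z) b * \<phi> b)" for z
    proof -
      have "fourth z \<in> fun_vs.span B" using B(3) by auto
      from fun_vs.sum_representation_eq [OF B(2) this fB(1) order_refl]
      have "\<phi> (fourth z) = \<phi> (\<Sum>b\<in>B. fun_scale (fun_vs.representation B (fourth z) b) b)" by simp
      also have "\<dots> = (\<Sum>b\<in>B. fun_vs.representation B (fourth z) b * \<phi> b)"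
        by (rule linear_on_sum [OF p(1) Theta2_subspace fB(1) B(1)])
      finally show ?thesis .
    qed
    hence f: "f = (\<Sum>b\<in>B. fun_scale (\<phi> b) (e b))"
      unfolding p(2) by (auto simp: fun_eq_iff sum_fun_apply fun_scale_def e_def lift_def on_cartan_def mult.commute)
    show "f \<in> fun_vs.span (e ` B)"
      unfolding f by (rule fun_vs.span_sum) (rule fun_vs.span_scale, rule fun_vs.span_base, rule imageI)
  qed
  have fE: "finite (e ` B)" "card (e ` B) \<le> card B" using fB(1) by (auto intro: card_image_le)
  have SE: "?S \<subseteq> fun_vs.span (e ` B)" using ME basis_forms_lift(3) by blast
  have "84 \<le> card (e ` B)"
    using fun_vs.independent_span_bound [OF fE(1) basis_forms_lift(1) SE] basis_forms_lift(2) by simp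
  thus "fun_vs.dim (Theta2 \<Gamma>) = 84" using fE(2) fB(2) B(4) by simp
  have "M \<subseteq> fun_vs.span ?S"
    using independent_spanning [OF basis_forms_lift(1) SE fE(1)] ME fE(2) fB(2) basis_forms_lift(2) by auto
  also have "\<dots> \<subseteq> lift ` macdonald"
    by (rule fun_vs.span_minimal [OF _ lift_subspace [OF macdonald_subspace]]) (auto intro: basis_forms_nth)
  finally show "M = lift ` macdonald" using macdonald_coordinate by blast
qed

lemma W_poly_act_coordinate: assumes "w \<in> carrier Weyl" "f \<in> M" shows "W_poly_act w f \<in> M"
proof -
  obtain F where F: "f = lift F" using assms(2) unfolding dimension(2) by blast
  have i: "inv\<^bsub>Weyl\<^esub> w \<in> carrier Weyl" using assms(1) by simp
  show ?thesis
    unfolding F W_poly_act_lift [OF assms(1) coset_rep [OF i]]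
    by (rule coordinate_comp [OF assms(2) [unfolded F] Weyl_normalizer [OF i coset_rep [OF i]]])
qed

lemma representation_coordinate: "representation Weyl W_poly_act M"
  unfolding representation_def
  using coordinate_subspace W_poly_act_coordinate W_poly_act_linear W_poly_act_one W_poly_act_mult
  by (auto simp: linear_on_def dimension(2))

text \<open>Passes from stability under cosets to stability under explicit coordinate maps; the
  inverse coset is taken because \<open>W_poly_act\<close> composes with inverses.\<close>

lemma cmap_closed:
  assumes "\<And>w f. w \<in> carrier Weyl \<Longrightarrow> f \<in> U \<Longrightarrow> W_poly_act w f \<in> U" "A \<in> cartan_maps" "lift F \<in> U"
  shows "lift (F \<circ> A) \<in> U"
proof -
  obtain g where g: "g \<in> normalizer_c" "A = cmap g" using cartan_maps_cmap assms(2) by blast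
  obtain w where w: "w \<in> carrier Weyl" "g \<in> w" using Weyl_element [OF g(1)] by blast
  have "W_poly_act (inv\<^bsub>Weyl\<^esub> w) (lift F) = lift (F \<circ> cmap g)"
    using w by (intro W_poly_act_lift) simp_all
  thus ?thesis using assms(1) [OF _ assms(3), of "inv\<^bsub>Weyl\<^esub> w"] w(1) g(2) by simp
qed

lemma irreducible_coordinate: "irreducible_rep Weyl W_poly_act M"
  unfolding irreducible_rep_def
proof (intro conjI allI impI)
  show "representation Weyl W_poly_act M" by (rule representation_coordinate)
  have p: "prod0246 \<in> macdonald" using orbit_prod by (simp add: macdonald_def fun_vs.span_base)
  show "M \<noteq> {0}" using macdonald_coordinate [OF p] lift_prod0246_nonzero by blast
  fix U assume "fun_vs.subspace U \<and> U \<subseteq> M \<and> (\<forall>w\<in>carrier Weyl. W_poly_act w ` U \<subseteq> U)"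
  hence U: "fun_vs.subspace U" "U \<subseteq> M" "\<And>w f. w \<in> carrier Weyl \<Longrightarrow> f \<in> U \<Longrightarrow> W_poly_act w f \<in> U" by blast+
  show "U = {0} \<or> U = M"
  proof (rule disjCI)
    assume "U \<noteq> M"
    define X where "X = {F \<in> macdonald. lift F \<in> U}"
    have X: "fun_vs.subspace X"
      using macdonald_subspace U(1) unfolding X_def fun_vs.subspace_def by (auto simp: lift_linear)
    have closed: "F \<circ> flip k \<in> X" "v \<noteq> 0 \<Longrightarrow> F \<circ> blk_refl v c \<in> X" if "F \<in> X" for F k v c
      using that macdonald_comp cmap_closed [OF U(3)] flip_in(2) blk_refl_in_cartan_maps unfolding X_def by auto
    have XU: "U = lift ` X" using U(2) unfolding X_def dimension(2) by blast
    have "F = 0" if F: "F \<in> X" for F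
    proof (rule ccontr)
      assume "F \<noteq> 0"
      have "prod0246 \<in> X" by (rule macdonald_generated [OF X _ closed F \<open>F \<noteq> 0\<close>]) (auto simp: X_def)
      hence "macdonald \<subseteq> X" by (rule macdonald_subsetI [OF X _ closed])
      thus False using \<open>U \<noteq> M\<close> U(2) XU dimension(2) by blast
    qed
    moreover have "0 \<in> X" by (rule fun_vs.subspace_0 [OF X])
    ultimately show "U = {0}" unfolding XU using lift_linear(3) by (auto simp: image_iff)
  qed
qed

text \<open>The translates of the product of four coordinates span a nonzero stable subspace, which
  by irreducibility is everything.\<close>

lemma Macdonald_coordinate: "Macdonald_rep M"
  unfolding Macdonald_rep_def
proof (intro conjI exI [of _ "[\<lambda>h. coord h 0, \<lambda>h. coord h 2, \<lambda>h. coord h 4, \<lambda>h. coord h 6]"])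
  show "irreducible_rep Weyl W_poly_act M" by (rule irreducible_coordinate)
  show "\<forall>\<l>\<in>set [\<lambda>h. coord h 0, \<lambda>h. coord h 2, \<lambda>h. coord h 4, \<lambda>h. coord h 6]. reflection_form \<l>"
    by (simp add: reflection_form_coord)
  have l: "on_cartan (\<lambda>h. \<Prod>\<l>\<leftarrow>[\<lambda>h. coord h 0, \<lambda>h. coord h 2, \<lambda>h. coord h 4, \<lambda>h. coord h 6]. \<l> h) = lift prod0246"
    by (simp add: lift_def prod0246_def [abs_def] mult.assoc)
  let ?X = "fun_vs.span {W_poly_act w (lift prod0246) | w. w \<in> carrier Weyl}"
  have p: "lift prod0246 \<in> M"
    using orbit_prod by (intro macdonald_coordinate) (simp add: macdonald_def fun_vs.span_base)
  have sub: "?X \<subseteq> M" using W_poly_act_coordinate p coordinate_subspace by (intro fun_vs.span_minimal) auto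
  have "W_poly_act v f \<in> ?X" if v: "v \<in> carrier Weyl" and "f \<in> ?X" for v f
    using that(2)
  proof (induction rule: fun_vs.span_induct_alt)
    case base
    have "W_poly_act v (fun_scale 0 0) = fun_scale 0 (W_poly_act v 0)" by (rule W_poly_act_linear)
    hence "W_poly_act v 0 = 0" by (simp only: fun_vs.scale_zero_left)
    thus ?case by (simp only: fun_vs.span_zero)
  next
    case (step c x y)
    then obtain w where w: "w \<in> carrier Weyl" "x = W_poly_act w (lift prod0246)" by blast
    have "W_poly_act v x = W_poly_act (v \<otimes>\<^bsub>Weyl\<^esub> w) (lift prod0246)" using w v by (simp add: W_poly_act_mult)
    moreover have "v \<otimes>\<^bsub>Weyl\<^esub> w \<in> carrier Weyl" using v w by simp
    ultimately have x: "W_poly_act v x \<in> ?X" by (intro fun_vs.span_base) blast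
    show ?case unfolding W_poly_act_linear by (rule fun_vs.span_add [OF fun_vs.span_scale [OF x] step(2)])
  qed
  hence "?X = {0} \<or> ?X = M"
    using irreducible_coordinate sub unfolding irreducible_rep_def by (auto simp: image_subset_iff)
  moreover have "lift prod0246 \<in> ?X"
    using W_poly_act_one [of prod0246] by (intro fun_vs.span_base) (metis (mono_tags, lifting) Weyl.one_closed mem_Collect_eq)
  moreover note lift_prod0246_nonzero
  ultimately show "M = fun_vs.span {W_poly_act w (on_cartan (\<lambda>h. \<Prod>\<l>\<leftarrow>[\<lambda>h. coord h 0, \<lambda>h. coord h 2, \<lambda>h. coord h 4, \<lambda>h. coord h 6]. \<l> h)) | w. w \<in> carrier Weyl}"
    unfolding l by blast
qed

text \<open>The pairing identifies a quartic form with a section: since the normalizer acts on the Cartan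
  subspace by orthogonal maps, it sends the fourth power of the linear form with coefficients
  \<open>a\<close> to the fourth power of the vector with coordinates \<open>a\<close>, equivariantly.\<close>

definition pairing :: "form \<Rightarrow> V \<times> V \<Rightarrow> complex" where
  "pairing F = (\<lambda>p. form_inner F (\<lambda>z. fourth z p))"

lemma pairing_linear:
  "pairing (F + F') = pairing F + pairing F'" "pairing (fun_scale c F) = fun_scale c (pairing F)" "pairing 0 = 0"
proof -
  have e: "pairing F p = form_inner (\<lambda>z. fourth z p) F" for F p
    unfolding pairing_def by (rule form_inner_commute)
  show "pairing (F + F') = pairing F + pairing F'" "pairing (fun_scale c F) = fun_scale c (pairing F)" "pairing 0 = 0"
    by (rule ext, simp only: e form_inner_linear plus_fun_apply fun_scale_apply zero_fun_apply)+
qed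

lemma pairing_pow4: "pairing (pow4 a) = fourth a"
  by (simp add: fun_eq_iff pairing_def form_inner_commute [of "pow4 a"] form_inner_pow4 fourth_quartics)

lemma pairing_Theta2: "F \<in> quartics \<Longrightarrow> pairing F \<in> Theta2 \<Gamma>"
proof (induction rule: quartics_induct)
  case zero show ?case unfolding pairing_linear by (rule fun_vs.subspace_0 [OF Theta2_subspace])
next
  case (step c a F)
  thus ?case unfolding pairing_linear pairing_pow4
    by (intro fun_vs.subspace_add [OF Theta2_subspace] fun_vs.subspace_scale [OF Theta2_subspace] fourth_Theta2)
qed

text \<open>On \<open>pow4 a\<close> both sides equal \<open>fourth (cmap m a)\<close>.\<close>

lemma pairing_equivariant:
  assumes "m \<in> normalizer_c" "n \<in> normalizer_c" "\<And>h. h \<in> cartan \<Longrightarrow> m (n h) = h" "F \<in> quartics"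
  shows "pairing (F \<circ> cmap n) = section_act m (pairing F)"
  using assms(4)
proof (induction rule: quartics_induct)
  case zero show ?case by (simp only: comp_linear pairing_linear section_act_zero)
next
  case (step c a F)
  have "pow4 a \<circ> cmap n = pow4 (cmap m a)" by (rule pow4_cmap [OF assms(1,2)]) (rule assms(3))
  thus ?case
    by (simp only: comp_linear pairing_linear section_act_linear pairing_pow4 section_act_fourth [OF assms(1)] step(2))
qed

text \<open>The kernel is stable under the generating reflections, so a nonzero kernel would contain
  \<open>prod0246\<close>. But the pairing of \<open>prod0246\<close>, evaluated at the standard
  frame, is \<open>c / 24\<close>.\<close>

lemma pairing_inject: assumes "F \<in> macdonald" "pairing F = 0" shows "F = 0"
proof (rule ccontr)
  assume "F \<noteq> 0"
  define X where "X = {F \<in> macdonald. pairing F = 0}"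
  have X: "fun_vs.subspace X"
    using macdonald_subspace unfolding X_def fun_vs.subspace_def by (auto simp: pairing_linear)
  have cl: "pairing (F \<circ> A) = 0" if A: "A \<in> cartan_maps" and F: "F \<in> X" for A F
  proof -
    obtain g where g: "g \<in> normalizer_c" "A = cmap g" using cartan_maps_cmap [OF A] by blast
    have "F \<in> quartics" using F macdonald_quartics by (auto simp: X_def)
    hence "pairing (F \<circ> cmap g) = section_act (spin_inv g) (pairing F)"
      using g by (intro pairing_equivariant) (simp_all add: normalizer_inv spin_inv_apply normalizer_Spin)
    moreover have "pairing F = 0" using F by (simp only: X_def mem_Collect_eq)
    ultimately show ?thesis by (simp only: g(2) section_act_zero)
  qed
  have closed: "F \<circ> flip k \<in> X" "v \<noteq> 0 \<Longrightarrow> F \<circ> blk_refl v c \<in> X" if "F \<in> X" for F k v c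
    using that macdonald_comp cl flip_in(2) blk_refl_in_cartan_maps by (auto simp: X_def)
  have "prod0246 \<in> X" by (rule macdonald_generated [OF X _ closed, of F]) (use assms \<open>F \<noteq> 0\<close> in \<open>auto simp: X_def\<close>)
  hence "pairing prod0246 frame = 0" by (simp add: X_def)
  moreover obtain c where c: "c \<noteq> 0" "\<And>z. fourth z frame = c * prod0246 z" using fourth_frame by blast
  have "(\<lambda>z. fourth z frame) = fun_scale c prod0246" using c(2) by (simp add: fun_eq_iff fun_scale_def)
  hence "pairing prod0246 frame = c * (1 / 24)"
    by (simp add: pairing_def form_inner_linear form_inner_prod0246 prod0246_quartics coeff0246_prod)
  ultimately show False using c(1) by simp
qed

text \<open>By injectivity the 84 basis forms give 84 independent sections, within the span of at
  most 84 averaged products.\<close>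

lemma pairing_surj: "Theta2 \<Gamma> \<subseteq> pairing ` macdonald"
proof -
  let ?v = "\<lambda>k. pairing (basis_forms ! k)"
  have comb: "(\<Sum>k\<in>A. fun_scale (c k) (?v k)) = pairing (\<Sum>k\<in>A. fun_scale (c k) (basis_forms ! k))" for c A
  proof (induction A rule: infinite_finite_induct)
    case (infinite A) show ?case by (simp only: sum.infinite [OF infinite] pairing_linear)
  next
    case empty show ?case by (simp only: sum.empty pairing_linear)
  next
    case (insert k A) thus ?case by (simp only: sum.insert [OF insert.hyps] pairing_linear insert.IH)
  qed
  have ind: "c k = 0" if s: "(\<Sum>k<84. fun_scale (c k) (?v k)) = 0" and k: "k < 84" for c k
  proof (rule basis_forms_independent [OF _ k])
    fix z
    have "(\<Sum>k<84. fun_scale (c k) (basis_forms ! k)) \<in> macdonald"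
      by (intro fun_vs.subspace_sum [OF macdonald_subspace] fun_vs.subspace_scale [OF macdonald_subspace] basis_forms_nth) simp
    hence "(\<Sum>k<84. fun_scale (c k) (basis_forms ! k)) = 0" using s unfolding comb by (rule pairing_inject)
    from fun_cong [OF this, of z] show "(\<Sum>k<84. c k * (basis_forms ! k) z) = 0"
      by (simp add: sum_fun_apply fun_scale_def)
  qed
  have v: "fun_vs.independent (?v ` {..<84})" "card (?v ` {..<84}) = 84"
    using independent_family [where n = 84 and v = ?v] ind by blast+
  have "?v ` {..<84} \<subseteq> Theta2 \<Gamma>" using pairing_Theta2 basis_forms_nth macdonald_quartics by auto
  hence vE: "?v ` {..<84} \<subseteq> fun_vs.span avg_basis" using Theta2_avg_basis by blast
  have "Theta2 \<Gamma> \<subseteq> fun_vs.span (?v ` {..<84})"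
    using independent_spanning [OF v(1) vE avg_basis_card(1)] avg_basis_card(2) v(2) Theta2_avg_basis by auto
  also have "\<dots> \<subseteq> pairing ` macdonald"
  proof (rule fun_vs.span_minimal)
    show "?v ` {..<84} \<subseteq> pairing ` macdonald" using basis_forms_nth by auto
    show "fun_vs.subspace (pairing ` macdonald)"
      unfolding fun_vs.subspace_def
    proof (intro conjI ballI allI)
      show "0 \<in> pairing ` macdonald" using imageI [OF fun_vs.subspace_0 [OF macdonald_subspace], of pairing] unfolding pairing_linear(3) .
      fix x y assume "x \<in> pairing ` macdonald" "y \<in> pairing ` macdonald"
      then obtain F F' where F: "F \<in> macdonald" "F' \<in> macdonald" and xy: "x = pairing F" "y = pairing F'" by blast
      show "x + y \<in> pairing ` macdonald"
        unfolding xy pairing_linear(1) [symmetric] by (rule imageI) (rule fun_vs.subspace_add [OF macdonald_subspace F])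
    next
      fix c x assume "x \<in> pairing ` macdonald"
      then obtain F where F: "F \<in> macdonald" and x: "x = pairing F" by blast
      show "fun_scale c x \<in> pairing ` macdonald"
        unfolding x pairing_linear(2) [symmetric] by (rule imageI) (rule fun_vs.subspace_scale [OF macdonald_subspace F])
    qed
  qed
  finally show ?thesis .
qed

lemma isomorphic_coordinate: "isomorphic_reps Weyl W_poly_act M W_section_act (Theta2 \<Gamma>)"
  unfolding isomorphic_reps_def
proof (intro exI [of _ "\<lambda>f. pairing (\<lambda>z. f (cpt z))"] conjI ballI)
  have e: "pairing (\<lambda>z. lift F (cpt z)) = pairing F" for F by simp
  show "linear_on fun_scale fun_scale M (\<lambda>f. pairing (\<lambda>z. f (cpt z)))"
    unfolding linear_on_def dimension(2) by (auto simp only: lift_linear [symmetric] e pairing_linear)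
  show "bij_betw (\<lambda>f. pairing (\<lambda>z. f (cpt z))) M (Theta2 \<Gamma>)"
    unfolding bij_betw_def
  proof
    have inj: "F = F'" if F: "F \<in> macdonald" "F' \<in> macdonald" "pairing F = pairing F'" for F F'
    proof -
      have d: "F - F' \<in> macdonald" using F fun_vs.subspace_diff [OF macdonald_subspace] by blast
      have "pairing (F' + (F - F')) = pairing F' + pairing (F - F')" by (rule pairing_linear(1))
      hence "pairing (F - F') = 0" using F(3) by simp
      thus ?thesis using pairing_inject [OF d] by simp
    qed
    show "inj_on (\<lambda>f. pairing (\<lambda>z. f (cpt z))) M"
      unfolding dimension(2)
    proof (rule inj_onI)
      fix x y assume "x \<in> lift ` macdonald" "y \<in> lift ` macdonald"
        and eq: "pairing (\<lambda>z. x (cpt z)) = pairing (\<lambda>z. y (cpt z))"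
      then obtain F F' where F: "F \<in> macdonald" "F' \<in> macdonald" and xy: "x = lift F" "y = lift F'" by blast
      have "pairing F = pairing F'" using eq unfolding xy e .
      thus "x = y" unfolding xy using inj [OF F] by simp
    qed
    have im: "(\<lambda>f. pairing (\<lambda>z. f (cpt z))) ` M = pairing ` macdonald"
      unfolding dimension(2) image_image e ..
    have "pairing ` macdonald \<subseteq> Theta2 \<Gamma>"
      by (rule image_subsetI, rule pairing_Theta2, rule subsetD [OF macdonald_quartics])
    thus "(\<lambda>f. pairing (\<lambda>z. f (cpt z))) ` M = Theta2 \<Gamma>"
      unfolding im using pairing_surj by (rule equalityI)
  qed
  fix w f assume w: "w \<in> carrier Weyl" and "f \<in> M"
  then obtain F where F: "F \<in> macdonald" "f = lift F" unfolding dimension(2) by blast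
  have i: "inv\<^bsub>Weyl\<^esub> w \<in> carrier Weyl" using w by simp
  note n = coset_rep [OF i] and m = coset_rep [OF w]
  have "pairing (F \<circ> cmap (coset_rep (inv\<^bsub>Weyl\<^esub> w))) = section_act (coset_rep w) (pairing F)"
    using Weyl_normalizer [OF w m] Weyl_normalizer [OF i n] Weyl_inv [OF w m n] F(1) macdonald_quartics
    by (intro pairing_equivariant) auto
  thus "pairing (\<lambda>z. W_poly_act w f (cpt z)) = W_section_act w (pairing (\<lambda>z. f (cpt z)))"
    unfolding F(2) W_poly_act_lift [OF w n] e W_section_act_def .
qed

end

theorem proposition9p16:
  fixes \<Gamma> :: "sym_algebra \<Rightarrow> (V \<times> V \<Rightarrow> complex)"
  assumes "nonzero_equivariant_map \<Gamma>"
  shows "(\<forall>w\<in>carrier Weyl. \<forall>m\<in>w. \<forall>n\<in>w. \<forall>s\<in>Theta2 \<Gamma>. section_act m s = section_act n s) \<and>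
         irreducible_rep Weyl W_section_act (Theta2 \<Gamma>) \<and>
         fun_vs.dim (Theta2 \<Gamma>) = 84 \<and>
         Macdonald_rep (coordinate_quartics \<Gamma>) \<and>
         isomorphic_reps Weyl W_section_act (Theta2 \<Gamma>) W_poly_act (coordinate_quartics \<Gamma>)"
proof -
  interpret equivariant_map \<Gamma> using assms by (rule equivariant_map.intro)
  have "section_act m s = section_act n s"
    if "w \<in> carrier Weyl" "m \<in> w" "n \<in> w" "s \<in> Theta2 \<Gamma>" for w m n s
    using that Weyl_normalizer Weyl_agree by (intro section_act_agree) blast+
  thus ?thesis
    \<comment> \<open>Irreducibility is known for the quartics, where the inner product lives, and
      is transported to \<open>Theta2\<close> along the pairing.\<close>
    using irreducible_rep_isomorphic [OF irreducible_coordinate isomorphic_coordinate representation_Theta2]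
      dimension(1) Macdonald_coordinate isomorphic_reps_sym [OF representation_coordinate isomorphic_coordinate]
    by blast
qed

end
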